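(* Let $k=0$ and $\mathbf f\in[L^2(\Omega)]^2$. Let $(\mathbf u_h,p_h)\in V_h\times M_h$ be the solution of the weak Galerkin scheme $$(\nabla_w\mathbf u_h,\nabla_w\mathbf v)_h-(p_h,\operatorname{div}_w\mathbf v)_h=(\mathbf f,\mathbf v^0)\quad\forall\,\mathbf v\in V_h,$$ $$(\operatorname{div}_w\mathbf u_h,q_h)_h=0\quad\forall\,q_h\in M_h.$$ Then there is a constant $C$ independent of $h$ and $\mathbf f$ such that $$\|\nabla_w\mathbf u_h\|_h+\|p_h\|\le C\|\mathbf f\|.$$ (In the paper $C=3C_1$, where $C_1$ is the constant in the discrete Poincaré inequality $\|v^0\|\le C_1\|\nabla_wv\|_h$ on $S_h^0$.)
   Context: Let $\Omega\subset\mathbb R^2$ be a convex polygonal domain. Let $T_h$ be a shape-regular triangulation into triangles $K$. For $k=0$ the local space is $W_{0,1}(K)=\{\{v^0,v^b\}: v^0\in P_0(K),\ v^b\in P_1(\partial K)\}$, where $P_1(\partial K)$ means degree at most 1 on each edge. The weak gradient $\nabla_wv\in[P_1(K)]^2$ is defined by $\int_K\nabla_wv\cdot\mathbf q=-\int_Kv^0\operatorname{div}\mathbf q+\int_{\partial K}v^b\mathbf q\cdot\mathbf n$ for all $\mathbf q\in[P_1(K)]^2$, taken row-wise for vectors. The weak divergence $\operatorname{div}_w\mathbf v\in P_1(K)$ is defined by $\int_K\operatorname{div}_w\mathbf v\,q=-\int_K\mathbf v^0\cdot\nabla q+\int_{\partial K}\mathbf v^b\cdot\mathbf n\,q$ for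 all $q\in P_1(K)$. Both are applied elementwise. $S_h^0$ is the set of weak functions with $v|_K\in W_{0,1}(K)$, $v^b$ single-valued on interior edges, and $v^b=0$ on $\partial\Omega$. $V_h=[S_h^0]^2$ and $M_h=\{q\in L^2_0(\Omega): q|_K\in P_0(K)\}$. $(u,v)_h=\sum_K\int_Kuv$, $\|u\|_h^2=(u,u)_h$, and $\|\cdot\|$ is the $L^2(\Omega)$ norm.
   Formalization: The parenthetical value C = 3C_1 is not asserted, only that C exists depending on the domain and shape regularity: 3C_1 fails on long thin rectangles (0,L)×(0,1) with f = ∇cos(πx/L), where ‖p_h‖/‖f‖ tends to L/π while C_1 stays bounded, as the inf-sup constant is missing. *)

theory Defs
  imports "HOL-Analysis.Analysis"
begin

type_synonym pt = "real^2"

definition convex_polygon :: "pt set \<Rightarrow> bool" where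
  "convex_polygon \<Omega> \<longleftrightarrow>
     (\<exists>P. finite P \<and> \<Omega> = interior (convex hull P) \<and> \<Omega> \<noteq> {})"

definition is_triangle :: "pt set \<Rightarrow> bool" where
  "is_triangle K \<longleftrightarrow> (\<exists>a b c. K = convex hull {a, b, c} \<and> \<not> collinear {a, b, c})"

definition verts :: "pt set \<Rightarrow> pt set" where
  "verts K = {x. x extreme_point_of K}"

definition edges :: "pt set \<Rightarrow> pt set set" where
  "edges K = {closed_segment a b | a b. a \<in> verts K \<and> b \<in> verts K \<and> a \<noteq> b}"

definition triangulation :: "pt set \<Rightarrow> pt set set \<Rightarrow> bool" where
  "triangulation \<Omega> T \<longleftrightarrow>
     finite T \<and> (\<forall>K\<in>T. is_triangle K) \<and> \<Union>T = closure \<Omega> \<and>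
     (\<forall>K\<in>T. \<forall>K'\<in>T. K \<noteq> K' \<longrightarrow>
        K \<inter> K' = {} \<or>
        (\<exists>v. v \<in> verts K \<and> v \<in> verts K' \<and> K \<inter> K' = {v}) \<or>
        (\<exists>E. E \<in> edges K \<and> E \<in> edges K' \<and> K \<inter> K' = E))"

definition shape_regular :: "real \<Rightarrow> pt set set \<Rightarrow> bool" where
  "shape_regular \<sigma> T \<longleftrightarrow> (\<forall>K\<in>T. \<exists>x. cball x (diameter K / \<sigma>) \<subseteq> K)"

definition outer_normal :: "pt set \<Rightarrow> pt set \<Rightarrow> pt" where
  "outer_normal K E = (THE n. norm n = 1 \<and> (\<forall>x\<in>K. \<forall>y\<in>E. n \<bullet> (x - y) \<le> 0))"

definition edge_int :: "pt set \<Rightarrow> (pt \<Rightarrow> real) \<Rightarrow> real" where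
  "edge_int E g = (SOME r. \<exists>a b. a \<noteq> b \<and> E = closed_segment a b \<and>
       r = dist a b * integral {0..1} (\<lambda>t::real. g (a + t *\<^sub>R (b - a))))"

text \<open>Weak functions (k = 0): an interior value v0 K (constant on each triangle K)
  and a boundary value vb E on each edge E (degree \<le> 1 on E).  Indexing vb by the
  edge makes it single-valued on interior edges.\<close>
type_synonym wfun = "(pt set \<Rightarrow> real) \<times> (pt set \<Rightarrow> pt \<Rightarrow> real)"
type_synonym vwfun = "(pt set \<Rightarrow> pt) \<times> (pt set \<Rightarrow> pt \<Rightarrow> pt)"

definition comp :: "vwfun \<Rightarrow> 2 \<Rightarrow> wfun" where
  "comp v i = ((\<lambda>K. fst v K $ i), (\<lambda>E x. snd v E x $ i))"

definition Sh0 :: "pt set \<Rightarrow> pt set set \<Rightarrow> wfun set" where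
  "Sh0 \<Omega> T = {v. \<forall>K\<in>T. \<forall>E\<in>edges K.
      (\<exists>c w. \<forall>x\<in>E. snd v E x = c + w \<bullet> x) \<and>
      (E \<subseteq> frontier \<Omega> \<longrightarrow> (\<forall>x\<in>E. snd v E x = 0))}"

definition Vh :: "pt set \<Rightarrow> pt set set \<Rightarrow> vwfun set" where
  "Vh \<Omega> T = {v. \<forall>i. comp v i \<in> Sh0 \<Omega> T}"

text \<open>M_h: piecewise constants (value p K on K) with zero mean.\<close>
definition Mh :: "pt set set \<Rightarrow> (pt set \<Rightarrow> real) set" where
  "Mh T = {p. (\<Sum>K\<in>T. p K * measure lebesgue K) = 0}"

definition is_wgrad :: "wfun \<Rightarrow> pt set \<Rightarrow> (pt \<Rightarrow> pt) \<Rightarrow> bool" where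
  "is_wgrad v K G \<longleftrightarrow>
     (\<exists>c A. \<forall>x. G x = c + A *v x) \<and>
     (\<forall>(c::pt) (B::real^2^2).
        integral K (\<lambda>x. G x \<bullet> (c + B *v x)) =
          - integral K (\<lambda>x. fst v K * trace B)
          + (\<Sum>E\<in>edges K. edge_int E (\<lambda>x. snd v E x * ((c + B *v x) \<bullet> outer_normal K E))))"

definition wgrad :: "wfun \<Rightarrow> pt set \<Rightarrow> pt \<Rightarrow> pt" where
  "wgrad v K = (THE G. is_wgrad v K G)"

definition is_wdiv :: "vwfun \<Rightarrow> pt set \<Rightarrow> (pt \<Rightarrow> real) \<Rightarrow> bool" where
  "is_wdiv v K D \<longleftrightarrow>
     (\<exists>c w. \<forall>x. D x = c + w \<bullet> x) \<and>
     (\<forall>(c::real) (w::pt).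
        integral K (\<lambda>x. D x * (c + w \<bullet> x)) =
          - integral K (\<lambda>x. fst v K \<bullet> w)
          + (\<Sum>E\<in>edges K. edge_int E (\<lambda>x. (snd v E x \<bullet> outer_normal K E) * (c + w \<bullet> x))))"

definition wdiv :: "vwfun \<Rightarrow> pt set \<Rightarrow> pt \<Rightarrow> real" where
  "wdiv v K = (THE D. is_wdiv v K D)"

definition grad_ip :: "pt set set \<Rightarrow> vwfun \<Rightarrow> vwfun \<Rightarrow> real" where
  "grad_ip T u v = (\<Sum>K\<in>T. \<Sum>i\<in>UNIV.
       integral K (\<lambda>x. wgrad (comp u i) K x \<bullet> wgrad (comp v i) K x))"

definition grad_norm :: "pt set set \<Rightarrow> vwfun \<Rightarrow> real" where
  "grad_norm T u = sqrt (grad_ip T u u)"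

definition p_div_ip :: "pt set set \<Rightarrow> (pt set \<Rightarrow> real) \<Rightarrow> vwfun \<Rightarrow> real" where
  "p_div_ip T p v = (\<Sum>K\<in>T. integral K (\<lambda>x. p K * wdiv v K x))"

definition pc_norm :: "pt set set \<Rightarrow> (pt set \<Rightarrow> real) \<Rightarrow> real" where
  "pc_norm T p = sqrt (\<Sum>K\<in>T. (p K)\<^sup>2 * measure lebesgue K)"

definition f_ip :: "pt set set \<Rightarrow> (pt \<Rightarrow> pt) \<Rightarrow> vwfun \<Rightarrow> real" where
  "f_ip T f v = (\<Sum>K\<in>T. LINT x|lebesgue_on K. f x \<bullet> fst v K)"

definition L2_vec :: "pt set \<Rightarrow> (pt \<Rightarrow> pt) \<Rightarrow> bool" where
  "L2_vec \<Omega> f \<longleftrightarrow> f \<in> borel_measurable (lebesgue_on \<Omega>) \<and>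
     integrable (lebesgue_on \<Omega>) (\<lambda>x. (norm (f x))\<^sup>2)"

definition L2_norm_vec :: "pt set \<Rightarrow> (pt \<Rightarrow> pt) \<Rightarrow> real" where
  "L2_norm_vec \<Omega> f = sqrt (LINT x|lebesgue_on \<Omega>. (norm (f x))\<^sup>2)"

end

theory Submission
  imports Defs
begin

text \<open>
  Testing with the discrete velocity itself removes the pressure, so the velocity is controlled by
  the data through a discrete Poincare inequality. That inequality comes from the fluxes of the
  position field through the edges: they sum to twice the area on each triangle and cancel between
  neighbours, so the squared interior values are expressed by their differences from the edge
  means, and these are read off from the weak gradient tested with the field vanishing at the
  opposite vertex.

  The pressure is controlled by an inf-sup condition. On a square, a mean-zero function is expanded
  in Haar functions along the quadtree, and each Haar function is the divergence of an explicit
  piecewise affine field vanishing outside its square; the levels are almost orthogonal in the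
  energy, because the gradient of a coarse field is constant on most fine squares and the gradient
  of a fine field has mean zero. Affine images and overlapping unions carry this over to
  parallelograms, triangles (three overlapping parallelograms) and convex polygons (triangles with
  a common interior point). Finally the interpolant given by means on triangles and
  \<open>L\<^sup>2\<close>-projections on edges preserves the mean divergence on each triangle and does
  not increase the energy.
\<close>

section \<open>The plane\<close>

text \<open>The constant may depend on \<open>\<Omega>\<close> and \<open>\<sigma>\<close> only.
  Shape regularity enters through the Poincare inequality alone, as a bound of
  \<open>(diameter K)\<^sup>2\<close> by \<open>\<sigma>\<^sup>2 / pi\<close> times the area; the
  inf-sup constant is that of the divergence equation on the polygon, because the weak gradient of
  the interpolant is the elementwise \<open>L\<^sup>2\<close>-projection of the true gradient. No
  Sobolev space appears: every field is continuous and affine off finitely many lines, so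
  integration by parts is the fundamental theorem of calculus along segments, and zero boundary
  values mean vanishing outside the set. The obstacle is the sum over the Haar levels, where the
  triangle inequality would lose a factor growing with their number. Cancellation between a coarse
  and a fine field fails only on fine squares that meet a crease of the coarse one, so the Gram
  matrix of the levels decays like powers of \<open>sqrt (3/4)\<close> away from the diagonal. The
  final constant is \<open>s + 16/3 * s * sqrt C\<close>, with \<open>s\<close> from the Poincare
  inequality and \<open>C\<close> from the divergence equation.\<close>

definition cr :: "pt \<Rightarrow> pt \<Rightarrow> real" where "cr u v = u$1 * v$2 - u$2 * v$1"

lemma affine_borel [measurable]: "(\<lambda>x::pt. a + (M :: real^2^2) *v x) \<in> borel \<rightarrow>\<^sub>M borel"
  by (intro borel_measurable_continuous_onI continuous_on_add continuous_on_const matrix_vector_mult_linear_continuous_on)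

text \<open>Compared on boxes, which determine the measure: the preimage of a box is a translate of
  it mapped by the inverse matrix \<open>N\<close>, and linear images scale area by the absolute
  determinant.\<close>

lemma lborel_affine_pt:
  fixes M :: "real^2^2" and a :: pt
  assumes "det M \<noteq> 0"
  shows "lborel = density (distr lborel borel (\<lambda>x. a + M *v x)) (\<lambda>_. ennreal \<bar>det M\<bar>)"
proof (rule lborel_eqI)
  fix l u :: pt assume le: "\<And>b. b \<in> Basis \<Longrightarrow> l \<bullet> b \<le> u \<bullet> b"
  let ?T = "\<lambda>x. a + M *v x"
  have [measurable]: "?T \<in> borel \<rightarrow>\<^sub>M borel"
    by (rule affine_borel)
  obtain N where N: "M ** N = mat 1" "N ** M = mat 1"
    using assms by (metis invertible_def invertible_det_nz)
  have "det M * det N = 1" using N det_mul[of M N] by simp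
  then have dN: "\<bar>det M\<bar> * \<bar>det N\<bar> = 1" by (metis abs_1 abs_mult)
  have eq: "?T -` box l u = (*v) N ` ((+) (-a) ` box l u)"
  proof (intro set_eqI iffI)
    fix x assume "x \<in> ?T -` box l u"
    then have "M *v x \<in> (+) (-a) ` box l u" by (force intro!: image_eqI[where x="a + M *v x"])
    then show "x \<in> (*v) N ` ((+) (-a) ` box l u)"
      by (metis N(2) image_eqI matrix_vector_mul_assoc matrix_vector_mul_lid)
  next
    fix x assume "x \<in> (*v) N ` ((+) (-a) ` box l u)"
    then show "x \<in> ?T -` box l u" by (auto simp: matrix_vector_mul_assoc N)
  qed
  have lm: "(+) (-a) ` box l u \<in> lmeasurable" by (rule measurable_translation) simp
  have "?T -` box l u \<in> sets borel" using measurable_sets[of ?T borel borel "box l u"] by simp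
  moreover have "?T -` box l u \<in> lmeasurable"
    unfolding eq using measurable_linear_image[OF matrix_vector_mul_linear lm] .
  moreover have "measure lebesgue (?T -` box l u) = \<bar>det N\<bar> * measure lebesgue (box l u)"
    unfolding eq measure_linear_image[OF matrix_vector_mul_linear lm, of N] measure_translation by simp
  ultimately have "emeasure lborel (?T -` box l u) = ennreal (\<bar>det N\<bar> * measure lborel (box l u))"
    using emeasure_eq_measure2[of "?T -` box l u" lebesgue] by (simp add: measure_completion)
  then show "emeasure (density (distr lborel borel ?T) (\<lambda>_. ennreal \<bar>det M\<bar>)) (box l u) = (\<Prod>b\<in>Basis. (u - l) \<bullet> b)"
    using le dN
    by (simp add: emeasure_density nn_integral_cmult emeasure_distr ennreal_mult'[symmetric] mult.assoc[symmetric]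
       nn_integral_cmult_indicator measure_lborel_box_eq)
qed simp

lemma
  fixes M :: "real^2^2" and a :: pt and f :: "pt \<Rightarrow> real"
  assumes d: "det M \<noteq> 0" and [measurable]: "f \<in> borel_measurable borel"
  shows integral_affine_pt: "(LINT y|lborel. f y) = \<bar>det M\<bar> * (LINT x|lborel. f (a + M *v x))"
    and integrable_affine_pt: "integrable lborel f \<longleftrightarrow> integrable lborel (\<lambda>x. f (a + M *v x))"
proof -
  have [measurable]: "(\<lambda>x. a + M *v x) \<in> borel \<rightarrow>\<^sub>M borel"
    by (rule affine_borel)
  have "(LINT y|lborel. f y) = (LINT y|density (distr lborel borel (\<lambda>x. a + M *v x)) (\<lambda>_. ennreal \<bar>det M\<bar>). f y)"
    using lborel_affine_pt[OF d, of a] by simp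
  also have "\<dots> = \<bar>det M\<bar> * (LINT x|lborel. f (a + M *v x))"
    by (simp add: integral_density integral_distr)
  finally show "(LINT y|lborel. f y) = \<bar>det M\<bar> * (LINT x|lborel. f (a + M *v x))" .
  have "integrable lborel f \<longleftrightarrow> integrable (density (distr lborel borel (\<lambda>x. a + M *v x)) (\<lambda>_. ennreal \<bar>det M\<bar>)) f"
    using lborel_affine_pt[OF d, of a] by simp
  also have "\<dots> \<longleftrightarrow> integrable lborel (\<lambda>x. f (a + M *v x))"
    using d by (simp add: integrable_density integrable_distr_eq)
  finally show "integrable lborel f \<longleftrightarrow> integrable lborel (\<lambda>x. f (a + M *v x))" .
qed

definition vec2 :: "real \<Rightarrow> real \<Rightarrow> pt" where "vec2 x y = vector [x, y]"

lemma vec2_nth [simp]: "vec2 x y $ 1 = x" "vec2 x y $ 2 = y"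
  by (simp_all add: vec2_def)

lemma pt_eqI: "x $ 1 = y $ 1 \<Longrightarrow> x $ 2 = y $ 2 \<Longrightarrow> x = (y :: pt)"
  by (simp add: vec_eq_iff forall_2)

lemma inner_pt: "(x::pt) \<bullet> y = x$1 * y$1 + x$2 * y$2"
  by (simp add: inner_vec_def sum_2)

lemma Basis_pt: "(Basis :: pt set) = {axis 1 1, axis 2 1}"
  by (auto simp: Basis_vec_def) (metis exhaust_2)

lemma axis_pt [simp]: "axis (1::2) (1::real) $ 1 = 1" "axis (1::2) (1::real) $ 2 = 0"
   "axis (2::2) (1::real) $ 1 = 0" "axis (2::2) (1::real) $ 2 = 1"
  by (simp_all add: axis_def)

lemma continuous_vec2: "continuous_on S (\<lambda>p. vec2 (fst p) (snd p))"
proof -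
  have *: "(\<lambda>p. vec2 (fst p) (snd p)) = (\<lambda>p. fst p *\<^sub>R axis 1 1 + snd p *\<^sub>R axis 2 1)"
    by (auto intro!: pt_eqI)
  show ?thesis by (simp only: *) (intro continuous_intros)
qed

text \<open>Identifies Lebesgue measure on \<open>real^2\<close> with a product measure, so that
  Fubini can be used on triangles.\<close>

lemma distr_vec2: "(lborel :: pt measure) = distr (lborel \<Otimes>\<^sub>M lborel) borel (\<lambda>(x, y). vec2 x y)"
proof (rule lborel_eqI)
  have m [measurable]: "(\<lambda>(x, y). vec2 x y) \<in> (borel \<Otimes>\<^sub>M borel) \<rightarrow>\<^sub>M borel"
    unfolding case_prod_beta borel_prod by (rule borel_measurable_continuous_onI[OF continuous_vec2])
  fix l u :: pt assume le: "\<And>b. b \<in> Basis \<Longrightarrow> l \<bullet> b \<le> u \<bullet> b"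
  have "(\<lambda>(x, y). vec2 x y) -` box l u = {l$1<..<u$1} \<times> {l$2<..<u$2}"
    by (auto simp: mem_box_cart forall_2)
  then have "emeasure (distr (lborel \<Otimes>\<^sub>M lborel) borel (\<lambda>(x, y). vec2 x y)) (box l u)
     = emeasure (lborel \<Otimes>\<^sub>M lborel) ({l$1<..<u$1} \<times> {l$2<..<u$2})"
    by (subst emeasure_distr) (auto simp: space_pair_measure)
  also have "\<dots> = emeasure lborel {l$1<..<u$1} * emeasure lborel {l$2<..<u$2}"
    by (rule lborel.emeasure_pair_measure_Times) auto
  also have "\<dots> = (\<Prod>b\<in>Basis. (u - l) \<bullet> b)"
    using le[of "axis 1 1"] le[of "axis 2 1"]
    by (simp add: Basis_pt axis_eq_axis inner_axis ennreal_mult'[symmetric])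
  finally show "emeasure (distr (lborel \<Otimes>\<^sub>M lborel) borel (\<lambda>(x, y). vec2 x y)) (box l u) = (\<Prod>b\<in>Basis. (u - l) \<bullet> b)" .
qed simp

lemma vec2_measurable [measurable]: "(\<lambda>(x, y). vec2 x y) \<in> (borel \<Otimes>\<^sub>M borel) \<rightarrow>\<^sub>M borel"
  unfolding case_prod_beta borel_prod by (rule borel_measurable_continuous_onI[OF continuous_vec2])

lemma integral_pt_Fubini:
  fixes f :: "pt \<Rightarrow> real"
  assumes [measurable]: "f \<in> borel_measurable borel" and i: "integrable lborel f"
  shows "(LINT x|lborel. f x) = (LINT t|lborel. LINT s|lborel. f (vec2 s t))"
proof -
  have "integrable (distr (lborel \<Otimes>\<^sub>M lborel) borel (\<lambda>(x, y). vec2 x y)) f"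
    using i distr_vec2 by simp
  then have i2: "integrable (lborel \<Otimes>\<^sub>M lborel) (\<lambda>(x, y). f (vec2 x y))"
    by (subst (asm) integrable_distr_eq) (auto simp: case_prod_unfold)
  have "(LINT x|lborel. f x) = (LINT x|distr (lborel \<Otimes>\<^sub>M lborel) borel (\<lambda>(x, y). vec2 x y). f x)"
    using distr_vec2 by simp
  also have "\<dots> = integral\<^sup>L (lborel \<Otimes>\<^sub>M lborel) (\<lambda>(x, y). f (vec2 x y))"
    by (subst integral_distr) (auto simp: case_prod_unfold)
  also have "\<dots> = (LINT t|lborel. LINT s|lborel. f (vec2 s t))"
    using lborel_pair.integral_snd[OF i2] by simp
  finally show ?thesis .
qed

definition cols :: "pt \<Rightarrow> pt \<Rightarrow> real^2^2" where "cols u v = (\<chi> i j. if j = 1 then u$i else v$i)"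

lemma det_cols: "det (cols u v) = cr u v"
  by (simp add: det_2 cr_def cols_def)

lemma mult_cols: "cols u v *v x = x$1 *\<^sub>R u + x$2 *\<^sub>R v"
  by (rule pt_eqI) (simp_all add: matrix_vector_mult_def sum_2 cols_def)

lemma collinear_cr: "collinear {a, b, c} \<longleftrightarrow> cr (b - a) (c - a) = 0"
proof -
  have 1: "collinear {a, b, c} \<longleftrightarrow> collinear {0, b - a, c - a}"
    using collinear_3_expand collinear_3[of b a c] by (simp add: insert_commute)
  have "cr u v = 0 \<longleftrightarrow> u = 0 \<or> v = 0 \<or> (\<exists>k. v = k *\<^sub>R u)" for u v
  proof
    assume z: "cr u v = 0"
    show "u = 0 \<or> v = 0 \<or> (\<exists>k. v = k *\<^sub>R u)"
    proof (cases "u$1 = 0")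
      case True
      show ?thesis
      proof (cases "u$2 = 0")
        case True then have "u = 0" using \<open>u$1 = 0\<close> by (auto intro: pt_eqI) then show ?thesis by simp
      next
        case False
        then have "v = (v$2 / u$2) *\<^sub>R u" using z \<open>u$1 = 0\<close> by (auto intro!: pt_eqI simp: cr_def)
        then show ?thesis by blast
      qed
    next
      case False
      then have "v = (v$1 / u$1) *\<^sub>R u" using z by (auto intro!: pt_eqI simp: cr_def field_simps)
      then show ?thesis by blast
    qed
  qed (auto simp: cr_def)
  then show ?thesis using 1 by (simp add: collinear_lemma)
qed

lemma mem_tri_iff:
  assumes "cr (b - a) (c - a) \<noteq> 0"
  shows "a + s *\<^sub>R (b - a) + t *\<^sub>R (c - a) \<in> convex hull {a, b, c} \<longleftrightarrow> 0 \<le> s \<and> 0 \<le> t \<and> s + t \<le> 1"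
proof
  assume "a + s *\<^sub>R (b - a) + t *\<^sub>R (c - a) \<in> convex hull {a, b, c}"
  then obtain u v where uv: "0 \<le> u" "0 \<le> v" "u + v \<le> 1"
    and e: "s *\<^sub>R (b - a) + t *\<^sub>R (c - a) = u *\<^sub>R (b - a) + v *\<^sub>R (c - a)"
    by (auto simp: convex_hull_3_alt)
  have "cr (s *\<^sub>R (b - a) + t *\<^sub>R (c - a)) (c - a) = s * cr (b - a) (c - a)" for s t
    by (simp add: cr_def algebra_simps)
  with e assms have "s = u" by (metis mult_cancel_right)
  moreover have "cr (b - a) (s *\<^sub>R (b - a) + t *\<^sub>R (c - a)) = t * cr (b - a) (c - a)" for s t
    by (simp add: cr_def algebra_simps)
  with e assms have "t = v" by (metis mult_cancel_right)
  ultimately show "0 \<le> s \<and> 0 \<le> t \<and> s + t \<le> 1" using uv by auto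
qed (auto simp: convex_hull_3_alt)

text \<open>Affine image of the reference triangle followed by Fubini. The inner variable runs along
  \<open>b - a\<close>; this order lets \<open>green_edge\<close> integrate a directional derivative
  exactly.\<close>

lemma integral_tri:
  fixes f :: "pt \<Rightarrow> real"
  assumes nc: "cr (b - a) (c - a) \<noteq> 0" and [measurable]: "f \<in> borel_measurable borel"
    and bd: "\<And>x. x \<in> convex hull {a, b, c} \<Longrightarrow> \<bar>f x\<bar> \<le> B"
  shows "(LINT x|lborel. indicator (convex hull {a, b, c}) x * f x) =
     \<bar>cr (b - a) (c - a)\<bar> * (LINT t|lborel. LINT s|lborel. indicator {0..1} t * indicator {0..1 - t} s *
        f (a + s *\<^sub>R (b - a) + t *\<^sub>R (c - a)))"
    and "integrable lborel (\<lambda>x. indicator (convex hull {a, b, c}) x * f x)"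
proof -
  let ?K = "convex hull {a, b, c}"
  let ?M = "cols (b - a) (c - a)"
  have cK: "compact ?K" by (simp add: compact_convex_hull)
  then have [measurable]: "?K \<in> sets borel" by (simp add: borel_compact)
  define g where "g x = indicator ?K x * f x" for x
  have gm [measurable]: "g \<in> borel_measurable borel" unfolding g_def by measurable
  have "integrable lborel (\<lambda>x. indicator ?K x * (f x * indicator ?K x))"
  proof (rule Bochner_Integration.integrable_bound[where f="\<lambda>x. indicator ?K x * B"])
    show "integrable lborel (\<lambda>x. indicator ?K x * B)"
      using cK emeasure_compact_finite[OF cK] by (intro integrable_mult_left integrable_real_indicator) auto
    show "AE x in lborel. norm (indicator ?K x * (f x * indicator ?K x)) \<le> norm (indicator ?K x * B)"
      using bd by (auto simp: indicator_def intro!: AE_I2) (use bd in force)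
  qed simp
  then have gi: "integrable lborel g" unfolding g_def
    by (rule Bochner_Integration.integrable_cong[THEN iffD1, rotated 2]) (auto simp: indicator_def)
  then show "integrable lborel (\<lambda>x. indicator ?K x * f x)" by (simp add: g_def[abs_def])
  have dM: "det ?M \<noteq> 0" unfolding det_cols by (rule nc)
  have [measurable]: "(\<lambda>x. a + ?M *v x) \<in> borel \<rightarrow>\<^sub>M borel"
    by (rule affine_borel)
  have "(LINT y|lborel. g y) = \<bar>cr (b - a) (c - a)\<bar> * (LINT x|lborel. g (a + ?M *v x))"
    using integral_affine_pt[OF dM gm, of a] by (simp only: det_cols)
  also have "(LINT x|lborel. g (a + ?M *v x)) = (LINT t|lborel. LINT s|lborel. g (a + ?M *v vec2 s t))"
    using gi integrable_affine_pt[OF dM gm, of a] by (intro integral_pt_Fubini) auto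
  also have "\<dots> = (LINT t|lborel. LINT s|lborel. indicator {0..1} t * indicator {0..1 - t} s *
        f (a + s *\<^sub>R (b - a) + t *\<^sub>R (c - a)))"
    by (intro Bochner_Integration.integral_cong refl)
       (auto simp: g_def mult_cols indicator_def mem_tri_iff[OF nc] add.assoc[symmetric])
  finally show "(LINT x|lborel. indicator ?K x * f x) = \<bar>cr (b - a) (c - a)\<bar> * (LINT t|lborel. LINT s|lborel. indicator {0..1} t * indicator {0..1 - t} s *
        f (a + s *\<^sub>R (b - a) + t *\<^sub>R (c - a)))" by (simp add: g_def[abs_def])
qed

section \<open>Green formula for Lipschitz functions on a triangle\<close>

text \<open>The weak operators are defined with the gauge integral, while Fubini, substitution and
  dominated convergence are applied to the Lebesgue integral. Bounded Borel functions on bounded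
  Borel sets are the common ground for passing between the two.\<close>

lemma
  fixes f :: "'a::euclidean_space \<Rightarrow> real"
  assumes [measurable]: "S \<in> sets borel" "f \<in> borel_measurable borel"
    and b: "bounded S" and bd: "\<And>x. x \<in> S \<Longrightarrow> \<bar>f x\<bar> \<le> B"
  shows bdd_integrable: "integrable lborel (\<lambda>x. indicator S x * f x)"
    and bdd_integrable_on: "f integrable_on S"
    and bdd_integral_eq: "integral S f = (LINT x|lborel. indicator S x * f x)"
proof -
  have fin: "emeasure lborel S < \<infinity>" using emeasure_bounded_finite[OF b] by simp
  have "integrable lborel (\<lambda>x. indicator S x * f x)"
  proof (rule Bochner_Integration.integrable_bound[where f="\<lambda>x. indicator S x * B"])
    show "integrable lborel (\<lambda>x. indicator S x * B)"
      using fin by (intro integrable_mult_left integrable_real_indicator) auto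
    show "AE x in lborel. norm (indicator S x * f x) \<le> norm (indicator S x * B)"
      by (rule AE_I2) (use bd in \<open>force simp: indicator_def\<close>)
  qed simp
  then show "integrable lborel (\<lambda>x. indicator S x * f x)" .
  then have s: "set_integrable lborel S f" by (simp add: set_integrable_def)
  show "f integrable_on S" "integral S f = (LINT x|lborel. indicator S x * f x)"
    using set_borel_integral_eq_integral[OF s] by (auto simp: set_lebesgue_integral_def)
qed

text \<open>A pair \<open>(n, d)\<close> encodes the line \<open>n \<bullet> x = d\<close>; a finite
  set of pairs records where a gradient may jump.\<close>

definition lset :: "(pt \<times> real) set \<Rightarrow> pt set" where
  "lset L = {x. \<exists>(n, d)\<in>L. n \<bullet> x = d}"

definition lines :: "(pt \<times> real) set \<Rightarrow> bool" where
  "lines L \<longleftrightarrow> finite L \<and> (\<forall>(n, d)\<in>L. n \<noteq> 0)"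

lemma lines_Un: "lines (A \<union> B) \<longleftrightarrow> lines A \<and> lines B"
  by (auto simp: lines_def)

lemma lset_UN: "lset L = (\<Union>(n, d)\<in>L. {x. n \<bullet> x = d})"
  by (auto simp: lset_def)

lemma closed_lset: "lines L \<Longrightarrow> closed (lset L)"
  unfolding lset_UN lines_def by (auto intro!: closed_UN simp: closed_hyperplane)

lemma negligible_lset: "lines L \<Longrightarrow> negligible (lset L)"
  unfolding lset_UN lines_def by (auto intro!: negligible_Union simp: negligible_hyperplane)

lemma null_lset: "lines L \<Longrightarrow> lset L \<in> null_sets lborel"
  using negligible_lset closed_lset by (metis borel_closed negligible_iff_null_sets null_sets_completion_iff sets_lborel)

lemma AE_lset: "lines L \<Longrightarrow> AE x in lborel. x \<notin> lset L"
  using AE_not_in null_lset by blast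

text \<open>\<open>G\<close> is the gradient of \<open>\<phi>\<close> off the lines, its values on
  them being arbitrary. Continuity of \<open>\<phi>\<close> and local boundedness of
  \<open>G\<close> are what allows the fundamental theorem to cross the lines.\<close>

definition gdiff :: "(pt \<times> real) set \<Rightarrow> (pt \<Rightarrow> real) \<Rightarrow> (pt \<Rightarrow> pt) \<Rightarrow> bool" where
  "gdiff L \<phi> G \<longleftrightarrow> lines L \<and> continuous_on UNIV \<phi> \<and> G \<in> borel_measurable borel \<and> (\<forall>r. bounded (G ` cball 0 r)) \<and>
     (\<forall>x. x \<notin> lset L \<longrightarrow> (\<phi> has_derivative (\<lambda>h. G x \<bullet> h)) (at x))"

definition avg :: "pt \<Rightarrow> pt \<Rightarrow> (pt \<Rightarrow> real) \<Rightarrow> real" where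
  "avg a b g = integral {0..1} (\<lambda>t::real. g (a + t *\<^sub>R (b - a)))"

text \<open>The product rule; it reduces Green's formula for affine fields to constant
  directions.\<close>

lemma gdiff_mult_affine:
  assumes "gdiff L \<phi> G"
  shows "gdiff L (\<lambda>x. \<phi> x * (c + w \<bullet> x)) (\<lambda>x. (c + w \<bullet> x) *\<^sub>R G x + \<phi> x *\<^sub>R w)"
proof -
  note g = assms[unfolded gdiff_def]
  have phi: "continuous_on UNIV \<phi>" and [measurable]: "G \<in> borel_measurable borel" using g by auto
  have [measurable]: "\<phi> \<in> borel_measurable borel" using phi by (rule borel_measurable_continuous_onI)
  have "bounded ((\<lambda>x. (c + w \<bullet> x) *\<^sub>R G x + \<phi> x *\<^sub>R w) ` cball 0 r)" for r
  proof -
    obtain B where B: "\<And>x. x \<in> cball 0 r \<Longrightarrow> norm (G x) \<le> B" using g by (force simp: bounded_iff)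
    have "compact ((\<lambda>x::pt. (c + w \<bullet> x)) ` cball 0 r)" "compact ((\<lambda>x. \<phi> x *\<^sub>R w) ` cball 0 r)"
      by (intro compact_continuous_image compact_cball continuous_intros continuous_on_subset[OF phi]; simp)+
    then obtain B1 B2 where B1: "\<And>x. x \<in> cball (0::pt) r \<Longrightarrow> norm (c + w \<bullet> x) \<le> B1"
      and B2: "\<And>x. x \<in> cball 0 r \<Longrightarrow> norm (\<phi> x *\<^sub>R w) \<le> B2"
      by (force dest!: compact_imp_bounded simp: bounded_iff)
    show ?thesis unfolding bounded_iff
    proof (intro exI ballI, clarify)
      fix x :: pt assume x: "x \<in> cball 0 r"
      have "norm ((c + w \<bullet> x) *\<^sub>R G x) \<le> B1 * B"
        unfolding norm_scaleR using B1[OF x] B[OF x] norm_ge_zero[of "c + w \<bullet> x"]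
        by (intro mult_mono) (auto intro: order_trans[OF norm_ge_zero])
      then show "norm ((c + w \<bullet> x) *\<^sub>R G x + \<phi> x *\<^sub>R w) \<le> B1 * B + B2"
        using B2[OF x] norm_triangle_ineq by (meson add_mono order_trans)
    qed
  qed
  moreover have "((\<lambda>x::pt. \<phi> x * (c + w \<bullet> x)) has_derivative (\<lambda>h. ((c + w \<bullet> x) *\<^sub>R G x + \<phi> x *\<^sub>R w) \<bullet> h)) (at x)"
    if "x \<notin> lset L" for x
  proof -
    have "(\<phi> has_derivative (\<lambda>h. G x \<bullet> h)) (at x)" using g that by auto
    note d = this
    show ?thesis by (auto intro!: derivative_eq_intros d simp: inner_simps algebra_simps)
  qed
  moreover have "continuous_on UNIV (\<lambda>x::pt. \<phi> x * (c + w \<bullet> x))" by (intro continuous_intros phi)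
  ultimately show ?thesis using g by (simp add: gdiff_def)
qed

lemma avg_eq:
  assumes "continuous_on UNIV \<phi>"
  shows "avg a b \<phi> = (LINT t|lborel. indicator {0..1} t * \<phi> (a + t *\<^sub>R (b - a)))"
    and "integrable lborel (\<lambda>t. indicator {0..1} t * \<phi> (a + t *\<^sub>R (b - a)))"
proof -
  have c: "continuous_on UNIV (\<lambda>t. \<phi> (a + t *\<^sub>R (b - a)))"
    by (rule continuous_on_compose2[OF assms]) (auto intro!: continuous_intros)
  then have [measurable]: "(\<lambda>t. \<phi> (a + t *\<^sub>R (b - a))) \<in> borel_measurable borel"
    by (rule borel_measurable_continuous_onI)
  have "compact ((\<lambda>t. \<phi> (a + t *\<^sub>R (b - a))) ` {0..1})"
    by (intro compact_continuous_image continuous_on_subset[OF c]) auto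
  then obtain B where B: "\<And>t. t \<in> {0..1} \<Longrightarrow> \<bar>\<phi> (a + t *\<^sub>R (b - a))\<bar> \<le> B"
    by (force dest!: compact_imp_bounded simp: bounded_iff)
  show "avg a b \<phi> = (LINT t|lborel. indicator {0..1} t * \<phi> (a + t *\<^sub>R (b - a)))"
    "integrable lborel (\<lambda>t. indicator {0..1} t * \<phi> (a + t *\<^sub>R (b - a)))"
    unfolding avg_def
    using bdd_integral_eq[of "{0..1::real}" "\<lambda>t. \<phi> (a + t *\<^sub>R (b - a))" B]
      bdd_integrable[of "{0..1::real}" "\<lambda>t. \<phi> (a + t *\<^sub>R (b - a))" B] B by auto
qed

text \<open>A line not parallel to \<open>u\<close> is crossed at a single parameter, and finitely
  many such points are harmless for a continuous \<open>\<phi>\<close>. The assumption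
  \<open>ok\<close> excludes paths running inside an exceptional line, where \<open>G\<close>
  carries no information.\<close>

lemma FTC_lines:
  assumes g: "gdiff L \<phi> G" and ok: "\<And>n d. (n, d) \<in> L \<Longrightarrow> n \<bullet> u = 0 \<Longrightarrow> n \<bullet> p \<noteq> d" and "0 \<le> r"
  shows "(LINT s|lborel. indicator {0..r} s * (G (p + s *\<^sub>R u) \<bullet> u)) = \<phi> (p + r *\<^sub>R u) - \<phi> p"
proof -
  let ?f = "\<lambda>s. G (p + s *\<^sub>R u) \<bullet> u"
  \<comment> \<open>Crossing parameters. For a line parallel to \<open>u\<close> the denominator is
    0 and the quotient contributes the extra point 0, which does no harm.\<close>
  let ?S = "(\<lambda>(n, d). (d - n \<bullet> p) / (n \<bullet> u)) ` L"
  have L: "lines L" and phi: "continuous_on UNIV \<phi>" and Gm [measurable]: "G \<in> borel_measurable borel"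
    and Gb: "\<And>r. bounded (G ` cball 0 r)" and der: "\<And>x. x \<notin> lset L \<Longrightarrow> (\<phi> has_derivative (\<lambda>h. G x \<bullet> h)) (at x)"
    using g by (auto simp: gdiff_def)
  have "(?f has_integral (\<phi> (p + r *\<^sub>R u) - \<phi> (p + 0 *\<^sub>R u))) {0..r}"
  proof (rule fundamental_theorem_of_calculus_interior_strong[of ?S])
    show "finite ?S" using L by (simp add: lines_def)
    show "continuous_on {0..r} (\<lambda>s. \<phi> (p + s *\<^sub>R u))"
      by (rule continuous_on_compose2[OF phi]) (auto intro!: continuous_intros)
    fix s assume s: "s \<in> {0<..<r} - ?S"
    have "p + s *\<^sub>R u \<notin> lset L"
    proof
      assume "p + s *\<^sub>R u \<in> lset L"
      then obtain n d where nd: "(n, d) \<in> L" "n \<bullet> p + s * (n \<bullet> u) = d" by (auto simp: lset_def inner_simps)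
      show False
      proof (cases "n \<bullet> u = 0")
        case True then show False using ok nd by auto
      next
        case False
        then have "s = (d - n \<bullet> p) / (n \<bullet> u)" using nd by (simp add: field_simps)
        then show False using s nd by force
      qed
    qed
    note der[OF this]
    then have "((\<lambda>s. \<phi> (p + s *\<^sub>R u)) has_derivative (\<lambda>h. G (p + s *\<^sub>R u) \<bullet> (h *\<^sub>R u))) (at s)"
      by (rule has_derivative_compose[rotated]) (auto intro!: derivative_eq_intros)
    then show "((\<lambda>s. \<phi> (p + s *\<^sub>R u)) has_vector_derivative ?f s) (at s)"
      by (simp add: has_vector_derivative_def)
  qed (use \<open>0 \<le> r\<close> in auto)
  moreover have "integral {0..r} ?f = (LINT s|lborel. indicator {0..r} s * ?f s)"
  proof -
    obtain B where B: "\<And>x. x \<in> cball 0 (norm p + r * norm u) \<Longrightarrow> norm (G x) \<le> B"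
      using Gb[of "norm p + r * norm u"] by (force simp: bounded_iff)
    have "\<bar>?f s\<bar> \<le> B * norm u" if "s \<in> {0..r}" for s
    proof -
      have "norm (p + s *\<^sub>R u) \<le> norm p + r * norm u"
        by (rule order_trans[OF norm_triangle_ineq]) (use that in \<open>auto intro!: mult_right_mono\<close>)
      then have "norm (G (p + s *\<^sub>R u)) \<le> B" by (intro B) simp
      then show ?thesis using Cauchy_Schwarz_ineq2[of "G (p + s *\<^sub>R u)" u]
        by (meson mult_right_mono norm_ge_zero order_trans)
    qed
    then show ?thesis by (intro bdd_integral_eq[where B="B * norm u"]) (auto intro!: measurable_compose[OF _ Gm])
  qed
  ultimately show ?thesis by (simp add: integral_unique)
qed

text \<open>Slices parallel to \<open>b - a\<close> run from the side \<open>ac\<close> to the side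
  \<open>bc\<close>. The fundamental theorem on each slice leaves the difference of the boundary
  values, and integrating over the slices gives the two means.\<close>

lemma green_edge:
  assumes nc: "cr (b - a) (c - a) \<noteq> 0" and g: "gdiff L \<phi> G"
  shows "integral (convex hull {a, b, c}) (\<lambda>x. G x \<bullet> (b - a)) = \<bar>cr (b - a) (c - a)\<bar> * (avg b c \<phi> - avg a c \<phi>)"
proof -
  let ?K = "convex hull {a, b, c}"
  let ?u = "b - a" and ?v = "c - a"
  have L: "lines L" and phi: "continuous_on UNIV \<phi>" and Gm [measurable]: "G \<in> borel_measurable borel"
    and Gb: "\<And>r. bounded (G ` cball 0 r)"
    using g by (auto simp: gdiff_def)
  have cK: "compact ?K" by (simp add: compact_convex_hull)
  then have KB [measurable]: "?K \<in> sets borel" by (simp add: borel_compact)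
  obtain r where r: "?K \<subseteq> cball 0 r" using compact_imp_bounded[OF cK] by (force simp: bounded_iff)
  obtain B where B: "\<And>x. x \<in> cball 0 r \<Longrightarrow> norm (G x) \<le> B" using Gb[of r] by (force simp: bounded_iff)
  have bd: "\<bar>G x \<bullet> ?u\<bar> \<le> B * norm ?u" if "x \<in> ?K" for x
    using Cauchy_Schwarz_ineq2[of "G x" ?u] B that r by (meson mult_right_mono norm_ge_zero order_trans subsetD)
  \<comment> \<open>Heights \<open>t\<close> whose slice may lie in an exceptional line parallel to
    \<open>b - a\<close>. There are finitely many, so the identity on slices holds for almost every
    \<open>t\<close>.\<close>
  define bad where "bad = (\<lambda>(n, d). (d - n \<bullet> a) / (n \<bullet> ?v)) ` L"
  have "finite bad" using L by (simp add: bad_def lines_def)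
  have nb: "n \<bullet> (a + t *\<^sub>R ?v) \<noteq> d" if "(n, d) \<in> L" "n \<bullet> ?u = 0" "t \<notin> bad" for n d t
  proof
    assume e: "n \<bullet> (a + t *\<^sub>R ?v) = d"
    have "n \<noteq> 0" using L that(1) by (auto simp: lines_def)
    have "n \<bullet> ?v \<noteq> 0"
    proof
      assume z: "n \<bullet> ?v = 0"
      have "n$1 * cr ?u ?v = 0" "n$2 * cr ?u ?v = 0" using z that(2) unfolding inner_pt cr_def by algebra+
      then show False using nc \<open>n \<noteq> 0\<close> pt_eqI[of n 0] by simp
    qed
    then have "t = (d - n \<bullet> a) / (n \<bullet> ?v)" using e by (simp add: inner_simps field_simps)
    then show False using that unfolding bad_def by force
  qed
  have inner: "(LINT s|lborel. indicator {0..1} t * indicator {0..1 - t} s * (G (a + s *\<^sub>R ?u + t *\<^sub>R ?v) \<bullet> ?u))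
      = indicator {0..1} t * \<phi> (b + t *\<^sub>R (c - b)) - indicator {0..1} t * \<phi> (a + t *\<^sub>R ?v)" if "t \<notin> bad" for t
  proof (cases "t \<in> {0..1}")
    case True
    have "(LINT s|lborel. indicator {0..1 - t} s * (G ((a + t *\<^sub>R ?v) + s *\<^sub>R ?u) \<bullet> ?u)) =
      \<phi> ((a + t *\<^sub>R ?v) + (1 - t) *\<^sub>R ?u) - \<phi> (a + t *\<^sub>R ?v)"
      by (rule FTC_lines[OF g]) (use nb that True in auto)
    moreover have "(a + t *\<^sub>R ?v) + (1 - t) *\<^sub>R ?u = b + t *\<^sub>R (c - b)" by (simp add: algebra_simps)
    ultimately show ?thesis using True by (simp add: add_ac)
  qed auto
  have "(LINT x|lborel. indicator ?K x * (G x \<bullet> ?u)) = \<bar>cr ?u ?v\<bar> * (LINT t|lborel. LINT s|lborel. indicator {0..1} t * indicator {0..1 - t} s * (G (a + s *\<^sub>R ?u + t *\<^sub>R ?v) \<bullet> ?u))"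
    by (rule integral_tri(1)[OF nc _ bd]) auto
  also have "(LINT t|lborel. LINT s|lborel. indicator {0..1} t * indicator {0..1 - t} s * (G (a + s *\<^sub>R ?u + t *\<^sub>R ?v) \<bullet> ?u))
    = (LINT t|lborel. indicator {0..1} t * \<phi> (b + t *\<^sub>R (c - b)) - indicator {0..1} t * \<phi> (a + t *\<^sub>R ?v))"
  proof (rule integral_cong_AE)
    have "AE t in lborel. t \<notin> bad"
      by (rule AE_not_in) (use \<open>finite bad\<close> in \<open>simp add: finite_imp_null_set_lborel\<close>)
    then show "AE t in lborel. (LINT s|lborel. indicator {0..1} t * indicator {0..1 - t} s * (G (a + s *\<^sub>R ?u + t *\<^sub>R ?v) \<bullet> ?u))
      = indicator {0..1} t * \<phi> (b + t *\<^sub>R (c - b)) - indicator {0..1} t * \<phi> (a + t *\<^sub>R ?v)"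
      by eventually_elim (rule inner)
    show "(\<lambda>t. indicator {0..1} t * \<phi> (b + t *\<^sub>R (c - b)) - indicator {0..1} t * \<phi> (a + t *\<^sub>R ?v)) \<in> borel_measurable lborel"
      using avg_eq(2)[OF phi, of b c] avg_eq(2)[OF phi, of a c] by measurable
    have "(\<lambda>p. indicator {0..1} (fst p) * indicator {0..1 - fst p} (snd p) * (G (a + snd p *\<^sub>R ?u + fst p *\<^sub>R ?v) \<bullet> ?u)) \<in> borel_measurable (lborel \<Otimes>\<^sub>M lborel)"
      unfolding indicator_def atLeastAtMost_iff by measurable
    from lborel.borel_measurable_lebesgue_integral[of "\<lambda>t s. indicator {0..1} t * indicator {0..1 - t} s * (G (a + s *\<^sub>R ?u + t *\<^sub>R ?v) \<bullet> ?u)" lborel] this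
    show "(\<lambda>t. LINT s|lborel. indicator {0..1} t * indicator {0..1 - t} s * (G (a + s *\<^sub>R ?u + t *\<^sub>R ?v) \<bullet> ?u)) \<in> borel_measurable lborel"
      by (simp add: case_prod_unfold)
  qed
  also have "\<dots> = avg b c \<phi> - avg a c \<phi>"
    using avg_eq[OF phi, of b c] avg_eq[OF phi, of a c] by simp
  finally show ?thesis
    using bdd_integral_eq[OF KB _ compact_imp_bounded[OF cK] bd] by simp
qed

section \<open>Edge integrals and outer normals of a triangle\<close>

lemma avg_swap: "avg b a g = avg a b g"
proof -
  let ?h = "\<lambda>t::real. g (a + t *\<^sub>R (b - a))"
  have "((\<lambda>t. g (b + t *\<^sub>R (a - b))) has_integral i) {0..1} \<longleftrightarrow> (?h has_integral i) {0..1}" for i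
  proof -
    have e: "(\<lambda>t. g (b + t *\<^sub>R (a - b))) = (\<lambda>t. ?h (1 - t))"
      by (rule ext) (simp add: algebra_simps)
    have *: "((\<lambda>t. k (1 - t)) has_integral i) {0..1}" if "(k has_integral i) {0..1}" for k :: "real \<Rightarrow> real"
      using has_integral_affinity[of k i 0 1 "-1" 1] that by (simp add: image_affinity_atLeastAtMost cong: image_cong)
    show ?thesis unfolding e using *[of ?h] *[of "\<lambda>t. ?h (1 - t)"] by auto
  qed
  then show ?thesis unfolding avg_def integral_def integrable_on_def by auto
qed

text \<open>\<open>edge_int\<close> selects its parametrization by \<open>SOME\<close>. The
  endpoints of a segment are unique up to order and \<open>avg\<close> is symmetric in them, so
  every selection yields the same number.\<close>

lemma edge_int_seg:
  assumes "a \<noteq> b"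
  shows "edge_int (closed_segment a b) g = dist a b * avg a b g"
proof -
  have "(\<exists>a' b'. a' \<noteq> b' \<and> closed_segment a b = closed_segment a' b' \<and> r = dist a' b' * avg a' b' g) \<longleftrightarrow> r = dist a b * avg a b g" for r
    using assms by (auto simp: closed_segment_eq doubleton_eq_iff avg_swap dist_commute)
  then show ?thesis unfolding edge_int_def avg_def[symmetric] by simp
qed

lemma cr_cycle: "cr (c - b) (a - b) = cr (b - a) (c - a)"
  by (simp add: cr_def algebra_simps)

lemma cr_swap: "cr v u = - cr u v"
  by (simp add: cr_def)

lemma cr_distinct:
  assumes "cr (b - a) (c - a) \<noteq> 0" shows "a \<noteq> b" "a \<noteq> c" "b \<noteq> c"
  using assms by (auto simp: cr_def)

lemma verts_tri:
  assumes "cr (b - a) (c - a) \<noteq> 0" shows "verts (convex hull {a, b, c}) = {a, b, c}"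
proof -
  have "\<not> affine_dependent {a, b, c}"
    using assms collinear_cr[of a b c] collinear_3_eq_affine_dependent by blast
  then show ?thesis unfolding verts_def by (auto simp: extreme_point_of_convex_hull_affine_independent)
qed

lemma edges_tri:
  assumes "cr (b - a) (c - a) \<noteq> 0"
  shows "edges (convex hull {a, b, c}) = {closed_segment a b, closed_segment b c, closed_segment a c}"
  unfolding edges_def verts_tri[OF assms] using cr_distinct[OF assms]
  by (auto simp: closed_segment_commute)

lemma sum_edges_tri:
  assumes "cr (b - a) (c - a) \<noteq> 0"
  shows "(\<Sum>E\<in>edges (convex hull {a, b, c}). F E) = F (closed_segment a b) + F (closed_segment b c) + F (closed_segment a c :: pt set)"
  unfolding edges_tri[OF assms] using cr_distinct[OF assms]
  by (simp add: closed_segment_eq doubleton_eq_iff add.assoc)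

lemma is_triangle_cr: "is_triangle K \<longleftrightarrow> (\<exists>a b c. K = convex hull {a, b, c} \<and> cr (b - a) (c - a) \<noteq> 0)"
  by (simp add: is_triangle_def collinear_cr)

text \<open>For \<open>u = (a, b)\<close> and a vector \<open>(c, d)\<close> orthogonal to it: such
  a vector is \<open>u\<close> turned by a right angle, times the cross product of the two over the
  squared length of \<open>u\<close>.\<close>

lemma perp_aux:
  fixes a b c d :: real
  assumes "c * a + d * b = 0"
  shows "c * (a\<^sup>2 + b\<^sup>2) = (a * d - b * c) * - b" "d * (a\<^sup>2 + b\<^sup>2) = (a * d - b * c) * a"
  using assms by algebra+

text \<open>The candidate \<open>n0\<close> is \<open>b - a\<close> turned by a right angle and
  normalized, with the sign that points away from \<open>c\<close>. Uniqueness: both endpoints of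
  the edge lie in \<open>K\<close>, so a competitor is orthogonal to \<open>b - a\<close>, and the
  vertex \<open>c\<close> fixes its sign. The last identity is base times height, that is, twice the
  area.\<close>

lemma outer_normal_tri:
  assumes nc: "cr (b - a) (c - a) \<noteq> 0" and K: "K = convex hull {a, b, c}"
  shows "norm (outer_normal K (closed_segment a b)) = 1"
    "outer_normal K (closed_segment a b) \<bullet> (b - a) = 0"
    "dist a b * (outer_normal K (closed_segment a b) \<bullet> (c - a)) = - \<bar>cr (b - a) (c - a)\<bar>"
proof -
  let ?u = "b - a" and ?v = "c - a"
  define D where "D = cr ?u ?v"
  have D: "D \<noteq> 0" using nc by (simp add: D_def)
  have u: "norm ?u > 0" using cr_distinct[OF nc] by simp
  have u2: "(?u$1)\<^sup>2 + (?u$2)\<^sup>2 = (norm ?u)\<^sup>2" using power2_norm_eq_inner[of ?u] by (simp only: inner_pt power2_eq_square)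
  define n0 where "n0 = (- sgn D / norm ?u) *\<^sub>R vec2 (- (?u$2)) (?u$1)"
  have "vec2 (- (?u$2)) (?u$1) \<bullet> ?u = 0" by (simp add: inner_pt algebra_simps)
  then have n0u: "n0 \<bullet> ?u = 0" by (simp add: n0_def)
  have n0v: "norm ?u * (n0 \<bullet> ?v) = - \<bar>D\<bar>"
  proof -
    have "norm ?u * (n0 \<bullet> ?v) = - (sgn D * cr ?u ?v)"
      using u by (simp add: n0_def inner_pt cr_def field_simps)
    then show ?thesis by (simp add: D_def[symmetric] abs_sgn mult.commute)
  qed
  have n0n: "norm n0 = 1"
  proof -
    have "norm (vec2 (- (?u$2)) (?u$1)) = norm ?u"
      by (simp add: norm_eq inner_pt algebra_simps)
    then show ?thesis using u D by (simp add: n0_def sgn_real_def)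
  qed
  have n0ok: "n0 \<bullet> (x - y) \<le> 0" if xy: "x \<in> K" "y \<in> closed_segment a b" for x y
  proof -
    obtain s t where st: "x = a + s *\<^sub>R ?u + t *\<^sub>R ?v" "0 \<le> t" using xy(1) unfolding K convex_hull_3_alt by auto
    obtain r where r: "y = a + r *\<^sub>R ?u" using xy(2) by (auto simp: in_segment algebra_simps)
    have "n0 \<bullet> (x - y) = t * (n0 \<bullet> ?v)"
      using n0u unfolding st r by (simp add: inner_add_right inner_diff_right algebra_simps)
    moreover have "n0 \<bullet> ?v \<le> 0" using n0v u by (smt (verit) zero_less_mult_iff)
    ultimately show ?thesis using st by (simp add: mult_nonneg_nonpos)
  qed
  have uniq: "n = n0" if n: "norm n = 1" "\<forall>x\<in>K. \<forall>y\<in>closed_segment a b. n \<bullet> (x - y) \<le> 0" for n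
  proof -
    have abc: "a \<in> K" "b \<in> K" "c \<in> K" unfolding K by (auto intro: hull_inc)
    have "n \<bullet> (b - a) \<le> 0" "n \<bullet> (a - b) \<le> 0" and nv: "n \<bullet> (c - a) \<le> 0"
      using n(2) abc by (metis ends_in_segment(1) ends_in_segment(2))+
    then have nu: "n \<bullet> ?u = 0" by (simp add: inner_diff_right)
    define k where "k = cr ?u n / (norm ?u)\<^sup>2"
    have nk: "n = k *\<^sub>R vec2 (- (?u$2)) (?u$1)"
    proof -
      have z: "n$1 * ?u$1 + n$2 * ?u$2 = 0" using nu by (simp add: inner_pt)
      have e: "n$1 * (norm ?u)\<^sup>2 = cr ?u n * - (?u$2)" "n$2 * (norm ?u)\<^sup>2 = cr ?u n * ?u$1"
        unfolding u2[symmetric] cr_def by (rule perp_aux[OF z])+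
      have nz: "(norm ?u)\<^sup>2 \<noteq> 0" using u by simp
      have "n$1 = k * - (?u$2)" "n$2 = k * ?u$1"
        unfolding k_def times_divide_eq_left eq_divide_eq using e nz by metis+
      then show ?thesis by (intro pt_eqI) (simp_all only: vec2_nth vector_scaleR_component real_scaleR_def)
    qed
    have "norm (vec2 (- (?u$2)) (?u$1)) = norm ?u"
      by (simp add: norm_eq inner_pt algebra_simps)
    then have k1: "\<bar>k\<bar> * norm ?u = 1" using n(1) nk by simp
    have "n \<bullet> ?v = k * D" unfolding D_def by (subst nk) (simp add: inner_pt cr_def algebra_simps)
    then have "k * D \<le> 0" using nv by argo
    have "k = - sgn D / norm ?u"
    proof (cases "D > 0")
      case True
      then have "k \<le> 0" using \<open>k * D \<le> 0\<close> by (simp add: mult_le_0_iff)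
      then have "- k * norm ?u = 1" using k1 by simp
      then have "k = - 1 / norm ?u" using u by (subst eq_divide_eq) auto
      then show ?thesis using True by simp
    next
      case False
      then have "k \<ge> 0" using \<open>k * D \<le> 0\<close> D by (simp add: mult_le_0_iff)
      then have "k * norm ?u = 1" using k1 by simp
      then have "k = 1 / norm ?u" using u by (subst eq_divide_eq) auto
      then show ?thesis using False D by (simp add: sgn_real_def)
    qed
    then show ?thesis by (subst nk) (simp only: n0_def)
  qed
  have "outer_normal K (closed_segment a b) = n0"
    unfolding outer_normal_def
  proof (rule the_equality)
    show "norm n0 = 1 \<and> (\<forall>x\<in>K. \<forall>y\<in>closed_segment a b. n0 \<bullet> (x - y) \<le> 0)"
      using n0n n0ok by blast
  qed (use uniq in blast)
  then show "norm (outer_normal K (closed_segment a b)) = 1"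
    "outer_normal K (closed_segment a b) \<bullet> (b - a) = 0"
    "dist a b * (outer_normal K (closed_segment a b) \<bullet> (c - a)) = - \<bar>cr (b - a) (c - a)\<bar>"
    using n0n n0u n0v by (simp_all add: D_def dist_norm norm_minus_commute)
qed

lemma pt_basis_cr:
  assumes "cr u v \<noteq> 0" shows "\<exists>s t. w = s *\<^sub>R u + t *\<^sub>R v"
proof (intro exI)
  show "w = (cr w v / cr u v) *\<^sub>R u + (cr u w / cr u v) *\<^sub>R v"
    using assms by (intro pt_eqI) (simp_all add: field_simps, simp_all add: cr_def algebra_simps)
qed

text \<open>Length times normal, tested with the two edge vectors that span the plane: only 0 and
  plus or minus twice the area occur, and \<open>green_const\<close> has nothing else to compare.
  The other two edges follow by relabelling the vertices.\<close>

lemma normals_tri: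
  assumes nc: "cr (b - a) (c - a) \<noteq> 0" and K: "K = convex hull {a, b, c}"
  shows "dist a b * (outer_normal K (closed_segment a b) \<bullet> (b - a)) = 0"
    "dist a b * (outer_normal K (closed_segment a b) \<bullet> (c - a)) = - \<bar>cr (b - a) (c - a)\<bar>"
    "dist b c * (outer_normal K (closed_segment b c) \<bullet> (b - a)) = \<bar>cr (b - a) (c - a)\<bar>"
    "dist b c * (outer_normal K (closed_segment b c) \<bullet> (c - a)) = \<bar>cr (b - a) (c - a)\<bar>"
    "dist a c * (outer_normal K (closed_segment a c) \<bullet> (b - a)) = - \<bar>cr (b - a) (c - a)\<bar>"
    "dist a c * (outer_normal K (closed_segment a c) \<bullet> (c - a)) = 0"
proof -
  have Kb: "K = convex hull {b, c, a}" and Kc: "K = convex hull {a, c, b}" by (simp_all add: K insert_commute)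
  have ncb: "cr (c - b) (a - b) \<noteq> 0" and ncc: "cr (c - a) (b - a) \<noteq> 0" using nc cr_cycle[of c b a] cr_swap[of "c - a" "b - a"] by simp_all
  note A = outer_normal_tri[OF nc K] and B = outer_normal_tri[OF ncb Kb] and C = outer_normal_tri[OF ncc Kc]
  show "dist a b * (outer_normal K (closed_segment a b) \<bullet> (b - a)) = 0"
    "dist a b * (outer_normal K (closed_segment a b) \<bullet> (c - a)) = - \<bar>cr (b - a) (c - a)\<bar>"
    "dist a c * (outer_normal K (closed_segment a c) \<bullet> (b - a)) = - \<bar>cr (b - a) (c - a)\<bar>"
    "dist a c * (outer_normal K (closed_segment a c) \<bullet> (c - a)) = 0"
    using A C by (simp_all add: cr_swap[of "c - a" "b - a"])
  show "dist b c * (outer_normal K (closed_segment b c) \<bullet> (b - a)) = \<bar>cr (b - a) (c - a)\<bar>"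
    "dist b c * (outer_normal K (closed_segment b c) \<bullet> (c - a)) = \<bar>cr (b - a) (c - a)\<bar>"
    using B unfolding cr_cycle[of c b a] by (simp_all add: inner_diff_right algebra_simps)
qed

lemma avg_mult_right: "avg a b (\<lambda>x. g x * k) = avg a b g * k"
  by (simp add: avg_def integral_mult_left)

lemma gdiff_bounded_on:
  assumes "gdiff L \<phi> G" "bounded S"
  obtains B where "\<And>x. x \<in> S \<Longrightarrow> norm (G x) \<le> B" "\<And>x. x \<in> S \<Longrightarrow> \<bar>\<phi> x\<bar> \<le> B"
proof -
  obtain r where r: "S \<subseteq> cball 0 r" using assms(2) by (force simp: bounded_iff)
  obtain B1 where B1: "\<And>x. x \<in> cball 0 r \<Longrightarrow> norm (G x) \<le> B1" using assms(1) by (force simp: gdiff_def bounded_iff)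
  have "compact (\<phi> ` cball 0 r)" using assms(1) by (auto simp: gdiff_def intro!: compact_continuous_image intro: continuous_on_subset)
  then obtain B2 where B2: "\<And>x. x \<in> cball 0 r \<Longrightarrow> \<bar>\<phi> x\<bar> \<le> B2" by (force dest!: compact_imp_bounded simp: bounded_iff)
  show ?thesis by (rule that[of "max B1 B2"]) (use r B1 B2 in \<open>force simp: max_def\<close>)+
qed

lemma gdiff_integrable_on:
  assumes g: "gdiff L \<phi> G" and K: "K \<in> sets borel" "bounded K"
  shows "(\<lambda>x. G x \<bullet> w) integrable_on K" "\<phi> integrable_on K"
proof -
  have [measurable]: "G \<in> borel_measurable borel" using g by (simp add: gdiff_def)
  have [measurable]: "\<phi> \<in> borel_measurable borel" using g by (auto simp: gdiff_def intro: borel_measurable_continuous_onI)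
  obtain B where B: "\<And>x. x \<in> K \<Longrightarrow> norm (G x) \<le> B" "\<And>x. x \<in> K \<Longrightarrow> \<bar>\<phi> x\<bar> \<le> B"
    using gdiff_bounded_on[OF g K(2)] by metis
  show "(\<lambda>x. G x \<bullet> w) integrable_on K"
  proof (rule bdd_integrable_on[OF K(1) _ K(2)])
    fix x assume "x \<in> K"
    then show "\<bar>G x \<bullet> w\<bar> \<le> B * norm w"
      using Cauchy_Schwarz_ineq2[of "G x" w] B by (meson mult_right_mono norm_ge_zero order_trans)
  qed simp
  show "\<phi> integrable_on K" by (rule bdd_integrable_on[OF K(1) _ K(2) B(2)]) auto
qed

lemma tri_borel: assumes "K = convex hull {a, b, c :: pt}" shows "K \<in> sets borel" "bounded K" "compact K"
proof -
  show "compact K" unfolding assms by (simp add: compact_convex_hull)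
  then show "K \<in> sets borel" "bounded K" by (auto simp: borel_compact compact_imp_bounded)
qed

text \<open>Both sides are linear in \<open>w\<close>, so \<open>w\<close> is expanded in the edge
  vectors \<open>b - a\<close> and \<open>c - a\<close>, for which \<open>green_edge\<close>
  evaluates the integral.\<close>

lemma green_const:
  assumes nc: "cr (b - a) (c - a) \<noteq> 0" and K: "K = convex hull {a, b, c}" and g: "gdiff L \<phi> G"
  shows "(\<Sum>E\<in>edges K. edge_int E (\<lambda>x. \<phi> x * (w \<bullet> outer_normal K E))) = integral K (\<lambda>x. G x \<bullet> w)"
proof -
  let ?u = "b - a" and ?v = "c - a"
  define D where "D = \<bar>cr (b - a) (c - a)\<bar>"
  obtain s t where w: "w = s *\<^sub>R ?u + t *\<^sub>R ?v" using pt_basis_cr[OF nc] by blast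
  note N = normals_tri[OF nc K, folded D_def]
  have ncc: "cr (c - a) (b - a) \<noteq> 0" using nc by (simp add: cr_swap[of "c - a" "b - a"])
  have gu: "integral K (\<lambda>x. G x \<bullet> ?u) = D * (avg b c \<phi> - avg a c \<phi>)"
    unfolding K D_def by (rule green_edge[OF nc g])
  have gv: "integral K (\<lambda>x. G x \<bullet> ?v) = D * (avg b c \<phi> - avg a b \<phi>)"
    using green_edge[OF ncc g] unfolding K D_def by (simp add: cr_swap[of "c - a" "b - a"] insert_commute avg_swap[of c b])
  have "integral K (\<lambda>x. G x \<bullet> w) = integral K (\<lambda>x. s * (G x \<bullet> ?u) + t * (G x \<bullet> ?v))"
    unfolding w by (simp add: inner_add_right)
  also have "\<dots> = s * integral K (\<lambda>x. G x \<bullet> ?u) + t * integral K (\<lambda>x. G x \<bullet> ?v)"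
    using gdiff_integrable_on(1)[OF g tri_borel(1,2)[OF K]]
    by (subst integral_add) (auto intro: integrable_on_mult_right simp del: inner_diff_right)
  also have "\<dots> = s * (D * (avg b c \<phi> - avg a c \<phi>)) + t * (D * (avg b c \<phi> - avg a b \<phi>))" by (simp only: gu gv)
  finally have R: "integral K (\<lambda>x. G x \<bullet> w) = s * (D * (avg b c \<phi> - avg a c \<phi>)) + t * (D * (avg b c \<phi> - avg a b \<phi>))" .
  have dn: "dist p q * (outer_normal K E \<bullet> w) = s * (dist p q * (outer_normal K E \<bullet> ?u)) + t * (dist p q * (outer_normal K E \<bullet> ?v))" for p q E
    unfolding w by (simp add: inner_add_right algebra_simps)
  have "(\<Sum>E\<in>edges K. edge_int E (\<lambda>x. \<phi> x * (w \<bullet> outer_normal K E)))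
    = avg a b \<phi> * (dist a b * (outer_normal K (closed_segment a b) \<bullet> w))
    + avg b c \<phi> * (dist b c * (outer_normal K (closed_segment b c) \<bullet> w))
    + avg a c \<phi> * (dist a c * (outer_normal K (closed_segment a c) \<bullet> w))"
    using cr_distinct[OF nc]
    unfolding K sum_edges_tri[OF nc] by (simp add: edge_int_seg avg_mult_right inner_commute algebra_simps)
  also have "\<dots> = integral K (\<lambda>x. G x \<bullet> w)"
    unfolding R dn N by (simp add: algebra_simps)
  finally show ?thesis .
qed

lemma seg_mem: "0 \<le> t \<Longrightarrow> t \<le> 1 \<Longrightarrow> a + t *\<^sub>R (b - a) \<in> closed_segment a b"
  unfolding in_segment by (rule exI[of _ t]) (simp add: algebra_simps)

lemma avg_add:
  assumes "continuous_on (closed_segment a b) f" "continuous_on (closed_segment a b) g"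
  shows "avg a b (\<lambda>x. f x + g x) = avg a b f + avg a b g"
proof -
  have *: "(\<lambda>t. h (a + t *\<^sub>R (b - a))) integrable_on {0..1}" if "continuous_on (closed_segment a b) h" for h :: "pt \<Rightarrow> real"
    by (intro integrable_continuous_real continuous_on_compose2[OF that])
      (auto intro!: continuous_intros seg_mem)
  show ?thesis unfolding avg_def by (intro integral_add * assms)
qed

lemma edge_int_add:
  assumes "a \<noteq> b" "E = closed_segment a b" "continuous_on E f" "continuous_on E g"
  shows "edge_int E (\<lambda>x. f x + g x) = edge_int E f + edge_int E g"
  using assms by (simp add: edge_int_seg avg_add distrib_left)

lemma edge_int_mult: "a \<noteq> b \<Longrightarrow> E = closed_segment a b \<Longrightarrow> edge_int E (\<lambda>x. k * f x) = k * edge_int E f"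
  by (simp add: edge_int_seg avg_def)

text \<open>By relabelling, later arguments only have to treat the edge from \<open>a\<close> to
  \<open>b\<close> with opposite vertex \<open>c\<close>.\<close>

lemma edge_seg:
  assumes "is_triangle K" "E \<in> edges K"
  obtains a b c where "E = closed_segment a b" "K = convex hull {a, b, c}" "cr (b - a) (c - a) \<noteq> 0" "a \<noteq> b"
proof -
  obtain a b c where K: "K = convex hull {a, b, c}" and nc: "cr (b - a) (c - a) \<noteq> 0"
    using assms(1) by (auto simp: is_triangle_cr)
  have "E \<in> {closed_segment a b, closed_segment b c, closed_segment a c}" using assms(2) edges_tri[OF nc] K by auto
  then consider "E = closed_segment a b" | "E = closed_segment b c" | "E = closed_segment a c" by auto
  then show ?thesis
  proof cases
    case 1 show ?thesis by (rule that[OF 1 K nc cr_distinct(1)[OF nc]])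
  next
    case 2 show ?thesis by (rule that[OF 2, of a]) (use nc K cr_distinct[OF nc] cr_cycle[of c b a] in \<open>auto simp: insert_commute\<close>)
  next
    case 3 show ?thesis by (rule that[OF 3, of b]) (use nc K cr_distinct[OF nc] cr_swap[of "c - a" "b - a"] in \<open>auto simp: insert_commute\<close>)
  qed
qed

lemma finite_edges: "is_triangle K \<Longrightarrow> finite (edges K)"
  by (auto simp: is_triangle_cr edges_tri)

lemma trace_pt: "trace (B :: real^2^2) = B$1$1 + B$2$2"
  by (simp add: trace_def sum_2)

text \<open>An affine field is \<open>q1 1\<close> times the first unit vector plus
  \<open>q1 2\<close> times the second. The product of \<open>\<phi>\<close> with an affine function
  is again covered by \<open>gdiff\<close>, so the formula for constant directions applies to each
  summand; the product rule produces the trace.\<close>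

lemma green_affine:
  assumes T: "is_triangle K" and g: "gdiff L \<phi> G"
  shows "(\<Sum>E\<in>edges K. edge_int E (\<lambda>x. \<phi> x * ((c + B *v x) \<bullet> outer_normal K E)))
     = integral K (\<lambda>x. G x \<bullet> (c + B *v x) + \<phi> x * trace B)"
proof -
  obtain p q r where K: "K = convex hull {p, q, r}" and nc: "cr (q - p) (r - p) \<noteq> 0" using T by (auto simp: is_triangle_cr)
  define q1 where "q1 i x = c$i + (B$i) \<bullet> x" for i and x :: pt
  have qe: "(c + B *v x) = q1 1 x *\<^sub>R axis 1 1 + q1 2 x *\<^sub>R axis 2 1" for x
    by (rule pt_eqI) (simp_all add: q1_def matrix_vector_mul_component inner_vec_def)
  have gi: "gdiff L (\<lambda>x. \<phi> x * q1 i x) (\<lambda>x. q1 i x *\<^sub>R G x + \<phi> x *\<^sub>R B$i)" for i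
    unfolding q1_def by (rule gdiff_mult_affine[OF g])
  note gc = green_const[OF nc K gi]
  have c: "continuous_on S \<phi>" for S using g by (auto simp: gdiff_def intro: continuous_on_subset)
  have "(\<Sum>E\<in>edges K. edge_int E (\<lambda>x. \<phi> x * ((c + B *v x) \<bullet> outer_normal K E))) =
    (\<Sum>E\<in>edges K. edge_int E (\<lambda>x. (\<phi> x * q1 1 x) * (axis 1 1 \<bullet> outer_normal K E)) + edge_int E (\<lambda>x. (\<phi> x * q1 2 x) * (axis 2 1 \<bullet> outer_normal K E)))"
  proof (rule sum.cong[OF refl])
    fix E assume "E \<in> edges K"
    then obtain a b where E: "E = closed_segment a b" "a \<noteq> b" using edge_seg[OF T] by metis
    show "edge_int E (\<lambda>x. \<phi> x * ((c + B *v x) \<bullet> outer_normal K E)) =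
       edge_int E (\<lambda>x. (\<phi> x * q1 1 x) * (axis 1 1 \<bullet> outer_normal K E)) + edge_int E (\<lambda>x. (\<phi> x * q1 2 x) * (axis 2 1 \<bullet> outer_normal K E))"
      unfolding qe by (subst edge_int_add[OF E(2,1), symmetric])
       (auto simp: q1_def algebra_simps inner_simps intro!: continuous_intros c)
  qed
  also have "\<dots> = integral K (\<lambda>x. (q1 1 x *\<^sub>R G x + \<phi> x *\<^sub>R B$1) \<bullet> axis 1 1) + integral K (\<lambda>x. (q1 2 x *\<^sub>R G x + \<phi> x *\<^sub>R B$2) \<bullet> axis 2 1)"
    unfolding sum.distrib gc ..
  also have "\<dots> = integral K (\<lambda>x. (q1 1 x *\<^sub>R G x + \<phi> x *\<^sub>R B$1) \<bullet> axis 1 1 + (q1 2 x *\<^sub>R G x + \<phi> x *\<^sub>R B$2) \<bullet> axis 2 1)"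
    by (rule integral_add[symmetric]) (rule gdiff_integrable_on(1)[OF gi tri_borel(1,2)[OF K]])+
  also have "\<dots> = integral K (\<lambda>x. G x \<bullet> (c + B *v x) + \<phi> x * trace B)"
    unfolding qe by (simp add: inner_axis trace_pt algebra_simps inner_simps)
  finally show ?thesis .
qed

section \<open>Existence of weak gradients and divergences\<close>

text \<open>Definiteness on the diagonal makes \<open>T\<close>, which lists the values of
  \<open>b x\<close> on the basis, injective and therefore onto. Weak gradients and divergences are
  representers obtained this way.\<close>

lemma Riesz_fin_dim:
  fixes b :: "'a::euclidean_space \<Rightarrow> 'a \<Rightarrow> real"
  assumes l1: "\<And>y. linear (\<lambda>x. b x y)" and l2: "\<And>x. linear (b x)"
    and pos: "\<And>x. b x x = 0 \<Longrightarrow> x = 0" and L: "linear L"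
  shows "\<exists>x. \<forall>y. b x y = L y"
proof -
  define T where "T x = (\<Sum>i\<in>Basis. b x i *\<^sub>R i)" for x
  have "linear T" unfolding T_def
    by (rule linearI) (simp_all add: linear_add[OF l1] linear_cmul[OF l1] scaleR_add_left sum.distrib scaleR_sum_right)
  have rep: "f y = (\<Sum>i\<in>Basis. (y \<bullet> i) * f i)" if "linear f" for f :: "'a \<Rightarrow> real" and y
    using that by (subst (1) euclidean_representation[of y, symmetric])
      (simp only: linear_sum linear_cmul real_scaleR_def)
  have Ti: "T x \<bullet> i = b x i" if "i \<in> Basis" for x i unfolding T_def using that by (simp add: inner_sum_left_Basis)
  have "inj T"
  proof (rule linear_injective_0[OF \<open>linear T\<close>, THEN iffD2], intro allI impI)
    fix x assume "T x = 0"
    then have "b x i = 0" if "i \<in> Basis" for i using Ti[OF that, of x] by simp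
    then have "b x x = 0" by (subst rep[OF l2]) simp
    then show "x = 0" by (rule pos)
  qed
  then have "surj T" using \<open>linear T\<close> linear_injective_imp_surjective by blast
  then obtain x where x: "T x = (\<Sum>i\<in>Basis. L i *\<^sub>R i)" by (metis surjD)
  have bi: "b x i = L i" if "i \<in> Basis" for i
    using Ti[OF that, of x] that unfolding x by (simp add: inner_sum_left_Basis)
  have "b x y = L y" for y using bi by (subst rep[OF l2], subst rep[OF L]) simp
  then show ?thesis by blast
qed

lemma cont_integrable:
  fixes f :: "pt \<Rightarrow> real"
  assumes "continuous_on UNIV f" "is_triangle K" shows "f integrable_on K"
proof -
  obtain a b c where K: "K = convex hull {a, b, c}" using assms(2) by (auto simp: is_triangle_cr)
  have "compact (f ` K)" using tri_borel(3)[OF K] assms(1) by (auto intro!: compact_continuous_image intro: continuous_on_subset)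
  then obtain B where "\<And>x. x \<in> K \<Longrightarrow> \<bar>f x\<bar> \<le> B" by (force dest!: compact_imp_bounded simp: bounded_iff)
  then show ?thesis using tri_borel[OF K] assms(1) by (intro bdd_integrable_on[of K f B] borel_measurable_continuous_onI)
qed

lemma interior_tri: assumes "is_triangle K" shows "interior K \<noteq> {}"
proof -
  obtain a b c where K: "K = convex hull {a, b, c}" and nc: "cr (b - a) (c - a) \<noteq> 0" using assms by (auto simp: is_triangle_cr)
  have "\<not> affine_dependent {a, b, c}"
    using nc collinear_cr[of a b c] collinear_3_eq_affine_dependent by blast
  moreover have "card {a, b, c} = Suc DIM(pt)" using cr_distinct[OF nc] by simp
  ultimately show ?thesis unfolding K using interior_convex_hull_eq_empty by blast
qed

text \<open>Together with \<open>affine_zero_ball\<close> this yields definiteness of the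
  \<open>L\<^sup>2\<close> product on affine functions: their squares are continuous and
  nonnegative, and an affine function vanishing on a ball is zero.\<close>

lemma zero_on_box_of_integral:
  fixes f :: "pt \<Rightarrow> real"
  assumes T: "is_triangle K" and f: "continuous_on UNIV f" and nn: "\<And>x::pt. 0 \<le> f x" and z: "integral K f = 0"
  obtains p e where "e > 0" "\<And>x. x \<in> ball p e \<Longrightarrow> f x = 0"
proof -
  obtain p where "p \<in> interior K" using interior_tri[OF T] by blast
  then obtain e0 where e0: "e0 > 0" "ball p e0 \<subseteq> K" by (meson mem_interior)
  have "p \<in> ball p e0" using e0 by simp
  then obtain l u where lu: "p \<in> box l u" "cbox l u \<subseteq> ball p e0"
    using open_contains_cbox[OF open_ball] by metis
  have fi: "f integrable_on K" "f integrable_on cbox l u"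
    using cont_integrable[OF f T] f by (auto intro!: integrable_continuous intro: continuous_on_subset)
  have "integral (cbox l u) f \<le> integral K f"
    by (rule integral_subset_le) (use lu e0 fi nn in auto)
  moreover have "integral (cbox l u) f \<ge> 0" using fi nn by (simp add: integral_nonneg)
  ultimately have "(f has_integral 0) (cbox l u)" using z fi by (metis antisym has_integral_integral)
  then have f0: "f x = 0" if "x \<in> cbox l u" for x
    using has_integral_0_cbox_imp_0[of l u f x] lu that nn f by (auto intro: continuous_on_subset)
  obtain e where "e > 0" "ball p e \<subseteq> box l u" using lu(1) by (meson open_box open_contains_ball)
  then show ?thesis using that[of e p] f0 box_subset_cbox by blast
qed

lemma affine_zero_ball:
  fixes f :: "pt \<Rightarrow> 'b::real_vector"
  assumes "linear f" "e > 0" "\<And>x. x \<in> ball p e \<Longrightarrow> c + f x = 0"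
  shows "c = 0 \<and> (\<forall>x. f x = 0)"
proof -
  have p: "c + f p = 0" using assms by auto
  have z: "f x = 0" for x
  proof (cases "x = 0")
    case True then show ?thesis using assms(1) by (simp add: linear_0)
  next
    case False
    define t where "t = e / (2 * norm x)"
    have t: "t > 0" using assms(2) False by (simp add: t_def)
    have "p + t *\<^sub>R x \<in> ball p e" using False assms(2) t by (simp add: dist_norm t_def)
    then have "c + f (p + t *\<^sub>R x) = 0" by (rule assms(3))
    then have "t *\<^sub>R f x = 0" using p assms(1) by (simp add: linear_add linear_cmul add.assoc[symmetric])
    then show ?thesis using t by simp
  qed
  then show ?thesis using p by simp
qed

lemma integral_const_K: "integral K (\<lambda>x::pt. c::real) = c * integral K (\<lambda>x. 1)"
  by (simp flip: integral_mult_right)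

text \<open>Continuity on each edge makes edge integrals additive in the test field; functions in
  \<open>Sh0\<close> have it because they are affine there.\<close>

definition nice :: "(pt set \<Rightarrow> pt \<Rightarrow> real) \<Rightarrow> pt set \<Rightarrow> bool" where
  "nice vb K \<longleftrightarrow> (\<forall>E\<in>edges K. continuous_on E (vb E))"

text \<open>Justifies the \<open>THE\<close> in \<open>wgrad\<close>. An affine field is a pair of a
  vector and a matrix, and such pairs form a Euclidean space; on it the defining equation says that
  the \<open>L\<^sup>2\<close> product \<open>b\<close> represents the functional
  \<open>L\<close>.\<close>

lemma is_wgrad_ex1:
  assumes T: "is_triangle K" and n: "nice (snd v) K"
  shows "\<exists>!G. is_wgrad v K G"
proof -
  let ?aff = "\<lambda>(c::pt, B::real^2^2) x. c + B *v x"
  define b where "b p q = integral K (\<lambda>x. ?aff p x \<bullet> ?aff q x)" for p q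
  define L where "L = (\<lambda>(c::pt, B::real^2^2). - integral K (\<lambda>x. fst v K * trace B)
          + (\<Sum>E\<in>edges K. edge_int E (\<lambda>x. snd v E x * ((c + B *v x) \<bullet> outer_normal K E))))"
  have ac: "continuous_on S (?aff p)" for S p
    by (auto simp: case_prod_unfold intro!: continuous_intros matrix_vector_mult_linear_continuous_on)
  have ii: "(\<lambda>x. ?aff p x \<bullet> ?aff q x) integrable_on K" for p q
    by (intro cont_integrable T continuous_intros ac)
  have aadd: "?aff (p + q) x = ?aff p x + ?aff q x" for p q x
    by (cases p; cases q) (simp add: matrix_vector_mult_add_rdistrib)
  have asc: "?aff (r *\<^sub>R p) x = r *\<^sub>R ?aff p x" for p r x
    by (cases p) (simp add: scaleR_matrix_vector_assoc scaleR_add_right)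
  have l1: "linear (\<lambda>x. b x y)" for y
    unfolding b_def by (rule linearI) (simp_all only: aadd asc inner_add_left inner_scaleR_left integral_add[OF ii ii] integral_mult_right, simp_all)
  have sym: "b x y = b y x" for x y unfolding b_def by (simp add: inner_commute)
  have l2: "linear (b x)" for x
  proof -
    have "b x = (\<lambda>y. b y x)" using sym by blast
    then show ?thesis using l1[of x] by argo
  qed
  have pos: "p = 0" if z: "b p p = 0" for p
  proof -
    obtain c B where p: "p = (c, B)" by (cases p)
    obtain q e where e: "e > 0" "\<And>x. x \<in> ball q e \<Longrightarrow> ?aff p x \<bullet> ?aff p x = 0"
      using zero_on_box_of_integral[OF T continuous_on_inner[OF ac ac] inner_ge_zero z[unfolded b_def]] by blast
    then have "\<And>x. x \<in> ball q e \<Longrightarrow> c + B *v x = 0" by (simp add: p)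
    then have "c = 0 \<and> (\<forall>x. B *v x = 0)" by (intro affine_zero_ball[OF _ e(1)]) auto
    then show ?thesis by (simp add: p zero_prod_def matrix_eq[of B 0])
  qed
  have ec: "continuous_on E (\<lambda>x. snd v E x * (?aff p x \<bullet> k))" if "E \<in> edges K" for E p k
    using n that unfolding nice_def by (intro continuous_intros ac) auto
  have L: "linear L"
  proof (rule linearI)
    fix p q :: "pt \<times> (real^2^2)"
    have "edge_int E (\<lambda>x. snd v E x * (?aff (p + q) x \<bullet> outer_normal K E)) = edge_int E (\<lambda>x. snd v E x * (?aff p x \<bullet> outer_normal K E))
       + edge_int E (\<lambda>x. snd v E x * (?aff q x \<bullet> outer_normal K E))" if E: "E \<in> edges K" for E
    proof -
      obtain a b c where E2: "E = closed_segment a b" "a \<noteq> b" using edge_seg[OF T E] by metis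
      show ?thesis unfolding aadd inner_add_left distrib_left
        by (rule edge_int_add[OF E2(2,1) ec[OF E] ec[OF E]])
    qed
    then have "(\<Sum>E\<in>edges K. edge_int E (\<lambda>x. snd v E x * (?aff (p + q) x \<bullet> outer_normal K E))) = (\<Sum>E\<in>edges K. edge_int E (\<lambda>x. snd v E x * (?aff p x \<bullet> outer_normal K E)))
       + (\<Sum>E\<in>edges K. edge_int E (\<lambda>x. snd v E x * (?aff q x \<bullet> outer_normal K E)))" by (simp add: sum.distrib)
    then show "L (p + q) = L p + L q" unfolding L_def
      by (cases p; cases q) (simp add: integral_const_K[of _ "_ * _"] integral_const_K[of _ "trace _"] integral_const_K[of _ "_ + _"] trace_add algebra_simps sum.distrib)
  next
    fix r and p :: "pt \<times> (real^2^2)"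
    have "edge_int E (\<lambda>x. snd v E x * (?aff (r *\<^sub>R p) x \<bullet> outer_normal K E)) = r * edge_int E (\<lambda>x. snd v E x * (?aff p x \<bullet> outer_normal K E))" if E: "E \<in> edges K" for E
    proof -
      obtain a b c where E2: "E = closed_segment a b" "a \<noteq> b" using edge_seg[OF T E] by metis
      have "snd v E x * (r *\<^sub>R ?aff p x \<bullet> k) = r * (snd v E x * (?aff p x \<bullet> k))" for x k by simp
      then show ?thesis unfolding asc using edge_int_mult[OF E2(2,1)] by (simp only:)
    qed
    then have "(\<Sum>E\<in>edges K. edge_int E (\<lambda>x. snd v E x * (?aff (r *\<^sub>R p) x \<bullet> outer_normal K E))) = r * (\<Sum>E\<in>edges K. edge_int E (\<lambda>x. snd v E x * (?aff p x \<bullet> outer_normal K E)))"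
      by (simp add: sum_distrib_left)
    then show "L (r *\<^sub>R p) = r *\<^sub>R L p" unfolding L_def
      by (cases p) (simp add: integral_const_K[of _ "_ * _"] integral_const_K[of _ "_ + _"] trace_pt algebra_simps sum_distrib_left)
  qed
  obtain p where p: "\<And>q. b p q = L q" using Riesz_fin_dim[OF l1 l2 pos L] by blast
  have iff: "is_wgrad v K G \<longleftrightarrow> (\<exists>r. G = ?aff r \<and> (\<forall>q. b r q = L q))" for G
    unfolding is_wgrad_def b_def L_def by (force simp: fun_eq_iff)
  have "?aff r = ?aff p" if "\<forall>q. b r q = L q" for r
  proof -
    have "b r q = b p q" for q using spec[OF that, of q] p[of q] by argo
    then have "b (r - p) (r - p) = 0" unfolding linear_diff[OF l1, of r p] by (metis diff_self)
    then have "r - p = 0" by (rule pos)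
    then show ?thesis by simp
  qed
  note u = this
  show ?thesis
  proof (rule ex1I[of _ "?aff p"])
    show "is_wgrad v K (?aff p)" unfolding iff using p by blast
    fix G assume "is_wgrad v K G"
    then obtain r where r: "G = ?aff r" "\<forall>q. b r q = L q" unfolding iff by blast
    show "G = ?aff p" unfolding r(1) by (rule u[OF r(2)])
  qed
qed

text \<open>The argument for the weak gradient, now on pairs of a number and a vector, which stand
  for scalar affine functions.\<close>

lemma is_wdiv_ex1:
  assumes T: "is_triangle K" and n: "\<And>i. nice (\<lambda>E x. snd v E x $ i) K"
  shows "\<exists>!D. is_wdiv v K D"
proof -
  let ?aff = "\<lambda>(c::real, w::pt) x. c + w \<bullet> x"
  define b where "b p q = integral K (\<lambda>x. ?aff p x * ?aff q x)" for p q
  define L where "L = (\<lambda>(c::real, w::pt). - integral K (\<lambda>x. fst v K \<bullet> w)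
          + (\<Sum>E\<in>edges K. edge_int E (\<lambda>x. (snd v E x \<bullet> outer_normal K E) * (c + w \<bullet> x))))"
  have ac: "continuous_on S (?aff p)" for S p
    by (auto simp: case_prod_unfold intro!: continuous_intros)
  have ii: "(\<lambda>x. ?aff p x * ?aff q x) integrable_on K" for p q
    by (intro cont_integrable T continuous_intros ac)
  have aadd: "?aff (p + q) x = ?aff p x + ?aff q x" for p q x
    by (cases p; cases q) (simp add: inner_add_left)
  have asc: "?aff (r *\<^sub>R p) x = r * ?aff p x" for p r x
    by (cases p) (simp add: algebra_simps)
  have l1: "linear (\<lambda>x. b x y)" for y
    unfolding b_def by (rule linearI) (simp_all only: aadd asc distrib_right mult.assoc integral_add[OF ii ii] integral_mult_right, simp_all)
  have sym: "b x y = b y x" for x y unfolding b_def by (simp add: mult.commute)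
  have l2: "linear (b x)" for x
  proof -
    have "b x = (\<lambda>y. b y x)" using sym by blast
    then show ?thesis using l1[of x] by argo
  qed
  have pos: "p = 0" if z: "b p p = 0" for p
  proof -
    obtain c w where p: "p = (c, w)" by (cases p)
    obtain q e where e: "e > 0" "\<And>x. x \<in> ball q e \<Longrightarrow> ?aff p x * ?aff p x = 0"
      using zero_on_box_of_integral[OF T continuous_on_mult[OF ac ac] zero_le_square z[unfolded b_def]] by blast
    then have "\<And>x. x \<in> ball q e \<Longrightarrow> c + w \<bullet> x = 0" by (simp add: p)
    then have "c = 0 \<and> (\<forall>x. w \<bullet> x = 0)" by (intro affine_zero_ball[OF _ e(1)]) (auto simp: bounded_linear.linear[OF bounded_linear_inner_right])
    then show ?thesis by (metis p inner_eq_zero_iff zero_prod_def)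
  qed
  have vc: "continuous_on E (snd v E)" if "E \<in> edges K" for E
    using n that unfolding nice_def by (subst continuous_on_componentwise) (auto simp: Basis_pt inner_axis)
  have ec: "continuous_on E (\<lambda>x. (snd v E x \<bullet> k) * ?aff p x)" if "E \<in> edges K" for E p k
    using that by (intro continuous_intros ac vc)
  have L: "linear L"
  proof (rule linearI)
    fix p q :: "real \<times> pt"
    have "edge_int E (\<lambda>x. (snd v E x \<bullet> outer_normal K E) * ?aff (p + q) x) = edge_int E (\<lambda>x. (snd v E x \<bullet> outer_normal K E) * ?aff p x)
       + edge_int E (\<lambda>x. (snd v E x \<bullet> outer_normal K E) * ?aff q x)" if E: "E \<in> edges K" for E
    proof -
      obtain a b c where E2: "E = closed_segment a b" "a \<noteq> b" using edge_seg[OF T E] by metis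
      show ?thesis unfolding aadd distrib_left
        by (rule edge_int_add[OF E2(2,1) ec[OF E] ec[OF E]])
    qed
    then have "(\<Sum>E\<in>edges K. edge_int E (\<lambda>x. (snd v E x \<bullet> outer_normal K E) * ?aff (p + q) x)) =
      (\<Sum>E\<in>edges K. edge_int E (\<lambda>x. (snd v E x \<bullet> outer_normal K E) * ?aff p x)) + (\<Sum>E\<in>edges K. edge_int E (\<lambda>x. (snd v E x \<bullet> outer_normal K E) * ?aff q x))"
      by (simp add: sum.distrib)
    then show "L (p + q) = L p + L q" unfolding L_def
      by (cases p; cases q) (simp add: integral_const_K[of _ "_ \<bullet> _"] integral_const_K[of _ "_ + _"] inner_add_right algebra_simps)
  next
    fix r and p :: "real \<times> pt"
    have "edge_int E (\<lambda>x. (snd v E x \<bullet> outer_normal K E) * ?aff (r *\<^sub>R p) x) = r * edge_int E (\<lambda>x. (snd v E x \<bullet> outer_normal K E) * ?aff p x)" if E: "E \<in> edges K" for E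
    proof -
      obtain a b c where E2: "E = closed_segment a b" "a \<noteq> b" using edge_seg[OF T E] by metis
      show ?thesis unfolding asc mult.left_commute[of _ r] using edge_int_mult[OF E2(2,1)] by (simp only:)
    qed
    then have "(\<Sum>E\<in>edges K. edge_int E (\<lambda>x. (snd v E x \<bullet> outer_normal K E) * ?aff (r *\<^sub>R p) x)) =
      r * (\<Sum>E\<in>edges K. edge_int E (\<lambda>x. (snd v E x \<bullet> outer_normal K E) * ?aff p x))"
      by (simp add: sum_distrib_left)
    then show "L (r *\<^sub>R p) = r *\<^sub>R L p" unfolding L_def
      by (cases p) (simp add: integral_const_K[of _ "_ * _"] integral_const_K[of _ "trace _"] integral_const_K[of _ "_ \<bullet> _"] algebra_simps)
  qed
  obtain p where p: "\<And>q. b p q = L q" using Riesz_fin_dim[OF l1 l2 pos L] by blast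
  have iff: "is_wdiv v K G \<longleftrightarrow> (\<exists>r. G = ?aff r \<and> (\<forall>q. b r q = L q))" for G
    unfolding is_wdiv_def b_def L_def by (force simp: fun_eq_iff)
  have "?aff r = ?aff p" if "\<forall>q. b r q = L q" for r
  proof -
    have "b r q = b p q" for q using spec[OF that, of q] p[of q] by argo
    then have "b (r - p) (r - p) = 0" unfolding linear_diff[OF l1, of r p] by (metis diff_self)
    then have "r - p = 0" by (rule pos)
    then show ?thesis by simp
  qed
  note u = this
  show ?thesis
  proof (rule ex1I[of _ "?aff p"])
    show "is_wdiv v K (?aff p)" unfolding iff using p by blast
    fix G assume "is_wdiv v K G"
    then obtain r where r: "G = ?aff r" "\<forall>q. b r q = L q" unfolding iff by blast
    show "G = ?aff p" unfolding r(1) by (rule u[OF r(2)])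
  qed
qed

lemma is_wgrad_wgrad: "is_triangle K \<Longrightarrow> nice (snd v) K \<Longrightarrow> is_wgrad v K (wgrad v K)"
  unfolding wgrad_def by (rule theI'[OF is_wgrad_ex1])

lemma is_wdiv_wdiv: "is_triangle K \<Longrightarrow> (\<And>i. nice (\<lambda>E x. snd v E x $ i) K) \<Longrightarrow> is_wdiv v K (wdiv v K)"
  unfolding wdiv_def by (rule theI'[OF is_wdiv_ex1])

lemma Sh0_nice:
  assumes "v \<in> Sh0 \<Omega> T" "K \<in> T" shows "nice (snd v) K"
  unfolding nice_def
proof
  fix E assume "E \<in> edges K"
  then obtain c w where "\<forall>x\<in>E. snd v E x = c + w \<bullet> x" using assms unfolding Sh0_def by blast
  then show "continuous_on E (snd v E)"
    by (subst continuous_on_cong[OF refl]) (auto intro!: continuous_intros)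
qed

section \<open>Piecewise affine fields\<close>

text \<open>Piecewise affine functions without naming the pieces: affine on every convex set that
  avoids the lines. In this form sums only need the union of the lines, and affine substitutions
  only their preimages. Constancy of \<open>G\<close> on such sets is what
  \<open>cross_bound\<close> exploits.\<close>

definition pwaff :: "(pt \<times> real) set \<Rightarrow> (pt \<Rightarrow> real) \<Rightarrow> (pt \<Rightarrow> pt) \<Rightarrow> bool" where
  "pwaff L \<phi> G \<longleftrightarrow> lines L \<and> continuous_on UNIV \<phi> \<and> G \<in> borel_measurable borel \<and> bounded (range G) \<and>
     (\<forall>U. convex U \<longrightarrow> U \<inter> lset L = {} \<longrightarrow> (\<exists>c w. \<forall>x\<in>U. \<phi> x = c + w \<bullet> x \<and> G x = w))"

lemma pwaff_gdiff: assumes "pwaff L \<phi> G" shows "gdiff L \<phi> G"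
proof -
  have L: "lines L" and b: "bounded (range G)" using assms by (auto simp: pwaff_def)
  have "bounded (G ` cball 0 r)" for r using b by (rule bounded_subset) auto
  moreover have "(\<phi> has_derivative (\<lambda>h. G x \<bullet> h)) (at x)" if "x \<notin> lset L" for x
  proof -
    have "open (- lset L)" using closed_lset[OF L] by auto
    moreover have "x \<in> - lset L" using that by simp
    ultimately obtain e where e: "e > 0" "ball x e \<subseteq> - lset L" by (rule openE)
    then obtain c w where cw: "\<And>y. y \<in> ball x e \<Longrightarrow> \<phi> y = c + w \<bullet> y \<and> G y = w"
      using assms convex_ball[of x e] unfolding pwaff_def by (metis disjoint_eq_subset_Compl)
    have "((\<lambda>y. c + w \<bullet> y) has_derivative (\<lambda>h. w \<bullet> h)) (at x)" by (auto intro!: derivative_eq_intros)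
    then have "(\<phi> has_derivative (\<lambda>h. w \<bullet> h)) (at x)"
      by (rule has_derivative_transform_within_open[of _ _ x UNIV "ball x e"]) (use e cw in auto)
    then show ?thesis using cw[of x] e by simp
  qed
  ultimately show ?thesis using assms by (simp add: gdiff_def pwaff_def)
qed

lemma pwaff_mono:
  assumes "pwaff L \<phi> G" "L \<subseteq> L'" "lines L'" shows "pwaff L' \<phi> G"
proof -
  have "lset L \<subseteq> lset L'" using assms(2) by (auto simp: lset_def)
  then show ?thesis using assms unfolding pwaff_def by (metis Int_mono order_refl subset_empty)
qed

lemma pwaff_add:
  assumes "pwaff L \<phi> G" "pwaff L \<psi> H" shows "pwaff L (\<lambda>x. \<phi> x + \<psi> x) (\<lambda>x. G x + H x)"
proof -
  have m[measurable]: "G \<in> borel_measurable borel" "H \<in> borel_measurable borel" using assms by (auto simp: pwaff_def)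
  have "bounded (range (\<lambda>x. G x + H x))"
  proof -
    obtain B C where "\<And>x. norm (G x) \<le> B" "\<And>x. norm (H x) \<le> C" using assms by (auto simp: pwaff_def bounded_iff)
    then have "norm (G x + H x) \<le> B + C" for x by (meson add_mono norm_triangle_ineq order_trans)
    then show ?thesis by (auto simp: bounded_iff)
  qed
  moreover have "\<exists>c w. \<forall>x\<in>U. \<phi> x + \<psi> x = c + w \<bullet> x \<and> G x + H x = w" if U: "convex U" "U \<inter> lset L = {}" for U
  proof -
    obtain c w where 1: "\<forall>x\<in>U. \<phi> x = c + w \<bullet> x \<and> G x = w" using assms(1) U unfolding pwaff_def by blast
    obtain c' w' where 2: "\<forall>x\<in>U. \<psi> x = c' + w' \<bullet> x \<and> H x = w'" using assms(2) U unfolding pwaff_def by blast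
    show ?thesis by (rule exI[of _ "c + c'"], rule exI[of _ "w + w'"]) (use 1 2 in \<open>auto simp: inner_add_left\<close>)
  qed
  ultimately show ?thesis using assms unfolding pwaff_def by (auto intro!: continuous_on_add)
qed

lemma pwaff_cmult:
  assumes "pwaff L \<phi> G" shows "pwaff L (\<lambda>x. k * \<phi> x) (\<lambda>x. k *\<^sub>R G x)"
proof -
  have m[measurable]: "G \<in> borel_measurable borel" using assms by (auto simp: pwaff_def)
  have "bounded (range (\<lambda>x. k *\<^sub>R G x))"
    using bounded_scaling[of "range G" k] assms by (simp add: pwaff_def image_image)
  moreover have "\<exists>c w. \<forall>x\<in>U. k * \<phi> x = c + w \<bullet> x \<and> k *\<^sub>R G x = w" if U: "convex U" "U \<inter> lset L = {}" for U
  proof -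
    obtain c w where 1: "\<forall>x\<in>U. \<phi> x = c + w \<bullet> x \<and> G x = w" using assms(1) U unfolding pwaff_def by blast
    show ?thesis by (rule exI[of _ "k * c"], rule exI[of _ "k *\<^sub>R w"]) (use 1 in \<open>auto simp: distrib_left\<close>)
  qed
  ultimately show ?thesis using assms unfolding pwaff_def by (auto intro!: continuous_on_mult)
qed

lemma pwaff_zero: "lines L \<Longrightarrow> pwaff L (\<lambda>x. 0) (\<lambda>x. 0)"
  unfolding pwaff_def by (auto intro!: exI[of _ 0])

lemma pwaff_sum:
  assumes "finite I" "lines L" "\<And>i. i \<in> I \<Longrightarrow> pwaff L (\<phi> i) (G i)"
  shows "pwaff L (\<lambda>x. \<Sum>i\<in>I. \<phi> i x) (\<lambda>x. \<Sum>i\<in>I. G i x)"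
  using assms(1,3) by (induction I rule: finite_induct) (simp_all add: pwaff_zero assms(2) pwaff_add)

lemma pwaff_sum_ex:
  assumes "finite I" "\<And>i. i \<in> I \<Longrightarrow> \<exists>L. pwaff L (\<phi> i) (G i)"
  shows "\<exists>L. pwaff L (\<lambda>x. \<Sum>i\<in>I. \<phi> i x) (\<lambda>x. \<Sum>i\<in>I. G i x)"
proof -
  obtain L where L: "\<And>i. i \<in> I \<Longrightarrow> pwaff (L i) (\<phi> i) (G i)" using assms(2) by metis
  have l: "lines (\<Union>i\<in>I. L i)" using L assms(1) by (fastforce simp: pwaff_def lines_def)
  have "pwaff (\<Union>i\<in>I. L i) (\<phi> i) (G i)" if "i \<in> I" for i
    by (rule pwaff_mono[OF L[OF that] _ l]) (use that in auto)
  then show ?thesis using pwaff_sum[OF assms(1) l] by blast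
qed

text \<open>Preimage of the lines under the map sending \<open>x\<close> to
  \<open>a + N *v x\<close>, as \<open>lset_laff\<close> confirms.\<close>

definition laff :: "pt \<Rightarrow> real^2^2 \<Rightarrow> (pt \<times> real) set \<Rightarrow> (pt \<times> real) set" where
  "laff a N L = (\<lambda>(n, d). (transpose N *v n, d - n \<bullet> a)) ` L"

lemma lset_laff: "x \<in> lset (laff a N L) \<longleftrightarrow> a + N *v x \<in> lset L"
proof -
  have "(transpose N *v n) \<bullet> x = d - n \<bullet> a \<longleftrightarrow> n \<bullet> (a + N *v x) = d" for n d
    using dot_lmul_matrix[of n N x] by (auto simp: inner_add_right transpose_matrix_vector)
  then show ?thesis by (simp add: lset_def laff_def split_beta)
qed

lemma lines_laff:
  assumes "det N \<noteq> 0" "lines L" shows "lines (laff a N L)"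
proof -
  have "n = 0" if "transpose N *v n = 0" for n
    using that assms(1) by (metis det_transpose invertible_det_nz matrix_left_invertible_ker invertible_left_inverse)
  then show ?thesis using assms(2) by (auto simp: lines_def laff_def)
qed

lemma pwaff_affine:
  assumes "pwaff L \<phi> G" "det N \<noteq> 0"
  shows "pwaff (laff a N L) (\<lambda>x. \<phi> (a + N *v x)) (\<lambda>x. transpose N *v G (a + N *v x))"
proof -
  have Gm[measurable]: "G \<in> borel_measurable borel" and Gb: "bounded (range G)" and L: "lines L"
    and phi: "continuous_on UNIV \<phi>" using assms by (auto simp: pwaff_def)
  have c: "continuous_on UNIV (\<lambda>x. a + N *v x)"
    by (intro continuous_intros matrix_vector_mult_linear_continuous_on)
  have "(\<lambda>y. 0 + transpose N *v y) \<circ> (\<lambda>x. G (a + N *v x)) \<in> borel_measurable borel"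
    by (rule measurable_comp[OF _ affine_borel]) measurable
  then have m: "(\<lambda>x. transpose N *v G (a + N *v x)) \<in> borel_measurable borel" by (simp add: o_def)
  have "bounded ((\<lambda>y. transpose N *v y) ` range G)"
    by (rule bounded_linear_image[OF Gb]) (rule matrix_vector_mul_bounded_linear)
  then have b: "bounded (range (\<lambda>x. transpose N *v G (a + N *v x)))" by (rule bounded_subset) auto
  have "\<exists>c w. \<forall>x\<in>U. \<phi> (a + N *v x) = c + w \<bullet> x \<and> transpose N *v G (a + N *v x) = w"
    if U: "convex U" "U \<inter> lset (laff a N L) = {}" for U
  proof -
    have "(\<lambda>x. a + N *v x) ` U = (+) a ` ((*v) N ` U)" by auto
    then have "convex ((\<lambda>x. a + N *v x) ` U)" using U(1)
      by (simp only: convex_translation convex_linear_image matrix_vector_mul_linear)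
    moreover have "(\<lambda>x. a + N *v x) ` U \<inter> lset L = {}" using U(2) lset_laff by blast
    ultimately obtain c w where cw: "\<forall>y\<in>(\<lambda>x. a + N *v x) ` U. \<phi> y = c + w \<bullet> y \<and> G y = w"
      using assms(1) unfolding pwaff_def by blast
    have "w \<bullet> (a + N *v x) = w \<bullet> a + (transpose N *v w) \<bullet> x" for x
      using dot_lmul_matrix[of w N x] by (simp add: inner_add_right transpose_matrix_vector)
    then show ?thesis by (intro exI[of _ "c + w \<bullet> a"] exI[of _ "transpose N *v w"]) (use cw in auto)
  qed
  then show ?thesis unfolding pwaff_def
    using lines_laff[OF assms(2) L] m b continuous_on_compose2[OF phi c] by auto
qed

text \<open>A convex set avoiding a line lies on one side of it. Packaging the side as a number
  \<open>\<sigma>\<close> turns absolute values into affine expressions.\<close>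

lemma sign_const:
  assumes "convex U" "\<And>x. x \<in> U \<Longrightarrow> n \<bullet> x \<noteq> d"
  obtains \<sigma> :: real where "\<sigma> = 1 \<or> \<sigma> = -1" "\<And>x. x \<in> U \<Longrightarrow> sgn (n \<bullet> x - d) = \<sigma>" "\<And>x. x \<in> U \<Longrightarrow> \<bar>n \<bullet> x - d\<bar> = \<sigma> * (n \<bullet> x - d)"
proof -
  have "connected U" using assms(1) by (rule convex_connected)
  then have "(\<forall>x\<in>U. n \<bullet> x > d) \<or> (\<forall>x\<in>U. n \<bullet> x < d)"
    using connected_ivt_hyperplane[of U _ _ n d] assms(2) by (meson linorder_not_less nle_le order_less_le)
  then show ?thesis using that[of 1] that[of "-1"] by fastforce
qed

lemma measurable_vec2 [measurable (raw)]:
  assumes "f \<in> borel_measurable M" "g \<in> borel_measurable M"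
  shows "(\<lambda>x. vec2 (f x) (g x)) \<in> borel_measurable M"
proof -
  have "(\<lambda>x. vec2 (f x) (g x)) = (\<lambda>x. f x *\<^sub>R axis 1 1 + g x *\<^sub>R axis 2 1)" by (auto intro!: pt_eqI)
  then show ?thesis using assms by simp
qed

section \<open>The basic field on the reference square\<close>

definition fold1 :: "real \<Rightarrow> real" where "fold1 t = min 1 \<bar>t\<bar>"

text \<open>First component of a field with divergence \<open>sgn (x$1)\<close> on
  \<open>S0\<close>. It is the integral in the first variable, starting from 0 on the vertical
  sides, of \<open>sgn (x$1)\<close> minus the second partial derivative of \<open>Psi2\<close>; the
  slopes of \<open>Psi2\<close> near the horizontal sides are such that it vanishes there too.
  \<open>fold1\<close> caps the coordinates so that the formula gives 0 outside the square.\<close>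

definition Psi1 :: "pt \<Rightarrow> real" where
  "Psi1 x = fold1 (x$1) + fold1 (x$2) - 3/2 + (\<bar>fold1 (x$1) - fold1 (x$2)\<bar> - \<bar>fold1 (x$1) + fold1 (x$2) - 1\<bar>) / 2"

text \<open>Up to sign, the distance from \<open>(\<bar>x$1\<bar>, \<bar>x$2\<bar>)\<close> to the
  boundary of the unit square: a pyramid over each quadrant of \<open>S0\<close>, with alternating
  signs.\<close>

definition Psi2 :: "pt \<Rightarrow> real" where
  "Psi2 x = sgn (x$1) * sgn (x$2) * ((\<bar>fold1 (x$1) - fold1 (x$2)\<bar> + \<bar>fold1 (x$1) + fold1 (x$2) - 1\<bar>) / 2 - 1/2)"

definition S0 :: "pt set" where "S0 = {x. \<bar>x$1\<bar> < 1 \<and> \<bar>x$2\<bar> < 1}"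

definition GPsi1 :: "pt \<Rightarrow> pt" where
  "GPsi1 x = (if x \<in> S0 then vec2 (sgn (x$1) * (1 + (sgn (\<bar>x$1\<bar> - \<bar>x$2\<bar>) - sgn (\<bar>x$1\<bar> + \<bar>x$2\<bar> - 1)) / 2))
       (sgn (x$2) * (1 - (sgn (\<bar>x$1\<bar> - \<bar>x$2\<bar>) + sgn (\<bar>x$1\<bar> + \<bar>x$2\<bar> - 1)) / 2)) else 0)"

definition GPsi2 :: "pt \<Rightarrow> pt" where
  "GPsi2 x = (if x \<in> S0 then vec2 (sgn (x$2) * ((sgn (\<bar>x$1\<bar> - \<bar>x$2\<bar>) + sgn (\<bar>x$1\<bar> + \<bar>x$2\<bar> - 1)) / 2))
       (sgn (x$1) * ((sgn (\<bar>x$1\<bar> + \<bar>x$2\<bar> - 1) - sgn (\<bar>x$1\<bar> - \<bar>x$2\<bar>)) / 2)) else 0)"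

text \<open>The axes, the sides, the diagonals and the diamond
  \<open>\<bar>x$1\<bar> + \<bar>x$2\<bar> = 1\<close>, all prolonged to full lines.\<close>

definition LPsi :: "(pt \<times> real) set" where
  "LPsi = {vec2 1 0, vec2 0 1, vec2 1 1, vec2 1 (-1)} \<times> {0, 1, -1}"

lemma vec2_eq_0: "vec2 a b = 0 \<longleftrightarrow> a = 0 \<and> b = 0"
  by (metis pt_eqI vec2_nth zero_index)

lemma lines_LPsi: "lines LPsi" by (auto simp: lines_def LPsi_def vec2_eq_0)

lemma S0_borel [measurable]: "S0 \<in> sets borel"
proof -
  have "open S0" unfolding S0_def by (intro open_Collect_conj open_Collect_less continuous_intros)
  then show ?thesis by simp
qed

lemma sgn_real_measurable [measurable]: "(sgn :: real \<Rightarrow> real) \<in> borel_measurable borel"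
  unfolding sgn_real_def[abs_def] by measurable

lemma GPsi_measurable [measurable]: "GPsi1 \<in> borel_measurable borel" "GPsi2 \<in> borel_measurable borel"
  unfolding GPsi1_def[abs_def] GPsi2_def[abs_def] by measurable

lemma Psi_outside: assumes "x \<notin> S0" shows "Psi1 x = 0" "Psi2 x = 0"
proof -
  have f: "fold1 (x$1) = 1 \<or> fold1 (x$2) = 1" using assms by (auto simp: S0_def fold1_def)
  have g: "0 \<le> fold1 t" "fold1 t \<le> 1" for t by (auto simp: fold1_def)
  show "Psi1 x = 0" "Psi2 x = 0"
    using f g[of "x$1"] g[of "x$2"] by (auto simp: Psi1_def Psi2_def abs_if field_simps)
qed

lemma fold1_inside: "x \<in> S0 \<Longrightarrow> fold1 (x$1) = \<bar>x$1\<bar> \<and> fold1 (x$2) = \<bar>x$2\<bar>"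
  by (auto simp: S0_def fold1_def)

lemma Psi1_cont: "continuous_on UNIV Psi1"
  unfolding Psi1_def fold1_def by (intro continuous_intros) simp_all

text \<open>The sign factors jump only on the axes, where the pyramids vanish.\<close>

lemma Psi2_cont: "continuous_on UNIV Psi2"
proof -
  define tent where "tent x = (\<bar>fold1 (x$1) - fold1 (x$2)\<bar> + \<bar>fold1 (x$1) + fold1 (x$2) - 1\<bar>) / 2 - 1/2" for x :: pt
  have tc: "continuous_on UNIV tent" unfolding tent_def fold1_def by (intro continuous_intros) simp_all
  have bd: "\<bar>tent x\<bar> \<le> \<bar>x$1\<bar>" "\<bar>tent x\<bar> \<le> \<bar>x$2\<bar>" for x
    unfolding tent_def fold1_def by (auto simp: min_def abs_if field_simps)
  have P: "Psi2 x = sgn (x$1) * sgn (x$2) * tent x" for x by (simp add: Psi2_def tent_def)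
  have "isCont Psi2 x" for x
  proof (cases "x$1 = 0 \<or> x$2 = 0")
    case True
    then have z: "tent x = 0" using bd[of x] by auto
    have "(tent \<longlongrightarrow> tent x) (at x)" using tc by (metis UNIV_I continuous_on_def tendsto_within_subset subset_UNIV)
    then have t0: "((\<lambda>y. \<bar>tent y\<bar>) \<longlongrightarrow> 0) (at x)" using z tendsto_rabs_zero by metis
    have "(Psi2 \<longlongrightarrow> 0) (at x)"
    proof (rule Lim_null_comparison[OF _ t0])
      have "norm (Psi2 y) \<le> \<bar>tent y\<bar>" for y by (simp add: P abs_mult sgn_real_def)
      then show "\<forall>\<^sub>F y in at x. norm (Psi2 y) \<le> \<bar>tent y\<bar>" by simp
    qed
    then show ?thesis using z by (simp add: isCont_def P)
  next
    case False
    have sc: "isCont (\<lambda>y::pt. sgn (y$i)) x" if "x$i \<noteq> 0" for i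
      using that by (intro isCont_sgn continuous_intros)
    have "isCont tent x" using tc by (simp add: continuous_on_eq_continuous_at)
    then have "isCont (\<lambda>x. sgn (x$1) * sgn (x$2) * tent x) x" using sc False by (intro continuous_intros) auto
    then show ?thesis using P by (simp add: fun_eq_iff[symmetric] P[abs_def])
  qed
  then show ?thesis by (simp add: continuous_at_imp_continuous_on)
qed

text \<open>\<open>U\<close> lies either outside \<open>S0\<close>, where everything is 0, or
  inside. There the signs of both coordinates, of \<open>\<bar>x$1\<bar> - \<bar>x$2\<bar>\<close>
  and of \<open>\<bar>x$1\<bar> + \<bar>x$2\<bar> - 1\<close> are constant on \<open>U\<close>; with
  these constants \<open>s\<close>, \<open>t\<close>, \<open>\<alpha>\<close>,
  \<open>\<beta>\<close> the formulas become affine and the witnesses are read off.\<close>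

lemma Psi_pwaff_aux:
  assumes U: "convex U" "U \<inter> lset LPsi = {}"
  shows "\<exists>c w. \<forall>x\<in>U. Psi1 x = c + w \<bullet> x \<and> GPsi1 x = w" "\<exists>c w. \<forall>x\<in>U. Psi2 x = c + w \<bullet> x \<and> GPsi2 x = w"
proof -
  have ne: "n \<bullet> x \<noteq> d" if "x \<in> U" "(n, d) \<in> LPsi" for n d x
    using U(2) that by (force simp: lset_def)
  have f: "x$1 \<noteq> d" "x$2 \<noteq> d" "x$1 + x$2 \<noteq> d" "x$1 - x$2 \<noteq> d" if "x \<in> U" "d \<in> {0, 1, -1}" for x d
    using ne[OF that(1), of "vec2 1 0" d] ne[OF that(1), of "vec2 0 1" d] ne[OF that(1), of "vec2 1 1" d] ne[OF that(1), of "vec2 1 (-1)" d] that(2)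
    by (auto simp: LPsi_def inner_pt)
  have comp: "(\<forall>x\<in>U. d < x$i) \<or> (\<forall>x\<in>U. x$i < d)" if "d \<in> {0, 1, -1}" for d and i :: 2
  proof -
    have "axis i 1 \<bullet> x \<noteq> d" if "x \<in> U" for x using f[OF that \<open>d \<in> _\<close>] exhaust_2[of i] by (auto simp: inner_axis')
    then obtain \<sigma> :: real where "\<sigma> = 1 \<or> \<sigma> = -1" "\<And>x. x \<in> U \<Longrightarrow> sgn (axis i 1 \<bullet> x - d) = \<sigma>" using sign_const[OF U(1)] by metis
    then have "(\<forall>x\<in>U. sgn (x$i - d) = 1) \<or> (\<forall>x\<in>U. sgn (x$i - d) = -1)" by (auto simp: inner_axis')
    then show ?thesis by (simp add: sgn_1_pos sgn_1_neg)
  qed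
  have "(\<forall>x\<in>U. x \<in> S0) \<or> (\<forall>x\<in>U. x \<notin> S0)"
    using comp[of 1 1] comp[of "-1" 1] comp[of 1 2] comp[of "-1" 2] by (auto simp: S0_def abs_if)
  then have "(\<exists>c w. \<forall>x\<in>U. Psi1 x = c + w \<bullet> x \<and> GPsi1 x = w) \<and> (\<exists>c w. \<forall>x\<in>U. Psi2 x = c + w \<bullet> x \<and> GPsi2 x = w)"
  proof
    assume "\<forall>x\<in>U. x \<notin> S0"
    then show ?thesis by (intro conjI exI[of _ 0]) (auto simp: Psi_outside GPsi1_def GPsi2_def)
  next
    assume ins: "\<forall>x\<in>U. x \<in> S0"
    have "\<exists>s::real. (s = 1 \<or> s = -1) \<and> (\<forall>x\<in>U. sgn (x$i) = s \<and> \<bar>x$i\<bar> = s * x$i)" for i :: 2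
      using comp[of 0 i] by (metis (no_types, lifting) abs_of_neg abs_of_pos insertI1 mult_1 mult_minus1 sgn_neg sgn_pos)
    note ex = this
    obtain s :: real where s: "s = 1 \<or> s = -1" "\<And>x. x \<in> U \<Longrightarrow> sgn (x$1) = s \<and> \<bar>x$1\<bar> = s * x$1"
      using ex[of 1] by blast
    obtain t :: real where t: "t = 1 \<or> t = -1" "\<And>x. x \<in> U \<Longrightarrow> sgn (x$2) = t \<and> \<bar>x$2\<bar> = t * x$2"
      using ex[of 2] by blast
    have n1: "vec2 s (-t) \<bullet> x \<noteq> 0" if "x \<in> U" for x using s(1) t(1) f[OF that, of 0] by (auto simp: inner_pt)
    obtain \<alpha> where al: "\<And>x. x \<in> U \<Longrightarrow> sgn (s * x$1 - t * x$2) = \<alpha>" "\<And>x. x \<in> U \<Longrightarrow> \<bar>s * x$1 - t * x$2\<bar> = \<alpha> * (s * x$1 - t * x$2)"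
    proof (rule sign_const[OF U(1) n1])
      fix \<sigma> assume "\<And>x. x \<in> U \<Longrightarrow> sgn (vec2 s (-t) \<bullet> x - 0) = \<sigma>" "\<And>x. x \<in> U \<Longrightarrow> \<bar>vec2 s (-t) \<bullet> x - 0\<bar> = \<sigma> * (vec2 s (-t) \<bullet> x - 0)"
      then show thesis by (intro that[of \<sigma>]) (simp_all add: inner_pt)
    qed
    have n2: "vec2 s t \<bullet> x \<noteq> 1" if "x \<in> U" for x using s(1) t(1) f[OF that, of 1] f[OF that, of "-1"] by (auto simp: inner_pt)
    obtain \<beta> where be: "\<And>x. x \<in> U \<Longrightarrow> sgn (s * x$1 + t * x$2 - 1) = \<beta>" "\<And>x. x \<in> U \<Longrightarrow> \<bar>s * x$1 + t * x$2 - 1\<bar> = \<beta> * (s * x$1 + t * x$2 - 1)"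
    proof (rule sign_const[OF U(1) n2])
      fix \<sigma> assume "\<And>x. x \<in> U \<Longrightarrow> sgn (vec2 s t \<bullet> x - 1) = \<sigma>" "\<And>x. x \<in> U \<Longrightarrow> \<bar>vec2 s t \<bullet> x - 1\<bar> = \<sigma> * (vec2 s t \<bullet> x - 1)"
      then show thesis by (intro that[of \<sigma>]) (simp_all add: inner_pt)
    qed
    have st: "s * s = 1" "t * t = 1" using s(1) t(1) by auto
    show ?thesis
    proof
      show "\<exists>c w. \<forall>x\<in>U. Psi1 x = c + w \<bullet> x \<and> GPsi1 x = w"
      proof (rule exI[of _ "(\<beta> - 3) / 2"], rule exI[of _ "vec2 (s * (1 + (\<alpha> - \<beta>) / 2)) (t * (1 - (\<alpha> + \<beta>) / 2))"], intro ballI conjI)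
        fix x assume x: "x \<in> U"
        have "Psi1 x = s * x$1 + t * x$2 - 3/2 + (\<alpha> * (s * x$1 - t * x$2) - \<beta> * (s * x$1 + t * x$2 - 1)) / 2"
          using ins s(2) t(2) al be fold1_inside x by (simp add: Psi1_def)
        also have "\<dots> = (\<beta> - 3) / 2 + vec2 (s * (1 + (\<alpha> - \<beta>) / 2)) (t * (1 - (\<alpha> + \<beta>) / 2)) \<bullet> x"
          by (simp add: inner_pt field_simps)
        finally show "Psi1 x = (\<beta> - 3) / 2 + vec2 (s * (1 + (\<alpha> - \<beta>) / 2)) (t * (1 - (\<alpha> + \<beta>) / 2)) \<bullet> x" .
        show "GPsi1 x = vec2 (s * (1 + (\<alpha> - \<beta>) / 2)) (t * (1 - (\<alpha> + \<beta>) / 2))"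
          using ins s(2) t(2) al be x by (simp add: GPsi1_def)
      qed
      show "\<exists>c w. \<forall>x\<in>U. Psi2 x = c + w \<bullet> x \<and> GPsi2 x = w"
      proof (rule exI[of _ "- s * t * (1 + \<beta>) / 2"], rule exI[of _ "vec2 (t * ((\<alpha> + \<beta>) / 2)) (s * ((\<beta> - \<alpha>) / 2))"], intro ballI conjI)
        fix x assume x: "x \<in> U"
        have "Psi2 x = s * t * ((\<alpha> * (s * x$1 - t * x$2) + \<beta> * (s * x$1 + t * x$2 - 1)) / 2 - 1 / 2)"
          using ins s(2) t(2) al be fold1_inside x by (simp add: Psi2_def)
        also have "\<dots> = - s * t * (1 + \<beta>) / 2 + vec2 (t * ((\<alpha> + \<beta>) / 2)) (s * ((\<beta> - \<alpha>) / 2)) \<bullet> x"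
          using s(1) t(1) by (elim disjE) (simp_all add: inner_pt field_simps)
        finally show "Psi2 x = - s * t * (1 + \<beta>) / 2 + vec2 (t * ((\<alpha> + \<beta>) / 2)) (s * ((\<beta> - \<alpha>) / 2)) \<bullet> x" .
        show "GPsi2 x = vec2 (t * ((\<alpha> + \<beta>) / 2)) (s * ((\<beta> - \<alpha>) / 2))"
          using ins s(2) t(2) al be x by (simp add: GPsi2_def)
      qed
    qed
  qed
  then show "\<exists>c w. \<forall>x\<in>U. Psi1 x = c + w \<bullet> x \<and> GPsi1 x = w" "\<exists>c w. \<forall>x\<in>U. Psi2 x = c + w \<bullet> x \<and> GPsi2 x = w" by auto
qed

lemma norm_pt_le: "norm (x::pt) \<le> \<bar>x$1\<bar> + \<bar>x$2\<bar>"
  using norm_le_l1_cart[of x] by (simp add: sum_2)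

lemma GPsi_bound: "norm (GPsi1 x) \<le> 4" "norm (GPsi2 x) \<le> 2"
proof -
  have s: "sgn (t::real) \<in> {0, 1, -1}" for t by (auto simp: sgn_real_def)
  show "norm (GPsi1 x) \<le> 4"
    using s[of "x$1"] s[of "x$2"] s[of "\<bar>x$1\<bar> - \<bar>x$2\<bar>"] s[of "\<bar>x$1\<bar> + \<bar>x$2\<bar> - 1"]
    by (intro order_trans[OF norm_pt_le]) (auto simp: GPsi1_def)
  show "norm (GPsi2 x) \<le> 2"
    using s[of "x$1"] s[of "x$2"] s[of "\<bar>x$1\<bar> - \<bar>x$2\<bar>"] s[of "\<bar>x$1\<bar> + \<bar>x$2\<bar> - 1"]
    by (intro order_trans[OF norm_pt_le]) (auto simp: GPsi2_def)
qed

lemma Psi_pwaff: "pwaff LPsi Psi1 GPsi1" "pwaff LPsi Psi2 GPsi2"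
proof -
  have "bounded (range GPsi1)" "bounded (range GPsi2)" unfolding bounded_iff using GPsi_bound by blast+
  then show "pwaff LPsi Psi1 GPsi1" "pwaff LPsi Psi2 GPsi2"
    unfolding pwaff_def using lines_LPsi Psi1_cont Psi2_cont Psi_pwaff_aux by (auto simp: GPsi_measurable)
qed

lemma GPsi_outside: "x \<notin> S0 \<Longrightarrow> GPsi1 x = 0" "x \<notin> S0 \<Longrightarrow> GPsi2 x = 0"
  by (auto simp: GPsi1_def GPsi2_def)

text \<open>The contributions of the pyramids cancel, even on the creases. This identity is the
  reason for the choice of the two functions.\<close>

lemma Psi_div: "x \<in> S0 \<Longrightarrow> GPsi1 x $ 1 + GPsi2 x $ 2 = sgn (x$1)"
  by (simp add: GPsi1_def GPsi2_def field_simps)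

section \<open>Haar fields on squares\<close>

lemma transpose_cols: "transpose (cols u v) *v g = vec2 (u \<bullet> g) (v \<bullet> g)"
  by (rule pt_eqI) (simp_all add: matrix_vector_mult_def sum_2 transpose_def cols_def inner_pt)

text \<open>\<open>SW\<close> swaps the coordinates. \<open>TW\<close> also stretches by 2, so that
  after a shift by 1 in the right direction it maps a half of the square onto the whole.
  \<open>SC\<close> rescales a square of the quadtree to the reference square.\<close>

definition SW :: "real^2^2" where "SW = cols (vec2 0 1) (vec2 1 0)"
definition TW :: "real^2^2" where "TW = cols (vec2 0 2) (vec2 1 0)"
definition SC :: "real \<Rightarrow> real^2^2" where "SC k = cols (vec2 k 0) (vec2 0 k)"

lemma mats: "0 + SW *v x = vec2 (x$2) (x$1)" "vec2 0 a + TW *v x = vec2 (x$2) (2 * x$1 + a)" "SC k *v x = k *\<^sub>R x"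
  "transpose SW *v g = vec2 (g$2) (g$1)" "transpose TW *v g = vec2 (2 * g$2) (g$1)" "transpose (SC k) *v g = k *\<^sub>R g"
  unfolding SW_def TW_def SC_def transpose_cols by (auto simp: mult_cols inner_pt intro!: pt_eqI)

lemma dets: "det SW = -1" "det TW = -2" "det (SC k) = k * k"
  unfolding SW_def TW_def SC_def det_cols by (simp_all add: cr_def)

text \<open>Component \<open>i\<close> of the field whose divergence is the Haar function
  \<open>j\<close>. Index 0 is the basic field, 1 its mirror image, and any other index puts
  compressed mirror images with opposite signs on the two halves. There the factor 1/2 in the first
  component offsets the chain rule for the compression.\<close>

definition bf :: "nat \<Rightarrow> 2 \<Rightarrow> pt \<Rightarrow> real" where
  "bf j i x = (if j = 0 then (if i = 1 then Psi1 x else Psi2 x)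
     else if j = 1 then (if i = 1 then Psi2 (vec2 (x$2) (x$1)) else Psi1 (vec2 (x$2) (x$1)))
     else if i = 1 then (1/2) * Psi2 (vec2 (x$2) (2 * x$1 + (-1))) + (-1/2) * Psi2 (vec2 (x$2) (2 * x$1 + 1))
     else Psi1 (vec2 (x$2) (2 * x$1 + (-1))) + (-1) * Psi1 (vec2 (x$2) (2 * x$1 + 1)))"

definition flipv :: "real \<Rightarrow> pt \<Rightarrow> pt" where "flipv k g = vec2 (k * g$2) (g$1)"

definition bG :: "nat \<Rightarrow> 2 \<Rightarrow> pt \<Rightarrow> pt" where
  "bG j i x = (if j = 0 then (if i = 1 then GPsi1 x else GPsi2 x)
     else if j = 1 then (if i = 1 then flipv 1 (GPsi2 (vec2 (x$2) (x$1))) else flipv 1 (GPsi1 (vec2 (x$2) (x$1))))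
     else if i = 1 then (1/2) *\<^sub>R flipv 2 (GPsi2 (vec2 (x$2) (2 * x$1 + (-1)))) + (-1/2) *\<^sub>R flipv 2 (GPsi2 (vec2 (x$2) (2 * x$1 + 1)))
     else flipv 2 (GPsi1 (vec2 (x$2) (2 * x$1 + (-1)))) + (-1) *\<^sub>R flipv 2 (GPsi1 (vec2 (x$2) (2 * x$1 + 1))))"

definition Lb :: "(pt \<times> real) set" where
  "Lb = LPsi \<union> laff 0 SW LPsi \<union> laff (vec2 0 (-1)) TW LPsi \<union> laff (vec2 0 1) TW LPsi"

lemma lines_Lb: "lines Lb"
  unfolding Lb_def lines_Un by (auto intro!: lines_laff lines_LPsi simp: dets)

lemma bf_pwaff: "pwaff Lb (bf j i) (bG j i)"
proof -
  have p: "pwaff Lb Psi1 GPsi1" "pwaff Lb Psi2 GPsi2"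
    by (rule pwaff_mono[OF Psi_pwaff(1) _ lines_Lb] pwaff_mono[OF Psi_pwaff(2) _ lines_Lb], simp add: Lb_def le_supI1)+
  have s: "pwaff Lb (\<lambda>x. f (vec2 (x$2) (x$1))) (\<lambda>x. flipv 1 (g (vec2 (x$2) (x$1))))" if "pwaff LPsi f g" for f g
  proof -
    have "pwaff (laff 0 SW LPsi) (\<lambda>x. f (0 + SW *v x)) (\<lambda>x. transpose SW *v g (0 + SW *v x))"
      by (rule pwaff_affine[OF that]) (simp add: dets)
    then have "pwaff Lb (\<lambda>x. f (0 + SW *v x)) (\<lambda>x. transpose SW *v g (0 + SW *v x))"
      by (rule pwaff_mono[OF _ _ lines_Lb]) (auto simp: Lb_def)
    then show ?thesis unfolding mats flipv_def by simp
  qed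
  have t: "pwaff Lb (\<lambda>x. f (vec2 (x$2) (2 * x$1 + a))) (\<lambda>x. flipv 2 (g (vec2 (x$2) (2 * x$1 + a))))"
    if "pwaff LPsi f g" "a = -1 \<or> a = 1" for f g a
  proof -
    have "pwaff (laff (vec2 0 a) TW LPsi) (\<lambda>x. f (vec2 0 a + TW *v x)) (\<lambda>x. transpose TW *v g (vec2 0 a + TW *v x))"
      by (rule pwaff_affine[OF that(1)]) (simp add: dets)
    then have "pwaff Lb (\<lambda>x. f (vec2 0 a + TW *v x)) (\<lambda>x. transpose TW *v g (vec2 0 a + TW *v x))"
      by (rule pwaff_mono[OF _ _ lines_Lb]) (use that(2) in \<open>auto simp: Lb_def\<close>)
    then show ?thesis unfolding mats flipv_def by simp
  qed
  note s1 = s[OF Psi_pwaff(1)] and s2 = s[OF Psi_pwaff(2)]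
  note t1 = t[OF Psi_pwaff(1)] and t2 = t[OF Psi_pwaff(2)]
  have a: "pwaff Lb (\<lambda>x. (1/2) * Psi2 (vec2 (x$2) (2 * x$1 + (-1))) + (-1/2) * Psi2 (vec2 (x$2) (2 * x$1 + 1)))
     (\<lambda>x. (1/2) *\<^sub>R flipv 2 (GPsi2 (vec2 (x$2) (2 * x$1 + (-1)))) + (-1/2) *\<^sub>R flipv 2 (GPsi2 (vec2 (x$2) (2 * x$1 + 1))))"
    by (intro pwaff_add pwaff_cmult t2) auto
  have b: "pwaff Lb (\<lambda>x. Psi1 (vec2 (x$2) (2 * x$1 + (-1))) + (-1) * Psi1 (vec2 (x$2) (2 * x$1 + 1)))
     (\<lambda>x. flipv 2 (GPsi1 (vec2 (x$2) (2 * x$1 + (-1)))) + (-1) *\<^sub>R flipv 2 (GPsi1 (vec2 (x$2) (2 * x$1 + 1))))"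
    by (intro pwaff_add pwaff_cmult t1) auto
  show ?thesis
  proof (cases "j = 0")
    case True then show ?thesis using p unfolding bf_def[abs_def] bG_def[abs_def] by (cases "i = 1") simp_all
  next
    case False
    show ?thesis
    proof (cases "j = 1")
      case True then show ?thesis using s1 s2 unfolding bf_def[abs_def] bG_def[abs_def] by (cases "i = 1") simp_all
    next
      case False
      then show ?thesis using a b \<open>j \<noteq> 0\<close> unfolding bf_def[abs_def] bG_def[abs_def] by (cases "i = 1") (simp_all only: if_False if_True refl)
    qed
  qed
qed

lemma flipv_0 [simp]: "flipv k 0 = 0" by (rule pt_eqI) (simp_all add: flipv_def)
lemma flipv_nth [simp]: "flipv k g $ 1 = k * g$2" "flipv k g $ 2 = g$1" by (simp_all add: flipv_def)

lemma bf_outside: assumes "x \<notin> S0" shows "bf j i x = 0" "bG j i x = 0"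
proof -
  have a: "vec2 (x$2) (x$1) \<notin> S0" "vec2 (x$2) (2 * x$1 + (-1)) \<notin> S0" "vec2 (x$2) (2 * x$1 + 1) \<notin> S0"
    using assms by (auto simp: S0_def)
  show "bf j i x = 0" "bG j i x = 0"
    unfolding bf_def bG_def by (simp_all only: Psi_outside[OF assms] Psi_outside[OF a(1)] Psi_outside[OF a(2)] Psi_outside[OF a(3)]
      GPsi_outside[OF assms] GPsi_outside[OF a(1)] GPsi_outside[OF a(2)] GPsi_outside[OF a(3)]) simp_all
qed

text \<open>The nonconstant Haar functions of a square with four children, as sign patterns;
  evaluated at an element of \<open>Sg\<close> they give the sign on that child.\<close>

definition hs :: "nat \<Rightarrow> pt \<Rightarrow> real" where
  "hs j x = (if j = 0 then sgn (x$1) else if j = 1 then sgn (x$2) else sgn (x$1) * sgn (x$2))"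

lemma bf_div: assumes "x \<in> S0" shows "bG j 1 x $ 1 + bG j 2 x $ 2 = hs j x"
proof -
  have n12: "(2::2) \<noteq> 1" by simp
  consider "j = 0" | "j = 1" | "j \<noteq> 0" "j \<noteq> 1" by auto
  then show ?thesis
  proof cases
    case 1 then show ?thesis using Psi_div[OF assms] by (simp add: bG_def hs_def)
  next
    case 2
    have "vec2 (x$2) (x$1) \<in> S0" using assms by (auto simp: S0_def)
    from Psi_div[OF this] 2 show ?thesis by (simp add: bG_def hs_def)
  next
    case 3
    let ?p = "vec2 (x$2) (2 * x$1 + (-1))" and ?m = "vec2 (x$2) (2 * x$1 + 1)"
    have e: "bG j 1 x = (1/2) *\<^sub>R flipv 2 (GPsi2 ?p) + (-1/2) *\<^sub>R flipv 2 (GPsi2 ?m)"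
       "bG j 2 x = flipv 2 (GPsi1 ?p) + (-1) *\<^sub>R flipv 2 (GPsi1 ?m)"
      using 3 by (simp_all add: bG_def)
    have E: "bG j 1 x $ 1 + bG j 2 x $ 2 = (GPsi1 ?p $ 1 + GPsi2 ?p $ 2) - (GPsi1 ?m $ 1 + GPsi2 ?m $ 2)"
      unfolding e by simp
    consider "x$1 > 0" | "x$1 < 0" | "x$1 = 0" by linarith
    then show ?thesis
    proof cases
      case 1
      then have "?p \<in> S0" "?m \<notin> S0" using assms by (auto simp: S0_def)
      then show ?thesis unfolding E using Psi_div[of ?p] GPsi_outside[of ?m] 3 1 by (simp add: hs_def)
    next
      case 2
      then have "?p \<notin> S0" "?m \<in> S0" using assms by (auto simp: S0_def)
      then show ?thesis unfolding E using Psi_div[of ?m] GPsi_outside[of ?p] 3 2 by (simp add: hs_def)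
    next
      case xx: 3
      then have "?p \<notin> S0" "?m \<notin> S0" using assms by (auto simp: S0_def)
      then show ?thesis unfolding E using GPsi_outside[of ?m] GPsi_outside[of ?p] 3 xx by (simp add: hs_def)
    qed
  qed
qed

lemma bf_bound: obtains M where "M > 0" "\<And>j i x. norm (bG j i x) \<le> M"
proof -
  have "\<exists>B. \<forall>x. norm (bG j i x) \<le> B" for j i using bf_pwaff[of j i] by (auto simp: pwaff_def bounded_iff)
  then obtain B where B: "\<And>j i x. norm (bG j i x) \<le> B j i" by metis
  let ?M = "Max ((\<lambda>(j, i). B j i) ` ({0, 1, 2} \<times> UNIV))"
  have "norm (bG j i x) \<le> ?M" for j i x
  proof -
    \<comment> \<open>All indices from 2 on are treated alike by the definition, so a maximum over
      finitely many bounds suffices.\<close>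
    have "bG j i x = bG (min j 2) i x" by (auto simp: bG_def min_def)
    then have "norm (bG j i x) \<le> B (min j 2) i" using B by metis
    also have "\<dots> \<le> ?M" by (rule Max_ge) (auto simp: min_def intro!: image_eqI[where x="(min j 2, i)"])
    finally show ?thesis .
  qed
  then have "norm (bG j i x) \<le> max 1 ?M" for j i x by (meson max.coboundedI2)
  then show ?thesis by (intro that[of "max 1 ?M"]) auto
qed

section \<open>The quadtree\<close>

definition sq :: "pt \<Rightarrow> real \<Rightarrow> pt set" where "sq c l = {x. \<bar>x$1 - c$1\<bar> < l \<and> \<bar>x$2 - c$2\<bar> < l}"

definition Sg :: "pt set" where "Sg = {vec2 1 1, vec2 1 (-1), vec2 (-1) 1, vec2 (-1) (-1)}"

lemma vec2_eq: "vec2 a b = vec2 c d \<longleftrightarrow> a = c \<and> b = d"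
  by (metis vec2_nth)

lemma sum_Sg: "(\<Sum>s\<in>Sg. f s) = f (vec2 1 1) + f (vec2 1 (-1)) + f (vec2 (-1) 1) + f (vec2 (-1) (-1) :: pt)"
  by (simp add: Sg_def vec2_eq add.assoc)

lemma finite_Sg [simp]: "finite Sg" by (simp add: Sg_def)

text \<open>\<open>l\<close> is half the side length, so the children of \<open>sq c l\<close> have
  centre \<open>ch c l s\<close> and half side \<open>l/2\<close>. Squares are open: the children
  are disjoint and cover the parent up to the two dividing segments, a null set.\<close>

abbreviation ch :: "pt \<Rightarrow> real \<Rightarrow> pt \<Rightarrow> pt" where "ch c l s \<equiv> c + (l/2) *\<^sub>R s"

lemma sq_box: "sq c l = box (c - vec2 l l) (c + vec2 l l)"
  by (auto simp: sq_def mem_box_cart forall_2)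

lemma sq_borel [measurable]: "sq c l \<in> sets borel" and sq_bounded: "bounded (sq c l)" and sq_convex: "convex (sq c l)"
  by (simp_all add: sq_box bounded_box convex_box)

lemma sq_measure: "l \<ge> 0 \<Longrightarrow> measure lborel (sq c l) = 4 * l\<^sup>2"
  unfolding sq_box
  by (subst measure_lborel_box) (auto simp: Basis_pt inner_axis axis_eq_axis power2_eq_square prod.insert_if)

lemma sq_finite: "emeasure lborel (sq c l) < \<infinity>" using emeasure_bounded_finite[OF sq_bounded] by simp

lemma child_sub: "s \<in> Sg \<Longrightarrow> sq (ch c l s) (l/2) \<subseteq> sq c l"
  by (auto simp: Sg_def sq_def abs_if split: if_splits)

lemma child_disj: "s \<in> Sg \<Longrightarrow> s' \<in> Sg \<Longrightarrow> s \<noteq> s' \<Longrightarrow> x \<in> sq (ch c l s) (l/2) \<Longrightarrow> x \<notin> sq (ch c l s') (l/2)"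
  by (auto simp: Sg_def sq_def abs_if split: if_splits)

lemma child_cover:
  assumes "x \<in> sq c l" "x$1 \<noteq> c$1" "x$2 \<noteq> c$2" shows "\<exists>s\<in>Sg. x \<in> sq (ch c l s) (l/2)"
  using assms by (auto simp: Sg_def sq_def abs_if field_simps split: if_splits)

lemma AE_offaxes: "AE x in lborel. (x::pt)$1 \<noteq> a \<and> x$2 \<noteq> b"
proof -
  have "lines {(vec2 1 0, a), (vec2 0 1, b)}" by (auto simp: lines_def vec2_eq_0)
  from AE_lset[OF this] show ?thesis by (rule AE_mp) (auto simp: lset_def inner_pt)
qed

lemma sum_child:
  assumes s: "s \<in> Sg" and x: "x \<in> sq (ch c l s) (l/2)" and f: "\<And>s. s \<in> Sg \<Longrightarrow> x \<notin> sq (ch c l s) (l/2) \<Longrightarrow> f s = 0"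
  shows "(\<Sum>s\<in>Sg. f s) = (f s :: 'a :: comm_monoid_add)"
proof -
  have "(\<Sum>s\<in>Sg. f s) = (\<Sum>s'\<in>{s}. f s')"
    by (rule sum.mono_neutral_right) (use s f child_disj[OF s _ _ x] in auto)
  then show ?thesis by simp
qed

lemma AE_child: "AE x in lborel. indicator (sq c l) x = (\<Sum>s\<in>Sg. indicator (sq (ch c l s) (l/2)) x :: real)"
  using AE_offaxes[of "c$1" "c$2"]
proof (rule AE_mp, intro AE_I2 impI)
  fix x :: pt assume a: "x$1 \<noteq> c$1 \<and> x$2 \<noteq> c$2"
  show "indicator (sq c l) x = (\<Sum>s\<in>Sg. indicator (sq (ch c l s) (l/2)) x :: real)"
  proof (cases "x \<in> sq c l")
    case True
    then obtain s where s: "s \<in> Sg" "x \<in> sq (ch c l s) (l/2)" using child_cover a by blast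
    then show ?thesis using True by (subst sum_child[OF s]) auto
  next
    case False
    then have "x \<notin> sq (ch c l s) (l/2)" if "s \<in> Sg" for s using child_sub[OF that] by auto
    then show ?thesis using False by simp
  qed
qed

lemma bint:
  assumes "f \<in> borel_measurable borel" "\<And>x. \<bar>f x\<bar> \<le> B" "S \<in> sets borel" "bounded S" "\<And>x. x \<notin> S \<Longrightarrow> f x = 0"
  shows "integrable lborel (f :: pt \<Rightarrow> real)"
proof -
  have "integrable lborel (\<lambda>x. indicator S x * f x)" by (rule bdd_integrable[OF assms(3,1,4)]) (rule assms(2))
  moreover have "(\<lambda>x. indicator S x * f x) = f" by (intro ext) (auto simp: indicator_def assms(5))
  ultimately show ?thesis by simp
qed

lemma sq_int:
  fixes f :: "pt \<Rightarrow> real"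
  assumes "f \<in> borel_measurable borel" "\<And>x. \<bar>f x\<bar> \<le> B"
  shows "integrable lborel (\<lambda>x. indicator (sq c l) x * f x)"
  by (rule bdd_integrable[OF sq_borel assms(1) sq_bounded]) (rule assms(2))

lemma integral_child:
  fixes f :: "pt \<Rightarrow> real"
  assumes [measurable]: "f \<in> borel_measurable borel" and B: "\<And>x. \<bar>f x\<bar> \<le> B"
  shows "(LINT x|lborel. indicator (sq c l) x * f x) = (\<Sum>s\<in>Sg. LINT x|lborel. indicator (sq (ch c l s) (l/2)) x * f x)"
proof -
  have "(LINT x|lborel. indicator (sq c l) x * f x) = (LINT x|lborel. (\<Sum>s\<in>Sg. indicator (sq (ch c l s) (l/2)) x * f x))"
  proof (rule integral_cong_AE)
    show "AE x in lborel. indicator (sq c l) x * f x = (\<Sum>s\<in>Sg. indicator (sq (ch c l s) (l/2)) x * f x)"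
      using AE_child[of c l] by eventually_elim (simp only: sum_distrib_right)
  qed measurable
  also have "\<dots> = (\<Sum>s\<in>Sg. LINT x|lborel. indicator (sq (ch c l s) (l/2)) x * f x)"
    by (rule Bochner_Integration.integral_sum) (rule sq_int[OF assms])
  finally show ?thesis .
qed

text \<open>Green's formula with a constant field on a triangle so large that its boundary avoids
  the support: all edge terms vanish. This is the source of the cancellation between fine and coarse
  levels.\<close>

lemma gdiff_integral_zero:
  assumes g: "gdiff L \<phi> G" and S: "bounded S" and z: "\<And>x. x \<notin> S \<Longrightarrow> \<phi> x = 0 \<and> G x = 0"
  shows "(LINT x|lborel. G x \<bullet> w) = 0"
proof -
  obtain r where r: "r > 0" "\<And>x. x \<in> S \<Longrightarrow> norm x < r" using S by (auto simp: bounded_pos_less)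
  \<comment> \<open>The legs lie on the lines where a coordinate equals \<open>-r\<close>, the
    hypotenuse on \<open>x$1 + x$2 = 2 * r\<close>, where one coordinate is at least
    \<open>r\<close>.\<close>
  define p q s where "p = vec2 (-r) (-r)" and "q = vec2 (3*r) (-r)" and "s = vec2 (-r) (3*r)"
  let ?K = "convex hull {p, q, s}"
  have nc: "cr (q - p) (s - p) \<noteq> 0" using r(1) by (simp add: cr_def p_def q_def s_def)
  have far: "norm x \<ge> r" if "\<bar>x$1\<bar> \<ge> r \<or> \<bar>x$2\<bar> \<ge> r" for x :: pt
    using that component_le_norm_cart[of x 1] component_le_norm_cart[of x 2] by auto
  then have z': "\<phi> x = 0" if "\<bar>x$1\<bar> \<ge> r \<or> \<bar>x$2\<bar> \<ge> r" for x using z r(2) that by (metis not_le)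
  have "avg a b \<phi> = 0" if "\<And>t. \<phi> (a + t *\<^sub>R (b - a)) = 0" for a b using that by (simp add: avg_def)
  moreover have "\<phi> (p + t *\<^sub>R (q - p)) = 0" for t by (rule z') (use r(1) in \<open>simp add: p_def q_def\<close>)
  moreover have "\<phi> (p + t *\<^sub>R (s - p)) = 0" for t by (rule z') (use r(1) in \<open>simp add: p_def s_def\<close>)
  moreover have "\<phi> (q + t *\<^sub>R (s - q)) = 0" for t
  proof (rule z')
    have "3 * r + t * (- r - 3 * r) + (- r + t * (3 * r - - r)) = 2 * r" by (simp add: algebra_simps)
    then show "r \<le> \<bar>(q + t *\<^sub>R (s - q)) $ 1\<bar> \<or> r \<le> \<bar>(q + t *\<^sub>R (s - q)) $ 2\<bar>"
      using r(1) by (simp add: q_def s_def) linarith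
  qed
  ultimately have av: "avg p q \<phi> = 0" "avg p s \<phi> = 0" "avg q s \<phi> = 0" by blast+
  have "edge_int E (\<lambda>x. \<phi> x * (w \<bullet> outer_normal ?K E)) = 0" if "E \<in> edges ?K" for E
    using that av cr_distinct[OF nc] unfolding edges_tri[OF nc] by (auto simp: edge_int_seg avg_mult_right)
  then have i0: "integral ?K (\<lambda>x. G x \<bullet> w) = 0" using green_const[OF nc refl g, of w] by simp
  have [measurable]: "G \<in> borel_measurable borel" using g by (simp add: gdiff_def)
  obtain B where B: "\<And>x. x \<in> ?K \<Longrightarrow> norm (G x) \<le> B" using gdiff_bounded_on[OF g tri_borel(2)[OF refl]] by metis
  have "integral ?K (\<lambda>x. G x \<bullet> w) = (LINT x|lborel. indicator ?K x * (G x \<bullet> w))"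
  proof (rule bdd_integral_eq)
    show "\<bar>G x \<bullet> w\<bar> \<le> B * norm w" if "x \<in> ?K" for x
      using Cauchy_Schwarz_ineq2[of "G x" w] B[OF that] by (meson mult_right_mono norm_ge_zero order_trans)
  qed (use tri_borel[of ?K p q s] in auto)
  also have "\<dots> = (LINT x|lborel. G x \<bullet> w)"
  proof (rule Bochner_Integration.integral_cong[OF refl])
    fix x
    show "indicator ?K x * (G x \<bullet> w) = G x \<bullet> w"
    proof (cases "x \<in> ?K")
      case False
      have "x = p + ((x$1 + r) / (4*r)) *\<^sub>R (q - p) + ((x$2 + r) / (4*r)) *\<^sub>R (s - p)"
        using r(1) by (intro pt_eqI) (simp_all add: p_def q_def s_def field_simps)
      then have "\<not> (0 \<le> (x$1 + r) / (4*r) \<and> 0 \<le> (x$2 + r) / (4*r) \<and> (x$1 + r) / (4*r) + (x$2 + r) / (4*r) \<le> 1)"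
        using mem_tri_iff[OF nc] False by metis
      moreover have "(x$1 + r) / (4*r) + (x$2 + r) / (4*r) = (x$1 + x$2 + 2 * r) / (4*r)"
        by (simp add: add_divide_distrib[symmetric])
      ultimately have "\<not> (- r \<le> x$1 \<and> - r \<le> x$2 \<and> x$1 + x$2 \<le> 2 * r)"
        using r(1) by (auto simp: divide_le_eq zero_le_divide_iff)
      then have "r \<le> \<bar>x$1\<bar> \<or> r \<le> \<bar>x$2\<bar>" by linarith
      then have "G x = 0" using far[of x] r(2)[of x] z[of x] by auto
      then show ?thesis by simp
    qed simp
  qed
  finally show ?thesis using i0 by simp
qed

section \<open>Almost orthogonality of the levels\<close>

definition mean :: "(pt \<Rightarrow> real) \<Rightarrow> pt \<Rightarrow> real \<Rightarrow> real" where
  "mean q c l = (LINT x|lborel. indicator (sq c l) x * q x) / (4 * l\<^sup>2)"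

text \<open>Normalized so that the mean on a child \<open>s\<close> is the mean on the square plus
  the sum of \<open>haar j\<close> times \<open>hs j s\<close>; see \<open>haar_inv\<close>.\<close>

definition haar :: "nat \<Rightarrow> (pt \<Rightarrow> real) \<Rightarrow> pt \<Rightarrow> real \<Rightarrow> real" where
  "haar j q c l = (\<Sum>s\<in>Sg. hs j s * mean q (ch c l s) (l/2)) / 4"

text \<open>The factor \<open>l\<close> balances the scaling of the argument, so gradient and
  divergence are those of the reference field times the coefficient.\<close>

definition node :: "2 \<Rightarrow> (pt \<Rightarrow> real) \<Rightarrow> pt \<Rightarrow> real \<Rightarrow> pt \<Rightarrow> real" where
  "node i q c l x = (\<Sum>j<3. haar j q c l * (l * bf j i ((1/l) *\<^sub>R (x - c))))"

definition nodeG :: "2 \<Rightarrow> (pt \<Rightarrow> real) \<Rightarrow> pt \<Rightarrow> real \<Rightarrow> pt \<Rightarrow> pt" where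
  "nodeG i q c l x = (\<Sum>j<3. haar j q c l *\<^sub>R bG j i ((1/l) *\<^sub>R (x - c)))"

text \<open>Sum of the fields of all squares \<open>k\<close> generations below
  \<open>sq c l\<close>. The recursion descends from the top square, so inductions run over
  \<open>k\<close> with the square arbitrary.\<close>

primrec lev :: "nat \<Rightarrow> 2 \<Rightarrow> (pt \<Rightarrow> real) \<Rightarrow> pt \<Rightarrow> real \<Rightarrow> pt \<Rightarrow> real" where
  "lev 0 i q c l x = node i q c l x"
| "lev (Suc k) i q c l x = (\<Sum>s\<in>Sg. lev k i q (ch c l s) (l/2) x)"

primrec levG :: "nat \<Rightarrow> 2 \<Rightarrow> (pt \<Rightarrow> real) \<Rightarrow> pt \<Rightarrow> real \<Rightarrow> pt \<Rightarrow> pt" where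
  "levG 0 i q c l x = nodeG i q c l x"
| "levG (Suc k) i q c l x = (\<Sum>s\<in>Sg. levG k i q (ch c l s) (l/2) x)"

text \<open>Squared \<open>L\<^sup>2\<close> norm of the Haar part of generation \<open>k\<close>:
  on each square the three Haar functions are orthogonal and have modulus 1 almost
  everywhere.\<close>

primrec dsq :: "nat \<Rightarrow> (pt \<Rightarrow> real) \<Rightarrow> pt \<Rightarrow> real \<Rightarrow> real" where
  "dsq 0 q c l = 4 * l\<^sup>2 * (\<Sum>j<3. (haar j q c l)\<^sup>2)"
| "dsq (Suc k) q c l = (\<Sum>s\<in>Sg. dsq k q (ch c l s) (l/2))"

primrec msq :: "nat \<Rightarrow> (pt \<Rightarrow> real) \<Rightarrow> pt \<Rightarrow> real \<Rightarrow> real" where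
  "msq 0 q c l = 4 * l\<^sup>2 * (mean q c l)\<^sup>2"
| "msq (Suc k) q c l = (\<Sum>s\<in>Sg. msq k q (ch c l s) (l/2))"

text \<open>Conditional expectation of \<open>q\<close> given the squares of generation
  \<open>k\<close>; \<open>msq k\<close> is its squared \<open>L\<^sup>2\<close> norm.\<close>

primrec cond :: "nat \<Rightarrow> (pt \<Rightarrow> real) \<Rightarrow> pt \<Rightarrow> real \<Rightarrow> pt \<Rightarrow> real" where
  "cond 0 q c l x = mean q c l * indicator (sq c l) x"
| "cond (Suc k) q c l x = (\<Sum>s\<in>Sg. cond k q (ch c l s) (l/2) x)"

text \<open>The area, at generation \<open>k\<close>, on which cancellation against a field with
  creases in \<open>L\<close> can fail.\<close>

primrec cross :: "nat \<Rightarrow> (pt \<times> real) set \<Rightarrow> pt \<Rightarrow> real \<Rightarrow> real" where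
  "cross 0 L c l = (if lset L \<inter> sq c l = {} then 0 else 4 * l\<^sup>2)"
| "cross (Suc k) L c l = (\<Sum>s\<in>Sg. cross k L (ch c l s) (l/2))"

lemma sum3: "(\<Sum>j<3. f j) = f 0 + f 1 + f (2::nat)"
  by (simp add: numeral_3_eq_3 numeral_2_eq_2)

lemma cross_nonneg: "0 \<le> cross k L c l"
  by (induction k arbitrary: c l) (auto intro!: sum_nonneg)

lemma dsq_nonneg: "0 \<le> dsq k q c l"
  by (induction k arbitrary: c l) (auto intro!: sum_nonneg mult_nonneg_nonneg)

lemma cross_zero: "lset L \<inter> sq c l = {} \<Longrightarrow> cross k L c l = 0"
proof (induction k arbitrary: c l)
  case (Suc k)
  have "cross k L (ch c l s) (l/2) = 0" if "s \<in> Sg" for s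
    using child_sub[OF that, of c l] Suc.prems by (intro Suc.IH) auto
  then show ?case by simp
qed simp

lemma cross_le_sum:
  assumes "finite L" shows "cross k L c l \<le> (\<Sum>r\<in>L. cross k {r} c l)"
proof (induction k arbitrary: c l)
  case 0
  show ?case
  proof (cases "lset L \<inter> sq c l = {}")
    case False
    then obtain r where r: "r \<in> L" "lset {r} \<inter> sq c l \<noteq> {}" by (fastforce simp: lset_def)
    then have "cross 0 {r} c l = 4 * l\<^sup>2" by simp
    then have "cross 0 L c l = cross 0 {r} c l" using False by simp
    also have "\<dots> \<le> (\<Sum>r\<in>L. cross 0 {r} c l)" by (rule member_le_sum) (use r assms cross_nonneg in auto)
    finally show ?thesis .
  qed (auto intro!: sum_nonneg)
next
  case (Suc k)
  have "cross (Suc k) L c l \<le> (\<Sum>s\<in>Sg. \<Sum>r\<in>L. cross k {r} (ch c l s) (l/2))"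
    by (simp, rule sum_mono) (rule Suc)
  also have "\<dots> = (\<Sum>r\<in>L. cross (Suc k) {r} c l)" by (simp, rule sum.swap)
  finally show ?case .
qed

text \<open>So at most three quarters of the squares of each further generation meet a given line,
  which gives the geometric decay in \<open>almost_orth\<close>.\<close>

lemma line_misses_child:
  assumes "n \<noteq> 0" shows "\<exists>s\<in>Sg. lset {(n, d)} \<inter> sq (ch c l s) (l/2) = {}"
proof -
  \<comment> \<open>\<open>\<tau>\<close> records on which side of the line the centre lies. The
    child is taken in the quadrant in whose direction \<open>\<tau> * (n \<bullet> x)\<close>
    increases, so the line cannot reach it.\<close>
  define \<tau> :: real where "\<tau> = (if n \<bullet> c \<ge> d then 1 else -1)"
  define s where "s = vec2 (if \<tau> * n$1 \<ge> 0 then 1 else -1) (if \<tau> * n$2 \<ge> 0 then 1 else -1)"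
  have sS: "s \<in> Sg" by (auto simp: s_def Sg_def)
  have t: "\<tau> = 1 \<or> \<tau> = -1" by (auto simp: \<tau>_def)
  have "n \<bullet> x \<noteq> d" if x: "x \<in> sq (ch c l s) (l/2)" for x
  proof
    assume e: "n \<bullet> x = d"
    let ?y = "x - c"
    have y: "s$1 * ?y$1 > 0" "s$2 * ?y$2 > 0" using x by (auto simp: s_def sq_def abs_if split: if_splits)
    have m: "\<tau> * n$i = s$i * \<bar>n$i\<bar>" for i :: 2 using t exhaust_2[of i] by (auto simp: s_def abs_if)
    have "\<tau> * (n \<bullet> ?y) = \<bar>n$1\<bar> * (s$1 * ?y$1) + \<bar>n$2\<bar> * (s$2 * ?y$2)"
      using m[of 1] m[of 2] unfolding inner_pt by (simp add: distrib_left mult.assoc[symmetric] del: vector_minus_component)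
    moreover have "\<bar>n$1\<bar> * (s$1 * ?y$1) \<ge> 0" "\<bar>n$2\<bar> * (s$2 * ?y$2) \<ge> 0" using y by (simp_all add: mult_nonneg_nonneg del: vector_minus_component)
    moreover have "\<bar>n$1\<bar> * (s$1 * ?y$1) > 0 \<or> \<bar>n$2\<bar> * (s$2 * ?y$2) > 0"
    proof -
      have "n$1 \<noteq> 0 \<or> n$2 \<noteq> 0" using assms pt_eqI[of n 0] by auto
      then show ?thesis using mult_pos_pos[OF _ y(1), of "\<bar>n$1\<bar>"] mult_pos_pos[OF _ y(2), of "\<bar>n$2\<bar>"] by linarith
    qed
    ultimately have "\<tau> * (n \<bullet> ?y) > 0" by linarith
    moreover have "n \<bullet> ?y = d - n \<bullet> c" using e by (simp add: inner_diff_right)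
    ultimately show False by (auto simp: \<tau>_def split: if_splits)
  qed
  then show ?thesis using sS by (auto simp: lset_def)
qed

lemma cross_line:
  assumes "n \<noteq> 0" shows "cross k {(n, d)} c l \<le> (3/4)^k * (4 * l\<^sup>2)"
proof (induction k arbitrary: c l)
  case (Suc k)
  obtain s0 where s0: "s0 \<in> Sg" "lset {(n, d)} \<inter> sq (ch c l s0) (l/2) = {}" using line_misses_child[OF assms] by blast
  have "cross (Suc k) {(n, d)} c l = cross k {(n, d)} (ch c l s0) (l/2) + (\<Sum>s\<in>Sg - {s0}. cross k {(n, d)} (ch c l s) (l/2))"
    using s0(1) by (simp add: sum.remove)
  also have "\<dots> = (\<Sum>s\<in>Sg - {s0}. cross k {(n, d)} (ch c l s) (l/2))" using cross_zero[OF s0(2)] by simp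
  also have "\<dots> \<le> (\<Sum>s\<in>Sg - {s0}. (3/4)^k * (4 * (l/2)\<^sup>2))" by (rule sum_mono) (rule Suc)
  also have "\<dots> = 3 * ((3/4)^k * (4 * (l/2)\<^sup>2))" using s0(1) by (simp add: Sg_def vec2_eq)
  also have "\<dots> = (3/4)^(Suc k) * (4 * l\<^sup>2)" by (simp add: field_simps power2_eq_square)
  finally show ?case .
qed simp

text \<open>Crease lines of the field on \<open>sq c l\<close>. As an image of \<open>Lb\<close> the
  set has at most \<open>card Lb\<close> elements for every square, which keeps \<open>CC\<close>
  uniform.\<close>

definition Lq :: "pt \<Rightarrow> real \<Rightarrow> (pt \<times> real) set" where
  "Lq c l = laff (- ((1/l) *\<^sub>R c)) (SC (1/l)) Lb"

lemma sq_scale: "l > 0 \<Longrightarrow> x \<in> sq c l \<longleftrightarrow> (1/l) *\<^sub>R (x - c) \<in> S0"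
  by (simp add: sq_def S0_def abs_mult)

lemma node_pwaff: assumes "l > 0" shows "pwaff (Lq c l) (node i q c l) (nodeG i q c l)"
proof -
  have L: "lines (Lq c l)" unfolding Lq_def by (rule lines_laff[OF _ lines_Lb]) (use assms in \<open>simp add: dets\<close>)
  have e: "- ((1/l) *\<^sub>R c) + SC (1/l) *v x = (1/l) *\<^sub>R (x - c)" for x by (simp add: mats scaleR_diff_right)
  have "pwaff (Lq c l) (\<lambda>x. haar j q c l * (l * bf j i ((1/l) *\<^sub>R (x - c)))) (\<lambda>x. haar j q c l *\<^sub>R bG j i ((1/l) *\<^sub>R (x - c)))" for j
  proof -
    have "pwaff (Lq c l) (\<lambda>x. bf j i (- ((1/l) *\<^sub>R c) + SC (1/l) *v x)) (\<lambda>x. transpose (SC (1/l)) *v bG j i (- ((1/l) *\<^sub>R c) + SC (1/l) *v x))"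
      unfolding Lq_def by (rule pwaff_affine[OF bf_pwaff]) (use assms in \<open>simp add: dets\<close>)
    then have "pwaff (Lq c l) (\<lambda>x. l * bf j i ((1/l) *\<^sub>R (x - c))) (\<lambda>x. l *\<^sub>R ((1/l) *\<^sub>R bG j i ((1/l) *\<^sub>R (x - c))))"
      unfolding e mats(6) by (rule pwaff_cmult)
    then have "pwaff (Lq c l) (\<lambda>x. l * bf j i ((1/l) *\<^sub>R (x - c))) (\<lambda>x. bG j i ((1/l) *\<^sub>R (x - c)))"
      using assms by simp
    then show ?thesis by (rule pwaff_cmult)
  qed
  then show ?thesis unfolding node_def[abs_def] nodeG_def[abs_def] by (intro pwaff_sum L) auto
qed

lemma node_outside: "l > 0 \<Longrightarrow> x \<notin> sq c l \<Longrightarrow> node i q c l x = 0 \<and> nodeG i q c l x = 0"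
  unfolding node_def nodeG_def sq_scale by (simp add: bf_outside)

lemma lev_props:
  assumes "l > 0"
  shows "(\<exists>L. pwaff L (lev k i q c l) (levG k i q c l)) \<and> (\<forall>x. x \<notin> sq c l \<longrightarrow> lev k i q c l x = 0 \<and> levG k i q c l x = 0)"
  using assms
proof (induction k arbitrary: c l)
  case 0
  then show ?case using node_pwaff[OF 0] node_outside[OF 0] unfolding lev.simps(1)[abs_def] levG.simps(1)[abs_def] by blast
next
  case (Suc k)
  have "\<exists>L. pwaff L (\<lambda>x. \<Sum>s\<in>Sg. lev k i q (ch c l s) (l/2) x) (\<lambda>x. \<Sum>s\<in>Sg. levG k i q (ch c l s) (l/2) x)"
    by (rule pwaff_sum_ex) (use Suc in auto)
  moreover have "lev k i q (ch c l s) (l/2) x = 0 \<and> levG k i q (ch c l s) (l/2) x = 0" if "s \<in> Sg" "x \<notin> sq c l" for s x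
    using Suc.IH[of "l/2"] Suc.prems child_sub[OF that(1), of c l] that(2) by auto
  ultimately show ?case by simp
qed

lemma levG_outside: "l > 0 \<Longrightarrow> x \<notin> sq c l \<Longrightarrow> levG k i q c l x = 0" and
  lev_outside: "l > 0 \<Longrightarrow> x \<notin> sq c l \<Longrightarrow> lev k i q c l x = 0"
  using lev_props by blast+

lemma levG_meas: "l > 0 \<Longrightarrow> levG k i q c l \<in> borel_measurable borel"
  using lev_props[of l k i q c] by (auto simp: pwaff_def)

lemma levG_bdd: assumes "l > 0" obtains B where "B \<ge> 0" "\<And>x. norm (levG k i q c l x) \<le> B"
proof -
  obtain B where "\<And>x. norm (levG k i q c l x) \<le> B" using lev_props[OF assms, of k i q c] by (auto simp: pwaff_def bounded_iff)
  then show ?thesis using that[of "max B 0"] by (metis max.cobounded1 max.cobounded2 order_trans)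
qed

lemma inner_int:
  assumes l: "l > 0" and [measurable]: "A \<in> borel_measurable borel" and A: "\<And>x. norm (A x) \<le> M"
  shows "integrable lborel (\<lambda>x. A x \<bullet> levG k i q c l x)"
proof -
  obtain B where B: "B \<ge> 0" "\<And>x. norm (levG k i q c l x) \<le> B" using levG_bdd[OF l] by metis
  have [measurable]: "levG k i q c l \<in> borel_measurable borel" by (rule levG_meas[OF l])
  have M: "M \<ge> 0" using A by (meson norm_ge_zero order_trans)
  show ?thesis
  proof (rule bint[OF _ _ sq_borel[of c l] sq_bounded])
    show "\<bar>A x \<bullet> levG k i q c l x\<bar> \<le> M * B" for x
      using Cauchy_Schwarz_ineq2[of "A x" "levG k i q c l x"] mult_mono[OF A B(2) M norm_ge_zero] order_trans by blast
  qed (use levG_outside[OF l] in auto)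
qed

lemma sqrt_CS:
  assumes "finite I" "\<And>i. i \<in> I \<Longrightarrow> 0 \<le> a i" "\<And>i. i \<in> I \<Longrightarrow> 0 \<le> b i"
  shows "(\<Sum>i\<in>I. sqrt (a i * b i)) \<le> sqrt ((\<Sum>i\<in>I. a i) * (\<Sum>i\<in>I. b i :: real))"
proof -
  have "(\<Sum>i\<in>I. sqrt (a i) * sqrt (b i))\<^sup>2 \<le> (\<Sum>i\<in>I. (sqrt (a i))\<^sup>2) * (\<Sum>i\<in>I. (sqrt (b i))\<^sup>2)"
    by (rule Cauchy_Schwarz_ineq_sum)
  also have "\<dots> = (\<Sum>i\<in>I. a i) * (\<Sum>i\<in>I. b i)" using assms by simp
  finally show ?thesis by (intro real_le_rsqrt) (simp add: real_sqrt_mult)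
qed

context
  fixes M :: real
  assumes M0: "M > 0" and bGM: "\<And>j i x. norm (bG j i x) \<le> M"
begin

lemma nodeG_norm: "norm (nodeG i q c l x) \<le> 3 * M * sqrt (\<Sum>j<3. (haar j q c l)\<^sup>2)"
proof -
  have h: "\<bar>haar j q c l\<bar> \<le> sqrt (\<Sum>j<3. (haar j q c l)\<^sup>2)" if "j < 3" for j
    using member_le_sum[of j "{..<3}" "\<lambda>j. (haar j q c l)\<^sup>2"] that by (intro real_le_rsqrt) auto
  have "norm (nodeG i q c l x) \<le> (\<Sum>j\<in>{..<3::nat}. sqrt (\<Sum>j<3. (haar j q c l)\<^sup>2) * M)"
    unfolding nodeG_def
  proof (rule sum_norm_le)
    fix j assume "j \<in> {..<3::nat}"
    then show "norm (haar j q c l *\<^sub>R bG j i ((1/l) *\<^sub>R (x - c))) \<le> sqrt (\<Sum>j<3. (haar j q c l)\<^sup>2) * M"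
      unfolding norm_scaleR using h[of j] bGM by (intro mult_mono) (auto simp: sum_nonneg)
  qed
  then show ?thesis by (simp add: sum3 mult_ac)
qed

text \<open>Induction over the generations. On a bottom square missed by the lines \<open>A\<close>
  is constant, and by \<open>gdiff_integral_zero\<close> the pairing vanishes; on the others it is
  at most the product of the sup bounds and the area. Cauchy-Schwarz over the squares separates area
  and Haar coefficients.\<close>

lemma cross_bound:
  assumes l: "l > 0" and [measurable]: "A \<in> borel_measurable borel" and A: "\<And>x. norm (A x) \<le> MA"
    and const: "\<And>U. convex U \<Longrightarrow> U \<inter> lset L = {} \<Longrightarrow> \<exists>w. \<forall>x\<in>U. A x = w"
  shows "\<bar>LINT x|lborel. A x \<bullet> levG k i q c l x\<bar> \<le> MA * (3 * M) * sqrt (cross k L c l * dsq k q c l)"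
  using l
proof (induction k arbitrary: c l)
  case 0
  have MA: "MA \<ge> 0" using A by (meson norm_ge_zero order_trans)
  define H where "H = (\<Sum>j<3. (haar j q c l)\<^sup>2)"
  have H: "H \<ge> 0" by (simp add: H_def sum_nonneg)
  note nG = nodeG_norm[of i q c l, folded H_def]
  have g: "gdiff (Lq c l) (node i q c l) (nodeG i q c l)" by (rule pwaff_gdiff[OF node_pwaff[OF 0]])
  have [measurable]: "nodeG i q c l \<in> borel_measurable borel" using g by (simp add: gdiff_def)
  show ?case
  proof (cases "lset L \<inter> sq c l = {}")
    case True
    then obtain w where w: "\<forall>x\<in>sq c l. A x = w" using const[OF sq_convex[of c l]] by (metis inf_commute)
    have "A x \<bullet> nodeG i q c l x = nodeG i q c l x \<bullet> w" for x
      using w node_outside[OF 0, of x c i q] by (cases "x \<in> sq c l") (auto simp: inner_commute)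
    then have "(LINT x|lborel. A x \<bullet> levG 0 i q c l x) = (LINT x|lborel. nodeG i q c l x \<bullet> w)" by simp
    also have "\<dots> = 0" by (rule gdiff_integral_zero[OF g sq_bounded]) (rule node_outside[OF 0])
    finally show ?thesis using True by simp
  next
    case False
    have b: "\<bar>A x \<bullet> nodeG i q c l x\<bar> \<le> indicator (sq c l) x * (MA * (3 * M * sqrt H))" for x
    proof (cases "x \<in> sq c l")
      case True
      have "\<bar>A x \<bullet> nodeG i q c l x\<bar> \<le> MA * (3 * M * sqrt H)"
        using Cauchy_Schwarz_ineq2[of "A x" "nodeG i q c l x"] mult_mono[OF A nG MA norm_ge_zero] order_trans by blast
      then show ?thesis using True by simp
    qed (simp add: node_outside[OF 0])
    have "\<bar>LINT x|lborel. A x \<bullet> nodeG i q c l x\<bar> \<le> (LINT x|lborel. \<bar>A x \<bullet> nodeG i q c l x\<bar>)"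
      using integral_norm_bound[of lborel "\<lambda>x. A x \<bullet> nodeG i q c l x"] by simp
    also have "\<dots> \<le> (LINT x|lborel. indicator (sq c l) x * (MA * (3 * M * sqrt H)))"
    proof (rule integral_mono)
      show "integrable lborel (\<lambda>x. indicator (sq c l) x * (MA * (3 * M * sqrt H)))" by (rule sq_int[of _ "\<bar>MA * (3 * M * sqrt H)\<bar>"]) auto
      show "integrable lborel (\<lambda>x. \<bar>A x \<bullet> nodeG i q c l x\<bar>)"
        using inner_int[OF 0 assms(2) A, of 0 i q c] by (simp add: integrable_abs)
    qed (rule b)
    also have "\<dots> = 4 * l\<^sup>2 * (MA * (3 * M * sqrt H))" using sq_measure[of l c] 0 sq_finite[of c l] by simp
    also have "\<dots> = MA * (3 * M) * sqrt ((4 * l\<^sup>2) * (4 * l\<^sup>2 * H))"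
    proof -
      have "sqrt ((4 * l\<^sup>2) * (4 * l\<^sup>2 * H)) = sqrt ((4 * l\<^sup>2)\<^sup>2 * H)" by (simp add: power2_eq_square mult_ac)
      also have "\<dots> = \<bar>4 * l\<^sup>2\<bar> * sqrt H" by (simp only: real_sqrt_mult real_sqrt_abs)
      finally show ?thesis by simp
    qed
    finally show ?thesis using False by (simp add: H_def)
  qed
next
  case (Suc k)
  have MA: "MA \<ge> 0" using A by (meson norm_ge_zero order_trans)
  have l2: "l/2 > 0" using Suc.prems by simp
  have "(LINT x|lborel. A x \<bullet> levG (Suc k) i q c l x) = (\<Sum>s\<in>Sg. LINT x|lborel. A x \<bullet> levG k i q (ch c l s) (l/2) x)"
    unfolding levG.simps inner_sum_right by (rule Bochner_Integration.integral_sum) (rule inner_int[OF l2 assms(2) A])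
  then have "\<bar>LINT x|lborel. A x \<bullet> levG (Suc k) i q c l x\<bar> \<le> (\<Sum>s\<in>Sg. \<bar>LINT x|lborel. A x \<bullet> levG k i q (ch c l s) (l/2) x\<bar>)"
    by (simp add: sum_abs)
  also have "\<dots> \<le> (\<Sum>s\<in>Sg. MA * (3 * M) * sqrt (cross k L (ch c l s) (l/2) * dsq k q (ch c l s) (l/2)))"
    by (rule sum_mono) (rule Suc.IH[OF l2])
  also have "\<dots> = MA * (3 * M) * (\<Sum>s\<in>Sg. sqrt (cross k L (ch c l s) (l/2) * dsq k q (ch c l s) (l/2)))"
    by (simp add: sum_distrib_left)
  also have "\<dots> \<le> MA * (3 * M) * sqrt (cross (Suc k) L c l * dsq (Suc k) q c l)"
    using MA M0 by (intro mult_left_mono) (auto intro!: sqrt_CS cross_nonneg dsq_nonneg simp del: cross.simps(1) dsq.simps(1))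
  finally show ?case .
qed

text \<open>The area in \<open>cross_bound\<close> decays by 3/4 per generation and stands under a
  square root.\<close>

definition rr :: real where "rr = sqrt (3/4)"
text \<open>The coarse and the fine gradient contribute a factor \<open>3 * M\<close> each, through
  \<open>nodeG_norm\<close>; the root counts the crease lines of one square.\<close>

definition CC :: real where "CC = 9 * M\<^sup>2 * sqrt (real (card Lb))"

lemma CC_nonneg: "CC \<ge> 0" by (simp add: CC_def)

text \<open>For \<open>j = 0\<close> the coarse gradient takes the role of \<open>A\<close> in
  \<open>cross_bound\<close>, with its own crease lines. For larger \<open>j\<close> fields of
  different children have disjoint supports, so the integral splits over the children and
  \<open>sqrt_CS\<close> reassembles the bound.\<close>

lemma almost_orth:
  assumes l: "l > 0"
  shows "\<bar>LINT x|lborel. levG j i q c l x \<bullet> levG (j + k) i q c l x\<bar> \<le> CC * rr^k * sqrt (dsq j q c l * dsq (j + k) q c l)"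
  using l
proof (induction j arbitrary: c l)
  case 0
  let ?H = "\<Sum>j<3. (haar j q c l)\<^sup>2"
  have H: "?H \<ge> 0" by (simp add: sum_nonneg)
  have g: "pwaff (Lq c l) (node i q c l) (nodeG i q c l)" by (rule node_pwaff[OF 0])
  have fin: "finite (Lq c l)" and nz: "\<And>n d. (n, d) \<in> Lq c l \<Longrightarrow> n \<noteq> 0" using g by (auto simp: pwaff_def lines_def)
  have "cross k (Lq c l) c l \<le> (\<Sum>r\<in>Lq c l. cross k {r} c l)" by (rule cross_le_sum[OF fin])
  also have "\<dots> \<le> (\<Sum>r\<in>Lq c l. (3/4)^k * (4 * l\<^sup>2))"
    by (rule sum_mono) (use cross_line nz in force)
  also have "\<dots> \<le> real (card Lb) * ((3/4)^k * (4 * l\<^sup>2))"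
    unfolding sum_constant by (rule mult_right_mono) (use lines_Lb in \<open>auto simp: Lq_def laff_def lines_def intro!: card_image_le\<close>)
  finally have X: "cross k (Lq c l) c l \<le> real (card Lb) * ((3/4)^k * (4 * l\<^sup>2))" .
  have "\<bar>LINT x|lborel. nodeG i q c l x \<bullet> levG k i q c l x\<bar> \<le> (3 * M * sqrt ?H) * (3 * M) * sqrt (cross k (Lq c l) c l * dsq k q c l)"
  proof (rule cross_bound[OF 0])
    show "nodeG i q c l \<in> borel_measurable borel" using g by (simp add: pwaff_def)
    show "\<exists>w. \<forall>x\<in>U. nodeG i q c l x = w" if "convex U" "U \<inter> lset (Lq c l) = {}" for U
      using g that unfolding pwaff_def by meson
  qed (rule nodeG_norm)
  also have "\<dots> \<le> (3 * M * sqrt ?H) * (3 * M) * sqrt (real (card Lb) * ((3/4)^k * (4 * l\<^sup>2)) * dsq k q c l)"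
    using X M0 H dsq_nonneg by (intro mult_left_mono real_sqrt_le_mono mult_right_mono) auto
  also have "\<dots> = CC * rr^k * sqrt (4 * l\<^sup>2 * ?H * dsq k q c l)"
  proof -
    have "sqrt ((3/4)^k) = rr^k" by (simp only: rr_def real_sqrt_power)
    then show ?thesis unfolding CC_def real_sqrt_mult power2_eq_square by simp
  qed
  finally show ?case by simp
next
  case (Suc j)
  have l2: "l/2 > 0" using Suc.prems by simp
  let ?g = "\<lambda>n s. levG n i q (ch c l s) (l/2)"
  have "levG (Suc j) i q c l x \<bullet> levG (Suc j + k) i q c l x = (\<Sum>s\<in>Sg. ?g j s x \<bullet> ?g (j + k) s x)" for x
  proof (cases "\<exists>s\<in>Sg. x \<in> sq (ch c l s) (l/2)")
    case True
    then obtain s where s: "s \<in> Sg" "x \<in> sq (ch c l s) (l/2)" by blast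
    show ?thesis unfolding add_Suc levG.simps
      by (subst (1 2 3) sum_child[OF s]) (auto simp: levG_outside[OF l2])
  next
    case False
    then show ?thesis by (simp add: levG_outside[OF l2])
  qed
  then have "(LINT x|lborel. levG (Suc j) i q c l x \<bullet> levG (Suc j + k) i q c l x) = (LINT x|lborel. (\<Sum>s\<in>Sg. ?g j s x \<bullet> ?g (j + k) s x))" by simp
  also have "\<dots> = (\<Sum>s\<in>Sg. LINT x|lborel. ?g j s x \<bullet> ?g (j + k) s x)"
  proof (rule Bochner_Integration.integral_sum)
    fix s
    obtain B where "\<And>x. norm (?g j s x) \<le> B" using levG_bdd[OF l2] by metis
    then show "integrable lborel (\<lambda>x. ?g j s x \<bullet> ?g (j + k) s x)" by (rule inner_int[OF l2 levG_meas[OF l2]])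
  qed
  finally have "\<bar>LINT x|lborel. levG (Suc j) i q c l x \<bullet> levG (Suc j + k) i q c l x\<bar> \<le> (\<Sum>s\<in>Sg. \<bar>LINT x|lborel. ?g j s x \<bullet> ?g (j + k) s x\<bar>)"
    by (simp add: sum_abs)
  also have "\<dots> \<le> (\<Sum>s\<in>Sg. CC * rr^k * sqrt (dsq j q (ch c l s) (l/2) * dsq (j + k) q (ch c l s) (l/2)))"
    by (rule sum_mono) (rule Suc.IH[OF l2])
  also have "\<dots> = CC * rr^k * (\<Sum>s\<in>Sg. sqrt (dsq j q (ch c l s) (l/2) * dsq (j + k) q (ch c l s) (l/2)))"
    by (simp add: sum_distrib_left)
  also have "\<dots> \<le> CC * rr^k * sqrt (dsq (Suc j) q c l * dsq (Suc j + k) q c l)"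
    unfolding add_Suc dsq.simps using CC_nonneg
    by (intro mult_left_mono sqrt_CS dsq_nonneg) (auto simp: rr_def)
  finally show ?case .
qed

text \<open>The indices up to \<open>j\<close> and those beyond it contribute at most one full
  geometric series each.\<close>

lemma geo_sum: "(\<Sum>k<n. rr^(nat \<bar>int j - int k\<bar>)) \<le> 2 / (1 - rr)"
proof -
  have r: "0 \<le> rr" "rr < 1" by (auto simp: rr_def real_sqrt_lt_1_iff)
  have g: "(\<Sum>k\<in>A. rr^k) \<le> 1 / (1 - rr)" if "finite A" for A :: "nat set"
  proof -
    have "(\<Sum>k\<in>A. rr^k) \<le> (\<Sum>k. rr^k)" by (rule sum_le_suminf) (use r that in auto)
    then show ?thesis using suminf_geometric[of rr] r by simp
  qed
  have "(\<Sum>k<n. rr^(nat \<bar>int j - int k\<bar>)) \<le> (\<Sum>k\<in>{..<n} \<inter> {..j}. rr^(nat \<bar>int j - int k\<bar>)) + (\<Sum>k\<in>{..<n} - {..j}. rr^(nat \<bar>int j - int k\<bar>))"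
    by (subst sum.Int_Diff[of _ _ "{..j}"]) auto
  also have "(\<Sum>k\<in>{..<n} \<inter> {..j}. rr^(nat \<bar>int j - int k\<bar>)) = (\<Sum>k\<in>(\<lambda>k. j - k) ` ({..<n} \<inter> {..j}). rr^k)"
    by (subst sum.reindex) (auto simp: inj_on_def nat_diff_distrib' intro!: sum.cong arg_cong[where f="\<lambda>m. rr^m"])
  also have "(\<Sum>k\<in>{..<n} - {..j}. rr^(nat \<bar>int j - int k\<bar>)) = (\<Sum>k\<in>(\<lambda>k. k - j) ` ({..<n} - {..j}). rr^k)"
    by (subst sum.reindex) (auto simp: inj_on_def intro!: sum.cong arg_cong[where f="\<lambda>m. rr^m"])
  finally show ?thesis using g[of "(\<lambda>k. j - k) ` ({..<n} \<inter> {..j})"] g[of "(\<lambda>k. k - j) ` ({..<n} - {..j})"] by simp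
qed

text \<open>Schur's test: expand the square, replace the geometric mean of \<open>dsq j\<close> and
  \<open>dsq k\<close> by half their sum, and sum the powers of \<open>rr\<close> over the other
  index.\<close>

lemma energy:
  assumes l: "l > 0"
  shows "(LINT x|lborel. (norm (\<Sum>k<n. levG k i q c l x))\<^sup>2) \<le> CC * (2 / (1 - rr)) * (\<Sum>k<n. dsq k q c l)"
proof -
  let ?g = "\<lambda>k. levG k i q c l" and ?d = "\<lambda>k. dsq k q c l"
  have int: "integrable lborel (\<lambda>x. ?g j x \<bullet> ?g k x)" for j k
  proof -
    obtain B where "\<And>x. norm (?g j x) \<le> B" using levG_bdd[OF l] by metis
    then show ?thesis by (rule inner_int[OF l levG_meas[OF l]])
  qed
  have o: "\<bar>LINT x|lborel. ?g j x \<bullet> ?g k x\<bar> \<le> CC * rr^(nat \<bar>int j - int k\<bar>) * ((?d j + ?d k) / 2)" for j k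
  proof -
    have 1: "\<bar>LINT x|lborel. ?g j x \<bullet> ?g k x\<bar> \<le> CC * rr^(nat \<bar>int j - int k\<bar>) * sqrt (?d j * ?d k)"
    proof (cases "j \<le> k")
      case True
      then have "nat \<bar>int j - int k\<bar> = k - j" by auto
      then show ?thesis using almost_orth[OF l, of j i q c "k - j"] True by simp
    next
      case False
      then have "nat \<bar>int j - int k\<bar> = j - k" by auto
      then show ?thesis using almost_orth[OF l, of k i q c "j - k"] False by (simp add: inner_commute mult.commute)
    qed
    have "sqrt (?d j * ?d k) \<le> (?d j + ?d k) / 2" by (rule arith_geo_mean_sqrt) (rule dsq_nonneg)+
    then have "CC * rr^(nat \<bar>int j - int k\<bar>) * sqrt (?d j * ?d k) \<le> CC * rr^(nat \<bar>int j - int k\<bar>) * ((?d j + ?d k) / 2)"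
      using CC_nonneg by (intro mult_left_mono) (auto simp: rr_def)
    then show ?thesis using 1 by linarith
  qed
  have "(LINT x|lborel. (norm (\<Sum>k<n. ?g k x))\<^sup>2) = (LINT x|lborel. (\<Sum>j<n. \<Sum>k<n. ?g j x \<bullet> ?g k x))"
    by (simp add: power2_norm_eq_inner inner_sum_left inner_sum_right inner_commute)
  also have "\<dots> = (\<Sum>j<n. \<Sum>k<n. LINT x|lborel. ?g j x \<bullet> ?g k x)"
    by (simp add: int)
  also have "\<dots> \<le> (\<Sum>j<n. \<Sum>k<n. CC * rr^(nat \<bar>int j - int k\<bar>) * ((?d j + ?d k) / 2))"
    by (intro sum_mono) (rule order_trans[OF abs_ge_self o])
  also have "\<dots> = (\<Sum>j<n. \<Sum>k<n. CC * rr^(nat \<bar>int j - int k\<bar>) * ?d j / 2) + (\<Sum>j<n. \<Sum>k<n. CC * rr^(nat \<bar>int j - int k\<bar>) * ?d k / 2)"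
    by (simp add: sum.distrib[symmetric] algebra_simps add_divide_distrib)
  also have "(\<Sum>j<n. \<Sum>k<n. CC * rr^(nat \<bar>int j - int k\<bar>) * ?d k / 2) = (\<Sum>j<n. \<Sum>k<n. CC * rr^(nat \<bar>int j - int k\<bar>) * ?d j / 2)"
    by (subst sum.swap) (simp add: abs_minus_commute)
  also have "(\<Sum>j<n. \<Sum>k<n. CC * rr^(nat \<bar>int j - int k\<bar>) * ?d j / 2) = (\<Sum>j<n. (CC * ?d j / 2) * (\<Sum>k<n. rr^(nat \<bar>int j - int k\<bar>)))"
    by (simp add: sum_distrib_left mult_ac)
  also have "\<dots> + \<dots> = (\<Sum>j<n. (CC * ?d j) * (\<Sum>k<n. rr^(nat \<bar>int j - int k\<bar>)))"
    by (simp add: sum.distrib[symmetric] field_simps)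
  also have "\<dots> \<le> (\<Sum>j<n. (CC * ?d j) * (2 / (1 - rr)))"
    using CC_nonneg dsq_nonneg by (intro sum_mono mult_left_mono geo_sum) auto
  also have "\<dots> = CC * (2 / (1 - rr)) * (\<Sum>k<n. ?d k)"
    by (simp add: sum_distrib_left sum_divide_distrib mult_ac)
  finally show ?thesis .
qed

end

section \<open>The divergence equation on squares\<close>

lemma mean_mult: "l > 0 \<Longrightarrow> (LINT x|lborel. indicator (sq c l) x * q x) = 4 * l\<^sup>2 * mean q c l"
  by (simp add: mean_def)

text \<open>A measurable function is almost everywhere a limit of continuous ones. Truncation at
  height \<open>B\<close> preserves this and supplies the dominating constant for the passage to the
  limit under the integral.\<close>

lemma L2_density:
  fixes q :: "pt \<Rightarrow> real"
  assumes [measurable]: "q \<in> borel_measurable borel" and qB: "\<And>x. \<bar>q x\<bar> \<le> B" and e: "e > 0"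
  obtains g where "continuous_on UNIV g" "\<And>x. \<bar>g x\<bar> \<le> B" "(LINT x|lborel. indicator (sq c l) x * (q x - g x)\<^sup>2) \<le> e"
proof -
  have "q \<in> borel_measurable lebesgue" by (rule measurable_completion) simp
  then have "q measurable_on UNIV" by (rule lebesgue_measurable_imp_measurable_on) simp
  then obtain N g where N: "negligible N" and g: "\<And>n. continuous_on UNIV (g n)"
    and lim: "\<And>x. x \<notin> N \<Longrightarrow> (\<lambda>n. g n x) \<longlonglongrightarrow> q x"
    unfolding measurable_on_def by auto
  define h where "h n x = max (-B) (min B (g n x))" for n :: nat and x
  have hc: "continuous_on UNIV (h n)" for n unfolding h_def by (intro continuous_intros g)
  then have hm [measurable]: "h n \<in> borel_measurable borel" for n by (rule borel_measurable_continuous_onI)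
  have B0: "B \<ge> 0" using qB[of 0] by linarith
  have hB: "\<bar>h n x\<bar> \<le> B" for n x using B0 by (auto simp: h_def)
  have hl: "(\<lambda>n. h n x) \<longlonglongrightarrow> q x" if "x \<notin> N" for x
  proof -
    have "(\<lambda>n. h n x) \<longlonglongrightarrow> max (-B) (min B (q x))" unfolding h_def by (intro tendsto_intros lim that)
    moreover have "max (-B) (min B (q x)) = q x" using qB[of x] by auto
    ultimately show ?thesis by simp
  qed
  have AEN: "AE x in lborel. x \<notin> N"
  proof -
    have "AE x in lebesgue. x \<notin> N" using N by (simp add: AE_not_in negligible_iff_null_sets)
    then show ?thesis by (simp add: AE_completion_iff)
  qed
  have "(\<lambda>n. LINT x|lborel. indicator (sq c l) x * (q x - h n x)\<^sup>2) \<longlonglongrightarrow> (LINT x|lborel. indicator (sq c l) x * (0::real))"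
  proof (rule integral_dominated_convergence[where w="\<lambda>x. indicator (sq c l) x * (2 * B)\<^sup>2"])
    show "integrable lborel (\<lambda>x. indicator (sq c l) x * (2 * B)\<^sup>2)" by (rule sq_int[of _ "(2*B)\<^sup>2"]) auto
    show "AE x in lborel. (\<lambda>n. indicator (sq c l) x * (q x - h n x)\<^sup>2) \<longlonglongrightarrow> indicator (sq c l) x * 0"
      using AEN
    proof eventually_elim
      case (elim x)
      have "(\<lambda>n. (q x - h n x)\<^sup>2) \<longlonglongrightarrow> (q x - q x)\<^sup>2" by (intro tendsto_intros hl elim)
      then show ?case by (intro tendsto_mult tendsto_const) simp
    qed
    show "AE x in lborel. norm (indicator (sq c l) x * (q x - h n x)\<^sup>2) \<le> indicator (sq c l) x * (2 * B)\<^sup>2" for n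
    proof (rule AE_I2)
      fix x
      have "\<bar>q x - h n x\<bar> \<le> 2 * B" using qB[of x] hB[of n x] by linarith
      then have "(q x - h n x)\<^sup>2 \<le> (2 * B)\<^sup>2" using abs_le_square_iff[of "q x - h n x" "2 * B"] B0 by simp
      then show "norm (indicator (sq c l) x * (q x - h n x)\<^sup>2) \<le> indicator (sq c l) x * (2 * B)\<^sup>2" by (simp add: indicator_def)
    qed
  qed measurable
  then have "(\<lambda>n. LINT x|lborel. indicator (sq c l) x * (q x - h n x)\<^sup>2) \<longlonglongrightarrow> 0" by simp
  then have "eventually (\<lambda>n. (LINT x|lborel. indicator (sq c l) x * (q x - h n x)\<^sup>2) < e) sequentially"
    using e by (rule order_tendstoD(2))
  then obtain n where "(LINT x|lborel. indicator (sq c l) x * (q x - h n x)\<^sup>2) < e" by (auto simp: eventually_sequentially)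
  then show ?thesis by (rule that[OF hc hB less_imp_le])
qed

lemma hs_Sg:
  assumes s: "s \<in> Sg" and l: "l > 0" and x: "x \<in> sq (ch c l s) (l/2)"
  shows "hs j ((1/l) *\<^sub>R (x - c)) = hs j s"
proof -
  have "sgn (((1/l) *\<^sub>R (x - c)) $ i) = sgn (s$i)" for i :: 2
  proof -
    have si: "s$i = 1 \<or> s$i = -1" using s exhaust_2[of i] by (auto simp: Sg_def)
    have "\<bar>x$i - c$i - l / 2 * s$i\<bar> < l / 2" using x exhaust_2[of i] by (auto simp: sq_def algebra_simps)
    then have "x$i - c$i - l / 2 * s$i < l / 2" "- (x$i - c$i - l / 2 * s$i) < l / 2" by linarith+
    then have "(s$i = 1 \<and> x$i > c$i) \<or> (s$i = -1 \<and> x$i < c$i)" using si by (elim disjE) simp_all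
    then show ?thesis using l by (auto simp: sgn_mult)
  qed
  then show ?thesis unfolding hs_def by presburger
qed

context
  fixes q :: "pt \<Rightarrow> real" and B :: real
  assumes qm [measurable]: "q \<in> borel_measurable borel" and qB: "\<And>x. \<bar>q x\<bar> \<le> B"
begin

lemma q2B: "\<bar>(q x)\<^sup>2\<bar> \<le> B\<^sup>2"
  using qB[of x] abs_le_square_iff[of "q x" B] by (smt (verit) power2_eq_square zero_le_power2)

lemma mean_child: assumes "l > 0" shows "mean q c l = (\<Sum>s\<in>Sg. mean q (ch c l s) (l/2)) / 4"
proof -
  have "4 * l\<^sup>2 * mean q c l = (\<Sum>s\<in>Sg. 4 * (l/2)\<^sup>2 * mean q (ch c l s) (l/2))"
    using integral_child[OF qm qB, of c l] assms mean_mult[of "l/2" _ q] by (simp add: mean_mult)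
  also have "\<dots> = l\<^sup>2 * (\<Sum>s\<in>Sg. mean q (ch c l s) (l/2))"
    by (simp add: sum_distrib_left power_divide)
  finally show ?thesis using assms by simp
qed

text \<open>The three sign patterns and the constant are orthogonal on the four children, so the
  transform is inverted by its transpose.\<close>

lemma haar_inv: assumes "l > 0" "s \<in> Sg"
  shows "mean q (ch c l s) (l/2) = mean q c l + (\<Sum>j<3. haar j q c l * hs j s)"
  using assms(2) unfolding mean_child[OF assms(1)] sum3 haar_def sum_Sg
  by (auto simp: Sg_def hs_def field_simps)

text \<open>Pythagoras for the four values on the children: the mixed terms cancel because the sign
  patterns are orthogonal.\<close>

lemma dsq_0: assumes "l > 0" shows "dsq 0 q c l = msq 1 q c l - msq 0 q c l"
proof -
  have e: "(\<Sum>s\<in>Sg. (mean q c l + (\<Sum>j<3. haar j q c l * hs j s))\<^sup>2) = 4 * (mean q c l)\<^sup>2 + 4 * (\<Sum>j<3. (haar j q c l)\<^sup>2)"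
    unfolding sum_Sg sum3 by (simp add: hs_def power2_eq_square algebra_simps)
  have "msq 1 q c l = (\<Sum>s\<in>Sg. l\<^sup>2 * (mean q (ch c l s) (l/2))\<^sup>2)" by (simp add: power_divide)
  also have "\<dots> = l\<^sup>2 * (\<Sum>s\<in>Sg. (mean q c l + (\<Sum>j<3. haar j q c l * hs j s))\<^sup>2)"
    unfolding sum_distrib_left by (rule sum.cong[OF refl]) (simp only: haar_inv[OF assms])
  also have "\<dots> = l\<^sup>2 * (4 * (mean q c l)\<^sup>2 + 4 * (\<Sum>j<3. (haar j q c l)\<^sup>2))" unfolding e ..
  finally show ?thesis by (simp add: algebra_simps)
qed

lemma dsq_msq: "l > 0 \<Longrightarrow> dsq k q c l = msq (Suc k) q c l - msq k q c l"
proof (induction k arbitrary: c l)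
  case 0 then show ?case using dsq_0 by simp
next
  case (Suc k)
  have "dsq (Suc k) q c l = (\<Sum>s\<in>Sg. msq (Suc k) q (ch c l s) (l/2) - msq k q (ch c l s) (l/2))"
    unfolding dsq.simps(2) by (rule sum.cong[OF refl], rule Suc.IH) (use Suc.prems in simp)
  then show ?case by (simp only: sum_subtractf msq.simps(2))
qed

text \<open>Completing the square. With \<open>k\<close> the mean it bounds \<open>msq 0\<close>;
  for other \<open>k\<close> it shows that the mean is the best constant approximation.\<close>

lemma mean_best:
  assumes l: "l > 0"
  shows "(LINT x|lborel. indicator (sq c l) x * (q x - k)\<^sup>2) = (LINT x|lborel. indicator (sq c l) x * (q x)\<^sup>2) - 4 * l\<^sup>2 * (mean q c l)\<^sup>2 + 4 * l\<^sup>2 * (mean q c l - k)\<^sup>2"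
proof -
  have i: "integrable lborel (\<lambda>x. indicator (sq c l) x * (q x)\<^sup>2)" by (rule sq_int[OF _ q2B]) simp
  have i2: "integrable lborel (\<lambda>x. indicator (sq c l) x * q x)" by (rule sq_int[OF _ qB]) simp
  have i3: "integrable lborel (\<lambda>x. indicator (sq c l) x * (1::real))" by (rule sq_int[of _ 1]) auto
  have "(LINT x|lborel. indicator (sq c l) x * (q x - k)\<^sup>2) = (LINT x|lborel. indicator (sq c l) x * (q x)\<^sup>2 - (2 * k) * (indicator (sq c l) x * q x) + k\<^sup>2 * (indicator (sq c l) x * 1))"
    by (rule Bochner_Integration.integral_cong) (auto simp: power2_eq_square algebra_simps)
  also have "\<dots> = (LINT x|lborel. indicator (sq c l) x * (q x)\<^sup>2) - (2 * k) * (LINT x|lborel. indicator (sq c l) x * q x) + k\<^sup>2 * (LINT x|lborel. indicator (sq c l) x * (1::real))"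
    using i i2 i3 by simp
  also have "\<dots> = (LINT x|lborel. indicator (sq c l) x * (q x)\<^sup>2) - 4 * l\<^sup>2 * (mean q c l)\<^sup>2 + 4 * l\<^sup>2 * (mean q c l - k)\<^sup>2"
    unfolding mean_mult[OF l, of c q] using l sq_measure[of l c] sq_finite[of c l] by (simp add: power2_eq_square algebra_simps del: mult_1_right)
  finally show ?thesis .
qed

lemma msq_le: "l > 0 \<Longrightarrow> msq k q c l \<le> (LINT x|lborel. indicator (sq c l) x * (q x)\<^sup>2)"
proof (induction k arbitrary: c l)
  case 0
  have "0 \<le> (LINT x|lborel. indicator (sq c l) x * (q x - mean q c l)\<^sup>2)" by (rule Bochner_Integration.integral_nonneg) simp
  then show ?case unfolding mean_best[OF 0] by simp
next
  case (Suc k)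
  have "msq (Suc k) q c l \<le> (\<Sum>s\<in>Sg. LINT x|lborel. indicator (sq (ch c l s) (l/2)) x * (q x)\<^sup>2)"
    unfolding msq.simps(2) by (rule sum_mono, rule Suc.IH) (use Suc.prems in simp)
  then show ?case using integral_child[of "\<lambda>x. (q x)\<^sup>2" "B\<^sup>2" c l] q2B by simp
qed

text \<open>Bessel's inequality for the Haar system: the increments of \<open>msq\<close> telescope
  and \<open>msq\<close> stays below the squared norm of \<open>q\<close>.\<close>

lemma dsq_sum: assumes l: "l > 0" shows "(\<Sum>k<n. dsq k q c l) \<le> (LINT x|lborel. indicator (sq c l) x * (q x)\<^sup>2)"
proof -
  have "(\<Sum>k<n. dsq k q c l) = msq n q c l - msq 0 q c l"
    unfolding dsq_msq[OF l] by (rule sum_lessThan_telescope)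
  moreover have "msq 0 q c l \<ge> 0" by simp
  ultimately show ?thesis using msq_le[OF l, of n c] by linarith
qed

lemma cond_props: "l > 0 \<Longrightarrow> cond n q c l \<in> borel_measurable borel \<and> (\<forall>x. x \<notin> sq c l \<longrightarrow> cond n q c l x = 0) \<and> (\<exists>K. \<forall>x. \<bar>cond n q c l x\<bar> \<le> K)"
proof (induction n arbitrary: c l)
  case 0
  have "\<bar>cond 0 q c l x\<bar> \<le> \<bar>mean q c l\<bar>" for x by (auto simp: indicator_def)
  moreover have "cond 0 q c l \<in> borel_measurable borel" unfolding cond.simps(1)[abs_def] by measurable
  ultimately show ?case by auto
next
  case (Suc n)
  have IH: "cond n q (ch c l s) (l/2) \<in> borel_measurable borel" "x \<notin> sq (ch c l s) (l/2) \<Longrightarrow> cond n q (ch c l s) (l/2) x = 0"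
    "\<exists>K. \<forall>x. \<bar>cond n q (ch c l s) (l/2) x\<bar> \<le> K" for s x using Suc.IH[of "l/2" "ch c l s"] Suc.prems by auto
  obtain K where K: "\<And>s x. \<bar>cond n q (ch c l s) (l/2) x\<bar> \<le> K s" using IH(3) by metis
  have "\<bar>cond (Suc n) q c l x\<bar> \<le> (\<Sum>s\<in>Sg. K s)" for x
    unfolding cond.simps(2) by (rule order_trans[OF sum_abs sum_mono]) (rule K)
  moreover have "cond (Suc n) q c l \<in> borel_measurable borel" unfolding cond.simps(2)[abs_def] by (intro borel_measurable_sum IH(1))
  moreover have "cond (Suc n) q c l x = 0" if "x \<notin> sq c l" for x
    unfolding cond.simps(2) by (rule sum.neutral) (use IH(2) that child_sub[of _ c l] in blast)
  ultimately show ?case by blast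
qed

text \<open>The divergence of a node is the combination of Haar functions that
  \<open>haar_inv\<close> identifies as mean on the child minus mean on the square. Points on the
  dividing axes belong to no child, hence the statement almost everywhere.\<close>

lemma lev_div: "l > 0 \<Longrightarrow> AE x in lborel. levG k 1 q c l x $ 1 + levG k 2 q c l x $ 2 = cond (Suc k) q c l x - cond k q c l x"
proof (induction k arbitrary: c l)
  case 0
  show ?case using AE_offaxes[of "c$1" "c$2"]
  proof eventually_elim
    case (elim x)
    show ?case
    proof (cases "x \<in> sq c l")
      case True
      then obtain s where s: "s \<in> Sg" "x \<in> sq (ch c l s) (l/2)" using child_cover elim by blast
      have y: "(1/l) *\<^sub>R (x - c) \<in> S0" using True sq_scale[OF 0] by blast
      have "levG 0 1 q c l x $ 1 + levG 0 2 q c l x $ 2 = (\<Sum>j<3. haar j q c l * (bG j 1 ((1/l) *\<^sub>R (x - c)) $ 1 + bG j 2 ((1/l) *\<^sub>R (x - c)) $ 2))"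
        by (simp add: nodeG_def sum_component sum.distrib[symmetric] algebra_simps)
      also have "\<dots> = (\<Sum>j<3. haar j q c l * hs j s)" unfolding bf_div[OF y] hs_Sg[OF s(1) 0 s(2)] ..
      also have "\<dots> = mean q (ch c l s) (l/2) - mean q c l" using haar_inv[OF 0 s(1)] by simp
      also have "mean q (ch c l s) (l/2) = cond 1 q c l x"
        unfolding One_nat_def cond.simps using s(2) by (subst sum_child[OF s]) auto
      finally show ?thesis using True by simp
    next
      case False
      then have "x \<notin> sq (ch c l s) (l/2)" if "s \<in> Sg" for s using child_sub[OF that] by auto
      then show ?thesis using False by (simp add: node_outside[OF 0])
    qed
  qed
next
  case (Suc k)
  have "AE x in lborel. \<forall>s\<in>Sg. levG k 1 q (ch c l s) (l/2) x $ 1 + levG k 2 q (ch c l s) (l/2) x $ 2 = cond (Suc k) q (ch c l s) (l/2) x - cond k q (ch c l s) (l/2) x"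
    by (subst AE_ball_countable) (use Suc in \<open>auto simp: countable_finite simp del: cond.simps\<close>)
  then show ?case
  proof eventually_elim
    case (elim x)
    have "levG (Suc k) 1 q c l x $ 1 + levG (Suc k) 2 q c l x $ 2 = (\<Sum>s\<in>Sg. levG k 1 q (ch c l s) (l/2) x $ 1 + levG k 2 q (ch c l s) (l/2) x $ 2)"
      by (simp add: sum_component sum.distrib)
    also have "\<dots> = (\<Sum>s\<in>Sg. cond (Suc k) q (ch c l s) (l/2) x - cond k q (ch c l s) (l/2) x)"
      by (rule sum.cong[OF refl]) (use elim in blast)
    also have "\<dots> = cond (Suc (Suc k)) q c l x - cond (Suc k) q c l x"
      by (simp only: sum_subtractf cond.simps(2))
    finally show ?case .
  qed
qed

text \<open>The induction ends at squares of side \<open>2 * l / 2^n\<close>, on which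
  \<open>g\<close> varies by at most \<open>w\<close>. There the mean approximates \<open>q\<close>
  at least as well as the constant \<open>g c\<close>, and \<open>8 * l\<^sup>2 * w\<^sup>2\<close>
  is twice the area times \<open>w\<^sup>2\<close>.\<close>

lemma cond_close:
  assumes gm [measurable]: "g \<in> borel_measurable borel" and gB: "\<And>x. \<bar>g x\<bar> \<le> B"
  shows "l > 0 \<Longrightarrow> (\<And>x y. x \<in> sq c l \<Longrightarrow> y \<in> sq c l \<Longrightarrow> \<bar>x$1 - y$1\<bar> \<le> 2 * l / 2^n \<Longrightarrow> \<bar>x$2 - y$2\<bar> \<le> 2 * l / 2^n \<Longrightarrow> \<bar>g x - g y\<bar> \<le> w)
    \<Longrightarrow> (LINT x|lborel. indicator (sq c l) x * (q x - cond n q c l x)\<^sup>2) \<le> 2 * (LINT x|lborel. indicator (sq c l) x * (q x - g x)\<^sup>2) + 8 * l\<^sup>2 * w\<^sup>2"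
proof (induction n arbitrary: c l)
  case 0
  have dB: "\<bar>(q x - g x)\<^sup>2\<bar> \<le> (2 * B)\<^sup>2" for x
  proof -
    have "\<bar>q x - g x\<bar> \<le> \<bar>2 * B\<bar>" using qB[of x] gB[of x] by linarith
    then show ?thesis using abs_le_square_iff[of "q x - g x" "2 * B"] by simp
  qed
  have i1: "integrable lborel (\<lambda>x. indicator (sq c l) x * (q x - g x)\<^sup>2)" by (rule sq_int[OF _ dB]) simp
  have i2: "integrable lborel (\<lambda>x. indicator (sq c l) x * w\<^sup>2)" by (rule sq_int[of _ "w\<^sup>2"]) auto
  have i3: "integrable lborel (\<lambda>x. indicator (sq c l) x * (q x - g c)\<^sup>2)"
  proof (rule sq_int)
    fix x
    have "\<bar>q x - g c\<bar> \<le> \<bar>2 * B\<bar>" using qB[of x] gB[of c] by linarith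
    then show "\<bar>(q x - g c)\<^sup>2\<bar> \<le> (2 * B)\<^sup>2" using abs_le_square_iff[of "q x - g c" "2 * B"] by simp
  qed simp
  have cin: "c \<in> sq c l" using 0 by (simp add: sq_def)
  have "(LINT x|lborel. indicator (sq c l) x * (q x - cond 0 q c l x)\<^sup>2) = (LINT x|lborel. indicator (sq c l) x * (q x - mean q c l)\<^sup>2)"
    by (rule Bochner_Integration.integral_cong) (auto simp: indicator_def)
  also have "\<dots> \<le> (LINT x|lborel. indicator (sq c l) x * (q x - g c)\<^sup>2)"
    unfolding mean_best[OF 0(1)] by simp
  also have "\<dots> \<le> (LINT x|lborel. 2 * (indicator (sq c l) x * (q x - g x)\<^sup>2) + 2 * (indicator (sq c l) x * w\<^sup>2))"
  proof (rule integral_mono)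
    fix x
    show "indicator (sq c l) x * (q x - g c)\<^sup>2 \<le> 2 * (indicator (sq c l) x * (q x - g x)\<^sup>2) + 2 * (indicator (sq c l) x * w\<^sup>2)"
    proof (cases "x \<in> sq c l")
      case True
      then have "\<bar>g x - g c\<bar> \<le> w" using cin 0(1) by (intro 0(2)) (auto simp: sq_def)
      then have 1: "(g x - g c)\<^sup>2 \<le> w\<^sup>2" using abs_le_square_iff[of "g x - g c" w] by simp
      have "(q x - g c)\<^sup>2 \<le> 2 * (q x - g x)\<^sup>2 + 2 * (g x - g c)\<^sup>2"
        using zero_le_power2[of "(q x - g x) - (g x - g c)"] by (simp add: power2_eq_square algebra_simps)
      then show ?thesis using True 1 by simp
    qed simp
  qed (use i1 i2 i3 in auto)
  also have "\<dots> = 2 * (LINT x|lborel. indicator (sq c l) x * (q x - g x)\<^sup>2) + 8 * l\<^sup>2 * w\<^sup>2"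
  proof -
    have "(LINT x|lborel. indicator (sq c l) x * w\<^sup>2) = 4 * l\<^sup>2 * w\<^sup>2"
      using sq_measure[of l c] 0(1) sq_finite[of c l] by simp
    then show ?thesis using i1 i2 by simp
  qed
  finally show ?case .
next
  case (Suc n)
  have l2: "l/2 > 0" using Suc.prems by simp
  have cm [measurable]: "cond (Suc n) q c l \<in> borel_measurable borel" using cond_props[OF Suc.prems(1)] by blast
  obtain K where K: "\<And>x. \<bar>cond (Suc n) q c l x\<bar> \<le> K" using cond_props[OF Suc.prems(1)] by blast
  have B1: "\<bar>(q x - cond (Suc n) q c l x)\<^sup>2\<bar> \<le> (B + K)\<^sup>2" for x
  proof -
    have "\<bar>q x - cond (Suc n) q c l x\<bar> \<le> \<bar>B + K\<bar>" using qB[of x] K[of x] by linarith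
    then show ?thesis using abs_le_square_iff[of "q x - cond (Suc n) q c l x" "B + K"] by simp
  qed
  have dB: "\<bar>(q x - g x)\<^sup>2\<bar> \<le> (2 * B)\<^sup>2" for x
  proof -
    have "\<bar>q x - g x\<bar> \<le> \<bar>2 * B\<bar>" using qB[of x] gB[of x] by linarith
    then show ?thesis using abs_le_square_iff[of "q x - g x" "2 * B"] by simp
  qed
  have "(LINT x|lborel. indicator (sq c l) x * (q x - cond (Suc n) q c l x)\<^sup>2) = (\<Sum>s\<in>Sg. LINT x|lborel. indicator (sq (ch c l s) (l/2)) x * (q x - cond (Suc n) q c l x)\<^sup>2)"
    by (rule integral_child[OF _ B1]) measurable
  also have "\<dots> = (\<Sum>s\<in>Sg. LINT x|lborel. indicator (sq (ch c l s) (l/2)) x * (q x - cond n q (ch c l s) (l/2) x)\<^sup>2)"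
  proof (intro sum.cong[OF refl] Bochner_Integration.integral_cong refl)
    fix s x assume s: "s \<in> Sg"
    show "indicator (sq (ch c l s) (l/2)) x * (q x - cond (Suc n) q c l x)\<^sup>2 = indicator (sq (ch c l s) (l/2)) x * (q x - cond n q (ch c l s) (l/2) x)\<^sup>2"
    proof (cases "x \<in> sq (ch c l s) (l/2)")
      case True
      have "cond (Suc n) q c l x = cond n q (ch c l s) (l/2) x"
        unfolding cond.simps(2) by (rule sum_child[OF s True]) (use cond_props[OF l2] in blast)
      then show ?thesis by simp
    qed simp
  qed
  also have "\<dots> \<le> (\<Sum>s\<in>Sg. 2 * (LINT x|lborel. indicator (sq (ch c l s) (l/2)) x * (q x - g x)\<^sup>2) + 8 * (l/2)\<^sup>2 * w\<^sup>2)"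
  proof (rule sum_mono, rule Suc.IH[OF l2])
    fix s x y assume s: "s \<in> Sg" and xy: "x \<in> sq (ch c l s) (l/2)" "y \<in> sq (ch c l s) (l/2)" "\<bar>x$1 - y$1\<bar> \<le> 2 * (l/2) / 2^n" "\<bar>x$2 - y$2\<bar> \<le> 2 * (l/2) / 2^n"
    show "\<bar>g x - g y\<bar> \<le> w" by (rule Suc.prems(2)) (use xy child_sub[OF s, of c l] in auto)
  qed
  also have "\<dots> = 2 * (\<Sum>s\<in>Sg. LINT x|lborel. indicator (sq (ch c l s) (l/2)) x * (q x - g x)\<^sup>2) + 8 * l\<^sup>2 * w\<^sup>2"
    by (simp add: sum.distrib sum_distrib_left Sg_def vec2_eq power_divide)
  also have "(\<Sum>s\<in>Sg. LINT x|lborel. indicator (sq (ch c l s) (l/2)) x * (q x - g x)\<^sup>2) = (LINT x|lborel. indicator (sq c l) x * (q x - g x)\<^sup>2)"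
    by (rule integral_child[OF _ dB, symmetric]) measurable
  finally show ?case .
qed

lemma cond_converges:
  assumes e: "e > 0"
  obtains n where "(LINT x|lborel. indicator (sq c 1) x * (q x - cond n q c 1 x)\<^sup>2) \<le> e"
proof -
  obtain g where g: "continuous_on UNIV g" "\<And>x. \<bar>g x\<bar> \<le> B" "(LINT x|lborel. indicator (sq c 1) x * (q x - g x)\<^sup>2) \<le> e/4"
    using L2_density[OF qm qB, of "e/4"] e by auto
  \<comment> \<open>The two errors \<open>2 * (e/4)\<close> and \<open>8 * (e/16)\<close> add up to
    \<open>e\<close>.\<close>
  define w where "w = sqrt (e / 16)"
  have w: "w > 0" "w\<^sup>2 = e / 16" using e by (auto simp: w_def)
  have "uniformly_continuous_on (cbox (c - vec2 1 1) (c + vec2 1 1)) g"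
    by (rule compact_uniformly_continuous) (auto intro: continuous_on_subset[OF g(1)])
  then obtain d where d: "d > 0" "\<And>x y. x \<in> cbox (c - vec2 1 1) (c + vec2 1 1) \<Longrightarrow> y \<in> cbox (c - vec2 1 1) (c + vec2 1 1) \<Longrightarrow> dist y x < d \<Longrightarrow> dist (g y) (g x) < w"
    unfolding uniformly_continuous_on_def using w by metis
  \<comment> \<open>Two points of a square of generation \<open>n\<close> differ by at most
    \<open>2 / 2^n\<close> in each coordinate, hence by at most \<open>4 * (1/2)^n\<close> in
    distance.\<close>
  obtain n where n: "(1/2)^n < d / 4" using real_arch_pow_inv[of "d/4" "1/2"] d(1) by auto
  have "(LINT x|lborel. indicator (sq c 1) x * (q x - cond n q c 1 x)\<^sup>2) \<le> 2 * (LINT x|lborel. indicator (sq c 1) x * (q x - g x)\<^sup>2) + 8 * 1\<^sup>2 * w\<^sup>2"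
  proof (rule cond_close)
    show "g \<in> borel_measurable borel" using g(1) by (rule borel_measurable_continuous_onI)
    fix x y assume xy: "x \<in> sq c 1" "y \<in> sq c 1" "\<bar>x$1 - y$1\<bar> \<le> 2 * 1 / 2^n" "\<bar>x$2 - y$2\<bar> \<le> 2 * 1 / 2^n"
    have "dist x y \<le> \<bar>x$1 - y$1\<bar> + \<bar>x$2 - y$2\<bar>" using norm_pt_le[of "x - y"] by (simp add: dist_norm)
    also have "\<dots> \<le> 4 * (1/2)^n" using xy(3,4) by (simp add: power_one_over)
    also have "\<dots> < d" using n by simp
    finally have "dist (g x) (g y) < w" using xy(1,2) box_subset_cbox by (intro d(2)) (auto simp: sq_box)
    then show "\<bar>g x - g y\<bar> \<le> w" by (simp add: dist_real_def)
  qed (auto simp: g(2))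
  also have "\<dots> \<le> e" using g(3) w(2) by simp
  finally show ?thesis by (rule that)
qed

end

lemma measurable_nth_pt [measurable (raw)]:
  assumes "f \<in> borel_measurable M" shows "(\<lambda>x. (f x :: pt) $ i) \<in> borel_measurable M"
proof -
  have "(\<lambda>x. f x \<bullet> axis i 1) \<in> borel_measurable M" using assms by measurable
  then show ?thesis by (simp add: inner_axis)
qed

text \<open>Solvability only up to an error \<open>\<epsilon>\<close>, with a bound that does not depend on it, is all
  the inf-sup condition needs; it avoids passing to the limit in the Haar expansion.\<close>

definition div_solvable :: "pt set \<Rightarrow> real \<Rightarrow> (pt \<Rightarrow> real) \<Rightarrow> real \<Rightarrow> bool" where
  "div_solvable A C q \<epsilon> \<longleftrightarrow> (\<exists>L \<phi>1 G1 \<phi>2 G2. pwaff L \<phi>1 G1 \<and> pwaff L \<phi>2 G2 \<and>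
     (\<forall>x. x \<notin> A \<longrightarrow> \<phi>1 x = 0 \<and> \<phi>2 x = 0 \<and> G1 x = 0 \<and> G2 x = 0) \<and>
     (LINT x|lborel. (norm (G1 x))\<^sup>2 + (norm (G2 x))\<^sup>2) \<le> C * (LINT x|lborel. (q x)\<^sup>2) \<and>
     (LINT x|lborel. (G1 x $ 1 + G2 x $ 2 - q x)\<^sup>2) \<le> \<epsilon>)"

text \<open>One constant serves all data and all tolerances. The bound \<open>B\<close> secures
  integrability and does not enter \<open>C\<close>.\<close>

definition good :: "pt set \<Rightarrow> bool" where
  "good A \<longleftrightarrow> bounded A \<and> A \<in> sets borel \<and> (\<exists>C\<ge>0. \<forall>q B \<epsilon>. q \<in> borel_measurable borel \<longrightarrow> (\<forall>x. \<bar>q x\<bar> \<le> B) \<longrightarrow>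
     (\<forall>x. x \<notin> A \<longrightarrow> q x = 0) \<longrightarrow> (LINT x|lborel. q x) = 0 \<longrightarrow> \<epsilon> > 0 \<longrightarrow> div_solvable A C q \<epsilon>)"

lemma goodE:
  assumes "good A"
  obtains C where "bounded A" "A \<in> sets borel" "C \<ge> 0" "\<And>q B \<epsilon>. q \<in> borel_measurable borel \<Longrightarrow> (\<And>x. \<bar>q x\<bar> \<le> B) \<Longrightarrow>
    (\<And>x. x \<notin> A \<Longrightarrow> q x = 0) \<Longrightarrow> (LINT x|lborel. q x) = 0 \<Longrightarrow> \<epsilon> > 0 \<Longrightarrow> div_solvable A C q \<epsilon>"
  using assms unfolding good_def by blast

lemma goodI:
  assumes "bounded A" "A \<in> sets borel" "C \<ge> 0" "\<And>q B \<epsilon>. q \<in> borel_measurable borel \<Longrightarrow> (\<And>x. \<bar>q x\<bar> \<le> B) \<Longrightarrow>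
    (\<And>x. x \<notin> A \<Longrightarrow> q x = 0) \<Longrightarrow> (LINT x|lborel. q x) = 0 \<Longrightarrow> \<epsilon> > 0 \<Longrightarrow> div_solvable A C q \<epsilon>"
  shows "good A"
  using assms unfolding good_def by blast

text \<open>The fields of the first \<open>n\<close> generations have divergence
  \<open>cond n\<close> minus \<open>cond 0\<close> by telescoping, and \<open>cond 0\<close>
  vanishes because \<open>q\<close> has mean zero. Each of the two components costs
  \<open>?C\<close>.\<close>

lemma good_square: "good (sq 0 1)"
proof -
  obtain M where M: "M > 0" "\<And>j i x. norm (bG j i x) \<le> M" using bf_bound by metis
  let ?C = "CC M * (2 / (1 - rr))"
  have "3/4 \<le> (1::real)" by simp
  then have "rr \<le> 1" by (simp only: rr_def[OF M] real_sqrt_le_1_iff)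
  then have C0: "?C \<ge> 0" by (intro mult_nonneg_nonneg CC_nonneg[OF M]) simp
  have *: "div_solvable (sq 0 1) (?C + ?C) q \<epsilon>"
    if qm[measurable]: "q \<in> borel_measurable borel" and qB: "\<And>x. \<bar>q x\<bar> \<le> B" and q0: "\<And>x. x \<notin> sq 0 1 \<Longrightarrow> q x = 0" and qi: "(LINT x|lborel. q x) = 0"
      and e: "\<epsilon> > 0" for q B \<epsilon>
  proof -
    let ?S = "sq 0 1"
    have ind: "indicator ?S x * q x = q x" for x using q0[of x] by (auto simp: indicator_def)
    have "mean q 0 1 = 0" by (simp add: mean_def ind qi del: indicator_simps)
    obtain n where n: "(LINT x|lborel. indicator ?S x * (q x - cond n q 0 1 x)\<^sup>2) \<le> \<epsilon>"
      using cond_converges[OF qm qB e] by metis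
    define \<phi> where "\<phi> i x = (\<Sum>k<n. lev k i q 0 1 x)" for i x
    define G where "G i x = (\<Sum>k<n. levG k i q 0 1 x)" for i x
    have "\<exists>L. pwaff L (\<phi> i) (G i)" for i
      unfolding \<phi>_def G_def by (rule pwaff_sum_ex) (use lev_props[of 1] in auto)
    then obtain L where L: "\<And>i. pwaff (L i) (\<phi> i) (G i)" by metis
    then have "lines (L 1 \<union> L 2)" unfolding lines_Un by (auto simp: pwaff_def)
    then have P: "pwaff (L 1 \<union> L 2) (\<phi> 1) (G 1)" "pwaff (L 1 \<union> L 2) (\<phi> 2) (G 2)" using L by (auto intro: pwaff_mono)
    have z: "\<phi> i x = 0" "G i x = 0" if "x \<notin> ?S" for i x
      using that by (simp_all add: \<phi>_def G_def lev_outside levG_outside)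
    have Gm [measurable]: "G i \<in> borel_measurable borel" for i using L[of i] by (simp add: pwaff_def)
    have gi: "integrable lborel (\<lambda>x. (norm (G i x))\<^sup>2)" for i
    proof -
      obtain K where "\<And>x. norm (G i x) \<le> K" using L[of i] by (auto simp: pwaff_def bounded_iff)
      then show ?thesis
        by (intro bint[of _ "K\<^sup>2" ?S] sq_borel sq_bounded) (auto simp: z power_mono)
    qed
    have en: "(LINT x|lborel. (norm (G i x))\<^sup>2) \<le> ?C * (LINT x|lborel. (q x)\<^sup>2)" for i
    proof -
      have "(LINT x|lborel. (norm (G i x))\<^sup>2) \<le> ?C * (\<Sum>k<n. dsq k q 0 1)"
        unfolding G_def by (rule energy[OF M]) simp
      also have "\<dots> \<le> ?C * (LINT x|lborel. indicator ?S x * (q x)\<^sup>2)"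
        by (rule mult_left_mono[OF dsq_sum[OF qm qB] C0]) simp
      also have "(LINT x|lborel. indicator ?S x * (q x)\<^sup>2) = (LINT x|lborel. (q x)\<^sup>2)"
        by (rule Bochner_Integration.integral_cong) (auto simp: indicator_def q0)
      finally show ?thesis .
    qed
    have "AE x in lborel. \<forall>k\<in>{..<n}. levG k 1 q 0 1 x $ 1 + levG k 2 q 0 1 x $ 2 = cond (Suc k) q 0 1 x - cond k q 0 1 x"
      by (subst AE_ball_countable) (use lev_div[OF qm qB, of 1] in \<open>auto simp del: cond.simps\<close>)
    then have dv: "AE x in lborel. G 1 x $ 1 + G 2 x $ 2 = cond n q 0 1 x"
    proof eventually_elim
      case (elim x)
      have "G 1 x $ 1 + G 2 x $ 2 = (\<Sum>k<n. levG k 1 q 0 1 x $ 1 + levG k 2 q 0 1 x $ 2)"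
        by (simp add: G_def sum_component sum.distrib)
      also have "\<dots> = (\<Sum>k<n. cond (Suc k) q 0 1 x - cond k q 0 1 x)" by (rule sum.cong[OF refl]) (use elim in blast)
      also have "\<dots> = cond n q 0 1 x - cond 0 q 0 1 x" by (rule sum_lessThan_telescope)
      finally show ?case using \<open>mean q 0 1 = 0\<close> by simp
    qed
    have cp: "cond n q 0 1 \<in> borel_measurable borel" "\<And>x. x \<notin> ?S \<Longrightarrow> cond n q 0 1 x = 0" using cond_props[OF qm qB, of 1 n 0] by auto
    note cp(1)[measurable]
    have "(LINT x|lborel. (G 1 x $ 1 + G 2 x $ 2 - q x)\<^sup>2) = (LINT x|lborel. indicator ?S x * (q x - cond n q 0 1 x)\<^sup>2)"
    proof (rule integral_cong_AE)
      show "AE x in lborel. (G 1 x $ 1 + G 2 x $ 2 - q x)\<^sup>2 = indicator ?S x * (q x - cond n q 0 1 x)\<^sup>2"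
        using dv by eventually_elim (auto simp: indicator_def q0 cp(2) power2_commute)
    qed measurable
    then have "(LINT x|lborel. (G 1 x $ 1 + G 2 x $ 2 - q x)\<^sup>2) \<le> \<epsilon>" using n by simp
    moreover have "(LINT x|lborel. (norm (G 1 x))\<^sup>2 + (norm (G 2 x))\<^sup>2) \<le> (?C + ?C) * (LINT x|lborel. (q x)\<^sup>2)"
      using en[of 1] en[of 2] gi by (simp add: distrib_right)
    ultimately show ?thesis unfolding div_solvable_def using P z by blast
  qed
  then show ?thesis by (intro goodI[of _ "?C + ?C"] sq_bounded sq_borel) (use C0 in \<open>auto intro: *\<close>)
qed

section \<open>The divergence equation on triangles and polygons\<close>

text \<open>Cutting the data down to \<open>A\<close> changes them only on a null set. The coverings
  of triangles by open parallelograms, and of polygons by triangles, are only shown to be complete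
  up to null sets.\<close>

lemma good_null:
  assumes g: "good A" and A': "bounded A'" "A' \<in> sets borel" and sub: "A \<subseteq> A'" and ae: "AE x in lborel. x \<in> A' \<longrightarrow> x \<in> A"
  shows "good A'"
proof -
  obtain C where A: "bounded A" "A \<in> sets borel" and C: "C \<ge> 0" "\<And>q B \<epsilon>. q \<in> borel_measurable borel \<Longrightarrow> (\<And>x. \<bar>q x\<bar> \<le> B) \<Longrightarrow> (\<And>x. x \<notin> A \<Longrightarrow> q x = 0) \<Longrightarrow> (LINT x|lborel. q x) = 0 \<Longrightarrow>
     \<epsilon> > 0 \<Longrightarrow> div_solvable A C q \<epsilon>" using goodE[OF g] by metis
  note A(2)[measurable]
  show ?thesis
  proof (rule goodI[OF A' C(1)])
    fix q :: "pt \<Rightarrow> real" and B \<epsilon> :: real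
    assume qm [measurable]: "q \<in> borel_measurable borel" and qB: "\<And>x. \<bar>q x\<bar> \<le> B" and q0: "\<And>x. x \<notin> A' \<Longrightarrow> q x = 0"
      and qi: "(LINT x|lborel. q x) = 0" and e: "\<epsilon> > 0"
    define r where "r x = indicator A x * q x" for x
    have rm [measurable]: "r \<in> borel_measurable borel" unfolding r_def by measurable
    have rq: "AE x in lborel. q x = r x" using ae by eventually_elim (auto simp: r_def indicator_def q0)
    have "\<bar>r x\<bar> \<le> B" for x using qB[of x] by (auto simp: r_def indicator_def)
    moreover have "r x = 0" if "x \<notin> A" for x using that by (simp add: r_def)
    moreover have "(LINT x|lborel. r x) = 0"
    proof -
      have "(LINT x|lborel. r x) = (LINT x|lborel. q x)" by (rule integral_cong_AE) (use rq in auto)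
      then show ?thesis using qi by simp
    qed
    ultimately obtain L \<phi>1 G1 \<phi>2 G2 where 1: "pwaff L \<phi>1 G1" "pwaff L \<phi>2 G2" "\<forall>x. x \<notin> A \<longrightarrow> \<phi>1 x = 0 \<and> \<phi>2 x = 0 \<and> G1 x = 0 \<and> G2 x = 0"
      and 2: "(LINT x|lborel. (norm (G1 x))\<^sup>2 + (norm (G2 x))\<^sup>2) \<le> C * (LINT x|lborel. (r x)\<^sup>2)"
      and 3: "(LINT x|lborel. (G1 x $ 1 + G2 x $ 2 - r x)\<^sup>2) \<le> \<epsilon>" using C(2)[OF rm _ _ _ e] unfolding div_solvable_def by blast
    have [measurable]: "G1 \<in> borel_measurable borel" "G2 \<in> borel_measurable borel" using 1 by (auto simp: pwaff_def)
    have "(LINT x|lborel. (r x)\<^sup>2) = (LINT x|lborel. (q x)\<^sup>2)" by (rule integral_cong_AE) (use rq in auto)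
    moreover have "(LINT x|lborel. (G1 x $ 1 + G2 x $ 2 - r x)\<^sup>2) = (LINT x|lborel. (G1 x $ 1 + G2 x $ 2 - q x)\<^sup>2)"
      by (rule integral_cong_AE) (use rq in auto)
    ultimately show "div_solvable A' C q \<epsilon>"
      unfolding div_solvable_def using 1 2 3 sub by (intro exI conjI) auto
  qed
qed

lemma norm_sum_sq: "(norm (a + b))\<^sup>2 \<le> 2 * (norm (a :: 'a :: real_inner))\<^sup>2 + 2 * (norm b)\<^sup>2"
  using zero_le_power2[of "norm (a - b)"] by (simp add: power2_norm_eq_inner inner_simps inner_commute)

lemma pwaff_sq_integrable:
  assumes "pwaff L \<phi> G" "bounded A" "A \<in> sets borel" "\<And>x. x \<notin> A \<Longrightarrow> G x = 0"
  shows "integrable lborel (\<lambda>x. (norm (G x))\<^sup>2)"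
proof -
  obtain K where "\<And>x. norm (G x) \<le> K" using assms(1) by (auto simp: pwaff_def bounded_iff)
  moreover have [measurable]: "G \<in> borel_measurable borel" using assms(1) by (simp add: pwaff_def)
  ultimately show ?thesis
    by (intro bint[of _ "K\<^sup>2" A] assms(2,3)) (auto simp: assms(4) power_mono)
qed

lemma pwaff_div_integrable:
  assumes "pwaff L \<phi> G" "pwaff L \<psi> H" "bounded A" "A \<in> sets borel" "\<And>x. x \<notin> A \<Longrightarrow> G x = 0 \<and> H x = 0"
    and [measurable]: "q \<in> borel_measurable borel" and q: "\<And>x. \<bar>q x\<bar> \<le> K" "\<And>x. x \<notin> A \<Longrightarrow> q x = 0"
  shows "integrable lborel (\<lambda>x. (G x $ 1 + H x $ 2 - q x)\<^sup>2)"
proof -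
  obtain M where M: "\<And>x. norm (G x) \<le> M" using assms(1) by (auto simp: pwaff_def bounded_iff)
  obtain N where N: "\<And>x. norm (H x) \<le> N" using assms(2) by (auto simp: pwaff_def bounded_iff)
  have [measurable]: "G \<in> borel_measurable borel" "H \<in> borel_measurable borel" using assms(1,2) by (auto simp: pwaff_def)
  have "\<bar>(G x $ 1 + H x $ 2 - q x)\<^sup>2\<bar> \<le> (M + N + K)\<^sup>2" for x
  proof -
    have "\<bar>G x $ 1 + H x $ 2 - q x\<bar> \<le> \<bar>M + N + K\<bar>"
      using component_le_norm_cart[of "G x" 1] component_le_norm_cart[of "H x" 2] M[of x] N[of x] q(1)[of x] by linarith
    then show ?thesis using abs_le_square_iff[of "G x $ 1 + H x $ 2 - q x" "M + N + K"] by simp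
  qed
  then show ?thesis by (intro bint[of _ "(M + N + K)\<^sup>2" A] assms(3,4)) (auto simp: assms(5) q(2))
qed

text \<open>The field is substituted and then multiplied by \<open>N\<close>, as in the Piola
  transform. Its divergence is merely transported, since \<open>N\<close> and its inverse cancel
  under the trace.\<close>

lemma good_affine:
  assumes g: "good A" and d: "det N \<noteq> 0"
  shows "good ((\<lambda>x. a + N *v x) ` A)"
proof -
  obtain C where A: "bounded A" "A \<in> sets borel" and C: "C \<ge> 0" "\<And>q B \<epsilon>. q \<in> borel_measurable borel \<Longrightarrow> (\<And>x. \<bar>q x\<bar> \<le> B) \<Longrightarrow> (\<And>x. x \<notin> A \<Longrightarrow> q x = 0) \<Longrightarrow> (LINT x|lborel. q x) = 0 \<Longrightarrow>
     \<epsilon> > 0 \<Longrightarrow> div_solvable A C q \<epsilon>" using goodE[OF g] by metis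
  obtain I where I: "N ** I = mat 1" "I ** N = mat 1"
    using d by (metis invertible_def invertible_det_nz)
  have dI: "det I \<noteq> 0" using I det_mul[of N I] by auto
  have IN: "I *v (N *v x) = x" and NI: "N *v (I *v x) = x" for x by (simp_all add: matrix_vector_mul_assoc I)
  have Ie: "I$1$1 * N$1$1 + I$1$2 * N$2$1 = 1" "I$1$1 * N$1$2 + I$1$2 * N$2$2 = 0"
    "I$2$1 * N$1$1 + I$2$2 * N$2$1 = 0" "I$2$1 * N$1$2 + I$2$2 * N$2$2 = 1"
    using I(2) by (simp_all add: vec_eq_iff forall_2 matrix_matrix_mult_def sum_2 mat_def)
  define b where "b = - (I *v a)"
  have gx: "b + I *v (a + N *v x) = x" for x by (simp add: b_def matrix_vector_right_distrib IN)
  have xg: "a + N *v (b + I *v y) = y" for y by (simp add: b_def matrix_vector_right_distrib NI matrix_vector_mult_diff_distrib)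
  obtain \<kappa> where \<kappa>: "\<kappa> > 0" "\<And>g. norm (transpose I *v g) \<le> norm g * \<kappa>"
    using bounded_linear.pos_bounded[OF matrix_vector_mul_bounded_linear[of "transpose I"]] by blast
  define \<nu> where "\<nu> = \<bar>N$1$1\<bar> + \<bar>N$1$2\<bar> + \<bar>N$2$1\<bar> + \<bar>N$2$2\<bar>"
  have \<nu>: "\<bar>N$1$1\<bar> \<le> \<nu>" "\<bar>N$1$2\<bar> \<le> \<nu>" "\<bar>N$2$1\<bar> \<le> \<nu>" "\<bar>N$2$2\<bar> \<le> \<nu>" by (simp_all add: \<nu>_def)
  \<comment> \<open>Two components, each bounded through \<open>norm_sum_sq\<close> by twice the sum
    of the two squared gradients.\<close>
  define k where "k = 4 * (\<nu> * \<kappa>)\<^sup>2"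
  have k0: "k \<ge> 0" by (simp add: k_def)
  show ?thesis
  proof (rule goodI[of _ "k * C"])
    have "(\<lambda>x. a + N *v x) ` A = (+) a ` ((*v) N ` A)" by auto
    then show "bounded ((\<lambda>x. a + N *v x) ` A)"
      by (simp only: bounded_translation bounded_linear_image[OF A(1)] matrix_vector_mul_bounded_linear)
    have "(\<lambda>x. a + N *v x) ` A = (\<lambda>y. b + I *v y) -` A"
      using gx xg by (auto simp: image_iff) (metis xg)+
    then show "(\<lambda>x. a + N *v x) ` A \<in> sets borel"
      using measurable_sets[OF affine_borel A(2), of b I] by simp
    show "0 \<le> k * C" using k0 C by simp
    fix q :: "pt \<Rightarrow> real" and B \<epsilon> :: real
    assume qm [measurable]: "q \<in> borel_measurable borel" and qB: "\<And>x. \<bar>q x\<bar> \<le> B" and q0: "\<And>x. x \<notin> (\<lambda>x. a + N *v x) ` A \<Longrightarrow> q x = 0"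
      and qi: "(LINT x|lborel. q x) = 0" and e: "\<epsilon> > 0"
    define r where "r x = q (a + N *v x)" for x
    have rm [measurable]: "r \<in> borel_measurable borel" unfolding r_def by (rule measurable_compose[OF affine_borel qm])
    have r0: "r x = 0" if "x \<notin> A" for x unfolding r_def
    proof (rule q0)
      show "a + N *v x \<notin> (\<lambda>x. a + N *v x) ` A"
      proof
        assume "a + N *v x \<in> (\<lambda>x. a + N *v x) ` A"
        then obtain y where y: "y \<in> A" "a + N *v x = a + N *v y" by blast
        have "x = y" using gx[of x] gx[of y] unfolding y(2) by simp
        then show False using y(1) that by simp
      qed
    qed
    have ri: "(LINT x|lborel. r x) = 0" using integral_affine_pt[OF d qm, of a] qi d by (simp add: r_def)
    \<comment> \<open>The substitution multiplies the squared error by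
      \<open>\<bar>det N\<bar>\<close>, so the tolerance is divided by it beforehand.\<close>
    have "div_solvable A C r (\<epsilon> / \<bar>det N\<bar>)"
      by (rule C(2)[OF rm _ r0 ri, of B]) (use e d qB in \<open>simp_all add: r_def\<close>)
    then obtain L \<phi>1 G1 \<phi>2 G2 where 1: "pwaff L \<phi>1 G1" "pwaff L \<phi>2 G2" "\<forall>x. x \<notin> A \<longrightarrow> \<phi>1 x = 0 \<and> \<phi>2 x = 0 \<and> G1 x = 0 \<and> G2 x = 0"
      and 2: "(LINT x|lborel. (norm (G1 x))\<^sup>2 + (norm (G2 x))\<^sup>2) \<le> C * (LINT x|lborel. (r x)\<^sup>2)"
      and 3: "(LINT x|lborel. (G1 x $ 1 + G2 x $ 2 - r x)\<^sup>2) \<le> \<epsilon> / \<bar>det N\<bar>" unfolding div_solvable_def by blast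
    have Gm [measurable]: "G1 \<in> borel_measurable borel" "G2 \<in> borel_measurable borel" using 1 by (auto simp: pwaff_def)
    \<comment> \<open>\<open>T i\<close> forms the gradient of component \<open>i\<close> of the new
      field: row \<open>i\<close> of \<open>N\<close> combines the two components, and the
      transposed inverse comes from the chain rule.\<close>
    define T where "T i g1 g2 = N$i$1 *\<^sub>R (transpose I *v g1) + N$i$2 *\<^sub>R (transpose I *v g2)" for i g1 g2
    define F where "F i y = N$i$1 * \<phi>1 (b + I *v y) + N$i$2 * \<phi>2 (b + I *v y)" for i y
    define H where "H i y = T i (G1 (b + I *v y)) (G2 (b + I *v y))" for i y
    have P: "pwaff (laff b I L) (F i) (H i)" for i
      unfolding F_def[abs_def] H_def[abs_def] T_def by (intro pwaff_add pwaff_cmult pwaff_affine 1 dI)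
    have Hm [measurable]: "H i \<in> borel_measurable borel" for i using P by (simp add: pwaff_def)
    have Hx: "H i (a + N *v x) = T i (G1 x) (G2 x)" for i x by (simp add: H_def gx)
    have z: "F i y = 0 \<and> H i y = 0" if "y \<notin> (\<lambda>x. a + N *v x) ` A" for i y
    proof -
      have "b + I *v y \<notin> A" using that xg[of y] by (metis imageI)
      then show ?thesis using 1(3) by (simp add: F_def H_def T_def)
    qed
    have Tb: "(norm (T i g1 g2))\<^sup>2 \<le> (\<nu> * \<kappa>)\<^sup>2 * (2 * (norm g1)\<^sup>2 + 2 * (norm g2)\<^sup>2)" for i g1 g2
    proof -
      have "norm (N$i$j *\<^sub>R (transpose I *v g)) \<le> \<nu> * \<kappa> * norm g" for j g
      proof -
        have "\<bar>N$i$j\<bar> \<le> \<nu>" using \<nu> exhaust_2[of i] exhaust_2[of j] by auto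
        then have "\<bar>N$i$j\<bar> * norm (transpose I *v g) \<le> \<nu> * (norm g * \<kappa>)"
          using \<kappa>(2)[of g] by (intro mult_mono) auto
        then show ?thesis by (simp add: mult_ac)
      qed
      then have n: "(norm (N$i$j *\<^sub>R (transpose I *v g)))\<^sup>2 \<le> (\<nu> * \<kappa>)\<^sup>2 * (norm g)\<^sup>2" for j g
        by (metis norm_ge_zero power_mono power_mult_distrib)
      show ?thesis unfolding T_def
        using norm_sum_sq[of "N$i$1 *\<^sub>R (transpose I *v g1)" "N$i$2 *\<^sub>R (transpose I *v g2)"] n[of 1 g1] n[of 2 g2]
        by (simp add: distrib_left)
    qed
    have Tdiv: "T 1 g1 g2 $ 1 + T 2 g1 g2 $ 2 = g1$1 + g2$2" for g1 g2
    proof -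
      have t: "(transpose I *v g) $ i = I$1$i * g$1 + I$2$i * g$2" for g i
        by (simp add: matrix_vector_mult_def transpose_def sum_2)
      have "T 1 g1 g2 $ 1 + T 2 g1 g2 $ 2 = (I$1$1 * N$1$1 + I$1$2 * N$2$1) * g1$1 + (I$2$1 * N$1$1 + I$2$2 * N$2$1) * g1$2
         + (I$1$1 * N$1$2 + I$1$2 * N$2$2) * g2$1 + (I$2$1 * N$1$2 + I$2$2 * N$2$2) * g2$2"
        unfolding T_def vector_add_component vector_scaleR_component t by (simp add: algebra_simps)
      then show ?thesis unfolding Ie by simp
    qed
    have gi: "integrable lborel (\<lambda>x. (norm (G1 x))\<^sup>2)" "integrable lborel (\<lambda>x. (norm (G2 x))\<^sup>2)"
      using pwaff_sq_integrable[OF 1(1) A] pwaff_sq_integrable[OF 1(2) A] 1(3) by auto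
    have "(LINT y|lborel. (norm (H 1 y))\<^sup>2 + (norm (H 2 y))\<^sup>2) = \<bar>det N\<bar> * (LINT x|lborel. (norm (T 1 (G1 x) (G2 x)))\<^sup>2 + (norm (T 2 (G1 x) (G2 x)))\<^sup>2)"
      by (subst integral_affine_pt[OF d, of _ a]) (simp_all add: Hx)
    also have "(LINT x|lborel. (norm (T 1 (G1 x) (G2 x)))\<^sup>2 + (norm (T 2 (G1 x) (G2 x)))\<^sup>2) \<le> k * (LINT x|lborel. (norm (G1 x))\<^sup>2 + (norm (G2 x))\<^sup>2)"
    proof -
      have "(LINT x|lborel. (norm (T 1 (G1 x) (G2 x)))\<^sup>2 + (norm (T 2 (G1 x) (G2 x)))\<^sup>2) \<le> (LINT x|lborel. k * ((norm (G1 x))\<^sup>2 + (norm (G2 x))\<^sup>2))"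
      proof (rule integral_mono')
        fix x
        show "(norm (T 1 (G1 x) (G2 x)))\<^sup>2 + (norm (T 2 (G1 x) (G2 x)))\<^sup>2 \<le> k * ((norm (G1 x))\<^sup>2 + (norm (G2 x))\<^sup>2)"
          using Tb[of 1 "G1 x" "G2 x"] Tb[of 2 "G1 x" "G2 x"] by (simp add: k_def algebra_simps)
      qed (use gi k0 in \<open>auto intro!: mult_nonneg_nonneg add_nonneg_nonneg\<close>)
      then show ?thesis by simp
    qed
    finally have E: "(LINT y|lborel. (norm (H 1 y))\<^sup>2 + (norm (H 2 y))\<^sup>2) \<le> \<bar>det N\<bar> * (k * (LINT x|lborel. (norm (G1 x))\<^sup>2 + (norm (G2 x))\<^sup>2))"
      by (simp add: mult_left_mono)
    have q2: "(LINT y|lborel. (q y)\<^sup>2) = \<bar>det N\<bar> * (LINT x|lborel. (r x)\<^sup>2)"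
      by (subst integral_affine_pt[OF d, of _ a]) (simp_all add: r_def)
    have "\<bar>det N\<bar> * (k * (LINT x|lborel. (norm (G1 x))\<^sup>2 + (norm (G2 x))\<^sup>2)) \<le> \<bar>det N\<bar> * (k * (C * (LINT x|lborel. (r x)\<^sup>2)))"
      using 2 k0 by (intro mult_left_mono) auto
    then have E2: "(LINT y|lborel. (norm (H 1 y))\<^sup>2 + (norm (H 2 y))\<^sup>2) \<le> k * C * (LINT y|lborel. (q y)\<^sup>2)"
      using E unfolding q2 by (simp add: mult_ac)
    have "(LINT y|lborel. (H 1 y $ 1 + H 2 y $ 2 - q y)\<^sup>2) = \<bar>det N\<bar> * (LINT x|lborel. (G1 x $ 1 + G2 x $ 2 - r x)\<^sup>2)"
      by (subst integral_affine_pt[OF d, of _ a]) (simp_all add: Hx Tdiv r_def)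
    also have "\<dots> \<le> \<epsilon>" using 3 d by (simp add: field_simps)
    finally show "div_solvable ((\<lambda>x. a + N *v x) ` A) (k * C) q \<epsilon>"
      unfolding div_solvable_def using P z E2 by blast
  qed
qed

text \<open>\<open>q\<close> is split into its restrictions to \<open>A\<close> and to
  \<open>B - A\<close>. Both become mean-free when the integral \<open>m\<close> over
  \<open>A\<close> is transferred as a constant density on \<open>D\<close>, which lies in both
  sets.\<close>

lemma good_union:
  assumes gA: "good A" and gB: "good B" and D: "D \<in> sets borel" "D \<subseteq> A" "D \<subseteq> B" "measure lborel D > 0"
  shows "good (A \<union> B)"
proof -
  obtain CA where A: "bounded A" "A \<in> sets borel" and CA: "CA \<ge> 0" "\<And>q B \<epsilon>. q \<in> borel_measurable borel \<Longrightarrow> (\<And>x. \<bar>q x\<bar> \<le> B) \<Longrightarrow>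
    (\<And>x. x \<notin> A \<Longrightarrow> q x = 0) \<Longrightarrow> (LINT x|lborel. q x) = 0 \<Longrightarrow> \<epsilon> > 0 \<Longrightarrow> div_solvable A CA q \<epsilon>" using goodE[OF gA] by metis
  obtain CB where B: "bounded B" "B \<in> sets borel" and CB: "CB \<ge> 0" "\<And>q K \<epsilon>. q \<in> borel_measurable borel \<Longrightarrow> (\<And>x. \<bar>q x\<bar> \<le> K) \<Longrightarrow>
    (\<And>x. x \<notin> B \<Longrightarrow> q x = 0) \<Longrightarrow> (LINT x|lborel. q x) = 0 \<Longrightarrow> \<epsilon> > 0 \<Longrightarrow> div_solvable B CB q \<epsilon>" using goodE[OF gB] by metis
  note [measurable] = A(2) B(2) D(1)
  have bD: "bounded D" using A(1) D(2) bounded_subset by blast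
  define mD mA where "mD = measure lborel D" and "mA = measure lborel A"
  have mD: "mD > 0" using D(4) by (simp add: mD_def)
  have mAD: "mA \<ge> mD" unfolding mA_def mD_def
    using D(2) emeasure_bounded_finite[OF A(1)] by (intro measure_mono_fmeasurable) (auto simp: fmeasurable_def)
  have fin: "emeasure lborel S < \<infinity>" if "bounded S" for S :: "pt set" using emeasure_bounded_finite[OF that] by simp
  \<comment> \<open>Bounds the squared norm of either part relative to that of \<open>q\<close>: the
    density on \<open>D\<close> has squared norm \<open>m\<^sup>2 / mD\<close>, which is at most
    \<open>mA / mD\<close> times that of \<open>q\<close>.\<close>
  define k where "k = 2 + 2 * mA / mD"
  have k0: "k \<ge> 0" using mD mAD by (simp add: k_def)
  show ?thesis
  proof (rule goodI[of _ "2 * (CA + CB) * k"])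
    show "bounded (A \<union> B)" "A \<union> B \<in> sets borel" "0 \<le> 2 * (CA + CB) * k" using A B CA(1) CB(1) k0 by auto
    fix q :: "pt \<Rightarrow> real" and K \<epsilon> :: real
    assume qm [measurable]: "q \<in> borel_measurable borel" and qB: "\<And>x. \<bar>q x\<bar> \<le> K" and q0: "\<And>x. x \<notin> A \<union> B \<Longrightarrow> q x = 0"
      and qi: "(LINT x|lborel. q x) = 0" and e: "\<epsilon> > 0"
    have K0: "K \<ge> 0" using qB[of 0] by linarith
    have q2B: "\<bar>(q x)\<^sup>2\<bar> \<le> K\<^sup>2" for x using qB[of x] K0 abs_le_square_iff[of "q x" K] by simp
    have iq2: "integrable lborel (\<lambda>x. (q x)\<^sup>2)"
      by (rule bint[where S="A \<union> B", OF _ q2B]) (use A B q0 in auto)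
    have iS: "integrable lborel (\<lambda>x. indicator S x * q x)" "integrable lborel (\<lambda>x. indicator S x * (q x)\<^sup>2)" if "S \<in> sets borel" "bounded S" for S
      using bdd_integrable[OF that(1) qm that(2) qB] bdd_integrable[of S "\<lambda>x. (q x)\<^sup>2" "K\<^sup>2"] that q2B by auto
    have i1: "integrable lborel (indicator D :: pt \<Rightarrow> real)" "integrable lborel (indicator A :: pt \<Rightarrow> real)"
      using fin bD A by (auto intro!: integrable_real_indicator)
    define m where "m = (LINT x|lborel. indicator A x * q x)"
    define q1 where "q1 x = indicator A x * q x - (m / mD) * indicator D x" for x
    define q2 where "q2 x = indicator (B - A) x * q x + (m / mD) * indicator D x" for x
    have qq: "q x = q1 x + q2 x" for x using q0[of x] by (auto simp: q1_def q2_def indicator_def)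
    have m1 [measurable]: "q1 \<in> borel_measurable borel" "q2 \<in> borel_measurable borel" unfolding q1_def[abs_def] q2_def[abs_def] by measurable
    have b1: "\<bar>q1 x\<bar> \<le> K + \<bar>m / mD\<bar>" "\<bar>q2 x\<bar> \<le> K + \<bar>m / mD\<bar>" for x
    proof -
      have i: "\<bar>indicator S x * q x\<bar> \<le> K" "\<bar>(m / mD) * indicator D x\<bar> \<le> \<bar>m / mD\<bar>" for S
        using qB[of x] K0 by (auto simp: indicator_def)
      show "\<bar>q1 x\<bar> \<le> K + \<bar>m / mD\<bar>" unfolding q1_def by (rule order_trans[OF abs_triangle_ineq4 add_mono[OF i]])
      show "\<bar>q2 x\<bar> \<le> K + \<bar>m / mD\<bar>" unfolding q2_def by (rule order_trans[OF abs_triangle_ineq add_mono[OF i]])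
    qed
    have z1: "x \<notin> A \<Longrightarrow> q1 x = 0" "x \<notin> B \<Longrightarrow> q2 x = 0" for x using D(2,3) by (auto simp: q1_def q2_def indicator_def)
    have int1: "(LINT x|lborel. q1 x) = 0"
      unfolding q1_def using iS(1)[OF A(2,1)] i1 mD by (simp add: m_def[symmetric]) (simp add: mD_def)
    have iq: "integrable lborel q1" "integrable lborel q2" using bint[OF m1(1) b1(1) A(2,1) z1(1)] bint[OF m1(2) b1(2) B(2,1) z1(2)] by auto
    have int2: "(LINT x|lborel. q2 x) = 0"
    proof -
      have "(LINT x|lborel. q x) = (LINT x|lborel. q1 x) + (LINT x|lborel. q2 x)" unfolding qq using iq by simp
      then show ?thesis using qi int1 by simp
    qed
    \<comment> \<open>Cauchy-Schwarz, obtained from the nonnegative variance of \<open>q\<close> on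
      \<open>A\<close>.\<close>
    have m2: "m\<^sup>2 \<le> mA * (LINT x|lborel. (q x)\<^sup>2)"
    proof -
      have A0: "mA > 0" using mAD mD by simp
      have "0 \<le> (LINT x|lborel. indicator A x * (q x - m / mA)\<^sup>2)" by (rule Bochner_Integration.integral_nonneg) simp
      also have "\<dots> = (LINT x|lborel. indicator A x * (q x)\<^sup>2 - (2 * (m / mA)) * (indicator A x * q x) + (m / mA)\<^sup>2 * indicator A x)"
        by (rule Bochner_Integration.integral_cong) (auto simp: power2_eq_square algebra_simps)
      also have "\<dots> = (LINT x|lborel. indicator A x * (q x)\<^sup>2) - (2 * (m / mA)) * m + (m / mA)\<^sup>2 * mA"
        using iS[OF A(2,1)] i1 by (simp add: m_def mA_def)
      also have "\<dots> = (LINT x|lborel. indicator A x * (q x)\<^sup>2) - m\<^sup>2 / mA" using A0 by (simp add: field_simps power2_eq_square)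
      finally have "m\<^sup>2 \<le> mA * (LINT x|lborel. indicator A x * (q x)\<^sup>2)" using A0 by (simp add: field_simps)
      also have "\<dots> \<le> mA * (LINT x|lborel. (q x)\<^sup>2)"
        using A0 iS(2)[OF A(2,1)] iq2 by (intro mult_left_mono integral_mono) (auto simp: indicator_def)
      finally show ?thesis .
    qed
    have en: "(LINT x|lborel. (r x)\<^sup>2) \<le> k * (LINT x|lborel. (q x)\<^sup>2)"
      if r: "r \<in> borel_measurable borel" "\<And>x. (r x)\<^sup>2 \<le> 2 * (q x)\<^sup>2 + 2 * ((m / mD)\<^sup>2 * indicator D x)" for r
    proof -
      have "(LINT x|lborel. (r x)\<^sup>2) \<le> (LINT x|lborel. 2 * (q x)\<^sup>2 + 2 * ((m / mD)\<^sup>2 * indicator D x))"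
        by (rule integral_mono') (use iq2 i1 r in auto)
      also have "\<dots> = 2 * (LINT x|lborel. (q x)\<^sup>2) + 2 * ((m / mD)\<^sup>2 * mD)" using iq2 i1 by (simp add: mD_def)
      also have "(m / mD)\<^sup>2 * mD = m\<^sup>2 / mD" using mD by (simp add: power2_eq_square)
      also have "m\<^sup>2 / mD \<le> mA * (LINT x|lborel. (q x)\<^sup>2) / mD" using m2 mD by (simp add: divide_right_mono)
      finally show ?thesis by (simp add: k_def algebra_simps)
    qed
    have sqle: "(a + b)\<^sup>2 \<le> 2 * a\<^sup>2 + 2 * b\<^sup>2" for a b :: real using norm_sum_sq[of a b] by simp
    have i: "(indicator S x * q x)\<^sup>2 \<le> (q x)\<^sup>2" "((m / mD) * indicator D x)\<^sup>2 = (m / mD)\<^sup>2 * indicator D x" for S x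
      by (auto simp: indicator_def)
    have en1: "(LINT x|lborel. (q1 x)\<^sup>2) \<le> k * (LINT x|lborel. (q x)\<^sup>2)"
    proof (rule en)
      fix x show "(q1 x)\<^sup>2 \<le> 2 * (q x)\<^sup>2 + 2 * ((m / mD)\<^sup>2 * indicator D x)"
        using sqle[of "indicator A x * q x" "- (m / mD) * indicator D x"] i(1)[of A x] i(2)[of x]
        by (simp add: q1_def)
    qed measurable
    have en2: "(LINT x|lborel. (q2 x)\<^sup>2) \<le> k * (LINT x|lborel. (q x)\<^sup>2)"
    proof (rule en)
      fix x show "(q2 x)\<^sup>2 \<le> 2 * (q x)\<^sup>2 + 2 * ((m / mD)\<^sup>2 * indicator D x)"
        using sqle[of "indicator (B - A) x * q x" "(m / mD) * indicator D x"] i(1)[of "B - A" x] i(2)[of x]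
        by (simp add: q2_def)
    qed measurable
    \<comment> \<open>Adding two errors costs
      \<open>(a + b)\<^sup>2 \<le> 2 * a\<^sup>2 + 2 * b\<^sup>2\<close>, so two tolerances
      \<open>\<epsilon> / 4\<close> give \<open>\<epsilon>\<close>.\<close>
    have e4: "\<epsilon> / 4 > 0" using e by simp
    obtain L \<phi>1 G1 \<phi>2 G2 where 1: "pwaff L \<phi>1 G1" "pwaff L \<phi>2 G2" "\<forall>x. x \<notin> A \<longrightarrow> \<phi>1 x = 0 \<and> \<phi>2 x = 0 \<and> G1 x = 0 \<and> G2 x = 0"
      and E1: "(LINT x|lborel. (norm (G1 x))\<^sup>2 + (norm (G2 x))\<^sup>2) \<le> CA * (LINT x|lborel. (q1 x)\<^sup>2)"
      and F1: "(LINT x|lborel. (G1 x $ 1 + G2 x $ 2 - q1 x)\<^sup>2) \<le> \<epsilon> / 4"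
      using CA(2)[OF m1(1) b1(1) z1(1) int1 e4] unfolding div_solvable_def by blast
    obtain L' \<psi>1 H1 \<psi>2 H2 where 2: "pwaff L' \<psi>1 H1" "pwaff L' \<psi>2 H2" "\<forall>x. x \<notin> B \<longrightarrow> \<psi>1 x = 0 \<and> \<psi>2 x = 0 \<and> H1 x = 0 \<and> H2 x = 0"
      and E2: "(LINT x|lborel. (norm (H1 x))\<^sup>2 + (norm (H2 x))\<^sup>2) \<le> CB * (LINT x|lborel. (q2 x)\<^sup>2)"
      and F2: "(LINT x|lborel. (H1 x $ 1 + H2 x $ 2 - q2 x)\<^sup>2) \<le> \<epsilon> / 4"
      using CB(2)[OF m1(2) b1(2) z1(2) int2 e4] unfolding div_solvable_def by blast
    have ll: "lines (L \<union> L')" using 1 2 by (simp add: lines_Un pwaff_def)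
    have P: "pwaff (L \<union> L') (\<lambda>x. \<phi>1 x + \<psi>1 x) (\<lambda>x. G1 x + H1 x)" "pwaff (L \<union> L') (\<lambda>x. \<phi>2 x + \<psi>2 x) (\<lambda>x. G2 x + H2 x)"
      using pwaff_mono[OF 1(1) _ ll] pwaff_mono[OF 1(2) _ ll] pwaff_mono[OF 2(1) _ ll] pwaff_mono[OF 2(2) _ ll] by (auto intro!: pwaff_add)
    have Gm [measurable]: "G1 \<in> borel_measurable borel" "G2 \<in> borel_measurable borel" "H1 \<in> borel_measurable borel" "H2 \<in> borel_measurable borel"
      using 1 2 by (auto simp: pwaff_def)
    have z: "x \<notin> A \<union> B \<Longrightarrow> \<phi>1 x + \<psi>1 x = 0 \<and> \<phi>2 x + \<psi>2 x = 0 \<and> G1 x + H1 x = 0 \<and> G2 x + H2 x = 0" for x using 1(3) 2(3) by simp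
    have gi: "integrable lborel (\<lambda>x. (norm (G1 x))\<^sup>2)" "integrable lborel (\<lambda>x. (norm (G2 x))\<^sup>2)" "integrable lborel (\<lambda>x. (norm (H1 x))\<^sup>2)" "integrable lborel (\<lambda>x. (norm (H2 x))\<^sup>2)"
      using pwaff_sq_integrable[OF 1(1) A] pwaff_sq_integrable[OF 1(2) A] 1(3) pwaff_sq_integrable[OF 2(1) B] pwaff_sq_integrable[OF 2(2) B] 2(3) by auto
    have "(LINT x|lborel. (norm (G1 x + H1 x))\<^sup>2 + (norm (G2 x + H2 x))\<^sup>2) \<le>
       (LINT x|lborel. 2 * ((norm (G1 x))\<^sup>2 + (norm (G2 x))\<^sup>2) + 2 * ((norm (H1 x))\<^sup>2 + (norm (H2 x))\<^sup>2))"
    proof (rule integral_mono')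
      fix x show "(norm (G1 x + H1 x))\<^sup>2 + (norm (G2 x + H2 x))\<^sup>2 \<le> 2 * ((norm (G1 x))\<^sup>2 + (norm (G2 x))\<^sup>2) + 2 * ((norm (H1 x))\<^sup>2 + (norm (H2 x))\<^sup>2)"
        using norm_sum_sq[of "G1 x" "H1 x"] norm_sum_sq[of "G2 x" "H2 x"] by simp
    qed (use gi in auto)
    also have "\<dots> = 2 * (LINT x|lborel. (norm (G1 x))\<^sup>2 + (norm (G2 x))\<^sup>2) + 2 * (LINT x|lborel. (norm (H1 x))\<^sup>2 + (norm (H2 x))\<^sup>2)"
      using gi by simp
    also have "\<dots> \<le> 2 * (CA * (k * (LINT x|lborel. (q x)\<^sup>2))) + 2 * (CB * (k * (LINT x|lborel. (q x)\<^sup>2)))"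
      using E1 E2 mult_left_mono[OF en1 CA(1)] mult_left_mono[OF en2 CB(1)] by linarith
    finally have E: "(LINT x|lborel. (norm (G1 x + H1 x))\<^sup>2 + (norm (G2 x + H2 x))\<^sup>2) \<le> 2 * (CA + CB) * k * (LINT x|lborel. (q x)\<^sup>2)"
      by (simp add: algebra_simps)
    have di: "integrable lborel (\<lambda>x. (G1 x $ 1 + G2 x $ 2 - q1 x)\<^sup>2)" "integrable lborel (\<lambda>x. (H1 x $ 1 + H2 x $ 2 - q2 x)\<^sup>2)"
      using pwaff_div_integrable[OF 1(1,2) A _ m1(1) b1(1) z1(1)] 1(3) pwaff_div_integrable[OF 2(1,2) B _ m1(2) b1(2) z1(2)] 2(3) by auto
    have "(LINT x|lborel. ((G1 x + H1 x) $ 1 + (G2 x + H2 x) $ 2 - q x)\<^sup>2) \<le> (LINT x|lborel. 2 * (G1 x $ 1 + G2 x $ 2 - q1 x)\<^sup>2 + 2 * (H1 x $ 1 + H2 x $ 2 - q2 x)\<^sup>2)"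
    proof (rule integral_mono')
      fix x show "((G1 x + H1 x) $ 1 + (G2 x + H2 x) $ 2 - q x)\<^sup>2 \<le> 2 * (G1 x $ 1 + G2 x $ 2 - q1 x)\<^sup>2 + 2 * (H1 x $ 1 + H2 x $ 2 - q2 x)\<^sup>2"
        using sqle[of "G1 x $ 1 + G2 x $ 2 - q1 x" "H1 x $ 1 + H2 x $ 2 - q2 x"] unfolding qq by (simp add: algebra_simps)
    qed (use di in auto)
    also have "\<dots> \<le> \<epsilon>" using di F1 F2 by simp
    finally show "div_solvable (A \<union> B) (2 * (CA + CB) * k) q \<epsilon>"
      unfolding div_solvable_def using P z E by (intro exI conjI) auto
  qed
qed

lemma good_UN:
  assumes "finite I" "I \<noteq> {}" "\<And>i. i \<in> I \<Longrightarrow> good (A i)" "D \<in> sets borel" "\<And>i. i \<in> I \<Longrightarrow> D \<subseteq> A i" "measure lborel D > 0"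
  shows "good (\<Union>i\<in>I. A i)"
  using assms(1-3,5)
proof (induction I rule: finite_ne_induct)
  case (insert i I)
  have "good (A i \<union> (\<Union>i\<in>I. A i))"
    by (rule good_union[OF _ _ assms(4) _ _ assms(6)]) (use insert in auto)
  then show ?case by simp
qed auto

section \<open>Parallelograms and triangles\<close>

definition bc :: "pt \<Rightarrow> pt \<Rightarrow> pt \<Rightarrow> pt \<Rightarrow> real" where
  "bc a b c x = cr (x - a) (c - a) / cr (b - a) (c - a)"

lemma AE_cr: assumes "w \<noteq> 0" shows "AE x in lborel. cr (x - a) w \<noteq> k"
proof -
  have "lines {(vec2 (w$2) (- (w$1)), k + (a$1 * w$2 - a$2 * w$1))}"
    using assms pt_eqI[of w 0] by (auto simp: lines_def vec2_eq_0)
  from AE_lset[OF this] show ?thesis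
    by (rule AE_mp) (auto simp: lset_def inner_pt cr_def algebra_simps)
qed

text \<open>Affine image of the reference square, whose centre goes to \<open>a\<close> plus half of
  \<open>u + v\<close>. The coordinates are written by Cramer's rule so that
  \<open>good_triangle\<close> can rewrite them in barycentric form.\<close>

lemma pgm_good:
  assumes "cr u v \<noteq> 0"
  shows "good {x. 0 < cr (x - a) v / cr u v \<and> cr (x - a) v / cr u v < 1 \<and> 0 < cr u (x - a) / cr u v \<and> cr u (x - a) / cr u v < 1}"
proof -
  let ?c = "a + (1/2) *\<^sub>R (u + v)" and ?N = "cols ((1/2) *\<^sub>R u) ((1/2) *\<^sub>R v)"
  let ?P = "{x. 0 < cr (x - a) v / cr u v \<and> cr (x - a) v / cr u v < 1 \<and> 0 < cr u (x - a) / cr u v \<and> cr u (x - a) / cr u v < 1}"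
  have "det ?N \<noteq> 0" using assms by (simp add: det_cols cr_def)
  then have "good ((\<lambda>x. ?c + ?N *v x) ` sq 0 1)" by (rule good_affine[OF good_square])
  moreover have "(\<lambda>x. ?c + ?N *v x) ` sq 0 1 = ?P"
  proof -
    have e: "?c + ?N *v x = a + ((1 + x$1) / 2) *\<^sub>R u + ((1 + x$2) / 2) *\<^sub>R v" for x
      by (rule pt_eqI) (simp_all add: mult_cols field_simps)
    have c1: "cr (s *\<^sub>R u + t *\<^sub>R v) v = s * cr u v" "cr u (s *\<^sub>R u + t *\<^sub>R v) = t * cr u v" for s t
      by (simp_all add: cr_def algebra_simps)
    have c2: "cr (a + s *\<^sub>R u + t *\<^sub>R v - a) v / cr u v = s" "cr u (a + s *\<^sub>R u + t *\<^sub>R v - a) / cr u v = t" for s t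
      using assms c1[of s t] by (simp_all add: add.assoc)
    show ?thesis
    proof (intro set_eqI iffI)
      fix y assume "y \<in> (\<lambda>x. ?c + ?N *v x) ` sq 0 1"
      then obtain x where x: "x \<in> sq 0 1" "y = ?c + ?N *v x" by blast
      then show "y \<in> ?P" unfolding x(2) e mem_Collect_eq c2 by (auto simp: sq_def)
    next
      fix y assume y: "y \<in> ?P"
      obtain s t where st: "y - a = s *\<^sub>R u + t *\<^sub>R v" using pt_basis_cr[OF assms] by blast
      then have ya: "y = a + s *\<^sub>R u + t *\<^sub>R v" by (simp add: algebra_simps)
      have "0 < s" "s < 1" "0 < t" "t < 1" using y unfolding ya mem_Collect_eq c2 by auto
      then have "vec2 (2 * s - 1) (2 * t - 1) \<in> sq 0 1" by (auto simp: sq_def)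
      moreover have "y = ?c + ?N *v vec2 (2 * s - 1) (2 * t - 1)" unfolding e ya by simp
      ultimately show "y \<in> (\<lambda>x. ?c + ?N *v x) ` sq 0 1" by blast
    qed
  qed
  ultimately show ?thesis by simp
qed

lemma open_pos_measure: assumes "open S" "S \<noteq> {}" "bounded (S :: pt set)" shows "measure lborel S > 0"
proof -
  have "emeasure lborel S \<noteq> 0" using assms(1,2) open_not_negligible[of S] by (auto simp: negligible_iff_emeasure0)
  moreover have "emeasure lborel S \<noteq> \<infinity>" using emeasure_bounded_finite[OF assms(3)] by simp
  ultimately show ?thesis by (simp add: measure_def enn2real_positive_iff less_top zero_less_iff_neq_zero)
qed

text \<open>In barycentric coordinates \<open>1 - s - t\<close>, \<open>s\<close>, \<open>t\<close>,
  the open parallelogram spanned at a vertex by the two half edges consists of the points whose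
  other two coordinates lie between 0 and 1/2. The coordinates sum to 1, so at most one exceeds 1/2,
  and off six lines every point of the triangle lies in one of the three. The open medial triangle,
  with all coordinates between 0 and 1/2, is the common overlap.\<close>

lemma good_triangle:
  assumes nc: "cr (b - a) (c - a) \<noteq> 0" shows "good (convex hull {a, b, c})"
proof -
  let ?K = "convex hull {a, b, c}"
  define d where "d = cr (b - a) (c - a)"
  have d: "d \<noteq> 0" using nc by (simp add: d_def)
  define s where "s x = cr (x - a) (c - a) / d" for x
  define t where "t x = cr (b - a) (x - a) / d" for x
  have xst: "x = a + s x *\<^sub>R (b - a) + t x *\<^sub>R (c - a)" for x
  proof -
    obtain p q where pq: "x - a = p *\<^sub>R (b - a) + q *\<^sub>R (c - a)" using pt_basis_cr[OF nc] by blast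
    have "cr (x - a) (c - a) = p * d" "cr (b - a) (x - a) = q * d" unfolding pq d_def by (simp_all add: cr_def algebra_simps)
    then have "s x = p" "t x = q" using d by (simp_all add: s_def t_def)
    then show ?thesis using pq by (simp add: algebra_simps)
  qed
  have inK: "x \<in> ?K \<longleftrightarrow> 0 \<le> s x \<and> 0 \<le> t x \<and> s x + t x \<le> 1" for x
    using mem_tri_iff[OF nc, of "s x" "t x"] xst[of x] by simp
  let ?P1 = "{x. 0 < s x \<and> s x < 1/2 \<and> 0 < t x \<and> t x < 1/2}"
  let ?P2 = "{x. 0 < t x \<and> t x < 1/2 \<and> 0 < 1 - s x - t x \<and> 1 - s x - t x < 1/2}"
  let ?P3 = "{x. 0 < s x \<and> s x < 1/2 \<and> 0 < 1 - s x - t x \<and> 1 - s x - t x < 1/2}"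
  have r: "cr (x - a) (c - a) = s x * d" "cr (b - a) (x - a) = t x * d" for x using d by (simp_all add: s_def t_def)
  have g1: "good ?P1"
  proof -
    have E1: "cr ((1/2) *\<^sub>R (b - a)) ((1/2) *\<^sub>R (c - a)) = d / 4" by (simp add: cr_def d_def field_simps)
    have E2: "cr (x - a) ((1/2) *\<^sub>R (c - a)) = s x * d / 2" "cr ((1/2) *\<^sub>R (b - a)) (x - a) = t x * d / 2" for x
      unfolding r[symmetric] by (simp_all add: cr_def field_simps)
    have nz: "cr ((1/2) *\<^sub>R (b - a)) ((1/2) *\<^sub>R (c - a)) \<noteq> 0" unfolding E1 using d by simp
    have "good {x. 0 < (s x * d / 2) / (d / 4) \<and> (s x * d / 2) / (d / 4) < 1 \<and> 0 < (t x * d / 2) / (d / 4) \<and> (t x * d / 2) / (d / 4) < 1}"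
      using pgm_good[OF nz, of a] unfolding E1 E2 .
    moreover have "(y * d / 2) / (d / 4) = 2 * y" for y using d by simp
    moreover have "{x. 0 < 2 * s x \<and> 2 * s x < 1 \<and> 0 < 2 * t x \<and> 2 * t x < 1} = ?P1" by auto
    ultimately show ?thesis by (simp only:)
  qed
  have g2: "good ?P2"
  proof -
    have E1: "cr ((1/2) *\<^sub>R (a - b)) ((1/2) *\<^sub>R (c - b)) = - d / 4" by (simp add: cr_def d_def field_simps)
    have E2: "cr (x - b) ((1/2) *\<^sub>R (c - b)) = (1 - s x - t x) * - d / 2" "cr ((1/2) *\<^sub>R (a - b)) (x - b) = t x * - d / 2" for x
    proof -
      have "cr (x - b) ((1/2) *\<^sub>R (c - b)) = (- d + s x * d + t x * d) / 2"
        unfolding r[symmetric] unfolding d_def by (simp add: cr_def field_simps)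
      then show "cr (x - b) ((1/2) *\<^sub>R (c - b)) = (1 - s x - t x) * - d / 2" by (simp add: algebra_simps)
      have "cr ((1/2) *\<^sub>R (a - b)) (x - b) = - (t x * d) / 2"
        unfolding r[symmetric] by (simp add: cr_def field_simps)
      then show "cr ((1/2) *\<^sub>R (a - b)) (x - b) = t x * - d / 2" by simp
    qed
    have nz: "cr ((1/2) *\<^sub>R (a - b)) ((1/2) *\<^sub>R (c - b)) \<noteq> 0" unfolding E1 using d by simp
    have "good {x. 0 < ((1 - s x - t x) * - d / 2) / (- d / 4) \<and> ((1 - s x - t x) * - d / 2) / (- d / 4) < 1 \<and> 0 < (t x * - d / 2) / (- d / 4) \<and> (t x * - d / 2) / (- d / 4) < 1}"
      using pgm_good[OF nz, of b] unfolding E1 E2 .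
    moreover have "(y * - d / 2) / (- d / 4) = 2 * y" for y using d by simp
    moreover have "{x. 0 < 2 * (1 - s x - t x) \<and> 2 * (1 - s x - t x) < 1 \<and> 0 < 2 * t x \<and> 2 * t x < 1} = ?P2" by auto
    ultimately show ?thesis by (simp only:)
  qed
  have g3: "good ?P3"
  proof -
    have E1: "cr ((1/2) *\<^sub>R (a - c)) ((1/2) *\<^sub>R (b - c)) = d / 4" by (simp add: cr_def d_def field_simps)
    have E2: "cr (x - c) ((1/2) *\<^sub>R (b - c)) = (1 - s x - t x) * d / 2" "cr ((1/2) *\<^sub>R (a - c)) (x - c) = s x * d / 2" for x
    proof -
      have "cr (x - c) ((1/2) *\<^sub>R (b - c)) = (d - s x * d - t x * d) / 2"
        unfolding r[symmetric] unfolding d_def by (simp add: cr_def field_simps)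
      then show "cr (x - c) ((1/2) *\<^sub>R (b - c)) = (1 - s x - t x) * d / 2" by (simp add: algebra_simps)
      show "cr ((1/2) *\<^sub>R (a - c)) (x - c) = s x * d / 2"
        unfolding r[symmetric] by (simp add: cr_def field_simps)
    qed
    have nz: "cr ((1/2) *\<^sub>R (a - c)) ((1/2) *\<^sub>R (b - c)) \<noteq> 0" unfolding E1 using d by simp
    have "good {x. 0 < ((1 - s x - t x) * d / 2) / (d / 4) \<and> ((1 - s x - t x) * d / 2) / (d / 4) < 1 \<and> 0 < (s x * d / 2) / (d / 4) \<and> (s x * d / 2) / (d / 4) < 1}"
      using pgm_good[OF nz, of c] unfolding E1 E2 .
    moreover have "(y * d / 2) / (d / 4) = 2 * y" for y using d by simp
    moreover have "{x. 0 < 2 * (1 - s x - t x) \<and> 2 * (1 - s x - t x) < 1 \<and> 0 < 2 * s x \<and> 2 * s x < 1} = ?P3" by auto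
    ultimately show ?thesis by (simp only:)
  qed
  let ?D = "{x. 0 < s x \<and> s x < 1/2 \<and> 0 < t x \<and> t x < 1/2 \<and> 0 < 1 - s x - t x \<and> 1 - s x - t x < 1/2}"
  have "open ?D" unfolding s_def t_def cr_def using d
    by (intro open_Collect_conj open_Collect_less continuous_intros) auto
  moreover have "?D \<noteq> {}"
  proof -
    let ?x = "a + (1/3) *\<^sub>R (b - a) + (1/3) *\<^sub>R (c - a)"
    have "cr (?x - a) (c - a) = d / 3" "cr (b - a) (?x - a) = d / 3" unfolding d_def by (simp_all add: cr_def field_simps)
    then have "s ?x = 1/3" "t ?x = 1/3" using d by (simp_all add: s_def t_def)
    then have "?x \<in> ?D" by simp
    then show ?thesis by blast
  qed
  moreover have "bounded ?D" by (rule bounded_subset[OF tri_borel(2)[OF refl, of a b c]]) (auto simp: inK)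
  ultimately have D: "?D \<in> sets borel" "measure lborel ?D > 0" using open_pos_measure by auto
  have g12: "good (?P1 \<union> ?P2)" by (rule good_union[OF g1 g2 D(1) _ _ D(2)]) auto
  have g: "good ((?P1 \<union> ?P2) \<union> ?P3)" by (rule good_union[OF g12 g3 D(1) _ _ D(2)]) auto
  show ?thesis
  proof (rule good_null[OF g tri_borel(2)[OF refl] tri_borel(1)[OF refl]])
    show "(?P1 \<union> ?P2) \<union> ?P3 \<subseteq> ?K" by (auto simp: inK)
    have nz: "c - a \<noteq> 0" "b - a \<noteq> 0" "c - b \<noteq> 0" using cr_distinct[OF nc] by auto
    have w: "cr (b - a) (x - a) = - cr (x - a) (b - a)" "d * (1 - s x - t x) = - cr (x - b) (c - b)" for x
    proof -
      have "- cr (x - b) (c - b) = d - s x * d - t x * d" unfolding r[symmetric] unfolding d_def by (simp add: cr_def algebra_simps)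
      then show "d * (1 - s x - t x) = - cr (x - b) (c - b)" by (simp add: algebra_simps)
    qed (simp add: cr_def)
    have "AE x in lborel. cr (x - a) (c - a) \<noteq> k" "AE x in lborel. cr (x - a) (b - a) \<noteq> k" "AE x in lborel. cr (x - b) (c - b) \<noteq> k" for k
      using nz by (auto intro!: AE_cr)
    note AE = this
    show "AE x in lborel. x \<in> ?K \<longrightarrow> x \<in> (?P1 \<union> ?P2) \<union> ?P3"
      using AE(1)[of 0] AE(1)[of "d/2"] AE(2)[of 0] AE(2)[of "-d/2"] AE(3)[of 0] AE(3)[of "-d/2"]
    proof eventually_elim
      case (elim x)
      have "s x \<noteq> 0" "s x \<noteq> 1/2" using elim(1,2) r(1)[of x] by auto
      moreover have "t x \<noteq> 0" using elim(3) r(2)[of x] w(1)[of x] by auto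
      moreover have "t x \<noteq> 1/2"
      proof
        assume "t x = 1/2"
        then have "cr (b - a) (x - a) = d / 2" using r(2)[of x] by simp
        then show False using elim(4) w(1)[of x] by simp
      qed
      moreover have "1 - s x - t x \<noteq> 0" using elim(5) w(2)[of x] by auto
      moreover have "1 - s x - t x \<noteq> 1/2"
      proof
        assume "1 - s x - t x = 1/2"
        then have "d * (1/2) = - cr (x - b) (c - b)" using w(2)[of x] by (simp only:)
        then show False using elim(6) by simp
      qed
      ultimately show ?case by (auto simp: inK)
    qed
  qed
qed

section \<open>Covering a polygon by triangles around a common point\<close>

lemma int_tri:
  assumes nc: "cr (b - a) (c - a) \<noteq> 0" and st: "0 < s" "0 < t" "s + t < 1"
  shows "a + s *\<^sub>R (b - a) + t *\<^sub>R (c - a) \<in> interior (convex hull {a, b, c})"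
proof -
  define d where "d = cr (b - a) (c - a)"
  have d: "d \<noteq> 0" using nc by (simp add: d_def)
  let ?S = "{x. 0 < cr (x - a) (c - a) / d \<and> 0 < cr (b - a) (x - a) / d \<and> cr (x - a) (c - a) / d + cr (b - a) (x - a) / d < 1}"
  have st': "cr (a + p *\<^sub>R (b - a) + q *\<^sub>R (c - a) - a) (c - a) / d = p" "cr (b - a) (a + p *\<^sub>R (b - a) + q *\<^sub>R (c - a) - a) / d = q" for p q
  proof -
    have "cr (a + p *\<^sub>R (b - a) + q *\<^sub>R (c - a) - a) (c - a) = p * d" "cr (b - a) (a + p *\<^sub>R (b - a) + q *\<^sub>R (c - a) - a) = q * d"
      unfolding d_def by (simp_all add: cr_def algebra_simps)
    then show "cr (a + p *\<^sub>R (b - a) + q *\<^sub>R (c - a) - a) (c - a) / d = p" "cr (b - a) (a + p *\<^sub>R (b - a) + q *\<^sub>R (c - a) - a) / d = q"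
      using d by simp_all
  qed
  have "open ?S" unfolding cr_def using d by (intro open_Collect_conj open_Collect_less continuous_intros) auto
  moreover have "?S \<subseteq> convex hull {a, b, c}"
  proof
    fix x assume x: "x \<in> ?S"
    obtain p q where pq: "x - a = p *\<^sub>R (b - a) + q *\<^sub>R (c - a)" using pt_basis_cr[OF nc] by blast
    then have xa: "x = a + p *\<^sub>R (b - a) + q *\<^sub>R (c - a)" by (simp add: algebra_simps)
    show "x \<in> convex hull {a, b, c}" unfolding xa mem_tri_iff[OF nc] using x unfolding xa mem_Collect_eq st' by simp
  qed
  moreover have "a + s *\<^sub>R (b - a) + t *\<^sub>R (c - a) \<in> ?S" unfolding mem_Collect_eq st' using st by simp
  ultimately show ?thesis by (meson interior_maximal subsetD)
qed

text \<open>Exchange step of Caratheodory type: a multiple of the relation \<open>\<beta>\<close> is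
  subtracted until the first coefficient reaches zero. Passing to the negative relation when the sum
  of \<open>\<beta>\<close> is negative ensures that the total of the coefficients does not
  grow.\<close>

lemma cone_reduce:
  fixes \<alpha> \<beta> :: "nat \<Rightarrow> real"
  assumes \<alpha>: "\<And>i. i < 3 \<Longrightarrow> 0 \<le> \<alpha> i" "(\<Sum>i<3. \<alpha> i) \<le> 1" and \<beta>: "\<exists>i<3. \<beta> i \<noteq> 0"
  shows "\<exists>t. (\<forall>i<3. 0 \<le> \<alpha> i - t * \<beta> i) \<and> (\<Sum>i<3. \<alpha> i - t * \<beta> i) \<le> 1 \<and> (\<exists>i<3. \<alpha> i - t * \<beta> i = 0)"
proof -
  have main: "\<exists>t. (\<forall>i<3. 0 \<le> \<alpha> i - t * \<gamma> i) \<and> (\<Sum>i<3. \<alpha> i - t * \<gamma> i) \<le> 1 \<and> (\<exists>i<3. \<alpha> i - t * \<gamma> i = 0)"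
    if \<gamma>: "\<exists>i<3. \<gamma> i \<noteq> 0" "(\<Sum>i<3. \<gamma> i) \<ge> 0" for \<gamma> :: "nat \<Rightarrow> real"
  proof -
    define I where "I = {i. i < 3 \<and> \<gamma> i > 0}"
    have fin: "finite I" by (simp add: I_def)
    have "I \<noteq> {}"
    proof
      assume "I = {}"
      then have n: "\<gamma> i \<le> 0" if "i < 3" for i using that by (auto simp: I_def)
      then have "(\<Sum>i<3. \<gamma> i) \<le> 0" by (intro sum_nonpos) auto
      then have "(\<Sum>i<3. - \<gamma> i) = 0" using \<gamma>(2) by (simp add: sum_negf)
      then have "\<forall>i\<in>{..<3}. - \<gamma> i = 0" using n by (subst (asm) sum_nonneg_eq_0_iff) auto
      then show False using \<gamma>(1) by auto
    qed
    \<comment> \<open>The smallest ratio belongs to the coefficient that vanishes first.\<close>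
    define t where "t = Min ((\<lambda>i. \<alpha> i / \<gamma> i) ` I)"
    have "t \<in> (\<lambda>i. \<alpha> i / \<gamma> i) ` I" unfolding t_def using fin \<open>I \<noteq> {}\<close> by (intro Min_in) auto
    then obtain k where k: "k \<in> I" "t = \<alpha> k / \<gamma> k" by blast
    have tle: "t \<le> \<alpha> i / \<gamma> i" if "i \<in> I" for i unfolding t_def using fin that by (intro Min_le) auto
    have t0: "t \<ge> 0" using k \<alpha>(1)[of k] by (auto simp: I_def)
    have "0 \<le> \<alpha> i - t * \<gamma> i" if "i < 3" for i
    proof (cases "\<gamma> i > 0")
      case True
      then have "t \<le> \<alpha> i / \<gamma> i" using that by (intro tle) (simp add: I_def)
      then show ?thesis using True by (simp add: pos_le_divide_eq)
    next
      case False
      then have "t * \<gamma> i \<le> 0" using t0 by (simp add: mult_nonneg_nonpos)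
      then show ?thesis using \<alpha>(1)[OF that] by simp
    qed
    moreover have "(\<Sum>i<3. \<alpha> i - t * \<gamma> i) = (\<Sum>i<3. \<alpha> i) - t * (\<Sum>i<3. \<gamma> i)" by (simp add: sum_subtractf sum_distrib_left)
    then have "(\<Sum>i<3. \<alpha> i - t * \<gamma> i) \<le> 1" using \<alpha>(2) mult_nonneg_nonneg[OF t0 \<gamma>(2)] by linarith
    moreover have "\<alpha> k - t * \<gamma> k = 0" "k < 3" using k by (auto simp: I_def)
    ultimately show ?thesis by blast
  qed
  show ?thesis
  proof (cases "(\<Sum>i<3. \<beta> i) \<ge> 0")
    case True then show ?thesis using main[OF \<beta>] by blast
  next
    case False
    then have "\<exists>i<3. - \<beta> i \<noteq> 0" "(\<Sum>i<3. - \<beta> i) \<ge> 0" using \<beta> by (auto simp: sum_negf)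
    from main[OF this] obtain t where "(\<forall>i<3. 0 \<le> \<alpha> i - t * - \<beta> i) \<and> (\<Sum>i<3. \<alpha> i - t * - \<beta> i) \<le> 1 \<and> (\<exists>i<3. \<alpha> i - t * - \<beta> i = 0)" by blast
    then show ?thesis by (intro exI[of _ "- t"]) simp
  qed
qed

lemma all3: "(\<forall>i<3. P i) \<longleftrightarrow> P 0 \<and> P 1 \<and> P (2::nat)" and ex3: "(\<exists>i<3. P i) \<longleftrightarrow> P 0 \<or> P 1 \<or> P (2::nat)"
  by (auto simp: numeral_3_eq_3 numeral_2_eq_2 less_Suc_eq)

text \<open>Three plane vectors satisfy the linear relation with coefficients \<open>cr B C\<close>,
  \<open>cr C A\<close>, \<open>cr A B\<close>, which \<open>cone_reduce\<close> uses to remove one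
  of them. The other two are independent because \<open>y\<close> is not parallel to any nonzero
  generator.\<close>

lemma cone_two:
  fixes A B C y :: pt
  assumes y: "y = u *\<^sub>R A + v *\<^sub>R B + w *\<^sub>R C" and uvw: "0 \<le> u" "0 \<le> v" "0 \<le> w" "u + v + w \<le> 1"
    and nz: "y \<noteq> 0" "A \<noteq> 0 \<Longrightarrow> cr y A \<noteq> 0" "B \<noteq> 0 \<Longrightarrow> cr y B \<noteq> 0" "C \<noteq> 0 \<Longrightarrow> cr y C \<noteq> 0"
  shows "\<exists>X\<in>{A, B, C}. \<exists>Y\<in>{A, B, C}. \<exists>\<alpha> \<beta>. 0 \<le> \<alpha> \<and> 0 \<le> \<beta> \<and> \<alpha> + \<beta> \<le> 1 \<and> y = \<alpha> *\<^sub>R X + \<beta> *\<^sub>R Y \<and> cr X Y \<noteq> 0"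
proof -
  define \<alpha> :: "nat \<Rightarrow> real" where "\<alpha> i = (if i = 0 then u else if i = 1 then v else w)" for i
  define \<beta> :: "nat \<Rightarrow> real" where "\<beta> i = (if i = 0 then cr B C else if i = 1 then cr C A else cr A B)" for i
  have lin: "cr (a *\<^sub>R A + b *\<^sub>R B + c *\<^sub>R C) Z = a * cr A Z + b * cr B Z + c * cr C Z" for a b c Z
    by (simp add: cr_def algebra_simps)
  have self: "cr Z Z = 0" for Z by (simp add: cr_def)
  have bnz: "\<exists>i<3. \<beta> i \<noteq> 0"
  proof (rule ccontr)
    assume "\<not> (\<exists>i<3. \<beta> i \<noteq> 0)"
    then have z: "cr B C = 0" "cr C A = 0" "cr A B = 0" by (auto simp: \<beta>_def ex3)
    then have z': "cr C B = 0" "cr A C = 0" "cr B A = 0" using cr_swap by (metis add.inverse_neutral)+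
    have "cr y A = 0" "cr y B = 0" "cr y C = 0" unfolding y lin using z z' self by simp_all
    then have "A = 0" "B = 0" "C = 0" using nz by auto
    then show False using nz(1) y by simp
  qed
  obtain t where t: "\<forall>i<3. 0 \<le> \<alpha> i - t * \<beta> i" "(\<Sum>i<3. \<alpha> i - t * \<beta> i) \<le> 1" "\<exists>i<3. \<alpha> i - t * \<beta> i = 0"
  proof -
    have "0 \<le> \<alpha> i" if "i < 3" for i using uvw by (simp add: \<alpha>_def)
    moreover have "(\<Sum>i<3. \<alpha> i) \<le> 1" using uvw(4) by (simp add: sum3 \<alpha>_def)
    moreover note bnz
    ultimately have "\<exists>t. (\<forall>i<3. 0 \<le> \<alpha> i - t * \<beta> i) \<and> (\<Sum>i<3. \<alpha> i - t * \<beta> i) \<le> 1 \<and> (\<exists>i<3. \<alpha> i - t * \<beta> i = 0)"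
      by (rule cone_reduce)
    then show thesis using that by blast
  qed
  define p q r where "p = u - t * cr B C" and "q = v - t * cr C A" and "r = w - t * cr A B"
  have pqr: "0 \<le> p" "0 \<le> q" "0 \<le> r" "p + q + r \<le> 1" "p = 0 \<or> q = 0 \<or> r = 0"
    using t unfolding sum3 all3 ex3 by (simp_all add: \<alpha>_def \<beta>_def p_def q_def r_def)
  have yp: "y = p *\<^sub>R A + q *\<^sub>R B + r *\<^sub>R C"
    unfolding y p_def q_def r_def by (rule pt_eqI) (simp_all add: cr_def algebra_simps)
  have fin: "\<exists>\<alpha> \<beta>. 0 \<le> \<alpha> \<and> 0 \<le> \<beta> \<and> \<alpha> + \<beta> \<le> 1 \<and> y = \<alpha> *\<^sub>R X + \<beta> *\<^sub>R Y \<and> cr X Y \<noteq> 0"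
    if XY: "X \<in> {A, B, C}" "Y \<in> {A, B, C}" and ab: "0 \<le> a" "0 \<le> b" "a + b \<le> 1" "y = a *\<^sub>R X + b *\<^sub>R Y" for X Y a b
  proof -
    have "cr X Y \<noteq> 0"
    proof
      assume z: "cr X Y = 0"
      then have z': "cr Y X = 0" using cr_swap[of Y X] by simp
      have "cr y X = a * cr X X + b * cr Y X" "cr y Y = a * cr X Y + b * cr Y Y" unfolding ab(4) by (simp_all add: cr_def algebra_simps)
      then have "cr y X = 0" "cr y Y = 0" using z z' self by simp_all
      then have "X = 0" "Y = 0" using XY nz by auto
      then show False using ab(4) nz(1) by simp
    qed
    then show ?thesis using ab by blast
  qed
  from pqr(5) show ?thesis
  proof (elim disjE)
    assume "p = 0" then show ?thesis using fin[of B C q r] pqr yp by auto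
  next
    assume "q = 0" then show ?thesis using fin[of A C p r] pqr yp by auto
  next
    assume "r = 0" then show ?thesis using fin[of A B p q] pqr yp by auto
  qed
qed

lemma card_le_3: assumes "card S \<le> 3" "finite S" "S \<noteq> {}" shows "\<exists>p q r. S = {p, q, r}"
proof -
  have "card S = 1 \<or> card S = 2 \<or> card S = 3" using assms card_gt_0_iff[of S] by linarith
  then show ?thesis
  proof (elim disjE)
    assume "card S = 1"
    then obtain p where "S = {p}" by (rule card_1_singletonE)
    then have "S = {p, p, p}" by simp
    then show ?thesis by blast
  next
    assume "card S = 2"
    then obtain p q where "S = {p, q}" unfolding card_2_iff by blast
    then have "S = {p, q, q}" by simp
    then show ?thesis by blast
  next
    assume "card S = 3"
    then show ?thesis unfolding card_3_iff by blast
  qed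
qed

text \<open>The triangle for \<open>a\<close>, \<open>b\<close> has its third corner
  \<open>cc a b\<close> beyond \<open>o0\<close> as seen from the midpoint of \<open>a\<close> and
  \<open>b\<close>, so \<open>o0\<close> is interior to all triangles and a neighbourhood of it
  serves as overlap. Caratheodory's theorem and \<open>cone_two\<close> place almost every point in
  the hull of \<open>o0\<close> and two points of \<open>P\<close>. All pairs not in line with
  \<open>o0\<close> are taken, which avoids ordering the vertices cyclically.\<close>

lemma good_polygon:
  assumes P: "finite P" and ne: "interior (convex hull P) \<noteq> {}"
  shows "good (convex hull P)"
proof -
  let ?H = "convex hull P"
  obtain o0 where o0: "o0 \<in> interior ?H" using ne by blast
  then obtain e where e: "e > 0" "cball o0 e \<subseteq> ?H" by (meson mem_interior_cball)
  \<comment> \<open>Keeps the distance from \<open>o0\<close> to \<open>cc a b\<close> at most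
    \<open>e\<close>, hence the third corner in the polygon.\<close>
  define kk where "kk a b = e / (1 + norm (o0 - (1/2) *\<^sub>R (a + b)))" for a b
  define cc where "cc a b = o0 + kk a b *\<^sub>R (o0 - (1/2) *\<^sub>R (a + b))" for a b
  define tri where "tri = (\<lambda>(a, b). convex hull {a, b, cc a b})"
  define pairs where "pairs = {(a, b) \<in> P \<times> P. cr (a - o0) (b - o0) \<noteq> 0}"
  have fin: "finite pairs" unfolding pairs_def by (rule finite_subset[of _ "P \<times> P"]) (use P in auto)
  have k0: "kk a b > 0" for a b using e(1) by (simp add: kk_def add_pos_nonneg)
  have ccH: "cc a b \<in> ?H" for a b
  proof -
    have eN: "e / (1 + N) * N \<le> e" if "N \<ge> 0" for N using that e(1) by (simp add: divide_le_eq algebra_simps)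
    then have "kk a b * norm (o0 - (1/2) *\<^sub>R (a + b)) \<le> e"
      unfolding kk_def by (intro eN) simp
    then have "cc a b \<in> cball o0 e" using k0[of a b] by (simp add: cc_def dist_norm)
    then show ?thesis using e(2) by blast
  qed
  have crt: "cr (b - a) (cc a b - a) = (1 + kk a b) * cr (a - o0) (b - o0)" for a b
    by (simp add: cc_def cr_def field_simps)
  have nct: "cr (b - a) (cc a b - a) \<noteq> 0" if "(a, b) \<in> pairs" for a b
    using that k0[of a b] unfolding crt by (auto simp: pairs_def)
  have oin: "o0 \<in> interior (tri p)" if "p \<in> pairs" for p
  proof -
    obtain a b where p: "p = (a, b)" by (cases p)
    let ?k = "kk a b"
    have k1: "1 + ?k > 0" using k0[of a b] by simp
    have aux: "w = x + (k / (2 * (1 + k))) * (y - x) + (1 / (1 + k)) * (w + k * (w - (1/2) * (x + y)) - x)"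
      if "1 + k > 0" for w x y k :: real
    proof -
      have "k / (2 * (1 + k)) = (1 / (1 + k)) * (k / 2)" by simp
      then have "x + (k / (2 * (1 + k))) * (y - x) + (1 / (1 + k)) * (w + k * (w - (1/2) * (x + y)) - x)
        = x + (1 / (1 + k)) * ((k / 2) * (y - x) + (w + k * (w - (1/2) * (x + y)) - x))" by (simp only: distrib_left mult.assoc add.assoc)
      also have "(k / 2) * (y - x) + (w + k * (w - (1/2) * (x + y)) - x) = (1 + k) * (w - x)" by (simp add: field_simps)
      finally show ?thesis using that by simp
    qed
    \<comment> \<open>The equation \<open>cc = (1 + k) o0 - k m\<close>, with \<open>m\<close> the
      midpoint of \<open>a\<close> and \<open>b\<close>, solved for \<open>o0\<close>.\<close>
    have "o0 = a + (?k / (2 * (1 + ?k))) *\<^sub>R (b - a) + (1 / (1 + ?k)) *\<^sub>R (cc a b - a)"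
      using aux[OF k1] by (intro pt_eqI) (simp_all add: cc_def)
    moreover have "?k / (2 * (1 + ?k)) + 1 / (1 + ?k) < 1"
    proof -
      have "?k / (2 * (1 + ?k)) + 1 / (1 + ?k) = (?k / 2 + 1) / (1 + ?k)" by (simp add: add_divide_distrib)
      also have "\<dots> < 1" using k0[of a b] k1 by (simp add: divide_less_eq)
      finally show ?thesis .
    qed
    ultimately show ?thesis
      using int_tri[OF nct, of a b "?k / (2 * (1 + ?k))" "1 / (1 + ?k)"] that k0[of a b] k1 unfolding p tri_def by simp
  qed
  have triH: "tri p \<subseteq> ?H" if "p \<in> pairs" for p
  proof -
    obtain a b where p: "p = (a, b)" by (cases p)
    have "a \<in> ?H" "b \<in> ?H" using that unfolding p pairs_def by (auto intro: hull_inc)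
    then have "{a, b, cc a b} \<subseteq> ?H" using ccH by simp
    then show ?thesis unfolding p tri_def prod.case by (rule hull_minimal) (rule convex_convex_hull)
  qed
  have cover: "AE x in lborel. x \<in> ?H \<longrightarrow> x \<in> (\<Union>p\<in>pairs. tri p)"
  proof -
    have "AE x in lborel. \<forall>p\<in>P - {o0}. cr (x - o0) (p - o0) \<noteq> 0"
      using P by (subst AE_ball_countable) (auto simp: countable_finite intro!: AE_cr)
    moreover have "AE x in lborel. x \<noteq> o0" by (rule AE_lborel_singleton)
    ultimately show ?thesis
    proof eventually_elim
      case (elim x)
      show ?case
      proof
        assume "x \<in> ?H"
        then obtain S where S: "finite S" "S \<subseteq> P" "card S \<le> 3" "x \<in> convex hull S"
          unfolding caratheodory[of P] by auto
        then have "S \<noteq> {}" by auto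
        then obtain p q r where S3: "S = {p, q, r}" using card_le_3 S by metis
        then obtain u v w where uvw: "0 \<le> u" "0 \<le> v" "0 \<le> w" "u + v + w = 1" "x = u *\<^sub>R p + v *\<^sub>R q + w *\<^sub>R r"
          using S(4) unfolding S3 convex_hull_3 by blast
        have "x - o0 = u *\<^sub>R p + v *\<^sub>R q + w *\<^sub>R r - (u + v + w) *\<^sub>R o0" using uvw by simp
        also have "\<dots> = u *\<^sub>R (p - o0) + v *\<^sub>R (q - o0) + w *\<^sub>R (r - o0)" by (simp add: algebra_simps)
        finally have y: "x - o0 = u *\<^sub>R (p - o0) + v *\<^sub>R (q - o0) + w *\<^sub>R (r - o0)" .
        have pP: "p \<in> P" "q \<in> P" "r \<in> P" using S(2) S3 by auto
        have "\<exists>X\<in>{p - o0, q - o0, r - o0}. \<exists>Y\<in>{p - o0, q - o0, r - o0}. \<exists>\<alpha> \<beta>. 0 \<le> \<alpha> \<and> 0 \<le> \<beta> \<and> \<alpha> + \<beta> \<le> 1 \<and> x - o0 = \<alpha> *\<^sub>R X + \<beta> *\<^sub>R Y \<and> cr X Y \<noteq> 0"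
          by (rule cone_two[OF y]) (use uvw elim pP in auto)
        then obtain a b \<alpha> \<beta> where ab: "a \<in> P" "b \<in> P" "0 \<le> \<alpha>" "0 \<le> \<beta>" "\<alpha> + \<beta> \<le> 1" "x - o0 = \<alpha> *\<^sub>R (a - o0) + \<beta> *\<^sub>R (b - o0)" "cr (a - o0) (b - o0) \<noteq> 0"
          using pP by auto
        then have pr: "(a, b) \<in> pairs" by (simp add: pairs_def)
        have "x = (1 - \<alpha> - \<beta>) *\<^sub>R o0 + \<alpha> *\<^sub>R a + \<beta> *\<^sub>R b" using ab(6) by (simp add: algebra_simps)
        then have "x \<in> convex hull {o0, a, b}" unfolding convex_hull_3 using ab(3-5) by force
        also have "convex hull {o0, a, b} \<subseteq> tri (a, b)"
        proof (rule hull_minimal)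
          show "{o0, a, b} \<subseteq> tri (a, b)" using oin[OF pr] interior_subset unfolding tri_def by (auto intro: hull_inc)
          show "convex (tri (a, b))" unfolding tri_def by (simp add: convex_convex_hull)
        qed
        finally show "x \<in> (\<Union>p\<in>pairs. tri p)" using pr by blast
      qed
    qed
  qed
  have "pairs \<noteq> {}"
  proof
    assume "pairs = {}"
    then have "AE x in lborel. x \<notin> ?H" using cover by simp
    then have "AE x in lborel. x \<notin> ball o0 e" by eventually_elim (use e(2) in \<open>auto simp: subset_iff\<close>)
    then have "emeasure lborel (ball o0 e) = 0" by (subst (asm) AE_iff_measurable[of "ball o0 e"]) auto
    then show False using open_pos_measure[of "ball o0 e"] e(1) by (simp add: measure_def)
  qed
  let ?D = "ball o0 1 \<inter> (\<Inter>p\<in>pairs. interior (tri p))"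
  have "open ?D" using fin by (intro open_Int open_ball open_INT) auto
  moreover have "o0 \<in> ?D" using oin by auto
  moreover have "bounded ?D" by (rule bounded_subset[OF bounded_ball[of o0 1]]) (rule Int_lower1)
  ultimately have D: "?D \<in> sets borel" "measure lborel ?D > 0" using open_pos_measure[of ?D] by (blast intro: borel_open)+
  have g: "good (\<Union>p\<in>pairs. tri p)"
  proof (rule good_UN[OF fin \<open>pairs \<noteq> {}\<close> _ D(1) _ D(2)])
    fix p assume p: "p \<in> pairs"
    obtain a b where ab: "p = (a, b)" by (cases p)
    show "good (tri p)" unfolding ab tri_def prod.case by (rule good_triangle[OF nct]) (use p ab in simp)
    show "?D \<subseteq> tri p" using p interior_subset by blast
  qed
  have cH: "compact ?H" using P by (simp add: finite_imp_compact_convex_hull)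
  show ?thesis
    by (rule good_null[OF g compact_imp_bounded[OF cH] borel_compact[OF cH] _ cover]) (use triH in auto)
qed

section \<open>Triangles sharing an edge\<close>

lemma unit_perp:
  fixes n n' u :: pt
  assumes "n \<bullet> u = 0" "n' \<bullet> u = 0" "norm n = 1" "norm n' = 1" "u \<noteq> 0"
  shows "n' = n \<or> n' = - n"
proof -
  have 1: "n$1 * u$1 + n$2 * u$2 = 0" "n'$1 * u$1 + n'$2 * u$2 = 0" using assms by (simp_all add: inner_pt)
  have 2: "n$1 * n$1 + n$2 * n$2 = 1" "n'$1 * n'$1 + n'$2 * n'$2 = 1"
    using assms(3,4) by (simp_all add: norm_eq_1 inner_pt)
  have "u$1 * cr n n' = 0" "u$2 * cr n n' = 0" using 1 unfolding cr_def by algebra+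
  then have c: "n$1 * n'$2 - n$2 * n'$1 = 0" using assms(5) pt_eqI[of u 0] by (auto simp: cr_def)
  define k where "k = n \<bullet> n'"
  have k: "k = n$1 * n'$1 + n$2 * n'$2" by (simp add: k_def inner_pt)
  have e: "n'$1 = k * n$1" "n'$2 = k * n$2" using 2(1) c unfolding k by algebra+
  have "k * k = 1" using 2 e by algebra
  then have "k = 1 \<or> k = -1" using square_eq_1_iff by blast
  then show ?thesis using e by (auto intro: pt_eqI)
qed

lemma outer_normal_le:
  assumes T: "is_triangle K" and E: "E \<in> edges K" and xy: "x \<in> K" "y \<in> E"
  shows "outer_normal K E \<bullet> (x - y) \<le> 0"
proof -
  obtain a b c where abc: "E = closed_segment a b" "K = convex hull {a, b, c}" "cr (b - a) (c - a) \<noteq> 0" "a \<noteq> b" using edge_seg[OF T E] by metis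
  let ?n = "outer_normal K E"
  note N = outer_normal_tri[OF abc(3,2), folded abc(1)]
  have "dist a b > 0" using abc(4) by simp
  then have nc: "?n \<bullet> (c - a) \<le> 0" using N(3) by (smt (verit) zero_less_mult_iff abs_ge_zero)
  obtain s t where st: "x = a + s *\<^sub>R (b - a) + t *\<^sub>R (c - a)" "0 \<le> t" using xy(1) unfolding abc(2) convex_hull_3_alt by auto
  obtain r where r: "y = a + r *\<^sub>R (b - a)" using xy(2) unfolding abc(1) by (auto simp: in_segment algebra_simps)
  have "?n \<bullet> (x - y) = t * (?n \<bullet> (c - a))"
    using N(2) unfolding st r by (simp add: inner_add_right inner_diff_right algebra_simps)
  then show ?thesis using st nc by (simp add: mult_nonneg_nonpos)
qed

section \<open>Discrete Poincare inequality\<close>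

text \<open>Near the middle of an edge a triangle fills the side opposite to its normal. In edge
  coordinates the normal is \<open>p *\<^sub>R (b - a) + r *\<^sub>R (c - a)\<close> with
  \<open>r < 0\<close>, so moving against it increases the coordinate belonging to
  \<open>c\<close>.\<close>

lemma step_inside:
  assumes nc: "cr (b - a) (c - a) \<noteq> 0" and K: "K = convex hull {a, b, c}"
  shows "\<exists>e>0. \<forall>\<epsilon>. 0 < \<epsilon> \<longrightarrow> \<epsilon> \<le> e \<longrightarrow> midpoint a b - \<epsilon> *\<^sub>R outer_normal K (closed_segment a b) \<in> K"
proof -
  let ?n = "outer_normal K (closed_segment a b)"
  note N = outer_normal_tri[OF nc K]
  obtain p r where n: "?n = p *\<^sub>R (b - a) + r *\<^sub>R (c - a)" using pt_basis_cr[OF nc] by blast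
  have "r * (?n \<bullet> (c - a)) = 1"
  proof -
    have "?n \<bullet> ?n = 1" using N(1) by (simp add: norm_eq_1)
    moreover have "?n \<bullet> ?n = p * (?n \<bullet> (b - a)) + r * (?n \<bullet> (c - a))" by (subst (2) n) (simp add: inner_add_right)
    ultimately show ?thesis using N(2) by simp
  qed
  moreover have "?n \<bullet> (c - a) < 0"
  proof -
    have "dist a b * (?n \<bullet> (c - a)) < 0" using N(3) nc by simp
    then show ?thesis by (simp add: mult_less_0_iff)
  qed
  ultimately have r: "r < 0" by (smt (verit) mult_nonneg_nonpos)
  \<comment> \<open>Keeps the changes of both coordinates together at most 1/2, the room available
    at the midpoint.\<close>
  define e where "e = 1 / (2 * (\<bar>p\<bar> + \<bar>r\<bar> + 1))"
  have e0: "e > 0" by (simp add: e_def add_nonneg_pos)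
  moreover have "midpoint a b - \<epsilon> *\<^sub>R ?n \<in> K" if \<epsilon>: "0 < \<epsilon>" "\<epsilon> \<le> e" for \<epsilon>
  proof -
    have eq: "midpoint a b - \<epsilon> *\<^sub>R ?n = a + (1/2 - \<epsilon> * p) *\<^sub>R (b - a) + (- \<epsilon> * r) *\<^sub>R (c - a)"
      unfolding n midpoint_def by (rule pt_eqI) (simp_all add: algebra_simps field_simps)
    have "\<epsilon> * (\<bar>p\<bar> + \<bar>r\<bar>) \<le> e * (\<bar>p\<bar> + \<bar>r\<bar> + 1)" using \<epsilon> by (intro mult_mono) auto
    also have "\<dots> = 1/2" unfolding e_def by (simp add: field_simps)
    finally have le: "\<epsilon> * \<bar>p\<bar> + \<epsilon> * \<bar>r\<bar> \<le> 1/2" by (simp add: distrib_left)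
    have "\<bar>\<epsilon> * p\<bar> = \<epsilon> * \<bar>p\<bar>" "\<bar>\<epsilon> * r\<bar> = \<epsilon> * \<bar>r\<bar>" using \<epsilon> by (simp_all add: abs_mult)
    moreover have "\<epsilon> * r < 0" using \<epsilon> r by (simp add: mult_pos_neg)
    ultimately have "0 \<le> 1/2 - \<epsilon> * p" "0 \<le> - \<epsilon> * r" "1/2 - \<epsilon> * p + - \<epsilon> * r \<le> 1"
      using le abs_ge_self[of "\<epsilon> * p"] abs_ge_minus_self[of "\<epsilon> * p"] by linarith+
    then show ?thesis unfolding eq unfolding K mem_tri_iff[OF nc] by blast
  qed
  ultimately show ?thesis by blast
qed

lemma lagrange_cr: "(norm u)\<^sup>2 * (norm w)\<^sup>2 = (cr u w)\<^sup>2 + (w \<bullet> u)\<^sup>2" for u w :: pt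
proof -
  have "(u1 * u1 + u2 * u2) * (w1 * w1 + w2 * w2) = (u1 * w2 - u2 * w1)\<^sup>2 + (w1 * u1 + w2 * u2)\<^sup>2" for u1 u2 w1 w2 :: real by algebra
  then show ?thesis unfolding power2_norm_eq_inner cr_def inner_pt by blast
qed

lemma triangulation_inter:
  assumes "triangulation \<Omega> T" "K \<in> T" "K' \<in> T" "K \<noteq> K'"
  shows "K \<inter> K' = {} \<or> (\<exists>v. v \<in> verts K \<and> v \<in> verts K' \<and> K \<inter> K' = {v}) \<or> (\<exists>E. E \<in> edges K \<and> E \<in> edges K' \<and> K \<inter> K' = E)"
  using assms unfolding triangulation_def by blast

text \<open>Two triangles on the same side of \<open>E\<close> share its endpoints and a point
  slightly inside, three points that are not collinear, whereas distinct triangles of a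
  triangulation meet at most in a common edge.\<close>

lemma edge_same_side:
  assumes T: "triangulation \<Omega> T" and K: "K1 \<in> T" "K2 \<in> T" and E: "E \<in> edges K1" "E \<in> edges K2"
    and eq: "outer_normal K1 E = outer_normal K2 E"
  shows "K1 = K2"
proof (rule ccontr)
  assume ne: "K1 \<noteq> K2"
  have t: "is_triangle K1" "is_triangle K2" using T K by (auto simp: triangulation_def)
  obtain a b c where 1: "E = closed_segment a b" "K1 = convex hull {a, b, c}" "cr (b - a) (c - a) \<noteq> 0" "a \<noteq> b" using edge_seg[OF t(1) E(1)] by metis
  obtain a' b' c' where 2: "E = closed_segment a' b'" "K2 = convex hull {a', b', c'}" "cr (b' - a') (c' - a') \<noteq> 0" using edge_seg[OF t(2) E(2)] by metis
  let ?n = "outer_normal K1 E"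
  have mm: "midpoint a' b' = midpoint a b"
  proof -
    have "{a', b'} = {a, b}" using trans[OF 2(1)[symmetric] 1(1)] unfolding closed_segment_eq .
    then show ?thesis unfolding doubleton_eq_iff using midpoint_sym[of b a] by (elim disjE conjE) simp_all
  qed
  obtain e1 where e1: "e1 > 0" "\<And>\<epsilon>. 0 < \<epsilon> \<Longrightarrow> \<epsilon> \<le> e1 \<Longrightarrow> midpoint a b - \<epsilon> *\<^sub>R ?n \<in> K1" using step_inside[OF 1(3,2), folded 1(1)] by blast
  obtain e2 where e2: "e2 > 0" "\<And>\<epsilon>. 0 < \<epsilon> \<Longrightarrow> \<epsilon> \<le> e2 \<Longrightarrow> midpoint a b - \<epsilon> *\<^sub>R ?n \<in> K2" using step_inside[OF 2(3,2), folded 2(1)] unfolding mm eq[symmetric] by blast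
  define x where "x = midpoint a b - min e1 e2 *\<^sub>R ?n"
  have x: "x \<in> K1 \<inter> K2" unfolding x_def using e1 e2 by simp
  have ab: "a \<in> K1 \<inter> K2" "b \<in> K1 \<inter> K2"
  proof -
    have "E \<subseteq> K1" unfolding 1 by (rule closed_segment_subset_convex_hull) (auto intro: hull_inc)
    moreover have "E \<subseteq> K2" unfolding 2 by (rule closed_segment_subset_convex_hull) (auto intro: hull_inc)
    ultimately show "a \<in> K1 \<inter> K2" "b \<in> K1 \<inter> K2" unfolding 1(1) by auto
  qed
  have "(\<exists>E'. E' \<in> edges K1 \<and> K1 \<inter> K2 = E')"
  proof -
    have "K1 \<inter> K2 = {} \<or> (\<exists>v. v \<in> verts K1 \<and> v \<in> verts K2 \<and> K1 \<inter> K2 = {v}) \<or> (\<exists>E. E \<in> edges K1 \<and> E \<in> edges K2 \<and> K1 \<inter> K2 = E)"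
      by (rule triangulation_inter[OF T K ne])
    moreover have "K1 \<inter> K2 \<noteq> {}" using ab by blast
    moreover have "K1 \<inter> K2 \<noteq> {v}" for v using ab 1(4) by (metis singletonD)
    ultimately show ?thesis by metis
  qed
  then obtain p q where "K1 \<inter> K2 = closed_segment p q" unfolding edges_def by blast
  then have "{a, b, x} \<subseteq> closed_segment p q" using ab x by blast
  then have "collinear {a, b, x}" using collinear_closed_segment collinear_subset by blast
  then have z: "cr (b - a) (x - a) = 0" by (simp add: collinear_cr)
  define \<delta> where "\<delta> = min e1 e2"
  have d: "\<delta> > 0" using e1 e2 by (simp add: \<delta>_def)
  have xa: "x - a = (1/2) *\<^sub>R (b - a) - \<delta> *\<^sub>R ?n" unfolding x_def \<delta>_def[symmetric] midpoint_def by (rule pt_eqI) (simp_all add: field_simps)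
  have "cr (b - a) (x - a) = - \<delta> * cr (b - a) ?n" unfolding xa
  proof -
    have "u1 * (1/2 * u2 - \<delta> * w2) - u2 * (1/2 * u1 - \<delta> * w1) = - \<delta> * (u1 * w2 - u2 * w1)" for u1 u2 w1 w2 :: real by algebra
    then show "cr (b - a) ((1/2) *\<^sub>R (b - a) - \<delta> *\<^sub>R ?n) = - \<delta> * cr (b - a) ?n" unfolding cr_def vector_minus_component vector_scaleR_component real_scaleR_def by blast
  qed
  then have z2: "cr (b - a) ?n = 0" using z d by simp
  have n0: "?n \<bullet> (b - a) = 0" "norm ?n = 1" using outer_normal_tri[OF 1(3,2)] unfolding 1(1) by simp_all
  have "(norm (b - a))\<^sup>2 * (norm ?n)\<^sup>2 = (cr (b - a) ?n)\<^sup>2 + (?n \<bullet> (b - a))\<^sup>2" by (rule lagrange_cr)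
  then show False using z2 n0 1(4) by simp
qed

lemma midpoint_shrink:
  fixes x y :: "pt"
  assumes "s * r = s - 1/2"
  shows "(1 - s) *\<^sub>R y + s *\<^sub>R ((1 - r) *\<^sub>R x + r *\<^sub>R y) = (1/2) *\<^sub>R (x + y)"
proof -
  have "(1 - s) * v + s * ((1 - r) * u + r * v) = (1/2) * (u + v)" for u v :: real using assms by algebra
  then show ?thesis by (intro pt_eqI) simp_all
qed

text \<open>By convexity an edge not contained in the boundary has its midpoint in
  \<open>\<Omega>\<close>. A short step across the midpoint enters a triangle that contains the
  midpoint and is not \<open>K\<close>. The midpoint is no vertex of \<open>K\<close> and on no
  other edge of it, so the common edge is \<open>E\<close>.\<close>

lemma edge_neighbour:
  assumes T: "triangulation \<Omega> T" and cx: "convex \<Omega>" "open \<Omega>" and K: "K \<in> T" and E: "E \<in> edges K"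
    and nf: "\<not> E \<subseteq> frontier \<Omega>"
  shows "\<exists>K'\<in>T. K' \<noteq> K \<and> E \<in> edges K'"
proof -
  have t: "is_triangle K" using T K by (auto simp: triangulation_def)
  obtain a b c where 1: "E = closed_segment a b" "K = convex hull {a, b, c}" "cr (b - a) (c - a) \<noteq> 0" "a \<noteq> b" using edge_seg[OF t E] by metis
  let ?n = "outer_normal K E" and ?m = "midpoint a b"
  have EK: "E \<subseteq> K" unfolding 1 by (rule closed_segment_subset_convex_hull) (auto intro: hull_inc)
  have KO: "K \<subseteq> closure \<Omega>" using T K by (auto simp: triangulation_def)
  have mE: "?m \<in> E" unfolding 1 by (simp add: midpoint_in_closed_segment)
  obtain x where x: "x \<in> E" "x \<in> interior \<Omega>" using nf EK KO unfolding frontier_def by blast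
  obtain r where r: "0 \<le> r" "r \<le> 1" "x = (1 - r) *\<^sub>R a + r *\<^sub>R b" using x(1) unfolding 1 in_segment by blast
  have shr: "(1 - s) *\<^sub>R y + s *\<^sub>R x \<in> interior \<Omega>" if "y \<in> closure \<Omega>" "0 < s" "s \<le> 1" for y s
  proof -
    have "y - s *\<^sub>R (y - x) \<in> interior \<Omega>" by (rule mem_interior_closure_convex_shrink[OF cx(1) x(2)]) (use that in auto)
    then show ?thesis by (simp add: algebra_simps)
  qed
  have abO: "a \<in> closure \<Omega>" "b \<in> closure \<Omega>" using EK KO unfolding 1 by auto
  have mO: "?m \<in> \<Omega>"
  proof (cases "r \<le> 1/2")
    case True
    \<comment> \<open>Here \<open>x\<close> is on the half of the edge next to \<open>a\<close>, so
      the midpoint lies between \<open>x\<close> and \<open>b\<close>, and this is its weight at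
      \<open>x\<close>. The other case is symmetric.\<close>
    define s where "s = 1 / (2 * (1 - r))"
    have s: "0 < s" "s \<le> 1" "s * (1 - r) = 1/2" using True by (auto simp: s_def field_simps)
    have "s * r = s - 1/2" using s(3) by (simp add: algebra_simps)
    then have "(1 - s) *\<^sub>R b + s *\<^sub>R x = ?m" using midpoint_shrink[of s r b a] unfolding r midpoint_def by simp
    then show ?thesis using shr[OF abO(2) s(1,2)] interior_subset by (metis subsetD)
  next
    case False
    define s where "s = 1 / (2 * r)"
    have s: "0 < s" "s \<le> 1" "s * r = 1/2" using False by (auto simp: s_def field_simps)
    have "s * (1 - r) = s - 1/2" using s(3) by (simp add: algebra_simps)
    then have "(1 - s) *\<^sub>R a + s *\<^sub>R x = ?m" using midpoint_shrink[of s "1 - r" a b] unfolding r midpoint_def by (simp add: add.commute)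
    then show ?thesis using shr[OF abO(1) s(1,2)] interior_subset by (metis subsetD)
  qed
  \<comment> \<open>A point near the midpoint and outside \<open>Z\<close> lies only in triangles
    that contain the midpoint.\<close>
  define Z where "Z = \<Union>{K'\<in>T. ?m \<notin> K'}"
  have clT: "closed K'" if "K' \<in> T" for K'
  proof -
    have "is_triangle K'" using T that by (simp add: triangulation_def)
    then show ?thesis unfolding is_triangle_def by (auto simp: compact_imp_closed finite_imp_compact_convex_hull)
  qed
  have "closed Z" unfolding Z_def using T clT by (intro closed_Union) (auto simp: triangulation_def)
  then have "open (\<Omega> - Z)" using cx(2) by (simp add: open_Diff)
  moreover have "?m \<in> \<Omega> - Z" using mO by (auto simp: Z_def)
  ultimately obtain e where e: "e > 0" "cball ?m e \<subseteq> \<Omega> - Z" by (meson open_contains_cball)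
  note N = outer_normal_tri[OF 1(3,2), folded 1(1)]
  have "?m + e *\<^sub>R ?n \<in> cball ?m e" using N(1) e(1) by (simp add: dist_norm)
  then have y: "?m + e *\<^sub>R ?n \<in> \<Omega>" "?m + e *\<^sub>R ?n \<notin> Z" using e(2) by auto
  then obtain K' where K': "K' \<in> T" "?m + e *\<^sub>R ?n \<in> K'"
  proof -
    have "\<Union>T = closure \<Omega>" using T unfolding triangulation_def by (elim conjE)
    moreover have "?m + e *\<^sub>R ?n \<in> closure \<Omega>" by (rule subsetD[OF closure_subset y(1)])
    ultimately show thesis using that by blast
  qed
  have m': "?m \<in> K'" using y(2) K' unfolding Z_def by blast
  have ne: "K' \<noteq> K"
  proof
    assume "K' = K"
    then have "?n \<bullet> (?m + e *\<^sub>R ?n - ?m) \<le> 0" using K'(2) by (intro outer_normal_le[OF t E _ mE]) simp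
    moreover have "?n \<bullet> ?n = 1" using N(1) by (simp add: norm_eq_1)
    ultimately show False using e(1) by simp
  qed
  have mK: "?m \<in> K \<inter> K'" using mE EK m' by blast
  have m: "?m - b = (1/2) *\<^sub>R (a - b)" "?m - a = (1/2) *\<^sub>R (b - a)" unfolding midpoint_def by (rule pt_eqI; simp add: field_simps)+
  have crm: "cr (?m - b) (c - b) \<noteq> 0" "cr (?m - a) (c - a) \<noteq> 0"
  proof -
    have half: "cr ((1/2) *\<^sub>R u) w = cr u w / 2" for u w by (simp add: cr_def field_simps)
    have "cr (a - b) (c - b) = - cr (b - a) (c - a)" by (simp add: cr_def algebra_simps)
    then show "cr (?m - b) (c - b) \<noteq> 0" "cr (?m - a) (c - a) \<noteq> 0" unfolding m half using 1(3) by simp_all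
  qed
  have "K \<inter> K' = {} \<or> (\<exists>v. v \<in> verts K \<and> v \<in> verts K' \<and> K \<inter> K' = {v}) \<or> (\<exists>E. E \<in> edges K \<and> E \<in> edges K' \<and> K \<inter> K' = E)"
    by (rule triangulation_inter[OF T K K'(1) ne[symmetric]])
  moreover have "\<not> (\<exists>v. v \<in> verts K \<and> v \<in> verts K' \<and> K \<inter> K' = {v})"
  proof
    assume "\<exists>v. v \<in> verts K \<and> v \<in> verts K' \<and> K \<inter> K' = {v}"
    then obtain v where v: "v \<in> verts K" "K \<inter> K' = {v}" by (elim exE conjE)
    have mv: "?m = v" using mK unfolding v(2) by (rule singletonD)
    have "v \<in> {a, b, c}" using v(1) unfolding 1(2) verts_tri[OF 1(3)] .
    then have "v = a \<or> v = b \<or> v = c" by simp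
    moreover have "cr 0 w = 0" "cr w w = 0" for w by (simp_all add: cr_def)
    ultimately show False using crm unfolding mv by auto
  qed
  ultimately obtain E' where E': "E' \<in> edges K" "E' \<in> edges K'" "K \<inter> K' = E'" using mK by blast
  have mE': "?m \<in> E'" using mK E' by simp
  have "E' \<in> {closed_segment a b, closed_segment b c, closed_segment a c}" using E'(1) edges_tri[OF 1(3)] 1(2) by simp
  moreover have "E' \<noteq> closed_segment b c"
  proof
    assume "E' = closed_segment b c"
    then have "?m \<in> closed_segment b c" using mE' by simp
    then obtain u where "?m = (1 - u) *\<^sub>R b + u *\<^sub>R c" unfolding in_segment by blast
    then have "?m - b = u *\<^sub>R (c - b)" by (simp add: algebra_simps)
    moreover have "cr (u *\<^sub>R w) w = 0" for w by (simp add: cr_def)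
    ultimately show False using crm(1) by metis
  qed
  moreover have "E' \<noteq> closed_segment a c"
  proof
    assume "E' = closed_segment a c"
    then have "?m \<in> closed_segment a c" using mE' by simp
    then obtain u where "?m = (1 - u) *\<^sub>R a + u *\<^sub>R c" unfolding in_segment by blast
    then have "?m - a = u *\<^sub>R (c - a)" by (simp add: algebra_simps)
    moreover have "cr (u *\<^sub>R w) w = 0" for w by (simp add: cr_def)
    ultimately show False using crm(2) by metis
  qed
  ultimately have "E' = E" using 1(1) by blast
  then show ?thesis using E' K' ne by blast
qed

text \<open>Sum edge by edge. An interior edge belongs to exactly two triangles: their unit normals
  are orthogonal to it and different by \<open>edge_same_side\<close>, hence opposite. The terms
  cancel since \<open>F\<close> is odd in the normal and \<open>g\<close> does not depend on the
  triangle.\<close>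

lemma flux_cancel:
  fixes g :: "pt set \<Rightarrow> real" and F :: "pt set \<Rightarrow> pt set \<Rightarrow> real"
  assumes T: "triangulation \<Omega> T" and cx: "convex \<Omega>" "open \<Omega>"
    and F: "\<And>K K' E. K \<in> T \<Longrightarrow> E \<in> edges K \<Longrightarrow> outer_normal K' E = - outer_normal K E \<Longrightarrow> F K' E = - F K E"
    and g: "\<And>K E. K \<in> T \<Longrightarrow> E \<in> edges K \<Longrightarrow> E \<subseteq> frontier \<Omega> \<Longrightarrow> g E = 0"
  shows "(\<Sum>K\<in>T. \<Sum>E\<in>edges K. g E * F K E) = 0"
proof -
  have tri: "is_triangle K" if "K \<in> T" for K using T that by (simp add: triangulation_def)
  have fT: "finite T" using T by (simp add: triangulation_def)
  let ?\<E> = "\<Union>K\<in>T. edges K"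
  have fE: "finite ?\<E>" using fT finite_edges tri by auto
  have "(\<Sum>K\<in>T. \<Sum>E\<in>edges K. g E * F K E) = (\<Sum>K\<in>T. \<Sum>E\<in>{E\<in>?\<E>. E \<in> edges K}. g E * F K E)"
    by (intro sum.cong refl) auto
  also have "\<dots> = (\<Sum>E\<in>?\<E>. \<Sum>K\<in>{K\<in>T. E \<in> edges K}. g E * F K E)"
    by (rule sum.swap_restrict[OF fT fE])
  also have "\<dots> = 0"
  proof (rule sum.neutral, rule ballI)
    fix E assume "E \<in> ?\<E>"
    then obtain K where K: "K \<in> T" "E \<in> edges K" by blast
    show "(\<Sum>K\<in>{K\<in>T. E \<in> edges K}. g E * F K E) = 0"
    proof (cases "E \<subseteq> frontier \<Omega>")
      case True
      then show ?thesis using g[OF K] by simp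
    next
      case False
      obtain K' where K': "K' \<in> T" "K' \<noteq> K" "E \<in> edges K'" using edge_neighbour[OF T cx K False] by blast
      obtain a b c where 1: "E = closed_segment a b" "K = convex hull {a, b, c}" "cr (b - a) (c - a) \<noteq> 0" "a \<noteq> b" using edge_seg[OF tri[OF K(1)] K(2)] by metis
      have pm: "outer_normal L E = outer_normal K E \<or> outer_normal L E = - outer_normal K E" if L: "L \<in> T" "E \<in> edges L" for L
      proof -
        obtain a' b' c' where 2: "E = closed_segment a' b'" "L = convex hull {a', b', c'}" "cr (b' - a') (c' - a') \<noteq> 0" using edge_seg[OF tri[OF L(1)] L(2)] by metis
        have "{a', b'} = {a, b}" using trans[OF 2(1)[symmetric] 1(1)] unfolding closed_segment_eq .
        then have ab: "b' - a' = b - a \<or> b' - a' = - (b - a)" unfolding doubleton_eq_iff by (elim disjE conjE) simp_all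
        have "outer_normal L E \<bullet> (b' - a') = 0" "norm (outer_normal L E) = 1" using outer_normal_tri[OF 2(3,2)] unfolding 2(1) by auto
        moreover have "outer_normal L E \<bullet> (b - a) = 0" using ab calculation(1) by (metis inner_minus_right neg_equal_0_iff_equal)
        moreover have "outer_normal K E \<bullet> (b - a) = 0" "norm (outer_normal K E) = 1" using outer_normal_tri[OF 1(3,2)] unfolding 1(1) by auto
        ultimately show ?thesis using 1(4) by (intro unit_perp[of _ "b - a"]) auto
      qed
      have op: "outer_normal K' E = - outer_normal K E"
        using pm[OF K'(1,3)] edge_same_side[OF T K'(1) K(1) K'(3) K(2)] K'(2) by blast
      have "{L\<in>T. E \<in> edges L} = {K, K'}"
      proof
        show "{L\<in>T. E \<in> edges L} \<subseteq> {K, K'}"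
        proof
          fix L assume "L \<in> {L\<in>T. E \<in> edges L}"
          then have L: "L \<in> T" "E \<in> edges L" by auto
          from pm[OF L] show "L \<in> {K, K'}"
          proof
            assume "outer_normal L E = outer_normal K E"
            then show ?thesis using edge_same_side[OF T L(1) K(1) L(2) K(2)] by simp
          next
            assume "outer_normal L E = - outer_normal K E"
            then show ?thesis using edge_same_side[OF T L(1) K'(1) L(2) K'(3)] op by simp
          qed
        qed
      qed (use K K' in auto)
      then have "(\<Sum>K\<in>{K\<in>T. E \<in> edges K}. g E * F K E) = g E * F K E + g E * F K' E"
        using K'(2) by simp
      also have "\<dots> = 0" using F[OF K op] by simp
      finally show ?thesis .
    qed
  qed
  finally show ?thesis .
qed

section \<open>Edge means and fluxes of the position field\<close>

definition emean :: "pt set \<Rightarrow> (pt \<Rightarrow> real) \<Rightarrow> real" where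
  "emean E g = edge_int E g / edge_int E (\<lambda>_. 1)"

definition flux :: "pt set \<Rightarrow> pt set \<Rightarrow> real" where
  "flux K E = edge_int E (\<lambda>x. x \<bullet> outer_normal K E)"

lemma avg_cong: "(\<And>x. x \<in> closed_segment a b \<Longrightarrow> f x = g x) \<Longrightarrow> avg a b f = avg a b g"
  unfolding avg_def by (rule integral_cong) (simp add: seg_mem)

lemma avg_const: "avg a b (\<lambda>_. k) = k"
  by (simp add: avg_def)

lemma edge_int_cong:
  assumes "a \<noteq> b" "E = closed_segment a b" "\<And>x. x \<in> E \<Longrightarrow> f x = g x"
  shows "edge_int E f = edge_int E g"
  using assms avg_cong[of a b f g] by (simp add: edge_int_seg)

lemma emean_seg: "a \<noteq> b \<Longrightarrow> emean (closed_segment a b) g = avg a b g"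
  by (simp add: emean_def edge_int_seg avg_const)

lemma avg_bound:
  assumes "continuous_on (closed_segment a b) g" "\<And>x. x \<in> closed_segment a b \<Longrightarrow> \<bar>g x\<bar> \<le> B"
  shows "\<bar>avg a b g\<bar> \<le> B"
proof -
  have "norm (integral (cbox 0 1) (\<lambda>t::real. g (a + t *\<^sub>R (b - a)))) \<le> B * measure lborel (cbox 0 (1::real))"
  proof (rule integrable_bound)
    show "0 \<le> B" using assms(2)[of a] by force
    show "(\<lambda>t. g (a + t *\<^sub>R (b - a))) integrable_on cbox 0 1"
      by (intro integrable_continuous continuous_on_compose2[OF assms(1)]) (auto intro!: continuous_intros seg_mem)
    fix t :: real assume "t \<in> cbox 0 1"
    then show "norm (g (a + t *\<^sub>R (b - a))) \<le> B" using assms(2)[OF seg_mem[of t a b]] by simp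
  qed
  then show ?thesis by (simp add: avg_def)
qed

lemma tri_measure:
  assumes "is_triangle K"
  shows "measure lebesgue K = integral K (\<lambda>_. 1)" "measure lebesgue K > 0" "K \<in> lmeasurable"
proof -
  obtain a b c where K: "K = convex hull {a, b, c}" using assms by (auto simp: is_triangle_cr)
  show l: "K \<in> lmeasurable" by (rule lmeasurable_compact[OF tri_borel(3)[OF K]])
  then show "measure lebesgue K = integral K (\<lambda>_. 1)" by (rule lmeasure_integral)
  have "\<not> negligible K" using open_not_negligible[OF open_interior interior_tri[OF assms]] negligible_subset[OF _ interior_subset] by blast
  then show "measure lebesgue K > 0" using l negligible_iff_measure[of K] zero_less_measure_iff by blast
qed

lemma gdiff_const: "gdiff {} (\<lambda>_. k) (\<lambda>_. 0)"
  unfolding gdiff_def lines_def by (auto intro!: derivative_eq_intros boundedI)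

text \<open>Green's formula with \<open>\<phi> = 1\<close>: the position field has divergence
  2.\<close>

lemma flux_sum:
  assumes T: "is_triangle K" shows "(\<Sum>E\<in>edges K. flux K E) = 2 * measure lebesgue K"
proof -
  have tr: "trace (mat 1 :: real^2^2) = 2" by (simp add: trace_pt mat_def)
  have "(\<Sum>E\<in>edges K. flux K E) = integral K (\<lambda>x. 2)"
    using green_affine[OF T gdiff_const[of 1], of 0 "mat 1"] unfolding tr by (simp add: flux_def)
  also have "\<dots> = 2 * measure lebesgue K" unfolding tri_measure(1)[OF T] by (rule integral_const_K)
  finally show ?thesis .
qed

lemma edge_sub:
  assumes T: "is_triangle K" and E: "E \<in> edges K" shows "E \<subseteq> K"
proof -
  obtain a b c where 1: "E = closed_segment a b" "K = convex hull {a, b, c}" using edge_seg[OF T E] by metis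
  show ?thesis unfolding 1 by (rule closed_segment_subset_convex_hull) (auto intro: hull_inc)
qed

lemma flux_bound:
  assumes T: "is_triangle K" and E: "E \<in> edges K" and R: "\<And>x. x \<in> K \<Longrightarrow> norm x \<le> R"
  shows "\<bar>flux K E\<bar> \<le> diameter K * R"
proof -
  obtain a b c where 1: "E = closed_segment a b" "K = convex hull {a, b, c}" "cr (b - a) (c - a) \<noteq> 0" "a \<noteq> b" using edge_seg[OF T E] by metis
  note EK = edge_sub[OF T E]
  have n: "norm (outer_normal K E) = 1" using outer_normal_tri[OF 1(3,2)] unfolding 1(1) by simp
  have "\<bar>avg a b (\<lambda>x. x \<bullet> outer_normal K E)\<bar> \<le> R"
  proof (rule avg_bound)
    fix x assume "x \<in> closed_segment a b"
    then have "norm x \<le> R" using R EK 1(1) by blast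
    then show "\<bar>x \<bullet> outer_normal K E\<bar> \<le> R" using Cauchy_Schwarz_ineq2[of x "outer_normal K E"] n by simp
  qed (intro continuous_intros)
  moreover have "dist a b \<le> diameter K" using EK tri_borel(2)[OF 1(2)] unfolding 1(1) by (intro diameter_bounded_bound) auto
  moreover have "\<bar>flux K E\<bar> = dist a b * \<bar>avg a b (\<lambda>x. x \<bullet> outer_normal K E)\<bar>" unfolding flux_def using 1(4) by (simp add: 1(1) edge_int_seg abs_mult)
  moreover have "dist a b \<ge> 0" "\<bar>avg a b (\<lambda>x. x \<bullet> outer_normal K E)\<bar> \<ge> 0" by simp_all
  ultimately show ?thesis using mult_mono[of "dist a b" "diameter K" "\<bar>avg a b (\<lambda>x. x \<bullet> outer_normal K E)\<bar>" R] by linarith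
qed

lemma flux_opposite:
  assumes T: "is_triangle K" and E: "E \<in> edges K" and op: "outer_normal K' E = - outer_normal K E"
  shows "flux K' E = - flux K E"
proof -
  obtain a b c where 1: "E = closed_segment a b" "a \<noteq> b" using edge_seg[OF T E] by metis
  show ?thesis unfolding flux_def op using edge_int_mult[OF 1(2,1), of "-1" "\<lambda>x. x \<bullet> outer_normal K E"] by simp
qed

lemma is_wgrad_cont: "is_wgrad v K G \<Longrightarrow> continuous_on S G"
proof -
  assume "is_wgrad v K G"
  then obtain c A where "\<And>x. G x = c + A *v x" unfolding is_wgrad_def by blast
  then have "G = (\<lambda>x. c + A *v x)" by blast
  then show ?thesis by (auto intro!: continuous_intros matrix_vector_mult_linear_continuous_on)
qed

text \<open>The test field \<open>x - c\<close> is tangential on the two edges through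
  \<open>c\<close> and has constant normal component \<open>k\<close> on \<open>E\<close>, so of the
  boundary terms only the mean over \<open>E\<close> survives. Green's formula with
  \<open>\<phi> = 1\<close> shows that \<open>k\<close> times the length of \<open>E\<close> is
  twice the area.\<close>

lemma edge_mean_identity:
  assumes T: "is_triangle K" and G: "is_wgrad v K G"
    and 1: "E = closed_segment a b" "K = convex hull {a, b, c}" "cr (b - a) (c - a) \<noteq> 0"
  shows "integral K (\<lambda>x. G x \<bullet> (x - c)) = 2 * measure lebesgue K * (emean E (snd v E) - fst v K)"
proof -
  let ?q = "\<lambda>x. - c + mat 1 *v x"
  have q: "?q x = x - c" for x :: pt by simp
  have ab: "a \<noteq> b" "b \<noteq> c" "a \<noteq> c" using cr_distinct[OF 1(3)] by auto
  have Kb: "K = convex hull {b, c, a}" and Kc: "K = convex hull {a, c, b}" by (simp_all add: 1 insert_commute)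
  have ncb: "cr (c - b) (a - b) \<noteq> 0" and ncc: "cr (c - a) (b - a) \<noteq> 0" using 1(3) cr_cycle[of c b a] cr_swap[of "c - a" "b - a"] by simp_all
  define k where "k = (a - c) \<bullet> outer_normal K E"
  have e1: "edge_int E (\<lambda>x. \<psi> x * (?q x \<bullet> outer_normal K E)) = k * edge_int E \<psi>" for \<psi>
  proof -
    have "edge_int E (\<lambda>x. \<psi> x * (?q x \<bullet> outer_normal K E)) = edge_int E (\<lambda>x. k * \<psi> x)"
    proof (rule edge_int_cong[OF ab(1) 1(1)])
      fix x assume "x \<in> E"
      then obtain u where "x = (1 - u) *\<^sub>R a + u *\<^sub>R b" unfolding 1 in_segment by blast
      then have "x - c = (a - c) + u *\<^sub>R (b - a)" by (simp add: algebra_simps)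
      then have "(x - c) \<bullet> outer_normal K E = ((a - c) + u *\<^sub>R (b - a)) \<bullet> outer_normal K E" by (rule arg_cong)
      then have "(x - c) \<bullet> outer_normal K E = k + u * ((b - a) \<bullet> outer_normal K E)" by (simp only: k_def inner_add_left inner_scaleR_left)
      then show "\<psi> x * (?q x \<bullet> outer_normal K E) = k * \<psi> x"
        using outer_normal_tri(2)[OF 1(3,2)] unfolding q 1(1)[symmetric] by (simp add: inner_commute)
    qed
    then show ?thesis by (simp add: edge_int_mult[OF ab(1) 1(1)])
  qed
  have e0: "edge_int E' (\<lambda>x. \<psi> x * (?q x \<bullet> outer_normal K E')) = 0"
    if "E' = closed_segment b c \<or> E' = closed_segment a c" for E' \<psi>
  proof -
    have "\<exists>d. E' = closed_segment d c \<and> d \<noteq> c \<and> outer_normal K E' \<bullet> (c - d) = 0"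
      using that ab outer_normal_tri(2)[OF ncb Kb] outer_normal_tri(2)[OF ncc Kc] by (elim disjE) blast+
    then obtain d where d: "E' = closed_segment d c" "d \<noteq> c" "outer_normal K E' \<bullet> (c - d) = 0" by blast
    have "edge_int E' (\<lambda>x. \<psi> x * (?q x \<bullet> outer_normal K E')) = edge_int E' (\<lambda>x. 0 * \<psi> x)"
    proof (rule edge_int_cong[OF d(2,1)])
      fix x assume "x \<in> E'"
      then obtain u where "x = (1 - u) *\<^sub>R d + u *\<^sub>R c" unfolding d in_segment by blast
      then have "x - c = - ((1 - u) *\<^sub>R (c - d))" by (simp add: algebra_simps)
      then have "(x - c) \<bullet> outer_normal K E' = 0" using d(3) by (simp add: inner_commute)
      then show "\<psi> x * (?q x \<bullet> outer_normal K E') = 0 * \<psi> x" unfolding q by simp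
    qed
    then show ?thesis using edge_int_mult[OF d(2,1), of 0 \<psi>] by simp
  qed
  have S: "(\<Sum>E'\<in>edges K. edge_int E' (\<lambda>x. \<psi> E' x * (?q x \<bullet> outer_normal K E'))) = k * edge_int E (\<psi> E)" for \<psi>
    unfolding 1(2) sum_edges_tri[OF 1(3)] unfolding 1(2)[symmetric] using e0[of "closed_segment b c"] e0[of "closed_segment a c"] e1 unfolding 1(1)[symmetric] by simp
  have tr: "trace (mat 1 :: real^2^2) = 2" by (simp add: trace_pt mat_def)
  have "(\<Sum>E'\<in>edges K. edge_int E' (\<lambda>x. 1 * (?q x \<bullet> outer_normal K E'))) = integral K (\<lambda>x. 2)"
    using green_affine[OF T gdiff_const[of 1], of "- c" "mat 1"] unfolding tr by simp
  then have kd: "k * edge_int E (\<lambda>_. 1) = 2 * measure lebesgue K"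
    unfolding S[of "\<lambda>_ _. 1"] tri_measure(1)[OF T] by (simp only: integral_const_K[of K 2])
  have "integral K (\<lambda>x. G x \<bullet> ?q x) = - integral K (\<lambda>x. fst v K * 2) + k * edge_int E (snd v E)"
    using G unfolding is_wgrad_def tr[symmetric] S[symmetric] by blast
  also have "integral K (\<lambda>x. fst v K * 2) = fst v K * 2 * measure lebesgue K"
    unfolding tri_measure(1)[OF T] by (rule integral_const_K)
  also have "edge_int E (snd v E) = edge_int E (\<lambda>_. 1) * emean E (snd v E)"
    using ab(1) by (simp add: emean_def 1(1) edge_int_seg avg_const)
  finally show ?thesis using kd unfolding q by (simp add: algebra_simps)
qed

text \<open>Cauchy-Schwarz for \<open>edge_mean_identity\<close>, with
  \<open>norm (x - c) \<le> h\<close>, carried out by a pointwise completed square.\<close>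

lemma edge_mean_estimate:
  assumes T: "is_triangle K" and G: "is_wgrad v K G" and E: "E \<in> edges K" and h: "diameter K \<le> h"
  shows "4 * measure lebesgue K * (emean E (snd v E) - fst v K)\<^sup>2 \<le> h\<^sup>2 * integral K (\<lambda>x. G x \<bullet> G x)"
proof -
  obtain a b c where 1: "E = closed_segment a b" "K = convex hull {a, b, c}" "cr (b - a) (c - a) \<noteq> 0" "a \<noteq> b" using edge_seg[OF T E] by metis
  define d where "d = emean E (snd v E) - fst v K"
  define m where "m = measure lebesgue K"
  define I where "I = integral K (\<lambda>x. G x \<bullet> G x)"
  note bK = tri_borel(2)[OF 1(2)]
  have abcK: "a \<in> K" "b \<in> K" "c \<in> K" unfolding 1 by (auto intro: hull_inc)
  have h0: "h > 0" using diameter_bounded_bound[OF bK abcK(1,2)] 1(4) h zero_less_dist_iff[of a b] by linarith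
  \<comment> \<open>Minimizes \<open>I + s\<^sup>2 * h\<^sup>2 * m - 4 * s * m * d\<close> over
    \<open>s\<close>.\<close>
  define s where "s = 2 * d / h\<^sup>2"
  have pw: "2 * s * (G x \<bullet> (x - c)) \<le> G x \<bullet> G x + s\<^sup>2 * h\<^sup>2" if x: "x \<in> K" for x
  proof -
    have "0 \<le> (G x - s *\<^sub>R (x - c)) \<bullet> (G x - s *\<^sub>R (x - c))" by simp
    also have "\<dots> = G x \<bullet> G x - 2 * s * (G x \<bullet> (x - c)) + s\<^sup>2 * ((x - c) \<bullet> (x - c))"
      by (simp add: inner_diff_left inner_diff_right inner_commute power2_eq_square algebra_simps)
    finally have 1: "2 * s * (G x \<bullet> (x - c)) \<le> G x \<bullet> G x + s\<^sup>2 * ((x - c) \<bullet> (x - c))" by simp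
    have "norm (x - c) \<le> h" using diameter_bounded_bound[OF bK x abcK(3)] h by (simp add: dist_norm)
    then have "(x - c) \<bullet> (x - c) \<le> h\<^sup>2" unfolding power2_norm_eq_inner[symmetric] by (rule power_mono) simp
    then have "s\<^sup>2 * ((x - c) \<bullet> (x - c)) \<le> s\<^sup>2 * h\<^sup>2" by (rule mult_left_mono) simp
    then show ?thesis using 1 by linarith
  qed
  note cG = is_wgrad_cont[OF G]
  have i1: "(\<lambda>x. 2 * s * (G x \<bullet> (x - c))) integrable_on K" by (intro cont_integrable[OF _ T] continuous_intros cG)
  have i2: "(\<lambda>x. G x \<bullet> G x) integrable_on K" by (intro cont_integrable[OF _ T] continuous_intros cG)
  have i3: "(\<lambda>x. s\<^sup>2 * h\<^sup>2) integrable_on K" by (intro cont_integrable[OF _ T] continuous_intros)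
  have "integral K (\<lambda>x. 2 * s * (G x \<bullet> (x - c))) \<le> integral K (\<lambda>x. G x \<bullet> G x + s\<^sup>2 * h\<^sup>2)"
    by (rule integral_le[OF i1 integrable_add[OF i2 i3] pw])
  also have "\<dots> = I + s\<^sup>2 * h\<^sup>2 * m" unfolding integral_add[OF i2 i3] integral_const_K[of K "s\<^sup>2 * h\<^sup>2"] I_def m_def tri_measure(1)[OF T] by simp
  also have "integral K (\<lambda>x. 2 * s * (G x \<bullet> (x - c))) = 2 * s * (2 * m * d)"
    unfolding m_def d_def edge_mean_identity[OF T G 1(1-3), symmetric] by simp
  finally have "2 * s * (2 * m * d) \<le> I + s\<^sup>2 * h\<^sup>2 * m" .
  then have "h\<^sup>2 * (2 * s * (2 * m * d)) \<le> h\<^sup>2 * (I + s\<^sup>2 * h\<^sup>2 * m)" by (rule mult_left_mono) simp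
  moreover have hs: "h\<^sup>2 * s = 2 * d" using h0 by (simp add: s_def)
  have "h\<^sup>2 * (2 * s * (2 * m * d)) = (h\<^sup>2 * s) * (4 * m * d)" "h\<^sup>2 * (I + s\<^sup>2 * h\<^sup>2 * m) = h\<^sup>2 * I + (h\<^sup>2 * s) * (h\<^sup>2 * s) * m" by algebra+
  ultimately have "2 * d * (4 * m * d) \<le> h\<^sup>2 * I + 2 * d * (2 * d) * m" unfolding hs by metis
  then have "4 * m * d\<^sup>2 \<le> h\<^sup>2 * I" by (simp add: power2_eq_square algebra_simps)
  then show ?thesis by (simp add: m_def d_def I_def)
qed

text \<open>By \<open>flux_sum\<close>, two copies of \<open>m * w\<^sup>2\<close> equal the sum of
  \<open>w\<^sup>2\<close> times the fluxes. Replacing \<open>w\<close> by the edge means costs per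
  edge at most a third of \<open>m * w\<^sup>2\<close> plus a gradient term, so the three edges
  absorb one copy and leave the other. The edge terms are kept because they cancel only in the sum
  over the triangulation.\<close>

lemma element_poincare:
  assumes T: "is_triangle K" and G: "is_wgrad v K G" and R: "\<And>x. x \<in> K \<Longrightarrow> norm x \<le> R"
    and \<kappa>: "(diameter K)\<^sup>2 \<le> \<kappa> * measure lebesgue K"
  shows "(fst v K)\<^sup>2 * measure lebesgue K \<le> (\<Sum>E\<in>edges K. (emean E (snd v E))\<^sup>2 * flux K E)
    + 3/4 * \<kappa> * (3 * \<kappa> + 2) * R\<^sup>2 * integral K (\<lambda>x. G x \<bullet> G x)"
proof -
  define h where "h = diameter K"
  define m where "m = measure lebesgue K"
  define I where "I = integral K (\<lambda>x. G x \<bullet> G x)"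
  define w where "w = fst v K"
  obtain a b c where K: "K = convex hull {a, b, c}" and nc: "cr (b - a) (c - a) \<noteq> 0" using T by (auto simp: is_triangle_cr)
  have m0: "m > 0" unfolding m_def by (rule tri_measure(2)[OF T])
  have "a \<in> K" unfolding K by (simp add: hull_inc)
  then have R0: "R \<ge> 0" using R[of a] norm_ge_zero[of a] by linarith
  have h0: "h \<ge> 0" unfolding h_def by (rule diameter_ge_0[OF tri_borel(2)[OF K]])
  \<comment> \<open>Lets \<open>h * R * d\<^sup>2\<close> be bounded by
    \<open>2 * R * R * d\<^sup>2\<close>, the source of the summand 2 in the constant.\<close>
  have h2: "h \<le> 2 * R" unfolding h_def
  proof (rule diameter_le)
    show "K \<noteq> {} \<or> 0 \<le> 2 * R" using R0 by simp
    fix x y assume "x \<in> K" "y \<in> K"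
    then show "norm (x - y) \<le> 2 * R" using norm_triangle_ineq4[of x y] R[of x] R[of y] by linarith
  qed
  have \<kappa>0: "\<kappa> \<ge> 0"
  proof (rule ccontr)
    assume "\<not> \<kappa> \<ge> 0"
    then have "\<kappa> * m < 0" using m0 by (simp add: mult_neg_pos)
    then show False using \<kappa> unfolding m_def[symmetric] by (smt (verit) zero_le_power2)
  qed
  have each: "(w\<^sup>2 - (emean E (snd v E))\<^sup>2) * flux K E \<le> 1/3 * m * w\<^sup>2 + 1/4 * \<kappa> * (3 * \<kappa> + 2) * R\<^sup>2 * I" if E: "E \<in> edges K" for E
  proof -
    define e where "e = emean E (snd v E)"
    define d where "d = \<bar>e - w\<bar>"
    have d2: "4 * m * d\<^sup>2 \<le> h\<^sup>2 * I" using edge_mean_estimate[OF T G E, of h] by (simp add: h_def d_def e_def w_def m_def I_def)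
    have f: "\<bar>flux K E\<bar> \<le> h * R" unfolding h_def by (rule flux_bound[OF T E R])
    have "w\<^sup>2 - e\<^sup>2 = (w - e) * (2 * w + (e - w))" by algebra
    then have "\<bar>w\<^sup>2 - e\<^sup>2\<bar> = d * \<bar>2 * w + (e - w)\<bar>" by (simp add: d_def abs_mult abs_minus_commute)
    also have "\<dots> \<le> d * (2 * \<bar>w\<bar> + d)" by (rule mult_left_mono) (auto simp: d_def)
    finally have w: "\<bar>w\<^sup>2 - e\<^sup>2\<bar> \<le> d * (2 * \<bar>w\<bar> + d)" .
    have "(w\<^sup>2 - e\<^sup>2) * flux K E \<le> \<bar>w\<^sup>2 - e\<^sup>2\<bar> * \<bar>flux K E\<bar>" by (metis abs_ge_self abs_mult)
    also have "\<dots> \<le> d * (2 * \<bar>w\<bar> + d) * (h * R)" by (rule mult_mono[OF w f]) (auto simp: d_def)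
    also have "\<dots> = 2 * \<bar>w\<bar> * (h * R * d) + h * R * d\<^sup>2" by (simp add: power2_eq_square algebra_simps)
    also have "\<dots> \<le> 2 * \<bar>w\<bar> * (h * R * d) + 2 * R * R * d\<^sup>2" using h2 R0 by (intro add_left_mono mult_right_mono) auto
    finally have 1: "(w\<^sup>2 - e\<^sup>2) * flux K E \<le> 2 * \<bar>w\<bar> * (h * R * d) + 2 * R * R * d\<^sup>2" .
    \<comment> \<open>Young's inequality with the weight that leaves one third of
      \<open>m * w\<^sup>2\<close> for each of the three edges.\<close>
    have amgm: "2 * \<bar>w\<bar> * y \<le> 1/3 * m * w\<^sup>2 + 3 * (y\<^sup>2 / m)" for y
    proof -
      have "0 \<le> (m * \<bar>w\<bar> - 3 * y)\<^sup>2 / (3 * m)" using m0 by simp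
      also have "\<dots> = 1/3 * m * w\<^sup>2 + 3 * (y\<^sup>2 / m) - 2 * \<bar>w\<bar> * y"
        using m0 by (simp add: power2_diff power_mult_distrib field_simps power2_eq_square)
      finally show ?thesis by simp
    qed
    have "h\<^sup>2 * I \<le> (\<kappa> * m) * I"
      using \<kappa> unfolding h_def[symmetric] m_def[symmetric]
    proof (rule mult_right_mono)
      show "0 \<le> I" unfolding I_def by (rule integral_nonneg) (auto intro!: cont_integrable[OF _ T] continuous_intros is_wgrad_cont[OF G])
    qed
    then have "m * (4 * d\<^sup>2) \<le> m * (\<kappa> * I)" using d2 by (simp add: algebra_simps)
    then have d3: "d\<^sup>2 \<le> 1/4 * \<kappa> * I" using m0 by simp
    have "(h * R * d)\<^sup>2 / m = h\<^sup>2 * (R\<^sup>2 * d\<^sup>2) / m" by (simp add: power_mult_distrib)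
    also have "\<dots> \<le> (\<kappa> * m) * (R\<^sup>2 * d\<^sup>2) / m" using m0 \<kappa> unfolding h_def[symmetric] m_def[symmetric] by (intro divide_right_mono mult_right_mono) auto
    also have "\<dots> = \<kappa> * R\<^sup>2 * d\<^sup>2" using m0 by simp
    finally have "2 * \<bar>w\<bar> * (h * R * d) \<le> 1/3 * m * w\<^sup>2 + 3 * (\<kappa> * R\<^sup>2 * d\<^sup>2)" using amgm[of "h * R * d"] by linarith
    then have "(w\<^sup>2 - e\<^sup>2) * flux K E \<le> 1/3 * m * w\<^sup>2 + (3 * \<kappa> + 2) * R\<^sup>2 * d\<^sup>2" using 1 by (simp add: power2_eq_square algebra_simps)
    also have "(3 * \<kappa> + 2) * R\<^sup>2 * d\<^sup>2 \<le> (3 * \<kappa> + 2) * R\<^sup>2 * (1/4 * \<kappa> * I)" using d3 \<kappa>0 by (intro mult_left_mono) auto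
    finally show ?thesis by (simp add: e_def algebra_simps)
  qed
  have "2 * m * w\<^sup>2 - (\<Sum>E\<in>edges K. (emean E (snd v E))\<^sup>2 * flux K E) = (\<Sum>E\<in>edges K. (w\<^sup>2 - (emean E (snd v E))\<^sup>2) * flux K E)"
    by (simp add: left_diff_distrib sum_subtractf m_def flux_sum[OF T] flip: sum_distrib_left)
  also have "\<dots> \<le> (\<Sum>E\<in>edges K. 1/3 * m * w\<^sup>2 + 1/4 * \<kappa> * (3 * \<kappa> + 2) * R\<^sup>2 * I)" by (rule sum_mono[OF each])
  also have "\<dots> = m * w\<^sup>2 + 3/4 * \<kappa> * (3 * \<kappa> + 2) * R\<^sup>2 * I" unfolding K sum_edges_tri[OF nc] by (simp add: field_simps)
  finally show ?thesis unfolding m_def[symmetric] w_def[symmetric] I_def[symmetric] by (simp add: algebra_simps)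
qed

text \<open>The edge terms of all elements cancel by \<open>flux_cancel\<close>, as edge means are
  single-valued and vanish on the boundary.\<close>

lemma discrete_poincare:
  assumes T: "triangulation \<Omega> T" and cx: "convex \<Omega>" "open \<Omega>" and R: "\<And>x. x \<in> closure \<Omega> \<Longrightarrow> norm x \<le> R"
    and \<sigma>: "shape_regular \<sigma> T" "\<sigma> > 0" and v: "v \<in> Sh0 \<Omega> T"
  shows "(\<Sum>K\<in>T. (fst v K)\<^sup>2 * measure lebesgue K) \<le>
    3/4 * (\<sigma>\<^sup>2 / pi) * (3 * (\<sigma>\<^sup>2 / pi) + 2) * R\<^sup>2 * (\<Sum>K\<in>T. integral K (\<lambda>x. wgrad v K x \<bullet> wgrad v K x))"
proof -
  let ?\<kappa> = "\<sigma>\<^sup>2 / pi"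
  have tri: "is_triangle K" if "K \<in> T" for K using T that by (simp add: triangulation_def)
  have "(\<Sum>K\<in>T. (fst v K)\<^sup>2 * measure lebesgue K) \<le> (\<Sum>K\<in>T. (\<Sum>E\<in>edges K. (emean E (snd v E))\<^sup>2 * flux K E)
    + 3/4 * ?\<kappa> * (3 * ?\<kappa> + 2) * R\<^sup>2 * integral K (\<lambda>x. wgrad v K x \<bullet> wgrad v K x))"
  proof (rule sum_mono)
    fix K assume K: "K \<in> T"
    \<comment> \<open>The only use of shape regularity: the disc of radius
      \<open>diameter K / \<sigma>\<close> inside \<open>K\<close> bounds the area from below, which
      gives \<open>?\<kappa>\<close>.\<close>
    obtain x where x: "cball x (diameter K / \<sigma>) \<subseteq> K" using \<sigma>(1) K unfolding shape_regular_def by blast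
    have "(diameter K)\<^sup>2 \<le> ?\<kappa> * measure lebesgue K"
    proof -
      have r0: "diameter K / \<sigma> \<ge> 0" using \<sigma>(2) tri[OF K] by (auto simp: is_triangle_cr intro!: divide_nonneg_pos diameter_ge_0 tri_borel(2)[OF refl])
      have "measure lebesgue (cball x (diameter K / \<sigma>)) \<le> measure lebesgue K"
        using x tri_measure(3)[OF tri[OF K]] by (intro measure_mono_fmeasurable) (auto simp: fmeasurableD)
      also have "measure lebesgue (cball x (diameter K / \<sigma>)) = pi * (diameter K / \<sigma>)\<^sup>2"
        using content_cball[OF r0, of x] by (simp add: unit_ball_vol_2)
      finally show ?thesis using \<sigma>(2) by (simp add: field_simps)
    qed
    moreover have "K \<subseteq> closure \<Omega>" using T K by (auto simp: triangulation_def)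
    ultimately show "(fst v K)\<^sup>2 * measure lebesgue K \<le> (\<Sum>E\<in>edges K. (emean E (snd v E))\<^sup>2 * flux K E)
      + 3/4 * ?\<kappa> * (3 * ?\<kappa> + 2) * R\<^sup>2 * integral K (\<lambda>x. wgrad v K x \<bullet> wgrad v K x)"
      using R by (intro element_poincare[OF tri[OF K] is_wgrad_wgrad[OF tri[OF K] Sh0_nice[OF v K]]]) auto
  qed
  also have "\<dots> = (\<Sum>K\<in>T. \<Sum>E\<in>edges K. (emean E (snd v E))\<^sup>2 * flux K E) +
     3/4 * ?\<kappa> * (3 * ?\<kappa> + 2) * R\<^sup>2 * (\<Sum>K\<in>T. integral K (\<lambda>x. wgrad v K x \<bullet> wgrad v K x))"
    by (simp add: sum.distrib sum_distrib_left)
  also have "(\<Sum>K\<in>T. \<Sum>E\<in>edges K. (emean E (snd v E))\<^sup>2 * flux K E) = 0"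
  proof (rule flux_cancel[OF T cx])
    fix K E assume KE: "K \<in> T" "E \<in> edges K" "E \<subseteq> frontier \<Omega>"
    obtain a b c where 1: "E = closed_segment a b" "a \<noteq> b" using edge_seg[OF tri[OF KE(1)] KE(2)] by metis
    have "\<And>x. x \<in> E \<Longrightarrow> snd v E x = 0" using v KE unfolding Sh0_def by blast
    then have "avg a b (snd v E) = avg a b (\<lambda>_. 0)" unfolding 1 by (intro avg_cong) auto
    then have "emean E (snd v E) = 0" using 1 emean_seg[OF 1(2), of "snd v E"] by (simp add: avg_const)
    then show "(emean E (snd v E))\<^sup>2 = 0" by simp
  next
    fix K K' E assume "K \<in> T" "E \<in> edges K" "outer_normal K' E = - outer_normal K E"
    then show "flux K' E = - flux K E" using flux_opposite tri by blast
  qed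
  finally show ?thesis by simp
qed

section \<open>Fortin interpolation\<close>

lemma integral_id_01: "integral {0..1} (\<lambda>t::real. t) = 1/2" "integral {0..1} (\<lambda>t::real. t * t) = 1/3"
proof -
  have "((\<lambda>t::real. t) has_integral (1\<^sup>2/2 - 0\<^sup>2/2)) {0..1}"
    by (rule fundamental_theorem_of_calculus) (auto intro!: derivative_eq_intros simp flip: has_real_derivative_iff_has_vector_derivative)
  then show "integral {0..1} (\<lambda>t::real. t) = 1/2" by (simp add: integral_unique)
  have "((\<lambda>t::real. t * t) has_integral (1^3/3 - 0^3/3)) {0..1}"
    by (rule fundamental_theorem_of_calculus) (auto intro!: derivative_eq_intros simp: power2_eq_square simp flip: has_real_derivative_iff_has_vector_derivative)
  then show "integral {0..1} (\<lambda>t::real. t * t) = 1/3" by (simp add: integral_unique)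
qed

text \<open>Affine weights see only the mean and the first moment along the edge, so the projection
  below has just two equations to satisfy.\<close>

lemma avg_moments:
  assumes "continuous_on (closed_segment a b) g"
  shows "avg a b (\<lambda>x. g x * (d + z \<bullet> x)) = (d + z \<bullet> a) * avg a b g + (z \<bullet> (b - a)) * integral {0..1} (\<lambda>t. t * g (a + t *\<^sub>R (b - a)))"
proof -
  let ?g = "\<lambda>t. g (a + t *\<^sub>R (b - a))"
  have c: "continuous_on {0..1} ?g" by (rule continuous_on_compose2[OF assms]) (auto intro!: continuous_intros seg_mem)
  have i: "?g integrable_on {0..1}" "(\<lambda>t. t * ?g t) integrable_on {0..1}"
    by (intro integrable_continuous_real continuous_intros c)+
  have "avg a b (\<lambda>x. g x * (d + z \<bullet> x)) = integral {0..1} (\<lambda>t. (d + z \<bullet> a) * ?g t + (z \<bullet> (b - a)) * (t * ?g t))"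
    unfolding avg_def by (rule integral_cong) (simp add: inner_add_right algebra_simps)
  also have "\<dots> = integral {0..1} (\<lambda>t. (d + z \<bullet> a) * ?g t) + integral {0..1} (\<lambda>t. (z \<bullet> (b - a)) * (t * ?g t))"
    by (rule integral_add) (intro integrable_on_mult_right i)+
  finally show ?thesis by (simp add: avg_def)
qed

text \<open>The \<open>L\<^sup>2\<close>-projection onto affine functions on the edge. The last
  clause hands over the zero pair when \<open>\<phi>\<close> vanishes on \<open>E\<close>, so the
  boundary condition of the interpolant holds without a uniqueness argument.\<close>

lemma edge_projection_ex:
  assumes ab: "a \<noteq> b" and E: "E = closed_segment a b" and \<phi>: "continuous_on UNIV \<phi>"
  shows "\<exists>c w. (\<forall>d z. edge_int E (\<lambda>x. (c + w \<bullet> x) * (d + z \<bullet> x)) = edge_int E (\<lambda>x. \<phi> x * (d + z \<bullet> x))) \<and>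
    ((\<forall>x\<in>E. \<phi> x = 0) \<longrightarrow> c = 0 \<and> w = 0)"
proof (cases "\<forall>x\<in>E. \<phi> x = 0")
  case True
  have "edge_int E (\<lambda>x. (0 + 0 \<bullet> x) * (d + z \<bullet> x)) = edge_int E (\<lambda>x. \<phi> x * (d + z \<bullet> x))" for d z
    by (rule edge_int_cong[OF ab E]) (use True in simp)
  then show ?thesis by blast
next
  case False
  define M0 M1 where "M0 = avg a b \<phi>" and "M1 = integral {0..1} (\<lambda>t. t * \<phi> (a + t *\<^sub>R (b - a)))"
  \<comment> \<open>Solution of \<open>\<alpha> + \<beta>/2 = M0\<close> and
    \<open>\<alpha>/2 + \<beta>/3 = M1\<close>, the moment equations for
    \<open>\<alpha> + \<beta> * t\<close> on the unit interval.\<close>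
  define \<beta> where "\<beta> = 12 * (M1 - M0 / 2)"
  define \<alpha> where "\<alpha> = M0 - \<beta> / 2"
  define w where "w = (\<beta> / ((b - a) \<bullet> (b - a))) *\<^sub>R (b - a)"
  define c where "c = \<alpha> - w \<bullet> a"
  have wb: "w \<bullet> (b - a) = \<beta>" using ab by (simp add: w_def)
  have p: "c + w \<bullet> (a + t *\<^sub>R (b - a)) = \<alpha> + \<beta> * t" for t
    unfolding inner_add_right inner_scaleR_right wb by (simp add: c_def)
  have i: "(\<lambda>t::real. k * t) integrable_on {0..1}" "(\<lambda>t::real. k * (t * t)) integrable_on {0..1}" for k
    by (intro integrable_continuous_real continuous_intros)+
  have "avg a b (\<lambda>x. c + w \<bullet> x) = integral {0..1} (\<lambda>t. \<alpha> + \<beta> * t)" unfolding avg_def p ..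
  also have "\<dots> = integral {0..1} (\<lambda>t::real. \<alpha>) + integral {0..1} (\<lambda>t. \<beta> * t)" by (rule integral_add) (auto intro!: i)
  also have "\<dots> = M0" by (simp add: integral_id_01 \<alpha>_def)
  finally have A0: "avg a b (\<lambda>x. c + w \<bullet> x) = M0" .
  have "integral {0..1} (\<lambda>t. t * (c + w \<bullet> (a + t *\<^sub>R (b - a)))) = integral {0..1} (\<lambda>t. \<alpha> * t + \<beta> * (t * t))"
    unfolding p by (simp add: algebra_simps)
  also have "\<dots> = integral {0..1} (\<lambda>t. \<alpha> * t) + integral {0..1} (\<lambda>t. \<beta> * (t * t))" by (rule integral_add[OF i])
  also have "\<dots> = \<alpha> * (1/2) + \<beta> * (1/3)" by (simp only: integral_mult_right integral_id_01)
  also have "\<dots> = M1" by (simp add: \<alpha>_def \<beta>_def field_simps)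
  finally have A1: "integral {0..1} (\<lambda>t. t * (c + w \<bullet> (a + t *\<^sub>R (b - a)))) = M1" .
  have "edge_int E (\<lambda>x. (c + w \<bullet> x) * (d + z \<bullet> x)) = edge_int E (\<lambda>x. \<phi> x * (d + z \<bullet> x))" for d z
  proof -
    have "avg a b (\<lambda>x. (c + w \<bullet> x) * (d + z \<bullet> x)) = avg a b (\<lambda>x. \<phi> x * (d + z \<bullet> x))"
      using avg_moments[of a b "\<lambda>x. c + w \<bullet> x" d z] avg_moments[OF continuous_on_subset[OF \<phi> subset_UNIV], of a b d z]
      unfolding A0 A1 M0_def[symmetric] M1_def[symmetric] by (simp add: continuous_intros)
    then show ?thesis using ab by (simp add: E edge_int_seg)
  qed
  then show ?thesis using False by blast
qed

text \<open>Depends on the edge and not on a triangle, so the interpolant is single-valued on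
  interior edges by construction.\<close>

definition eproj :: "(pt \<Rightarrow> real) \<Rightarrow> pt set \<Rightarrow> real \<times> pt" where
  "eproj \<phi> E = (SOME p. (\<forall>d z. edge_int E (\<lambda>x. (fst p + snd p \<bullet> x) * (d + z \<bullet> x)) = edge_int E (\<lambda>x. \<phi> x * (d + z \<bullet> x))) \<and>
    ((\<forall>x\<in>E. \<phi> x = 0) \<longrightarrow> fst p = 0 \<and> snd p = 0))"

definition fortin :: "(pt \<Rightarrow> real) \<Rightarrow> wfun" where
  "fortin \<phi> = ((\<lambda>K. integral K \<phi> / measure lebesgue K), (\<lambda>E x. fst (eproj \<phi> E) + snd (eproj \<phi> E) \<bullet> x))"

lemma fortin_nice: "nice (snd (fortin \<phi>)) K"
  unfolding nice_def fortin_def by (auto intro!: continuous_intros)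

lemma fortin_edge:
  assumes "is_triangle K" "E \<in> edges K" "continuous_on UNIV \<phi>"
  shows "edge_int E (\<lambda>x. snd (fortin \<phi>) E x * (d + z \<bullet> x)) = edge_int E (\<lambda>x. \<phi> x * (d + z \<bullet> x))"
    "(\<And>x. x \<in> E \<Longrightarrow> \<phi> x = 0) \<Longrightarrow> snd (fortin \<phi>) E x = 0"
proof -
  obtain a b c where 1: "E = closed_segment a b" "a \<noteq> b" using edge_seg[OF assms(1,2)] by metis
  have "\<exists>p. (\<forall>d z. edge_int E (\<lambda>x. (fst p + snd p \<bullet> x) * (d + z \<bullet> x)) = edge_int E (\<lambda>x. \<phi> x * (d + z \<bullet> x))) \<and>
    ((\<forall>x\<in>E. \<phi> x = 0) \<longrightarrow> fst p = 0 \<and> snd p = 0)"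
    using edge_projection_ex[OF 1(2,1) assms(3)] by simp
  from someI_ex[OF this, folded eproj_def]
  have s: "\<And>d z. edge_int E (\<lambda>x. (fst (eproj \<phi> E) + snd (eproj \<phi> E) \<bullet> x) * (d + z \<bullet> x)) = edge_int E (\<lambda>x. \<phi> x * (d + z \<bullet> x))"
    "(\<forall>x\<in>E. \<phi> x = 0) \<Longrightarrow> fst (eproj \<phi> E) = 0 \<and> snd (eproj \<phi> E) = 0" by blast+
  show "edge_int E (\<lambda>x. snd (fortin \<phi>) E x * (d + z \<bullet> x)) = edge_int E (\<lambda>x. \<phi> x * (d + z \<bullet> x))"
    unfolding fortin_def snd_conv by (rule s(1))
  assume "\<And>x. x \<in> E \<Longrightarrow> \<phi> x = 0"
  then show "snd (fortin \<phi>) E x = 0" using s(2) by (simp add: fortin_def)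
qed

lemma fortin_Sh0:
  assumes T: "triangulation \<Omega> T" and \<phi>: "continuous_on UNIV \<phi>" and z: "\<And>x. x \<in> frontier \<Omega> \<Longrightarrow> \<phi> x = 0"
  shows "fortin \<phi> \<in> Sh0 \<Omega> T"
  unfolding Sh0_def mem_Collect_eq
proof (intro ballI conjI impI)
  fix K E assume KE: "K \<in> T" "E \<in> edges K"
  show "\<exists>c w. \<forall>x\<in>E. snd (fortin \<phi>) E x = c + w \<bullet> x" unfolding fortin_def by auto
  have t: "is_triangle K" using T KE by (simp add: triangulation_def)
  fix x assume E: "E \<subseteq> frontier \<Omega>" and "x \<in> E"
  show "snd (fortin \<phi>) E x = 0" by (rule fortin_edge(2)[OF t KE(2) \<phi>]) (use z E in blast)
qed

text \<open>The weak gradient sees only the mean on \<open>K\<close>, since the divergence of an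
  affine field is constant, and affine moments on the edges, since its normal component is affine.
  The interpolant keeps both, so Green's formula identifies its weak gradient as the projection of
  \<open>G\<close> onto affine fields.\<close>

lemma fortin_wgrad:
  assumes T: "is_triangle K" and g: "gdiff L \<phi> G"
  shows "integral K (\<lambda>x. wgrad (fortin \<phi>) K x \<bullet> (c + B *v x)) = integral K (\<lambda>x. G x \<bullet> (c + B *v x))"
proof -
  have \<phi>: "continuous_on UNIV \<phi>" using g by (simp add: gdiff_def)
  have W: "is_wgrad (fortin \<phi>) K (wgrad (fortin \<phi>) K)" by (rule is_wgrad_wgrad[OF T fortin_nice])
  have n: "(c + B *v x) \<bullet> n = c \<bullet> n + (n v* B) \<bullet> x" for n x :: pt
    using inner_commute[of "B *v x" n] by (simp add: inner_add_left dot_lmul_matrix)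
  obtain a1 b1 c1 where K: "K = convex hull {a1, b1, c1}" using T by (auto simp: is_triangle_cr)
  note bK = tri_borel[OF K]
  have ii: "(\<lambda>x. G x \<bullet> (c + B *v x)) integrable_on K"
  proof -
    obtain M where M: "\<And>x. x \<in> K \<Longrightarrow> norm (G x) \<le> M" using gdiff_bounded_on[OF g bK(2)] by metis
    have cc: "continuous_on UNIV (\<lambda>x. c + B *v x)" by (intro continuous_intros matrix_vector_mult_linear_continuous_on)
    have "compact ((\<lambda>x. c + B *v x) ` K)" using bK(3) continuous_on_subset[OF cc] by (intro compact_continuous_image) auto
    then obtain N where N: "\<And>x. x \<in> K \<Longrightarrow> norm (c + B *v x) \<le> N" by (force dest!: compact_imp_bounded simp: bounded_iff)
    have [measurable]: "G \<in> borel_measurable borel" using g by (simp add: gdiff_def)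
    have [measurable]: "(\<lambda>x. c + B *v x) \<in> borel_measurable borel" using cc by (rule borel_measurable_continuous_onI)
    show ?thesis
    proof (rule bdd_integrable_on[OF bK(1) _ bK(2)])
      fix x assume x: "x \<in> K"
      have "\<bar>G x \<bullet> (c + B *v x)\<bar> \<le> norm (G x) * norm (c + B *v x)" by (rule Cauchy_Schwarz_ineq2)
      also have "\<dots> \<le> M * N" by (intro mult_mono M N x norm_ge_zero order_trans[OF norm_ge_zero M[OF x]])
      finally show "\<bar>G x \<bullet> (c + B *v x)\<bar> \<le> M * N" .
    qed measurable
  qed
  have e: "edge_int E (\<lambda>x. snd (fortin \<phi>) E x * ((c + B *v x) \<bullet> outer_normal K E)) = edge_int E (\<lambda>x. \<phi> x * ((c + B *v x) \<bullet> outer_normal K E))"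
    if "E \<in> edges K" for E
    unfolding n by (rule fortin_edge(1)[OF T that \<phi>])
  have "integral K (\<lambda>x. wgrad (fortin \<phi>) K x \<bullet> (c + B *v x)) = - integral K (\<lambda>x. fst (fortin \<phi>) K * trace B)
    + (\<Sum>E\<in>edges K. edge_int E (\<lambda>x. snd (fortin \<phi>) E x * ((c + B *v x) \<bullet> outer_normal K E)))"
    using W unfolding is_wgrad_def by blast
  also have "(\<Sum>E\<in>edges K. edge_int E (\<lambda>x. snd (fortin \<phi>) E x * ((c + B *v x) \<bullet> outer_normal K E)))
    = (\<Sum>E\<in>edges K. edge_int E (\<lambda>x. \<phi> x * ((c + B *v x) \<bullet> outer_normal K E)))"
    by (rule sum.cong[OF refl e])
  also have "\<dots> = integral K (\<lambda>x. G x \<bullet> (c + B *v x) + \<phi> x * trace B)" by (rule green_affine[OF T g])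
  also have "\<dots> = integral K (\<lambda>x. G x \<bullet> (c + B *v x)) + integral K (\<lambda>x. \<phi> x * trace B)"
    by (rule integral_add[OF ii]) (intro integrable_on_mult_left cont_integrable[OF \<phi> T])
  also have "integral K (\<lambda>x. \<phi> x * trace B) = integral K \<phi> * trace B" by simp
  also have "integral K (\<lambda>x. fst (fortin \<phi>) K * trace B) = fst (fortin \<phi>) K * trace B * measure lebesgue K"
    unfolding tri_measure(1)[OF T] by (rule integral_const_K)
  also have "\<dots> = integral K \<phi> * trace B" using tri_measure(2)[OF T] by (simp add: fortin_def)
  finally show ?thesis by simp
qed

text \<open>A projection does not increase the norm: integrate \<open>2 * (G x \<bullet> ?W x) - ?W
  x \<bullet> ?W x \<le> (norm (G x))\<^sup>2\<close> and use that \<open>G\<close> and its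
  projection have the same product with the affine field \<open>?W\<close>.\<close>

lemma fortin_energy:
  assumes T: "is_triangle K" and g: "pwaff L \<phi> G"
  shows "integral K (\<lambda>x. wgrad (fortin \<phi>) K x \<bullet> wgrad (fortin \<phi>) K x) \<le> integral K (\<lambda>x. (norm (G x))\<^sup>2)"
proof -
  let ?W = "wgrad (fortin \<phi>) K"
  have W: "is_wgrad (fortin \<phi>) K ?W" by (rule is_wgrad_wgrad[OF T fortin_nice])
  then obtain c A where cA: "\<And>x. ?W x = c + A *v x" unfolding is_wgrad_def by blast
  obtain a1 b1 c1 where K: "K = convex hull {a1, b1, c1}" using T by (auto simp: is_triangle_cr)
  note bK = tri_borel[OF K] and cW = is_wgrad_cont[OF W]
  obtain M where M: "\<And>x. norm (G x) \<le> M" using g by (auto simp: pwaff_def bounded_iff)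
  have [measurable]: "G \<in> borel_measurable borel" using g by (simp add: pwaff_def)
  have [measurable]: "?W \<in> borel_measurable borel" using cW by (rule borel_measurable_continuous_onI)
  have "compact (?W ` K)" using bK(3) cW by (intro compact_continuous_image) auto
  then obtain N where N: "\<And>x. x \<in> K \<Longrightarrow> norm (?W x) \<le> N" by (force dest!: compact_imp_bounded simp: bounded_iff)
  have i1: "(\<lambda>x. G x \<bullet> ?W x) integrable_on K"
  proof (rule bdd_integrable_on[OF bK(1) _ bK(2)])
    fix x assume x: "x \<in> K"
    have "\<bar>G x \<bullet> ?W x\<bar> \<le> norm (G x) * norm (?W x)" by (rule Cauchy_Schwarz_ineq2)
    also have "\<dots> \<le> M * N" by (intro mult_mono M N x norm_ge_zero order_trans[OF norm_ge_zero M])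
    finally show "\<bar>G x \<bullet> ?W x\<bar> \<le> M * N" .
  qed measurable
  have i2: "(\<lambda>x. (norm (G x))\<^sup>2) integrable_on K"
    by (rule bdd_integrable_on[OF bK(1) _ bK(2), of _ "M\<^sup>2"]) (auto intro!: power_mono M)
  have i3: "(\<lambda>x. ?W x \<bullet> ?W x) integrable_on K" by (intro cont_integrable[OF _ T] continuous_intros cW)
  have "integral K (\<lambda>x. 2 * (G x \<bullet> ?W x) - ?W x \<bullet> ?W x) \<le> integral K (\<lambda>x. (norm (G x))\<^sup>2)"
  proof (rule integral_le[OF _ i2])
    show "(\<lambda>x. 2 * (G x \<bullet> ?W x) - ?W x \<bullet> ?W x) integrable_on K" by (intro integrable_diff integrable_on_mult_right i1 i3)
    fix x
    have "0 \<le> (G x - ?W x) \<bullet> (G x - ?W x)" by simp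
    then show "2 * (G x \<bullet> ?W x) - ?W x \<bullet> ?W x \<le> (norm (G x))\<^sup>2"
      unfolding power2_norm_eq_inner by (simp add: inner_diff_left inner_diff_right inner_commute)
  qed
  also have "integral K (\<lambda>x. 2 * (G x \<bullet> ?W x) - ?W x \<bullet> ?W x) = 2 * integral K (\<lambda>x. G x \<bullet> ?W x) - integral K (\<lambda>x. ?W x \<bullet> ?W x)"
    by (subst integral_diff) (auto intro!: integrable_on_mult_right i1 i3)
  also have "integral K (\<lambda>x. G x \<bullet> ?W x) = integral K (\<lambda>x. ?W x \<bullet> ?W x)"
    using fortin_wgrad[OF T pwaff_gdiff[OF g], of c A] unfolding cA[symmetric] by (simp add: inner_commute)
  finally show ?thesis by simp
qed

definition vfortin :: "(pt \<Rightarrow> real) \<Rightarrow> (pt \<Rightarrow> real) \<Rightarrow> vwfun" where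
  "vfortin \<phi> \<psi> = ((\<lambda>K. vec2 (fst (fortin \<phi>) K) (fst (fortin \<psi>) K)), (\<lambda>E x. vec2 (snd (fortin \<phi>) E x) (snd (fortin \<psi>) E x)))"

lemma comp_vfortin: "comp (vfortin \<phi> \<psi>) 1 = fortin \<phi>" "comp (vfortin \<phi> \<psi>) 2 = fortin \<psi>"
  by (simp_all add: comp_def vfortin_def)

lemma fortin_wdiv:
  assumes T: "is_triangle K" and g: "gdiff L1 \<phi> G" "gdiff L2 \<psi> H"
  shows "integral K (wdiv (vfortin \<phi> \<psi>) K) = integral K (\<lambda>x. G x $ 1 + H x $ 2)"
proof -
  let ?v = "vfortin \<phi> \<psi>"
  have \<phi>: "continuous_on UNIV \<phi>" "continuous_on UNIV \<psi>" using g by (simp_all add: gdiff_def)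
  obtain a1 b1 c1 where K: "K = convex hull {a1, b1, c1}" using T by (auto simp: is_triangle_cr)
  note bK = tri_borel[OF K]
  have "nice (\<lambda>E x. snd ?v E x $ i) K" for i
  proof -
    have "(\<lambda>E x. snd ?v E x $ i) = snd (fortin \<phi>) \<or> (\<lambda>E x. snd ?v E x $ i) = snd (fortin \<psi>)"
      using exhaust_2[of i] by (auto simp: vfortin_def)
    then show ?thesis using fortin_nice by metis
  qed
  then have D: "is_wdiv ?v K (wdiv ?v K)" by (rule is_wdiv_wdiv[OF T])
  \<comment> \<open>\<open>1 + 0 \<bullet> x\<close> is the constant test function 1 in the shape
    that \<open>is_wdiv\<close> expects. Constants suffice because pressures are constant on each
    triangle.\<close>
  have e: "edge_int E (\<lambda>x. (snd ?v E x \<bullet> outer_normal K E) * (1 + 0 \<bullet> x))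
    = edge_int E (\<lambda>x. \<phi> x * ((axis 1 1 + (0::real^2^2) *v x) \<bullet> outer_normal K E)) + edge_int E (\<lambda>x. \<psi> x * ((axis 2 1 + (0::real^2^2) *v x) \<bullet> outer_normal K E))"
    if E: "E \<in> edges K" for E
  proof -
    obtain a b c where 1: "E = closed_segment a b" "a \<noteq> b" using edge_seg[OF T E] by metis
    let ?n = "outer_normal K E"
    have c: "continuous_on E (snd (fortin \<theta>) E)" for \<theta> by (auto simp: fortin_def intro!: continuous_intros)
    have "edge_int E (\<lambda>x. (snd ?v E x \<bullet> ?n) * (1 + 0 \<bullet> x)) = edge_int E (\<lambda>x. snd (fortin \<phi>) E x * (?n$1 + 0 \<bullet> x) + snd (fortin \<psi>) E x * (?n$2 + 0 \<bullet> x))"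
      by (simp add: vfortin_def inner_pt)
    also have "\<dots> = edge_int E (\<lambda>x. snd (fortin \<phi>) E x * (?n$1 + 0 \<bullet> x)) + edge_int E (\<lambda>x. snd (fortin \<psi>) E x * (?n$2 + 0 \<bullet> x))"
      by (rule edge_int_add[OF 1(2,1)]) (intro continuous_intros c)+
    also have "\<dots> = edge_int E (\<lambda>x. \<phi> x * (?n$1 + 0 \<bullet> x)) + edge_int E (\<lambda>x. \<psi> x * (?n$2 + 0 \<bullet> x))"
      using fortin_edge(1)[OF T E \<phi>(1)] fortin_edge(1)[OF T E \<phi>(2)] by metis
    finally show ?thesis by (simp add: inner_axis')
  qed
  have "integral K (\<lambda>x. wdiv ?v K x * (1 + 0 \<bullet> x)) = - integral K (\<lambda>x. fst ?v K \<bullet> 0) +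
    (\<Sum>E\<in>edges K. edge_int E (\<lambda>x. (snd ?v E x \<bullet> outer_normal K E) * (1 + 0 \<bullet> x)))"
    using D unfolding is_wdiv_def by blast
  then have "integral K (wdiv ?v K) = (\<Sum>E\<in>edges K. edge_int E (\<lambda>x. (snd ?v E x \<bullet> outer_normal K E) * (1 + 0 \<bullet> x)))" by simp
  also have "\<dots> = (\<Sum>E\<in>edges K. edge_int E (\<lambda>x. \<phi> x * ((axis 1 1 + (0::real^2^2) *v x) \<bullet> outer_normal K E)))
    + (\<Sum>E\<in>edges K. edge_int E (\<lambda>x. \<psi> x * ((axis 2 1 + (0::real^2^2) *v x) \<bullet> outer_normal K E)))"
    unfolding sum.distrib[symmetric] by (rule sum.cong[OF refl e])
  also have "\<dots> = integral K (\<lambda>x. G x \<bullet> axis 1 1) + integral K (\<lambda>x. H x \<bullet> axis 2 1)"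
    unfolding green_affine[OF T g(1)] green_affine[OF T g(2)] by (simp add: trace_pt)
  also have "\<dots> = integral K (\<lambda>x. G x \<bullet> axis 1 1 + H x \<bullet> axis 2 1)"
    by (rule integral_add[symmetric]) (intro gdiff_integrable_on(1)[OF g(1) bK(1,2)] gdiff_integrable_on(1)[OF g(2) bK(1,2)])+
  finally show ?thesis by (simp add: inner_axis)
qed

section \<open>Stability\<close>

text \<open>The discriminant argument, tested at \<open>t = B / C\<close>; for \<open>C = 0\<close>
  a suitable \<open>t\<close> forces \<open>B = 0\<close>. It yields Cauchy-Schwarz for sums of
  integrals over triangles from pointwise inequalities.\<close>

lemma quadratic_cs:
  fixes A B C :: real
  assumes q: "\<And>t. 2 * t * B \<le> A + t\<^sup>2 * C" and "A \<ge> 0" "C \<ge> 0"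
  shows "\<bar>B\<bar> \<le> sqrt A * sqrt C"
proof (cases "C = 0")
  case True
  have "B = 0"
  proof (rule ccontr)
    assume "B \<noteq> 0"
    then have "2 * ((A + 1) / (2 * B)) * B = A + 1" by simp
    then show False using q[of "(A + 1) / (2 * B)"] True by simp
  qed
  then show ?thesis using assms(2,3) by simp
next
  case False
  then have C: "C > 0" using assms(3) by simp
  have "2 * (B / C) * B * C \<le> (A + (B / C)\<^sup>2 * C) * C" using q[of "B / C"] C by (intro mult_right_mono) auto
  then have "B\<^sup>2 \<le> A * C" using C by (simp add: field_simps power2_eq_square)
  then have "sqrt (B\<^sup>2) \<le> sqrt (A * C)" by (rule real_sqrt_le_mono)
  then show ?thesis by (simp add: real_sqrt_mult)
qed

lemma triangulation_inter_negligible: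
  assumes T: "triangulation \<Omega> T" and K: "K \<in> T" "K' \<in> T" "K \<noteq> K'"
  shows "negligible (K \<inter> K')"
proof -
  have seg: "negligible E" if "E \<in> edges K" for E
  proof -
    obtain a b where E: "E = closed_segment a b" using \<open>E \<in> edges K\<close> unfolding edges_def by blast
    have "interior (closed_segment a b) = {}" by (rule interior_closed_segment_ge2) simp
    then show ?thesis unfolding E using negligible_convex_interior[OF convex_closed_segment] by blast
  qed
  from triangulation_inter[OF T K] show ?thesis
  proof (elim disjE exE conjE)
    fix E assume "E \<in> edges K" "K \<inter> K' = E"
    then show ?thesis using seg by simp
  qed simp_all
qed

lemma AE_at_most_one:
  assumes T: "triangulation \<Omega> T"
  shows "AE x in lebesgue. \<forall>K\<in>T. \<forall>K'\<in>T. K \<noteq> K' \<longrightarrow> x \<notin> K \<inter> K'"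
proof -
  have fT: "finite T" using T by (simp add: triangulation_def)
  have "AE x in lebesgue. \<forall>p\<in>{(K, K'). K \<in> T \<and> K' \<in> T \<and> K \<noteq> K'}. x \<notin> fst p \<inter> snd p"
  proof (subst AE_ball_countable)
    show "countable {(K, K'). K \<in> T \<and> K' \<in> T \<and> K \<noteq> K'}"
      by (rule countable_finite, rule finite_subset[of _ "T \<times> T"]) (use fT in auto)
    show "\<forall>p\<in>{(K, K'). K \<in> T \<and> K' \<in> T \<and> K \<noteq> K'}. AE x in lebesgue. x \<notin> fst p \<inter> snd p"
    proof
      fix p assume "p \<in> {(K, K'). K \<in> T \<and> K' \<in> T \<and> K \<noteq> K'}"
      then have "negligible (fst p \<inter> snd p)" using triangulation_inter_negligible[OF T] by (cases p) auto
      then have "fst p \<inter> snd p \<in> null_sets lebesgue" by (simp only: negligible_iff_null_sets)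
      then show "AE x in lebesgue. x \<notin> fst p \<inter> snd p" by (rule AE_not_in)
    qed
  qed
  then show ?thesis by eventually_elim auto
qed

text \<open>Almost everywhere disjointness lets the sum collapse to one term. The inner quantifier
  over \<open>g\<close> provides the same triangle for \<open>p\<close> and for its square in
  \<open>inf_sup\<close>.\<close>

lemma sum_indicator_single:
  fixes g :: "pt set \<Rightarrow> real"
  assumes fin: "finite T" and d: "\<forall>K\<in>T. \<forall>K'\<in>T. K \<noteq> K' \<longrightarrow> x \<notin> K \<inter> K'"
  shows "(\<Sum>K\<in>T. g K * indicator K x) = 0 \<and> (\<forall>K\<in>T. x \<notin> K) \<or> (\<exists>K\<in>T. x \<in> K \<and> (\<forall>g. (\<Sum>K\<in>T. g K * indicator K x) = (g K :: real)))"
proof (cases "\<exists>K\<in>T. x \<in> K")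
  case True
  then obtain K where K: "K \<in> T" "x \<in> K" by blast
  have "(\<Sum>K\<in>T. g K * indicator K x) = g K" for g :: "pt set \<Rightarrow> real"
  proof -
    have "(\<Sum>K\<in>T. g K * indicator K x) = (\<Sum>K\<in>{K}. g K * indicator K x)"
      by (rule sum.mono_neutral_right[OF fin]) (use K d in \<open>auto simp: indicator_def\<close>)
    then show ?thesis using K by simp
  qed
  then show ?thesis using K by blast
next
  case False
  then show ?thesis by (simp add: indicator_def)
qed

lemma grad_ip_cs:
  assumes T: "triangulation \<Omega> T" and u: "u \<in> Vh \<Omega> T" and v: "v \<in> Vh \<Omega> T"
  shows "\<bar>grad_ip T u v\<bar> \<le> sqrt (grad_ip T u u) * sqrt (grad_ip T v v)" "0 \<le> grad_ip T u u"
proof -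
  have tri: "is_triangle K" if "K \<in> T" for K using T that by (simp add: triangulation_def)
  have c: "continuous_on UNIV (wgrad (comp w i) K)" if "w \<in> Vh \<Omega> T" "K \<in> T" for w i K
    using is_wgrad_wgrad[OF tri[OF that(2)] Sh0_nice[OF _ that(2)], of "comp w i" \<Omega>] that is_wgrad_cont unfolding Vh_def by blast
  have pos: "0 \<le> grad_ip T w w" if "w \<in> Vh \<Omega> T" for w
    unfolding grad_ip_def by (intro sum_nonneg integral_nonneg) (auto intro!: cont_integrable continuous_intros c that tri)
  then show "0 \<le> grad_ip T u u" using u by blast
  show "\<bar>grad_ip T u v\<bar> \<le> sqrt (grad_ip T u u) * sqrt (grad_ip T v v)"
  proof (rule quadratic_cs[OF _ pos[OF u] pos[OF v]])
    fix t :: real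
    have each: "2 * t * integral K (\<lambda>x. wgrad (comp u i) K x \<bullet> wgrad (comp v i) K x) \<le>
       integral K (\<lambda>x. wgrad (comp u i) K x \<bullet> wgrad (comp u i) K x) + t\<^sup>2 * integral K (\<lambda>x. wgrad (comp v i) K x \<bullet> wgrad (comp v i) K x)"
      if K: "K \<in> T" for K i
    proof -
      let ?U = "wgrad (comp u i) K" and ?V = "wgrad (comp v i) K"
      note cu = c[OF u K, of i] and cv = c[OF v K, of i]
      have i1: "(\<lambda>x. ?U x \<bullet> ?U x) integrable_on K" "(\<lambda>x. t\<^sup>2 * (?V x \<bullet> ?V x)) integrable_on K" "(\<lambda>x. 2 * t * (?U x \<bullet> ?V x)) integrable_on K"
        by (intro cont_integrable[OF _ tri[OF K]] continuous_intros cu cv)+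
      have "integral K (\<lambda>x. 2 * t * (?U x \<bullet> ?V x)) \<le> integral K (\<lambda>x. ?U x \<bullet> ?U x + t\<^sup>2 * (?V x \<bullet> ?V x))"
      proof (rule integral_le[OF i1(3) integrable_add[OF i1(1,2)]])
        fix x
        have "0 \<le> (?U x - t *\<^sub>R ?V x) \<bullet> (?U x - t *\<^sub>R ?V x)" by simp
        then show "2 * t * (?U x \<bullet> ?V x) \<le> ?U x \<bullet> ?U x + t\<^sup>2 * (?V x \<bullet> ?V x)"
          by (simp add: inner_diff_left inner_diff_right inner_commute power2_eq_square algebra_simps)
      qed
      then show ?thesis unfolding integral_add[OF i1(1,2)] by simp
    qed
    have "2 * t * grad_ip T u v = (\<Sum>K\<in>T. \<Sum>i\<in>UNIV. 2 * t * integral K (\<lambda>x. wgrad (comp u i) K x \<bullet> wgrad (comp v i) K x))"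
      by (simp add: grad_ip_def sum_distrib_left)
    also have "\<dots> \<le> (\<Sum>K\<in>T. \<Sum>i\<in>UNIV. integral K (\<lambda>x. wgrad (comp u i) K x \<bullet> wgrad (comp u i) K x) + t\<^sup>2 * integral K (\<lambda>x. wgrad (comp v i) K x \<bullet> wgrad (comp v i) K x))"
      by (intro sum_mono each)
    also have "\<dots> = grad_ip T u u + t\<^sup>2 * grad_ip T v v" by (simp add: grad_ip_def sum.distrib sum_distrib_left)
    finally show "2 * t * grad_ip T u v \<le> grad_ip T u u + t\<^sup>2 * grad_ip T v v" .
  qed
qed

text \<open>\<open>f\<close> is controlled on the open set \<open>\<Omega>\<close> only, whereas the
  triangles are closed and may touch its frontier. The frontier of a convex set is null, which gives
  measurability of \<open>f\<close> on each triangle and allows integrals to be compared through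
  \<open>F\<close>.\<close>

lemma f_ip_cs:
  assumes T: "triangulation \<Omega> T" and cx: "convex \<Omega>" "open \<Omega>" and f: "L2_vec \<Omega> f"
  shows "\<bar>f_ip T f v\<bar> \<le> L2_norm_vec \<Omega> f * sqrt (\<Sum>K\<in>T. (norm (fst v K))\<^sup>2 * measure lebesgue K)"
proof -
  have tri: "is_triangle K" if "K \<in> T" for K using T that by (simp add: triangulation_def)
  have fT: "finite T" using T by (simp add: triangulation_def)
  have U: "\<Union>T = closure \<Omega>" using T unfolding triangulation_def by (elim conjE)
  have O[simp]: "\<Omega> \<in> sets lebesgue" using cx(2) by (simp add: borel_open)
  have Ks: "K \<in> sets lebesgue" if "K \<in> T" for K using tri_measure(3)[OF tri[OF that]] by (simp add: fmeasurableD)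
  have nfr: "negligible (frontier \<Omega>)" by (rule negligible_convex_frontier[OF cx(1)])
  define F where "F x = indicator \<Omega> x * (norm (f x))\<^sup>2" for x
  have Fi: "integrable lebesgue F" and FL: "(LINT x|lebesgue_on \<Omega>. (norm (f x))\<^sup>2) = (LINT x|lebesgue. F x)"
    using f unfolding L2_vec_def F_def by (auto simp: integrable_restrict_space integral_restrict_space)
  have fm: "f \<in> borel_measurable (lebesgue_on K)" if K: "K \<in> T" for K
  proof (rule measurableI)
    fix B :: "pt set" assume B: "B \<in> sets borel"
    have "f -` B \<inter> \<Omega> \<in> sets (lebesgue_on \<Omega>)" using f B measurable_sets[of f "lebesgue_on \<Omega>" borel B] unfolding L2_vec_def by simp
    then have m: "f -` B \<inter> \<Omega> \<in> sets lebesgue" by (simp add: sets_restrict_space_iff)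
    have "negligible (f -` B \<inter> K - \<Omega>)"
    proof (rule negligible_subset[OF nfr])
      show "f -` B \<inter> K - \<Omega> \<subseteq> frontier \<Omega>" using K U cx(2) by (auto simp: frontier_def interior_open)
    qed
    then have n: "f -` B \<inter> K - \<Omega> \<in> sets lebesgue" by (rule negligible_imp_sets)
    have "f -` B \<inter> K = (f -` B \<inter> \<Omega>) \<inter> K \<union> (f -` B \<inter> K - \<Omega>)" by blast
    also have "\<dots> \<in> sets lebesgue" by (rule sets.Un[OF sets.Int[OF m Ks[OF K]] n])
    finally show "f -` B \<inter> space (lebesgue_on K) \<in> sets (lebesgue_on K)" using Ks[OF K] by (simp add: sets_restrict_space_iff)
  qed simp
  have AEO: "AE x in lebesgue. x \<notin> frontier \<Omega>" using nfr unfolding negligible_iff_null_sets by (rule AE_not_in)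
  have KF: "integrable lebesgue (\<lambda>x. indicator K x * F x)" if "K \<in> T" for K
    using integrable_mult_indicator[OF Ks[OF that] Fi] by simp
  have fK: "integrable (lebesgue_on K) (\<lambda>x. (norm (f x))\<^sup>2)" "(LINT x|lebesgue_on K. (norm (f x))\<^sup>2) = (LINT x|lebesgue. indicator K x * F x)" if K: "K \<in> T" for K
  proof -
    have m0: "(\<lambda>x. (norm (f x))\<^sup>2) \<in> borel_measurable (lebesgue_on K)" using fm[OF K] by measurable
    have m1: "(\<lambda>x. indicator K x *\<^sub>R (norm (f x))\<^sup>2) \<in> borel_measurable lebesgue"
      using borel_measurable_restrict_space_iff[of K lebesgue "\<lambda>x. (norm (f x))\<^sup>2"] Ks[OF K] m0 by simp
    have m2: "(\<lambda>x. indicator K x * F x) \<in> borel_measurable lebesgue" by (rule borel_measurable_integrable[OF KF[OF K]])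
    have ae: "AE x in lebesgue. indicator K x *\<^sub>R (norm (f x))\<^sup>2 = indicator K x * F x"
      using AEO by eventually_elim (use K U cx(2) in \<open>auto simp: F_def indicator_def frontier_def interior_open\<close>)
    show "integrable (lebesgue_on K) (\<lambda>x. (norm (f x))\<^sup>2)"
      using integrable_cong_AE[OF m1 m2 ae] KF[OF K] Ks[OF K] by (simp add: integrable_restrict_space)
    show "(LINT x|lebesgue_on K. (norm (f x))\<^sup>2) = (LINT x|lebesgue. indicator K x * F x)"
      using integral_cong_AE[OF m1 m2 ae] Ks[OF K] by (simp add: integral_restrict_space)
  qed
  have "\<bar>f_ip T f v\<bar> \<le> sqrt (LINT x|lebesgue_on \<Omega>. (norm (f x))\<^sup>2) * sqrt (\<Sum>K\<in>T. (norm (fst v K))\<^sup>2 * measure lebesgue K)"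
  proof (rule quadratic_cs)
    fix t :: real
    have each: "2 * t * (LINT x|lebesgue_on K. f x \<bullet> fst v K) \<le> (LINT x|lebesgue. indicator K x * F x) + t\<^sup>2 * ((norm (fst v K))\<^sup>2 * measure lebesgue K)"
      if K: "K \<in> T" for K
    proof -
      let ?v = "fst v K" and ?M = "lebesgue_on K"
      have pw: "2 * s * (f x \<bullet> ?v) \<le> (norm (f x))\<^sup>2 + s\<^sup>2 * (norm ?v)\<^sup>2" for x s
      proof -
        have "0 \<le> (f x - s *\<^sub>R ?v) \<bullet> (f x - s *\<^sub>R ?v)" by simp
        then show ?thesis unfolding power2_norm_eq_inner
          by (simp add: inner_diff_left inner_diff_right inner_commute power2_eq_square algebra_simps)
      qed
      interpret fm: finite_measure ?M
        by (rule finite_measure_lebesgue_on[OF tri_measure(3)[OF tri[OF K]]])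
      have ic: "integrable ?M (\<lambda>x. c)" for c :: real by simp
      have if1: "integrable ?M (\<lambda>x. f x \<bullet> ?v)"
      proof (rule Bochner_Integration.integrable_bound[OF Bochner_Integration.integrable_add[OF fK(1)[OF K] ic[of "(norm ?v)\<^sup>2"]]])
        show "(\<lambda>x. f x \<bullet> ?v) \<in> borel_measurable ?M" using fm[OF K] by (intro borel_measurable_inner) auto
        have "\<bar>f x \<bullet> ?v\<bar> \<le> (norm (f x))\<^sup>2 + (norm ?v)\<^sup>2" for x
          using pw[of 1 x] pw[of "-1" x] zero_le_power2[of "norm (f x)"] zero_le_power2[of "norm ?v"] by (simp add: abs_if)
        then show "AE x in ?M. norm (f x \<bullet> ?v) \<le> norm ((norm (f x))\<^sup>2 + (norm ?v)\<^sup>2)" by (intro AE_I2) simp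
      qed
      have "(LINT x|?M. 2 * t * (f x \<bullet> ?v)) \<le> (LINT x|?M. (norm (f x))\<^sup>2 + t\<^sup>2 * (norm ?v)\<^sup>2)"
        by (rule integral_mono) (auto intro!: if1 fK(1)[OF K] pw)
      also have "\<dots> = (LINT x|?M. (norm (f x))\<^sup>2) + t\<^sup>2 * (norm ?v)\<^sup>2 * measure ?M (space ?M)"
        using fK(1)[OF K] by (subst Bochner_Integration.integral_add) auto
      also have "measure ?M (space ?M) = measure lebesgue K" using Ks[OF K] by (simp add: measure_restrict_space)
      finally show ?thesis using if1 unfolding fK(2)[OF K] by (simp add: mult.assoc)
    qed
    have "2 * t * f_ip T f v = (\<Sum>K\<in>T. 2 * t * (LINT x|lebesgue_on K. f x \<bullet> fst v K))" by (simp add: f_ip_def sum_distrib_left)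
    also have "\<dots> \<le> (\<Sum>K\<in>T. (LINT x|lebesgue. indicator K x * F x) + t\<^sup>2 * ((norm (fst v K))\<^sup>2 * measure lebesgue K))" by (rule sum_mono[OF each])
    also have "\<dots> = (LINT x|lebesgue. (\<Sum>K\<in>T. indicator K x * F x)) + t\<^sup>2 * (\<Sum>K\<in>T. (norm (fst v K))\<^sup>2 * measure lebesgue K)"
      using KF by (simp add: sum.distrib sum_distrib_left Bochner_Integration.integral_sum)
    also have "(LINT x|lebesgue. (\<Sum>K\<in>T. indicator K x * F x)) \<le> (LINT x|lebesgue. F x)"
    proof (rule integral_mono_AE)
      show "integrable lebesgue (\<lambda>x. \<Sum>K\<in>T. indicator K x * F x)" by (intro Bochner_Integration.integrable_sum KF)
      show "AE x in lebesgue. (\<Sum>K\<in>T. indicator K x * F x) \<le> F x" using AE_at_most_one[OF T]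
      proof eventually_elim
        case (elim x)
        have "F x \<ge> 0" by (simp add: F_def)
        moreover have "(\<Sum>K\<in>T. indicator K x * F x) = (\<Sum>K\<in>T. F x * indicator K x)" by (simp add: mult.commute)
        ultimately show ?case using sum_indicator_single[OF fT elim, of "\<lambda>_. F x"] by auto
      qed
    qed (rule Fi)
    finally show "2 * t * f_ip T f v \<le> (LINT x|lebesgue_on \<Omega>. (norm (f x))\<^sup>2) + t\<^sup>2 * (\<Sum>K\<in>T. (norm (fst v K))\<^sup>2 * measure lebesgue K)"
      unfolding FL by simp
  next
    show "0 \<le> (LINT x|lebesgue_on \<Omega>. (norm (f x))\<^sup>2)" by (rule integral_nonneg_AE) simp
    show "0 \<le> (\<Sum>K\<in>T. (norm (fst v K))\<^sup>2 * measure lebesgue K)" by (intro sum_nonneg) simp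
  qed
  then show ?thesis by (simp add: L2_norm_vec_def)
qed

text \<open>Energies are compared on each element by \<open>fortin_energy\<close>. The triangles
  overlap in null sets, so the element integrals add up to at most the integral over the
  plane.\<close>

lemma grad_ip_vfortin_le:
  assumes T: "triangulation \<Omega> T" and g: "pwaff L \<phi> G" "pwaff L' \<psi> H"
    and z: "bounded A" "A \<in> sets borel" "\<And>x. x \<notin> A \<Longrightarrow> G x = 0 \<and> H x = 0"
  shows "grad_ip T (vfortin \<phi> \<psi>) (vfortin \<phi> \<psi>) \<le> (LINT x|lborel. (norm (G x))\<^sup>2 + (norm (H x))\<^sup>2)"
proof -
  have tri: "is_triangle K" if "K \<in> T" for K using T that by (simp add: triangulation_def)
  have fT: "finite T" using T by (simp add: triangulation_def)
  have Kb: "K \<in> sets borel" "bounded K" if "K \<in> T" for K using tri[OF that] tri_borel by (auto simp: is_triangle_cr)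
  let ?g = "\<lambda>x. (norm (G x))\<^sup>2 + (norm (H x))\<^sup>2"
  have [measurable]: "G \<in> borel_measurable borel" "H \<in> borel_measurable borel" using g by (simp_all add: pwaff_def)
  obtain M where M: "\<And>x. norm (G x) \<le> M" using g(1) by (auto simp: pwaff_def bounded_iff)
  obtain N where N: "\<And>x. norm (H x) \<le> N" using g(2) by (auto simp: pwaff_def bounded_iff)
  have gi: "integrable lborel ?g"
    by (intro Bochner_Integration.integrable_add pwaff_sq_integrable[OF g(1) z(1,2)] pwaff_sq_integrable[OF g(2) z(1,2)]) (simp_all add: z(3))
  have b: "\<bar>(norm (G x))\<^sup>2\<bar> \<le> M\<^sup>2" "\<bar>(norm (H x))\<^sup>2\<bar> \<le> N\<^sup>2" for x using M N by (simp_all add: power_mono)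
  have each: "integral K (\<lambda>x. (norm (G x))\<^sup>2) + integral K (\<lambda>x. (norm (H x))\<^sup>2) = (LINT x|lborel. indicator K x * ?g x)"
    "integrable lborel (\<lambda>x. indicator K x * ?g x)" if K: "K \<in> T" for K
  proof -
    have i: "integrable lborel (\<lambda>x. indicator K x * (norm (G x))\<^sup>2)" "integrable lborel (\<lambda>x. indicator K x * (norm (H x))\<^sup>2)"
      using bdd_integrable[OF Kb(1)[OF K] _ Kb(2)[OF K] b(1)] bdd_integrable[OF Kb(1)[OF K] _ Kb(2)[OF K] b(2)] by simp_all
    have "integral K (\<lambda>x. (norm (G x))\<^sup>2) = (LINT x|lborel. indicator K x * (norm (G x))\<^sup>2)"
      "integral K (\<lambda>x. (norm (H x))\<^sup>2) = (LINT x|lborel. indicator K x * (norm (H x))\<^sup>2)"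
      using bdd_integral_eq[OF Kb(1)[OF K] _ Kb(2)[OF K] b(1)] bdd_integral_eq[OF Kb(1)[OF K] _ Kb(2)[OF K] b(2)] by simp_all
    then show "integral K (\<lambda>x. (norm (G x))\<^sup>2) + integral K (\<lambda>x. (norm (H x))\<^sup>2) = (LINT x|lborel. indicator K x * ?g x)"
      using i by (simp add: distrib_left)
    show "integrable lborel (\<lambda>x. indicator K x * ?g x)" using Bochner_Integration.integrable_add[OF i] by (simp add: distrib_left)
  qed
  have "grad_ip T (vfortin \<phi> \<psi>) (vfortin \<phi> \<psi>) \<le> (\<Sum>K\<in>T. integral K (\<lambda>x. (norm (G x))\<^sup>2) + integral K (\<lambda>x. (norm (H x))\<^sup>2))"
    unfolding grad_ip_def sum_2 comp_vfortin by (intro sum_mono add_mono fortin_energy[OF tri g(1)] fortin_energy[OF tri g(2)])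
  also have "\<dots> = (LINT x|lborel. (\<Sum>K\<in>T. indicator K x * ?g x))"
    using each by (simp add: Bochner_Integration.integral_sum)
  also have "\<dots> \<le> (LINT x|lborel. ?g x)"
  proof (rule integral_mono_AE[OF _ gi])
    show "integrable lborel (\<lambda>x. \<Sum>K\<in>T. indicator K x * ?g x)" by (intro Bochner_Integration.integrable_sum each(2))
    show "AE x in lborel. (\<Sum>K\<in>T. indicator K x * ?g x) \<le> ?g x" using AE_at_most_one[OF T] unfolding AE_completion_iff
    proof eventually_elim
      case (elim x)
      have "0 \<le> ?g x" by simp
      moreover have "(\<Sum>K\<in>T. indicator K x * ?g x) = (\<Sum>K\<in>T. ?g x * indicator K x)" by (simp add: mult.commute)
      ultimately show ?case using sum_indicator_single[OF fT elim, of "\<lambda>_. ?g x"] by auto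
    qed
  qed
  finally show ?thesis .
qed

text \<open>The pressure is itself the right-hand side \<open>q\<close> of the divergence equation,
  and the interpolated solution is the test function: the pairing with piecewise constants sees only
  mean divergences, which are preserved. From \<open>q * D = 1/2 * q\<^sup>2 + 1/2 * D\<^sup>2 - 1/2
  * (D - q)\<^sup>2\<close> and the tolerance \<open>N\<^sup>2 / 4\<close> comes
  \<open>1/2 - 1/8 = 3/8\<close>.\<close>

lemma inf_sup:
  assumes T: "triangulation \<Omega> T" and cx: "convex \<Omega>" "open \<Omega>" and p: "p \<in> Mh T" and C0: "C \<ge> 0" and bd: "bounded (closure \<Omega>)"
    and solv: "\<And>q B \<epsilon>. q \<in> borel_measurable borel \<Longrightarrow> (\<And>x. \<bar>q x\<bar> \<le> B) \<Longrightarrow>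
    (\<And>x. x \<notin> closure \<Omega> \<Longrightarrow> q x = 0) \<Longrightarrow> (LINT x|lborel. q x) = 0 \<Longrightarrow> \<epsilon> > 0 \<Longrightarrow> div_solvable (closure \<Omega>) C q \<epsilon>"
  shows "\<exists>v\<in>Vh \<Omega> T. 3/8 * (pc_norm T p)\<^sup>2 \<le> p_div_ip T p v \<and> grad_ip T v v \<le> C * (pc_norm T p)\<^sup>2"
proof -
  have tri: "is_triangle K" if "K \<in> T" for K using T that by (simp add: triangulation_def)
  have fT: "finite T" using T by (simp add: triangulation_def)
  have U: "\<Union>T = closure \<Omega>" using T unfolding triangulation_def by (elim conjE)
  have Kb: "K \<in> sets borel" "bounded K" if "K \<in> T" for K using tri[OF that] tri_borel by (auto simp: is_triangle_cr)
  have clb: "closure \<Omega> \<in> sets borel" by (simp add: borel_closed)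
  define q where "q x = (\<Sum>K\<in>T. p K * indicator K x)" for x :: pt
  have qm[measurable]: "q \<in> borel_measurable borel" unfolding q_def using Kb(1) by measurable
  define Q where "Q = (\<Sum>K\<in>T. \<bar>p K\<bar>)"
  have qb: "\<bar>q x\<bar> \<le> Q" for x
  proof -
    have "\<bar>q x\<bar> \<le> (\<Sum>K\<in>T. \<bar>p K * indicator K x\<bar>)" unfolding q_def by (rule sum_abs)
    also have "\<dots> \<le> Q" unfolding Q_def by (rule sum_mono) (simp add: indicator_def)
    finally show ?thesis .
  qed
  have qz: "q x = 0" if "x \<notin> closure \<Omega>" for x using that U unfolding q_def by (intro sum.neutral) auto
  have KQ: "(LINT x|lborel. p K * indicator K x * h x) = p K * integral K h" "integrable lborel (\<lambda>x. p K * indicator K x * h x)"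
    if K: "K \<in> T" and h: "h \<in> borel_measurable borel" "\<And>x. \<bar>h x\<bar> \<le> B" for K h B
    using bdd_integral_eq[OF Kb(1)[OF K] h(1) Kb(2)[OF K], of B] bdd_integrable[OF Kb(1)[OF K] h(1) Kb(2)[OF K], of B] h(2)
    by (simp_all add: mult.assoc)
  have qh: "(LINT x|lborel. q x * h x) = (\<Sum>K\<in>T. p K * integral K h)" if h: "h \<in> borel_measurable borel" "\<And>x. \<bar>h x\<bar> \<le> B" for h B
  proof -
    have "(LINT x|lborel. q x * h x) = (LINT x|lborel. (\<Sum>K\<in>T. p K * indicator K x * h x))" unfolding q_def sum_distrib_right ..
    also have "\<dots> = (\<Sum>K\<in>T. LINT x|lborel. p K * indicator K x * h x)" by (rule Bochner_Integration.integral_sum) (rule KQ(2)[OF _ h])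
    also have "\<dots> = (\<Sum>K\<in>T. p K * integral K h)" by (rule sum.cong[OF refl KQ(1)[OF _ h]])
    finally show ?thesis .
  qed
  have "(LINT x|lborel. q x) = (\<Sum>K\<in>T. p K * measure lebesgue K)"
    using qh[of "\<lambda>_. 1" 1] tri_measure(1)[OF tri] by simp
  then have q0: "(LINT x|lborel. q x) = 0" using p by (simp add: Mh_def)
  define N where "N = pc_norm T p"
  have N2: "N\<^sup>2 = (\<Sum>K\<in>T. (p K)\<^sup>2 * measure lebesgue K)"
    unfolding N_def pc_norm_def by (rule real_sqrt_pow2) (intro sum_nonneg mult_nonneg_nonneg; simp)
  have one: "integrable lborel (indicat_real K)" "(LINT x|lborel. indicat_real K x) = measure lebesgue K" if K: "K \<in> T" for K
    using bdd_integrable[OF Kb(1)[OF K] _ Kb(2)[OF K], of "\<lambda>_. 1" 1] bdd_integral_eq[OF Kb(1)[OF K] _ Kb(2)[OF K], of "\<lambda>_. 1" 1]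
    unfolding tri_measure(1)[OF tri[OF K]] by simp_all
  have qq: "(LINT x|lborel. (q x)\<^sup>2) = N\<^sup>2"
  proof -
    have "(LINT x|lborel. (q x)\<^sup>2) = (LINT x|lborel. (\<Sum>K\<in>T. (p K)\<^sup>2 * indicator K x))"
    proof (rule integral_cong_AE)
      show "AE x in lborel. (q x)\<^sup>2 = (\<Sum>K\<in>T. (p K)\<^sup>2 * indicator K x)" using AE_at_most_one[OF T] unfolding AE_completion_iff
      proof eventually_elim
        case (elim x)
        from sum_indicator_single[OF fT elim, of p] show ?case
        proof
          assume "(\<Sum>K\<in>T. p K * indicator K x) = 0 \<and> (\<forall>K\<in>T. x \<notin> K)"
          then show ?case by (simp add: q_def)
        next
          assume "\<exists>K\<in>T. x \<in> K \<and> (\<forall>g. (\<Sum>K\<in>T. g K * indicator K x) = (g K :: real))"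
          then obtain K where "\<And>g. (\<Sum>K\<in>T. g K * indicator K x) = (g K :: real)" by blast
          then show ?case by (simp add: q_def)
        qed
      qed
    qed (use Kb(1) in measurable)
    also have "\<dots> = (\<Sum>K\<in>T. LINT x|lborel. (p K)\<^sup>2 * indicator K x)"
      by (intro Bochner_Integration.integral_sum integrable_mult_right) (rule one)
    also have "\<dots> = (\<Sum>K\<in>T. (p K)\<^sup>2 * measure lebesgue K)"
      by (rule sum.cong[OF refl]) (simp only: Bochner_Integration.integral_mult_right_zero one(2))
    finally show ?thesis unfolding N2 .
  qed
  show ?thesis
  \<comment> \<open>The tolerance \<open>N\<^sup>2 / 4\<close> must be positive, so norm zero is
    treated apart with the interpolant of 0.\<close>
  proof (cases "N = 0")
    case True
    have z: "pwaff {} (\<lambda>_. 0) (\<lambda>_. 0)" by (rule pwaff_zero) (simp add: lines_def)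
    have v: "vfortin (\<lambda>_. 0) (\<lambda>_. 0) \<in> Vh \<Omega> T" unfolding Vh_def mem_Collect_eq forall_2 comp_vfortin by (auto intro!: fortin_Sh0[OF T])
    have "grad_ip T (vfortin (\<lambda>_. 0) (\<lambda>_. 0)) (vfortin (\<lambda>_. 0) (\<lambda>_. 0)) \<le> 0"
      using grad_ip_vfortin_le[OF T z z bd clb] by simp
    moreover have "p_div_ip T p (vfortin (\<lambda>_. 0) (\<lambda>_. 0)) = 0"
      unfolding p_div_ip_def using fortin_wdiv[OF tri pwaff_gdiff[OF z] pwaff_gdiff[OF z]] by (intro sum.neutral) simp
    ultimately show ?thesis using v True unfolding N_def[symmetric] by (intro bexI[of _ "vfortin (\<lambda>_. 0) (\<lambda>_. 0)"]) auto
  next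
    case False
    then have "N\<^sup>2 / 4 > 0" by simp
    from solv[OF qm qb qz q0 this] obtain L \<phi> G \<psi> H where g: "pwaff L \<phi> G" "pwaff L \<psi> H"
      and z: "\<And>x. x \<notin> closure \<Omega> \<Longrightarrow> \<phi> x = 0 \<and> \<psi> x = 0 \<and> G x = 0 \<and> H x = 0"
      and e: "(LINT x|lborel. (norm (G x))\<^sup>2 + (norm (H x))\<^sup>2) \<le> C * (LINT x|lborel. (q x)\<^sup>2)"
      and d: "(LINT x|lborel. (G x $ 1 + H x $ 2 - q x)\<^sup>2) \<le> N\<^sup>2 / 4"
      unfolding div_solvable_def by blast
    \<comment> \<open>For open convex \<open>\<Omega>\<close> every frontier point is a limit of
      points outside the closure, where the field is zero; continuity then gives the boundary
      condition.\<close>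
    have frz: "\<theta> x = 0" if \<theta>: "continuous_on UNIV \<theta>" "\<And>x. x \<notin> closure \<Omega> \<Longrightarrow> \<theta> x = 0" and x: "x \<in> frontier \<Omega>" for \<theta> :: "pt \<Rightarrow> real" and x
    proof (rule ccontr)
      assume "\<theta> x \<noteq> 0"
      have "open {x. \<theta> x \<noteq> 0}" by (rule open_Collect_neq[OF \<theta>(1)]) (rule continuous_on_const)
      moreover have "{x. \<theta> x \<noteq> 0} \<subseteq> closure \<Omega>" using \<theta>(2) by blast
      ultimately have "x \<in> interior (closure \<Omega>)" using \<open>\<theta> x \<noteq> 0\<close> interior_maximal by blast
      then show False using x convex_interior_closure[OF cx(1)] by (simp add: frontier_def)
    qed
    have c: "continuous_on UNIV \<phi>" "continuous_on UNIV \<psi>" using g by (simp_all add: pwaff_def)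
    have z': "\<And>x. x \<notin> closure \<Omega> \<Longrightarrow> \<phi> x = 0" "\<And>x. x \<notin> closure \<Omega> \<Longrightarrow> \<psi> x = 0" using z by blast+
    have v: "vfortin \<phi> \<psi> \<in> Vh \<Omega> T" unfolding Vh_def mem_Collect_eq forall_2 comp_vfortin
    proof
      show "fortin \<phi> \<in> Sh0 \<Omega> T" by (rule fortin_Sh0[OF T c(1) frz[OF c(1) z'(1)]])
      show "fortin \<psi> \<in> Sh0 \<Omega> T" by (rule fortin_Sh0[OF T c(2) frz[OF c(2) z'(2)]])
    qed
    let ?D = "\<lambda>x. G x $ 1 + H x $ 2"
    obtain M1 where M1: "\<And>x. norm (G x) \<le> M1" using g(1) by (auto simp: pwaff_def bounded_iff)
    obtain M2 where M2: "\<And>x. norm (H x) \<le> M2" using g(2) by (auto simp: pwaff_def bounded_iff)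
    have Db: "\<bar>?D x\<bar> \<le> M1 + M2" for x
      using component_le_norm_cart[of "G x" 1] component_le_norm_cart[of "H x" 2] M1[of x] M2[of x] by linarith
    have Dm[measurable]: "?D \<in> borel_measurable borel" using g by (auto simp: pwaff_def intro!: borel_measurable_add measurable_nth_pt)
    have "p_div_ip T p (vfortin \<phi> \<psi>) = (\<Sum>K\<in>T. p K * integral K ?D)"
      unfolding p_div_ip_def using fortin_wdiv[OF tri pwaff_gdiff[OF g(1)] pwaff_gdiff[OF g(2)]] by (intro sum.cong) simp_all
    also have "\<dots> = (LINT x|lborel. q x * ?D x)" by (rule qh[OF Dm Db, symmetric])
    finally have pd: "p_div_ip T p (vfortin \<phi> \<psi>) = (LINT x|lborel. q x * ?D x)" .
    have Q0: "Q \<ge> 0" using qb[of 0] by linarith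
    have i1: "integrable lborel (\<lambda>x. q x * ?D x)"
    proof (rule bint[OF _ _ clb bd])
      show "(\<lambda>x. q x * ?D x) \<in> borel_measurable borel" using qm Dm by (rule borel_measurable_times)
      show "\<bar>q x * ?D x\<bar> \<le> Q * (M1 + M2)" for x unfolding abs_mult by (rule mult_mono[OF qb Db Q0]) simp
    qed (simp add: qz)
    have i2: "integrable lborel (\<lambda>x. (q x)\<^sup>2)"
    proof (rule bint[OF _ _ clb bd])
      have "\<bar>q x\<bar>\<^sup>2 \<le> Q\<^sup>2" for x by (rule power_mono[OF qb]) simp
      then show "\<bar>(q x)\<^sup>2\<bar> \<le> Q\<^sup>2" for x by simp
    qed (simp_all add: qz)
    have i3: "integrable lborel (\<lambda>x. (?D x - q x)\<^sup>2)"
    proof (rule pwaff_div_integrable[OF g bd clb])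
      show "G x = 0 \<and> H x = 0" if "x \<notin> closure \<Omega>" for x using z[OF that] by blast
      show "q \<in> borel_measurable borel" by (rule qm)
      show "\<bar>q x\<bar> \<le> Q" for x by (rule qb)
      show "q x = 0" if "x \<notin> closure \<Omega>" for x by (rule qz[OF that])
    qed
    have "1/2 * N\<^sup>2 - 1/2 * (LINT x|lborel. (?D x - q x)\<^sup>2) = (LINT x|lborel. 1/2 * (q x)\<^sup>2 - 1/2 * (?D x - q x)\<^sup>2)"
      unfolding qq[symmetric] using i2 i3 by simp
    also have "\<dots> \<le> (LINT x|lborel. q x * ?D x)"
    proof (rule integral_mono[OF _ i1])
      show "integrable lborel (\<lambda>x. 1/2 * (q x)\<^sup>2 - 1/2 * (?D x - q x)\<^sup>2)" using i2 i3 by simp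
      have "1/2 * y\<^sup>2 - 1/2 * (w - y)\<^sup>2 \<le> y * w" for y w :: real
      proof -
        have "1/2 * y\<^sup>2 - 1/2 * (w - y)\<^sup>2 = y * w - 1/2 * w\<^sup>2" by algebra
        then show ?thesis using zero_le_power2[of w] by linarith
      qed
      then show "1/2 * (q x)\<^sup>2 - 1/2 * (?D x - q x)\<^sup>2 \<le> q x * ?D x" for x .
    qed
    finally have "3/8 * N\<^sup>2 \<le> p_div_ip T p (vfortin \<phi> \<psi>)" using d unfolding pd by linarith
    moreover have "grad_ip T (vfortin \<phi> \<psi>) (vfortin \<phi> \<psi>) \<le> C * N\<^sup>2"
    proof (rule order_trans[OF grad_ip_vfortin_le[OF T g bd clb] e[unfolded qq]])
      show "G x = 0 \<and> H x = 0" if "x \<notin> closure \<Omega>" for x using z[OF that] by blast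
    qed
    ultimately show ?thesis using v unfolding N_def by blast
  qed
qed

theorem theorem3p1:
  fixes \<Omega> :: "pt set" and \<sigma> :: real
  assumes "convex_polygon \<Omega>" and "\<sigma> > 0"
  shows "\<exists>C. \<forall>T f u p.
     triangulation \<Omega> T \<longrightarrow> shape_regular \<sigma> T \<longrightarrow> L2_vec \<Omega> f \<longrightarrow>
     u \<in> Vh \<Omega> T \<longrightarrow> p \<in> Mh T \<longrightarrow>
     (\<forall>v\<in>Vh \<Omega> T. grad_ip T u v - p_div_ip T p v = f_ip T f v) \<longrightarrow>
     (\<forall>q\<in>Mh T. p_div_ip T q u = 0) \<longrightarrow>
     grad_norm T u + pc_norm T p \<le> C * L2_norm_vec \<Omega> f"
proof -
  obtain P where P: "finite P" "\<Omega> = interior (convex hull P)" "\<Omega> \<noteq> {}" using assms(1) unfolding convex_polygon_def by blast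
  have cx: "convex \<Omega>" "open \<Omega>" unfolding P(2) by (simp_all add: convex_interior convex_convex_hull)
  have cP: "compact (convex hull P)" using P(1) by (simp add: finite_imp_compact_convex_hull)
  have ne: "interior (convex hull P) \<noteq> {}" using P by simp
  have cl: "closure \<Omega> = convex hull P"
    unfolding P(2) convex_closure_interior[OF convex_convex_hull ne] using cP by (simp add: compact_imp_closed closure_closed)
  have "good (closure \<Omega>)" unfolding cl by (rule good_polygon[OF P(1) ne])
  then obtain C where bd: "bounded (closure \<Omega>)" and C0: "C \<ge> 0" and solv: "\<And>q B \<epsilon>. q \<in> borel_measurable borel \<Longrightarrow> (\<And>x. \<bar>q x\<bar> \<le> B) \<Longrightarrow>
    (\<And>x. x \<notin> closure \<Omega> \<Longrightarrow> q x = 0) \<Longrightarrow> (LINT x|lborel. q x) = 0 \<Longrightarrow> \<epsilon> > 0 \<Longrightarrow> div_solvable (closure \<Omega>) C q \<epsilon>"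
    using goodE by metis
  obtain R where R: "\<And>x. x \<in> closure \<Omega> \<Longrightarrow> norm x \<le> R" using bd by (auto simp: bounded_iff)
  \<comment> \<open>\<open>R\<close>, \<open>\<sigma>\<close> and \<open>C\<close> are fixed before
    a triangulation is chosen, which is the independence of \<open>h\<close>.\<close>
  define \<kappa> where "\<kappa> = 3/4 * (\<sigma>\<^sup>2 / pi) * (3 * (\<sigma>\<^sup>2 / pi) + 2) * R\<^sup>2"
  have k0: "\<kappa> \<ge> 0" unfolding \<kappa>_def by (intro mult_nonneg_nonneg add_nonneg_nonneg) auto
  define s where "s = sqrt \<kappa>"
  have s0: "s \<ge> 0" using k0 by (simp add: s_def)
  show ?thesis
  proof (intro exI allI impI)
    fix T f u p
    assume T: "triangulation \<Omega> T" and sr: "shape_regular \<sigma> T" and f: "L2_vec \<Omega> f" and u: "u \<in> Vh \<Omega> T" and p: "p \<in> Mh T"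
      and eq: "\<forall>v\<in>Vh \<Omega> T. grad_ip T u v - p_div_ip T p v = f_ip T f v" and dv: "\<forall>q\<in>Mh T. p_div_ip T q u = 0"
    define F where "F = L2_norm_vec \<Omega> f"
    have F0: "F \<ge> 0" unfolding F_def L2_norm_vec_def by (intro real_sqrt_ge_zero integral_nonneg_AE) simp
    \<comment> \<open>Cauchy-Schwarz for the load, then the Poincare inequality in each
      component.\<close>
    have fb: "\<bar>f_ip T f v\<bar> \<le> F * (s * grad_norm T v)" if v: "v \<in> Vh \<Omega> T" for v
    proof -
      have "(\<Sum>K\<in>T. (norm (fst v K))\<^sup>2 * measure lebesgue K) = (\<Sum>K\<in>T. (fst (comp v 1) K)\<^sup>2 * measure lebesgue K) + (\<Sum>K\<in>T. (fst (comp v 2) K)\<^sup>2 * measure lebesgue K)"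
        unfolding power2_norm_eq_inner inner_pt by (simp add: comp_def power2_eq_square distrib_right sum.distrib)
      also have "\<dots> \<le> \<kappa> * (\<Sum>K\<in>T. integral K (\<lambda>x. wgrad (comp v 1) K x \<bullet> wgrad (comp v 1) K x)) + \<kappa> * (\<Sum>K\<in>T. integral K (\<lambda>x. wgrad (comp v 2) K x \<bullet> wgrad (comp v 2) K x))"
        unfolding \<kappa>_def using v unfolding Vh_def by (intro add_mono discrete_poincare[OF T cx R sr assms(2)]) auto
      also have "\<dots> = \<kappa> * grad_ip T v v" unfolding grad_ip_def sum_2 by (simp add: sum.distrib distrib_left)
      finally have "sqrt (\<Sum>K\<in>T. (norm (fst v K))\<^sup>2 * measure lebesgue K) \<le> s * grad_norm T v"
        unfolding s_def grad_norm_def real_sqrt_mult[symmetric] by (rule real_sqrt_le_mono)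
      then have "F * sqrt (\<Sum>K\<in>T. (norm (fst v K))\<^sup>2 * measure lebesgue K) \<le> F * (s * grad_norm T v)" by (rule mult_left_mono[OF _ F0])
      then show ?thesis using f_ip_cs[OF T cx f, of v] unfolding F_def by linarith
    qed
    define a where "a = grad_norm T u"
    have a2: "a\<^sup>2 = grad_ip T u u" and a0: "a \<ge> 0" using grad_ip_cs(2)[OF T u u] by (simp_all add: a_def grad_norm_def)
    have "grad_ip T u u = f_ip T f u" using eq u dv p by force
    then have "a\<^sup>2 \<le> F * (s * a)" using fb[OF u] a2 unfolding a_def[symmetric] by linarith
    then have aa: "a * a \<le> (s * F) * a" by (simp add: power2_eq_square mult_ac)
    have aF: "a \<le> s * F"
    proof (cases "a = 0")
      case True then show ?thesis using s0 F0 by simp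
    next
      case False then show ?thesis using aa a0 by (simp add: mult_le_cancel_right)
    qed
    define N where "N = pc_norm T p"
    have N0: "N \<ge> 0" unfolding N_def pc_norm_def by (intro real_sqrt_ge_zero sum_nonneg mult_nonneg_nonneg) simp_all
    have "\<exists>v\<in>Vh \<Omega> T. 3/8 * N\<^sup>2 \<le> p_div_ip T p v \<and> grad_ip T v v \<le> C * N\<^sup>2"
      unfolding N_def
    proof (rule inf_sup[OF T cx p C0 bd])
      fix q :: "pt \<Rightarrow> real" and B \<epsilon> :: real
      assume q: "q \<in> borel_measurable borel" "\<And>x. \<bar>q x\<bar> \<le> B" "\<And>x. x \<notin> closure \<Omega> \<Longrightarrow> q x = 0" "(LINT x|lborel. q x) = 0" "\<epsilon> > 0"
      show "div_solvable (closure \<Omega>) C q \<epsilon>" by (rule solv[OF q(1) q(2) q(3) q(4) q(5)])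
    qed
    then obtain v where v: "v \<in> Vh \<Omega> T" "3/8 * N\<^sup>2 \<le> p_div_ip T p v" "grad_ip T v v \<le> C * N\<^sup>2"
      by blast
    define g where "g = grad_norm T v"
    have g: "g \<le> sqrt C * N"
      using real_sqrt_le_mono[OF v(3)] N0 by (simp add: g_def grad_norm_def real_sqrt_mult)
    \<comment> \<open>The first equation of the scheme expresses the inf-sup pairing by quantities
      already bounded by \<open>F\<close>.\<close>
    have "p_div_ip T p v = grad_ip T u v - f_ip T f v" using eq v(1) by force
    also have "\<dots> \<le> a * g + F * (s * g)"
      using grad_ip_cs(1)[OF T u v(1)] fb[OF v(1)] unfolding a_def g_def grad_norm_def by linarith
    also have "\<dots> = (a + s * F) * g" by (simp add: algebra_simps)
    also have "\<dots> \<le> (2 * (s * F)) * (sqrt C * N)"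
    proof (rule mult_mono[OF _ g])
      show "a + s * F \<le> 2 * (s * F)" using aF by linarith
      show "0 \<le> 2 * (s * F)" using s0 F0 by simp
      show "0 \<le> g" unfolding g_def grad_norm_def using grad_ip_cs(2)[OF T v(1) v(1)] by simp
    qed
    finally have "3/8 * N\<^sup>2 \<le> 2 * (s * F) * (sqrt C * N)" using v(2) by linarith
    \<comment> \<open>16/3 is 2 times the inverse of 3/8; one factor \<open>N\<close> is cancelled
      next.\<close>
    then have NN: "N * N \<le> (16/3 * s * sqrt C * F) * N" by (simp add: power2_eq_square mult_ac)
    have "N \<le> 16/3 * s * sqrt C * F"
    proof (cases "N = 0")
      case True then show ?thesis using s0 F0 C0 by simp
    next
      case False then show ?thesis using NN N0 by (simp add: mult_le_cancel_right)
    qed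
    then have "a + N \<le> (s + 16/3 * s * sqrt C) * F" using aF unfolding distrib_right by linarith
    then show "grad_norm T u + pc_norm T p \<le> (s + 16/3 * s * sqrt C) * L2_norm_vec \<Omega> f"
      unfolding a_def N_def F_def .
  qed
qed

end
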